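(* Let $(G^{\mathbb C},U,\tau,B)$ be a connected complex reductive Lie group, and let $\sigma$ be an antiholomorphic (antilinear) involution of $G^{\mathbb C}$ defining $G=(G^{\mathbb C})^\sigma$. Then, on $G^{\mathbb C}$, there exists an involution conjugate to $\sigma$ by an inner element, $\sigma'=\mathrm{Ad}_g\circ\sigma\circ\mathrm{Ad}_{g^{-1}}$ for some $g\in G^{\mathbb C}$, such that $G'=gGg^{-1}$ can be endowed with Cartan data $(H',\theta',B')$ making it a reductive subgroup of $(G^{\mathbb C},U,\tau,B)$.
   Context: A real reductive group is a tuple $(G,H,\theta,B)$: (1) $G$ is a real Lie group with reductive Lie algebra $\mathfrak g$; (2) $H<G$ is a maximal compact subgroup; (3) $\theta$ is an involution of $\mathfrak g$ with $+1$-eigenspace $\mathfrak h=\mathrm{Lie}(H)$ and $-1$-eigenspace $\mathfrak m$; (4) $B$ is a $\theta$- and $\mathrm{Ad}(G)$-invariant non-degenerate bilinear form on $\mathfrak g$ with $\mathfrak h\perp_B\mathfrak m$, negative definite on $\mathfrak h$, positive definite on $\mathfrak m$; (5) multiplication $H\times\exp(\mathfrak m)\to G$ is a diffeomorphism. $(H,\theta,B)$ is called Cartan data for $G$. A complex reductive Lie group $(G^{\mathbb C},U,\tau,B)$ is a complex Lie group whose underlying real group has such a structure, with maximal compact $U$ and antilinear Cartan involution $\tau$. A reductive subgroup of a reductive group is a reductive Lie group whose underlying group is a Lie subgroup and whose Cartan data is obtained by intersection (for the maximal compact) and restriction (for the involution and the form). $\mathrm{Ad}_g$ denotes conjugation by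 $g$. *)

theory Defs
  imports "HOL-Analysis.Analysis" "HOL-Algebra.Group"
begin

text \<open>
  A manifold is modelled on a linear subspace \<open>V\<close> of a Euclidean space type \<open>'e\<close>, so that one
  type accommodates all dimensions up to \<open>DIM('e)\<close>, including \<open>0\<close>.
  In \<open>Ck_on\<close> the set \<open>S\<close> is meant to be relatively open in \<open>V\<close>; the derivative within \<open>S\<close> is then
  determined exactly on \<open>V\<close>, and only its values on \<open>V\<close> are ever used, here and below.
\<close>

primrec Ck_on :: "nat \<Rightarrow> 'e::euclidean_space set \<Rightarrow> 'e set \<Rightarrow> ('e \<Rightarrow> 'f::euclidean_space) \<Rightarrow> bool" where
  "Ck_on 0 V S f = continuous_on S f"
| "Ck_on (Suc k) V S f =
     (\<exists>f'. (\<forall>x\<in>S. (f has_derivative f' x) (at x within S)) \<and>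
           (\<forall>v\<in>V. Ck_on k V S (\<lambda>x. f' x v)))"

definition smooth_on :: "'e::euclidean_space set \<Rightarrow> 'e set \<Rightarrow> ('e \<Rightarrow> 'f::euclidean_space) \<Rightarrow> bool" where
  "smooth_on V S f \<longleftrightarrow> (\<forall>k. Ck_on k V S f)"

type_synonym ('a, 'e) chart = "'a set \<times> ('a \<Rightarrow> 'e)"

record ('a, 'e) manifold =
  mtop :: "'a topology"
  model :: "'e set"
  atlas :: "('a, 'e) chart set"

definition loc_dom :: "('a, 'e) chart \<Rightarrow> ('b, 'f) chart \<Rightarrow> ('a \<Rightarrow> 'b) \<Rightarrow> 'e set" where
  "loc_dom c d f = snd c ` {x \<in> fst c. f x \<in> fst d}"

definition loc_rep :: "('a, 'e) chart \<Rightarrow> ('b, 'f) chart \<Rightarrow> ('a \<Rightarrow> 'b) \<Rightarrow> 'e \<Rightarrow> 'f" where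
  "loc_rep c d f = snd d \<circ> f \<circ> inv_into (fst c) (snd c)"

definition loc_deriv ::
    "('a, 'e::euclidean_space) chart \<Rightarrow> ('b, 'f::euclidean_space) chart \<Rightarrow> ('a \<Rightarrow> 'b) \<Rightarrow> 'e \<Rightarrow> 'e \<Rightarrow> 'f" where
  "loc_deriv c d f p = frechet_derivative (loc_rep c d f) (at p within loc_dom c d f)"

definition smooth_manifold :: "('a, 'e::euclidean_space) manifold \<Rightarrow> bool" where
  "smooth_manifold M \<longleftrightarrow>
     Hausdorff_space (mtop M) \<and>
     second_countable (mtop M) \<and>
     subspace (model M) \<and>
     topspace (mtop M) = (\<Union>c\<in>atlas M. fst c) \<and>
     (\<forall>c\<in>atlas M.
        openin (mtop M) (fst c) \<and>
        openin (top_of_set (model M)) (snd c ` fst c) \<and>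
        homeomorphic_map (subtopology (mtop M) (fst c)) (top_of_set (snd c ` fst c)) (snd c)) \<and>
     (\<forall>c\<in>atlas M. \<forall>d\<in>atlas M. smooth_on (model M) (loc_dom c d id) (loc_rep c d id))"

definition smooth_map ::
    "('a, 'e::euclidean_space) manifold \<Rightarrow> ('b, 'f::euclidean_space) manifold \<Rightarrow> ('a \<Rightarrow> 'b) \<Rightarrow> bool" where
  "smooth_map M N f \<longleftrightarrow>
     continuous_map (mtop M) (mtop N) f \<and>
     (\<forall>c\<in>atlas M. \<forall>d\<in>atlas N. smooth_on (model M) (loc_dom c d f) (loc_rep c d f))"

definition diffeomorphism ::
    "('a, 'e::euclidean_space) manifold \<Rightarrow> ('b, 'f::euclidean_space) manifold \<Rightarrow> ('a \<Rightarrow> 'b) \<Rightarrow> bool" where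
  "diffeomorphism M N f \<longleftrightarrow>
     smooth_map M N f \<and>
     (\<exists>g. smooth_map N M g \<and>
          (\<forall>x\<in>topspace (mtop M). g (f x) = x) \<and> (\<forall>y\<in>topspace (mtop N). f (g y) = y))"

definition prod_manifold ::
    "('a, 'e) manifold \<Rightarrow> ('b, 'f) manifold \<Rightarrow> ('a \<times> 'b, 'e \<times> 'f) manifold" where
  "prod_manifold M N =
     \<lparr>mtop = prod_topology (mtop M) (mtop N),
      model = model M \<times> model N,
      atlas = {(fst c \<times> fst d, map_prod (snd c) (snd d)) | c d. c \<in> atlas M \<and> d \<in> atlas N}\<rparr>"

definition real_line :: "(real, real) manifold" where
  "real_line = \<lparr>mtop = euclidean, model = UNIV, atlas = {(UNIV, id)}\<rparr>"

definition embedded_submanifold ::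
    "('a, 'e::euclidean_space) manifold \<Rightarrow> ('a, 'f::euclidean_space) manifold \<Rightarrow> bool" where
  "embedded_submanifold N M \<longleftrightarrow>
     smooth_manifold N \<and>
     topspace (mtop N) \<subseteq> topspace (mtop M) \<and>
     mtop N = subtopology (mtop M) (topspace (mtop N)) \<and>
     smooth_map N M id \<and>
     (\<forall>c\<in>atlas N. \<forall>d\<in>atlas M. \<forall>p\<in>loc_dom c d id. \<forall>v\<in>model N. loc_deriv c d id p v = 0 \<longrightarrow> v = 0)"

text \<open>
  Smooth maps whose derivative in charts intertwines \<open>J\<close> and \<open>J'\<close>. For complex structures \<open>J\<close>, \<open>J'\<close>
  on the models these are the holomorphic maps; replacing \<open>J'\<close> by \<open>-J'\<close> gives the antiholomorphic ones.
\<close>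

definition intertwining_map ::
    "('e \<Rightarrow> 'e) \<Rightarrow> ('f \<Rightarrow> 'f) \<Rightarrow> ('a, 'e::euclidean_space) manifold \<Rightarrow> ('b, 'f::euclidean_space) manifold
     \<Rightarrow> ('a \<Rightarrow> 'b) \<Rightarrow> bool" where
  "intertwining_map J J' M N f \<longleftrightarrow>
     smooth_map M N f \<and>
     (\<forall>c\<in>atlas M. \<forall>d\<in>atlas N. \<forall>p\<in>loc_dom c d f. \<forall>v\<in>model M.
        loc_deriv c d f p (J v) = J' (loc_deriv c d f p v))"

record ('a, 'e) lie_group = "'a monoid" +
  mfd :: "('a, 'e) manifold"

definition lie_group :: "('a, 'e::euclidean_space) lie_group \<Rightarrow> bool" where
  "lie_group G \<longleftrightarrow>
     group G \<and> smooth_manifold (mfd G) \<and> topspace (mtop (mfd G)) = carrier G \<and>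
     smooth_map (prod_manifold (mfd G) (mfd G)) (mfd G) (\<lambda>(x, y). x \<otimes>\<^bsub>G\<^esub> y) \<and>
     smooth_map (mfd G) (mfd G) (m_inv G)"

definition lie_subgroup ::
    "('a, 'e::euclidean_space) lie_group \<Rightarrow> ('a, 'f::euclidean_space) lie_group \<Rightarrow> bool" where
  "lie_subgroup K G \<longleftrightarrow>
     lie_group K \<and> subgroup (carrier K) G \<and>
     (\<forall>x\<in>carrier K. \<forall>y\<in>carrier K. x \<otimes>\<^bsub>K\<^esub> y = x \<otimes>\<^bsub>G\<^esub> y) \<and>
     embedded_submanifold (mfd K) (mfd G)"

definition conj_by :: "('a, 'b) monoid_scheme \<Rightarrow> 'a \<Rightarrow> 'a \<Rightarrow> 'a" where
  "conj_by G g x = g \<otimes>\<^bsub>G\<^esub> x \<otimes>\<^bsub>G\<^esub> inv\<^bsub>G\<^esub> g"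

text \<open>
  The tangent space at the identity is identified with the model space by the differential of a
  chart \<open>id_chart G\<close> around the identity. Under this identification the Lie algebra of \<open>G\<close> has
  underlying real vector space \<open>model (mfd G)\<close>, and, when the atlas is holomorphic, the complex
  structure of the model. Nothing below depends on the choice of the chart, up to transport by
  the differential of the coordinate change at the identity.
\<close>

definition id_chart :: "('a, 'e) lie_group \<Rightarrow> ('a, 'e) chart" where
  "id_chart G = (SOME c. c \<in> atlas (mfd G) \<and> \<one>\<^bsub>G\<^esub> \<in> fst c)"

abbreviation lie_algebra :: "('a, 'e) lie_group \<Rightarrow> 'e set" where
  "lie_algebra G \<equiv> model (mfd G)"

text \<open>Only meaningful for maps \<open>f\<close> that take the identity to the identity.\<close>

definition diff_one ::
    "('a, 'e::euclidean_space) lie_group \<Rightarrow> ('b, 'f::euclidean_space) lie_group \<Rightarrow> ('a \<Rightarrow> 'b) \<Rightarrow> 'e \<Rightarrow> 'f" where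
  "diff_one K G f = loc_deriv (id_chart K) (id_chart G) f (snd (id_chart K) \<one>\<^bsub>K\<^esub>)"

definition Ad :: "('a, 'e::euclidean_space) lie_group \<Rightarrow> 'a \<Rightarrow> 'e \<Rightarrow> 'e" where
  "Ad G g = diff_one G G (conj_by G g)"

text \<open>\<open>[X, Y] = ad(X)(Y)\<close>, where \<open>ad\<close> is the differential of \<open>Ad\<close> at the identity.\<close>

definition bracket :: "('a, 'e::euclidean_space) lie_group \<Rightarrow> 'e \<Rightarrow> 'e \<Rightarrow> 'e" where
  "bracket G X Y =
     (let (D, \<phi>) = id_chart G in
        frechet_derivative (\<lambda>p. Ad G (inv_into D \<phi> p) Y) (at (\<phi> \<one>\<^bsub>G\<^esub>) within \<phi> ` D) X)"

definition one_parameter_subgroup :: "('a, 'e::euclidean_space) lie_group \<Rightarrow> 'e \<Rightarrow> (real \<Rightarrow> 'a) \<Rightarrow> bool" where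
  "one_parameter_subgroup G X \<gamma> \<longleftrightarrow>
     smooth_map real_line (mfd G) \<gamma> \<and>
     (\<forall>s t. \<gamma> (s + t) = \<gamma> s \<otimes>\<^bsub>G\<^esub> \<gamma> t) \<and>
     ((snd (id_chart G) \<circ> \<gamma>) has_vector_derivative X) (at 0)"

definition lie_exp :: "('a, 'e::euclidean_space) lie_group \<Rightarrow> 'e \<Rightarrow> 'a" where
  "lie_exp G X = (THE g. \<exists>\<gamma>. one_parameter_subgroup G X \<gamma> \<and> g = \<gamma> 1)"

definition lie_ideal :: "('a, 'e::euclidean_space) lie_group \<Rightarrow> 'e set \<Rightarrow> bool" where
  "lie_ideal G I \<longleftrightarrow>
     subspace I \<and> I \<subseteq> lie_algebra G \<and> (\<forall>X\<in>lie_algebra G. \<forall>Y\<in>I. bracket G X Y \<in> I)"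

text \<open>Every ideal has a complementary ideal.\<close>

definition reductive_lie_algebra :: "('a, 'e::euclidean_space) lie_group \<Rightarrow> bool" where
  "reductive_lie_algebra G \<longleftrightarrow>
     (\<forall>I. lie_ideal G I \<longrightarrow>
        (\<exists>J. lie_ideal G J \<and> I \<inter> J = {0} \<and> {X + Y | X Y. X \<in> I \<and> Y \<in> J} = lie_algebra G))"

definition maximal_compact_subgroup :: "('a, 'e) lie_group \<Rightarrow> 'a set \<Rightarrow> bool" where
  "maximal_compact_subgroup G H \<longleftrightarrow>
     subgroup H G \<and> compactin (mtop (mfd G)) H \<and>
     (\<forall>L. subgroup L G \<and> compactin (mtop (mfd G)) L \<and> H \<subseteq> L \<longrightarrow> L = H)"

definition linear_between ::
    "'e::real_vector set \<Rightarrow> 'f::real_vector set \<Rightarrow> ('e \<Rightarrow> 'f) \<Rightarrow> bool" where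
  "linear_between V W f \<longleftrightarrow>
     f \<in> V \<rightarrow> W \<and>
     (\<forall>x\<in>V. \<forall>y\<in>V. f (x + y) = f x + f y) \<and> (\<forall>r. \<forall>x\<in>V. f (r *\<^sub>R x) = r *\<^sub>R f x)"

definition lie_algebra_involution :: "('a, 'e::euclidean_space) lie_group \<Rightarrow> ('e \<Rightarrow> 'e) \<Rightarrow> bool" where
  "lie_algebra_involution G \<theta> \<longleftrightarrow>
     linear_between (lie_algebra G) (lie_algebra G) \<theta> \<and>
     (\<forall>X\<in>lie_algebra G. \<forall>Y\<in>lie_algebra G. \<theta> (bracket G X Y) = bracket G (\<theta> X) (\<theta> Y)) \<and>
     (\<forall>X\<in>lie_algebra G. \<theta> (\<theta> X) = X)"

definition plus_space :: "('a, 'e::euclidean_space) lie_group \<Rightarrow> ('e \<Rightarrow> 'e) \<Rightarrow> 'e set" where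
  "plus_space G \<theta> = {X \<in> lie_algebra G. \<theta> X = X}"

definition minus_space :: "('a, 'e::euclidean_space) lie_group \<Rightarrow> ('e \<Rightarrow> 'e) \<Rightarrow> 'e set" where
  "minus_space G \<theta> = {X \<in> lie_algebra G. \<theta> X = - X}"

text \<open>
  Symmetry of \<open>B\<close> is not imposed: it is not part of the definition of a real reductive group
  followed here, and definiteness is a condition on the quadratic form \<open>X \<mapsto> B X X\<close>.
\<close>

definition cartan_form :: "('a, 'e::euclidean_space) lie_group \<Rightarrow> ('e \<Rightarrow> 'e) \<Rightarrow> ('e \<Rightarrow> 'e \<Rightarrow> real) \<Rightarrow> bool" where
  "cartan_form G \<theta> B \<longleftrightarrow>
     (\<forall>X\<in>lie_algebra G. linear_between (lie_algebra G) UNIV (B X)) \<and>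
     (\<forall>Y\<in>lie_algebra G. linear_between (lie_algebra G) UNIV (\<lambda>X. B X Y)) \<and>
     (\<forall>X\<in>lie_algebra G. \<forall>Y\<in>lie_algebra G. B (\<theta> X) (\<theta> Y) = B X Y) \<and>
     (\<forall>g\<in>carrier G. \<forall>X\<in>lie_algebra G. \<forall>Y\<in>lie_algebra G. B (Ad G g X) (Ad G g Y) = B X Y) \<and>
     (\<forall>X\<in>lie_algebra G. (\<forall>Y\<in>lie_algebra G. B X Y = 0) \<longrightarrow> X = 0) \<and>
     (\<forall>Y\<in>lie_algebra G. (\<forall>X\<in>lie_algebra G. B X Y = 0) \<longrightarrow> Y = 0) \<and>
     (\<forall>X\<in>plus_space G \<theta>. \<forall>Y\<in>minus_space G \<theta>. B X Y = 0 \<and> B Y X = 0) \<and>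
     (\<forall>X\<in>plus_space G \<theta>. X \<noteq> 0 \<longrightarrow> B X X < 0) \<and>
     (\<forall>X\<in>minus_space G \<theta>. X \<noteq> 0 \<longrightarrow> B X X > 0)"

text \<open>
  In the existential clause of \<open>cartan_data\<close>, \<open>L\<close> is \<open>H\<close> with its Lie subgroup structure and \<open>P\<close> is \<open>exp(\<mm>)\<close> with its submanifold structure;
  both are determined by the underlying sets.
\<close>

definition cartan_data ::
    "('a, 'e::euclidean_space) lie_group \<Rightarrow> 'a set \<Rightarrow> ('e \<Rightarrow> 'e) \<Rightarrow> ('e \<Rightarrow> 'e \<Rightarrow> real) \<Rightarrow> bool" where
  "cartan_data G H \<theta> B \<longleftrightarrow>
     maximal_compact_subgroup G H \<and>
     lie_algebra_involution G \<theta> \<and>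
     cartan_form G \<theta> B \<and>
     (\<exists>(L :: ('a, 'e) lie_group) (P :: ('a, 'e) manifold).
        lie_subgroup L G \<and> carrier L = H \<and>
        diff_one L G id ` lie_algebra L = plus_space G \<theta> \<and>
        embedded_submanifold P (mfd G) \<and> topspace (mtop P) = lie_exp G ` minus_space G \<theta> \<and>
        diffeomorphism (prod_manifold (mfd L) P) (mfd G) (\<lambda>(h, p). h \<otimes>\<^bsub>G\<^esub> p))"

definition real_reductive_group ::
    "('a, 'e::euclidean_space) lie_group \<Rightarrow> 'a set \<Rightarrow> ('e \<Rightarrow> 'e) \<Rightarrow> ('e \<Rightarrow> 'e \<Rightarrow> real) \<Rightarrow> bool" where
  "real_reductive_group G H \<theta> B \<longleftrightarrow> lie_group G \<and> reductive_lie_algebra G \<and> cartan_data G H \<theta> B"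

definition reductive_subgroup ::
    "('a, 'f::euclidean_space) lie_group \<Rightarrow> 'a set \<Rightarrow> ('f \<Rightarrow> 'f) \<Rightarrow> ('f \<Rightarrow> 'f \<Rightarrow> real) \<Rightarrow>
     ('a, 'e::euclidean_space) lie_group \<Rightarrow> 'a set \<Rightarrow> ('e \<Rightarrow> 'e) \<Rightarrow> ('e \<Rightarrow> 'e \<Rightarrow> real) \<Rightarrow> bool" where
  "reductive_subgroup K H' \<theta>' B' G H \<theta> B \<longleftrightarrow>
     real_reductive_group K H' \<theta>' B' \<and> real_reductive_group G H \<theta> B \<and>
     lie_subgroup K G \<and>
     H' = carrier K \<inter> H \<and>
     (\<forall>X\<in>lie_algebra K. diff_one K G id (\<theta>' X) = \<theta> (diff_one K G id X)) \<and>
     (\<forall>X\<in>lie_algebra K. \<forall>Y\<in>lie_algebra K. B' X Y = B (diff_one K G id X) (diff_one K G id Y))"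

text \<open>
  A complex manifold is modelled on a complex subspace of \<open>complex ^ 'n\<close>. Its underlying real
  manifold is the same record, the model being regarded as a real vector space. In
  \<open>complex_lie_group\<close>, the condition on \<^term>\<open>id\<close>, ranging over all pairs of charts, says that the
  coordinate changes are holomorphic.
\<close>

abbreviation i_mult :: "complex ^ 'n \<Rightarrow> complex ^ 'n" where
  "i_mult v \<equiv> \<i> *s v"

definition complex_lie_group :: "('a, complex ^ 'n) lie_group \<Rightarrow> bool" where
  "complex_lie_group G \<longleftrightarrow>
     lie_group G \<and> vec.subspace (model (mfd G)) \<and>
     intertwining_map i_mult i_mult (mfd G) (mfd G) id \<and>
     intertwining_map (map_prod i_mult i_mult) i_mult
       (prod_manifold (mfd G) (mfd G)) (mfd G) (\<lambda>(x, y). x \<otimes>\<^bsub>G\<^esub> y) \<and>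
     intertwining_map i_mult i_mult (mfd G) (mfd G) (m_inv G)"

definition complex_reductive_group ::
    "('a, complex ^ 'n) lie_group \<Rightarrow> 'a set \<Rightarrow> (complex ^ 'n \<Rightarrow> complex ^ 'n) \<Rightarrow>
     (complex ^ 'n \<Rightarrow> complex ^ 'n \<Rightarrow> real) \<Rightarrow> bool" where
  "complex_reductive_group G U \<tau> B \<longleftrightarrow>
     complex_lie_group G \<and> real_reductive_group G U \<tau> B \<and>
     (\<forall>X\<in>lie_algebra G. \<tau> (i_mult X) = - i_mult (\<tau> X))"

definition antiholomorphic_involution :: "('a, complex ^ 'n) lie_group \<Rightarrow> ('a \<Rightarrow> 'a) \<Rightarrow> bool" where
  "antiholomorphic_involution G \<sigma> \<longleftrightarrow>
     \<sigma> \<in> hom G G \<and> (\<forall>x\<in>carrier G. \<sigma> (\<sigma> x) = x) \<and>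
     intertwining_map i_mult (\<lambda>v. - i_mult v) (mfd G) (mfd G) \<sigma>"

definition fixed_points :: "('a, 'b) monoid_scheme \<Rightarrow> ('a \<Rightarrow> 'a) \<Rightarrow> 'a set" where
  "fixed_points G \<sigma> = {x \<in> carrier G. \<sigma> x = x}"

end

theory Submission
  imports Defs
begin

text \<open>
  Let \<open>S\<close> be the differential of \<open>\<sigma>\<close> at the identity. On the centre of the Lie algebra \<open>S\<close> commutes with \<open>\<tau>\<close>: central
  elements fixed by \<open>\<tau>\<close> generate relatively compact one-parameter subgroups, and so do their images under \<open>S\<close>, and
  multiplication by the imaginary unit exchanges the two eigenspaces of \<open>\<tau>\<close>. Modulo the centre, \<open>\<tau>S\<close> is symmetric for
  the positive definite form obtained by twisting the Killing form with \<open>\<tau>\<close>. Hence \<open>\<tau>S\<tau>S\<close> is a positive automorphism, and its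
  logarithm is a derivation vanishing on the centre, so it equals \<open>ad Z\<close> for some \<open>Z\<close>. Conjugation by
  \<open>g = exp (Z/4)\<close> makes \<open>\<sigma>\<close> commute with \<open>\<tau>\<close>.

  An involution \<open>s\<close> that commutes with \<open>\<tau>\<close> on the Lie algebra maps \<open>exp(\<mm>)\<close> to itself. It also preserves \<open>U\<close>, since the
  \<open>exp(\<mm>)\<close>-part of an element of \<open>s ` U\<close> is central and has bounded powers. So \<open>s\<close> respects the diffeomorphism
  \<open>U \<times> exp(\<mm>) \<rightarrow> G\<close>, which restricts to the fixed points. These are submanifolds because each of the three
  fixed-point sets is homogeneous under diffeomorphisms commuting with \<open>s\<close>, and near a fixed point an involution is linear
  in suitable coordinates.
\<close>

section \<open>Calculus on relatively open subsets of a subspace\<close>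

text \<open>Nothing relates \<open>\<sigma>\<close> to \<open>B\<close> or to \<open>U\<close>, so
  its differential \<open>S\<close> has to be controlled by structures that every automorphism
  respects. The Killing form is one of them, but it vanishes on the centre. There the bracket
  carries no information and topology has to decide: compactness tells the two eigenspaces of
  \<open>\<tau>\<close> apart, and maximality of \<open>U\<close> enters through this argument. The
  same argument yields injectivity of \<open>exp\<close> on \<open>\<mm>\<close>.

  The quarter: \<open>S\<close> and \<open>\<tau>\<close> both conjugate
  \<open>\<tau>S\<tau>S\<close> into its inverse. Replacing \<open>S\<close> by its conjugate under
  \<open>exp (tZ)\<close> therefore multiplies \<open>\<tau>S\<tau>S\<close> by its own power
  \<open>-4t\<close>, one factor for each side of each of the two occurrences of \<open>S\<close>.
  Taking \<open>t = 1/4\<close> makes the product trivial.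

  Differential geometry is done with velocities of curves: a derivative is identified by one curve
  whose image has a known velocity. The fixed group can be disconnected, so its structure is not
  deduced from its Lie algebra; it is obtained by restricting smooth maps of the ambient group to
  embedded submanifolds.\<close>

definition onb :: "'e::euclidean_space set \<Rightarrow> 'e set" where
  "onb V = (SOME B. B \<subseteq> V \<and> pairwise orthogonal B \<and> (\<forall>x\<in>B. norm x = 1) \<and> independent B \<and> span B = V)"

text \<open>The orthogonal projection onto \<open>V\<close>. Derivatives within \<open>V\<close> are
  determined only on \<open>V\<close>; composing with this map yields linear maps of the whole
  space, to which the standard calculus applies.\<close>

definition sub_proj :: "'e::euclidean_space set \<Rightarrow> 'e \<Rightarrow> 'e" where
  "sub_proj V x = (\<Sum>b\<in>onb V. (x \<bullet> b) *\<^sub>R b)"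

lemma onb:
  assumes "subspace V"
  shows "onb V \<subseteq> V" "pairwise orthogonal (onb V)" "\<And>x. x \<in> onb V \<Longrightarrow> norm x = 1"
    "independent (onb V)" "span (onb V) = V" "finite (onb V)"
proof -
  have "\<exists>B. B \<subseteq> V \<and> pairwise orthogonal B \<and> (\<forall>x\<in>B. norm x = 1) \<and> independent B \<and> span B = V"
    using orthonormal_basis_subspace[OF assms] by metis
  from someI_ex[OF this] show "onb V \<subseteq> V" "pairwise orthogonal (onb V)" "\<And>x. x \<in> onb V \<Longrightarrow> norm x = 1"
    "independent (onb V)" "span (onb V) = V" "finite (onb V)"
    unfolding onb_def[symmetric] by (auto intro: independent_imp_finite)
qed

lemma bounded_linear_sub_proj: "bounded_linear (sub_proj V)"
  unfolding sub_proj_def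
  by (intro bounded_linear_sum bounded_linear_scaleR_const bounded_linear_inner_left)

lemma sub_proj_in: "subspace V \<Longrightarrow> sub_proj V x \<in> V"
  unfolding sub_proj_def using onb(1)[of V] by (intro subspace_sum subspace_scale) auto

lemma sub_proj_id:
  assumes "subspace V" "x \<in> V"
  shows "sub_proj V x = x"
proof -
  have "sub_proj V b = b" if b: "b \<in> onb V" for b
  proof -
    have "sub_proj V b = (\<Sum>c\<in>onb V. if c = b then b else 0)"
      unfolding sub_proj_def
    proof (intro sum.cong refl)
      fix c assume c: "c \<in> onb V"
      have "b \<bullet> b = 1" using onb(3)[OF assms(1) b] by (simp add: norm_eq_1)
      moreover have "b \<bullet> c = 0" if "c \<noteq> b"
        using onb(2)[OF assms(1)] b c that by (auto simp: pairwise_def orthogonal_def)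
      ultimately show "(b \<bullet> c) *\<^sub>R c = (if c = b then b else 0)" by auto
    qed
    also have "\<dots> = b" using b onb(6)[OF assms(1)] by simp
    finally show ?thesis .
  qed
  then show ?thesis
    using linear_eq_on_span[of "sub_proj V" "\<lambda>x. x" "onb V" x] onb(5)[OF assms(1)] assms
      bounded_linear_sub_proj[of V] by (auto simp: bounded_linear.linear linear_ident)
qed

lemma sub_proj_eq_0_iff:
  assumes "subspace V" shows "sub_proj V (x - sub_proj V x) = 0"
proof -
  interpret bounded_linear "sub_proj V" by (rule bounded_linear_sub_proj)
  show ?thesis using sub_proj_id[OF assms sub_proj_in[OF assms]] by (simp add: diff)
qed

text \<open>\<open>Ck_on\<close> differentiates within \<open>S\<close>, while derivatives in charts
  are taken within the whole model. At points of a relatively open set the two filters agree, and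
  this lemma passes from one to the other.\<close>

lemma at_within_rel_open:
  assumes "openin (top_of_set V) S" "x \<in> S"
  shows "at x within S = at x within V"
proof -
  obtain T where "open T" "S = V \<inter> T" using assms by (auto simp: openin_open)
  then show ?thesis using assms by (intro at_within_nhd[of x T]) auto
qed

section \<open>Permanence properties of maps of class C^k\<close>

lemma Ck_on_cong:
  assumes "\<And>x. x \<in> S \<Longrightarrow> f x = g x"
  shows "Ck_on k V S f \<longleftrightarrow> Ck_on k V S g"
proof (cases k)
  case 0
  then show ?thesis using continuous_on_cong[of S S f g] assms by simp
next
  case (Suc j)
  have "(f has_derivative D) (at x within S) \<longleftrightarrow> (g has_derivative D) (at x within S)" if "x \<in> S" for D x
    using has_derivative_transform[of x S f g] has_derivative_transform[of x S g f] assms that by metis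
  then show ?thesis using Suc by simp
qed

lemma Ck_on_subset: "Ck_on k V S f \<Longrightarrow> T \<subseteq> S \<Longrightarrow> Ck_on k V T f"
proof (induction k arbitrary: f)
  case 0 then show ?case by (auto intro: continuous_on_subset)
next
  case (Suc k)
  then show ?case by simp (meson has_derivative_subset subsetD)
qed

lemma Ck_on_continuous: "Ck_on k V S f \<Longrightarrow> continuous_on S f"
  by (cases k) (auto intro: has_derivative_continuous_on)

lemma Ck_on_SucD: "Ck_on (Suc k) V S f \<Longrightarrow> Ck_on k V S f"
proof (induction k arbitrary: f)
  case 0 then show ?case using Ck_on_continuous[OF 0] by simp
next
  case (Suc k)
  then show ?case by (metis Ck_on.simps(2))
qed

lemma Ck_on_const: "Ck_on k V S (\<lambda>x. c)"
  by (induction k arbitrary: c) (auto intro!: exI[of _ "\<lambda>_ _. 0"])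

lemma Ck_on_bounded_linear: "bounded_linear f \<Longrightarrow> Ck_on k V S f"
  by (cases k) (auto intro!: exI[of _ "\<lambda>_. f"] Ck_on_const bounded_linear_imp_has_derivative
      linear_continuous_on)

lemma Ck_on_SucI:
  "(\<And>x. x \<in> S \<Longrightarrow> (f has_derivative f' x) (at x within S)) \<Longrightarrow>
   (\<And>v. v \<in> V \<Longrightarrow> Ck_on k V S (\<lambda>x. f' x v)) \<Longrightarrow> Ck_on (Suc k) V S f"
  unfolding Ck_on.simps by (intro exI[of _ f'] conjI ballI)

lemma Ck_on_SucE:
  assumes "Ck_on (Suc k) V S f"
  obtains f' where "\<And>x. x \<in> S \<Longrightarrow> (f has_derivative f' x) (at x within S)"
    "\<And>v. v \<in> V \<Longrightarrow> Ck_on k V S (\<lambda>x. f' x v)" "Ck_on k V S f"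
  using assms Ck_on_SucD[OF assms] unfolding Ck_on.simps by metis

lemma Ck_on_linear_comp:
  assumes "bounded_linear l"
  shows "Ck_on k V S f \<Longrightarrow> Ck_on k V S (\<lambda>x. l (f x))"
proof (induction k arbitrary: f)
  case 0
  then show ?case using assms by (simp add: bounded_linear.continuous_on)
next
  case (Suc k)
  from Suc.prems obtain f' where f': "\<And>x. x\<in>S \<Longrightarrow> (f has_derivative f' x) (at x within S)"
    "\<And>v. v\<in>V \<Longrightarrow> Ck_on k V S (\<lambda>x. f' x v)" by (rule Ck_on_SucE) iprover
  show ?case
    by (rule Ck_on_SucI[of _ _ "\<lambda>x v. l (f' x v)"])
      (rule bounded_linear.has_derivative[OF assms f'(1)] Suc.IH[OF f'(2)]; assumption)+
qed

lemma Ck_on_add: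
  "Ck_on k V S f \<Longrightarrow> Ck_on k V S g \<Longrightarrow> Ck_on k V S (\<lambda>x. f x + g x)"
proof (induction k arbitrary: f g)
  case 0
  then show ?case by (auto intro: continuous_on_add)
next
  case (Suc k)
  from Suc.prems(1) obtain f' where f': "\<And>x. x\<in>S \<Longrightarrow> (f has_derivative f' x) (at x within S)"
    "\<And>v. v\<in>V \<Longrightarrow> Ck_on k V S (\<lambda>x. f' x v)" by (rule Ck_on_SucE) iprover
  from Suc.prems(2) obtain g' where g': "\<And>x. x\<in>S \<Longrightarrow> (g has_derivative g' x) (at x within S)"
    "\<And>v. v\<in>V \<Longrightarrow> Ck_on k V S (\<lambda>x. g' x v)" by (rule Ck_on_SucE) iprover
  show ?case
    by (rule Ck_on_SucI[of _ _ "\<lambda>x v. f' x v + g' x v"])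
      (rule has_derivative_add[OF f'(1) g'(1)] Suc.IH[OF f'(2) g'(2)]; assumption)+
qed

lemma Ck_on_sum:
  assumes "\<And>i. i \<in> I \<Longrightarrow> Ck_on k V S (f i)"
  shows "Ck_on k V S (\<lambda>x. \<Sum>i\<in>I. f i x)"
  using assms
proof (induction I rule: infinite_finite_induct)
  case (insert i I)
  then show ?case using Ck_on_add[of k V S "f i"] by simp
qed (simp_all add: Ck_on_const)

text \<open>The product rule pairs each function with the derivative of the other, so the induction
  needs the functions themselves at order \<open>k\<close> as well; \<open>Ck_on_SucE\<close>
  provides them.\<close>

lemma Ck_on_bilinear:
  fixes h :: "'f::euclidean_space \<Rightarrow> 'g::euclidean_space \<Rightarrow> 'h::euclidean_space"
  assumes "bounded_bilinear h"
  shows "Ck_on k V S f \<Longrightarrow> Ck_on k V S g \<Longrightarrow> Ck_on k V S (\<lambda>x. h (f x) (g x))"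
proof (induction k arbitrary: f g)
  case 0
  then show ?case by (auto intro: bounded_bilinear.continuous_on[OF assms])
next
  case (Suc k)
  from Suc.prems(1) obtain f' where f': "\<And>x. x\<in>S \<Longrightarrow> (f has_derivative f' x) (at x within S)"
    "\<And>v. v\<in>V \<Longrightarrow> Ck_on k V S (\<lambda>x. f' x v)" "Ck_on k V S f" by (rule Ck_on_SucE) iprover
  from Suc.prems(2) obtain g' where g': "\<And>x. x\<in>S \<Longrightarrow> (g has_derivative g' x) (at x within S)"
    "\<And>v. v\<in>V \<Longrightarrow> Ck_on k V S (\<lambda>x. g' x v)" "Ck_on k V S g" by (rule Ck_on_SucE) iprover
  show ?case
  proof (rule Ck_on_SucI[of _ _ "\<lambda>x v. h (f x) (g' x v) + h (f' x v) (g x)"])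
    show "((\<lambda>x. h (f x) (g x)) has_derivative (\<lambda>v. h (f x) (g' x v) + h (f' x v) (g x))) (at x within S)"
      if "x \<in> S" for x by (rule bounded_bilinear.FDERIV[OF assms f'(1)[OF that] g'(1)[OF that]])
    show "Ck_on k V S (\<lambda>x. h (f x) (g' x v) + h (f' x v) (g x))" if "v \<in> V" for v
      by (rule Ck_on_add[OF Suc.IH[OF f'(3) g'(2)[OF that]] Suc.IH[OF f'(2)[OF that] g'(3)]])
  qed
qed

lemma has_derivative_sub_proj:
  assumes "subspace W" "f ` S \<subseteq> W" "(f has_derivative f') (at x within S)" "x \<in> S"
  shows "(f has_derivative (\<lambda>v. sub_proj W (f' v))) (at x within S)"
proof (rule has_derivative_transform[OF assms(4)])
  show "((\<lambda>x. sub_proj W (f x)) has_derivative (\<lambda>v. sub_proj W (f' v))) (at x within S)"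
    using bounded_linear.has_derivative[OF bounded_linear_sub_proj assms(3)] .
  show "f y = sub_proj W (f y)" if "y \<in> S" for y
    using sub_proj_id[OF assms(1), of "f y"] that assms(2) by auto
qed

text \<open>\<open>Ck_on\<close> controls the derivative of \<open>g\<close> only along fixed
  directions, whereas the chain rule applies it to the moving vector \<open>f' x v\<close>.
  Expanding that vector in an orthonormal basis of \<open>W\<close> leaves a sum of products, to
  which the induction hypothesis applies.\<close>

lemma Ck_on_compose:
  assumes W: "subspace W" and T: "T \<subseteq> W"
  shows "Ck_on k W T g \<Longrightarrow> Ck_on k V S f \<Longrightarrow> f ` S \<subseteq> T \<Longrightarrow> Ck_on k V S (\<lambda>x. g (f x))"
proof (induction k arbitrary: f g)
  case 0
  then show ?case by (auto intro: continuous_on_compose2)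
next
  case (Suc k)
  from Suc.prems(2) obtain f' where f': "\<And>x. x\<in>S \<Longrightarrow> (f has_derivative f' x) (at x within S)"
    "\<And>v. v\<in>V \<Longrightarrow> Ck_on k V S (\<lambda>x. f' x v)" by auto
  from Suc.prems(1) obtain g' where g': "\<And>x. x\<in>T \<Longrightarrow> (g has_derivative g' x) (at x within T)"
    "\<And>v. v\<in>W \<Longrightarrow> Ck_on k W T (\<lambda>x. g' x v)" by auto
  let ?D = "\<lambda>x v. \<Sum>b\<in>onb W. (f' x v \<bullet> b) *\<^sub>R g' (f x) b"
  have f: "Ck_on k V S f" using Suc.prems Ck_on_SucD by blast
  have 1: "((\<lambda>x. g (f x)) has_derivative ?D x) (at x within S)" if x: "x \<in> S" for x
  proof -
    have fx: "f x \<in> T" using x Suc.prems by auto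
    have "((\<lambda>x. g (f x)) has_derivative (\<lambda>v. g' (f x) (sub_proj W (f' x v)))) (at x within S)"
      using diff_chain_within[OF has_derivative_sub_proj[OF W _ f'(1)[OF x] x]
          has_derivative_subset[OF g'(1)[OF fx] Suc.prems(3)]] Suc.prems(3) T
      by (auto simp: o_def)
    moreover interpret bounded_linear "g' (f x)" using g'(1)[OF fx] has_derivative_bounded_linear by blast
    have "(\<lambda>v. g' (f x) (sub_proj W (f' x v))) = ?D x"
      by (simp add: sub_proj_def sum scale)
    ultimately show ?thesis by simp
  qed
  have 2: "Ck_on k V S (\<lambda>x. ?D x v)" if v: "v \<in> V" for v
  proof (intro Ck_on_sum Ck_on_bilinear[OF bounded_bilinear_scaleR])
    fix b assume b: "b \<in> onb W"
    show "Ck_on k V S (\<lambda>x. f' x v \<bullet> b)"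
      by (rule Ck_on_linear_comp[OF bounded_linear_inner_left f'(2)[OF v]])
    show "Ck_on k V S (\<lambda>x. g' (f x) b)"
      using Suc.IH[OF g'(2) f Suc.prems(3)] b onb(1)[OF W] by blast
  qed
  show ?case unfolding Ck_on.simps(2) by (rule exI[of _ ?D]) (use 1 2 in blast)
qed

section \<open>Uniqueness of derivatives within a subspace, and locality\<close>

lemma has_vector_derivative_curve:
  assumes "(\<alpha> has_vector_derivative v) (at t within I)" "\<alpha> ` I \<subseteq> V" "(f has_derivative f') (at (\<alpha> t) within V)"
  shows "((\<lambda>t. f (\<alpha> t)) has_vector_derivative f' v) (at t within I)"
proof -
  have 1: "(\<alpha> has_derivative (\<lambda>x. x *\<^sub>R v)) (at t within I)"
    using assms(1) unfolding has_vector_derivative_def .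
  have 2: "(f has_derivative f') (at (\<alpha> t) within \<alpha> ` I)"
    by (rule has_derivative_subset[OF assms(3,2)])
  have 3: "((\<lambda>t. f (\<alpha> t)) has_derivative f' \<circ> (\<lambda>x. x *\<^sub>R v)) (at t within I)"
    using diff_chain_within[OF 1 2] unfolding o_def .
  moreover have "f' \<circ> (\<lambda>x. x *\<^sub>R v) = (\<lambda>x. x *\<^sub>R f' v)"
    using linear_cmul[OF bounded_linear.linear[OF has_derivative_bounded_linear[OF assms(3)]]] by (simp add: o_def)
  ultimately show ?thesis unfolding has_vector_derivative_def by simp
qed

lemma has_derivative_line:
  assumes "subspace V" "x \<in> V" "v \<in> V" "(f has_derivative f') (at x within V)"
  shows "((\<lambda>t. f (x + t *\<^sub>R v)) has_vector_derivative f' v) (at 0)"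
proof -
  have "((\<lambda>t. x + t *\<^sub>R v) has_vector_derivative v) (at 0)"
    by (auto intro!: derivative_eq_intros simp: has_vector_derivative_def)
  moreover have "range (\<lambda>t. x + t *\<^sub>R v) \<subseteq> V" using assms by (auto simp: subspace_add subspace_scale)
  ultimately show ?thesis using has_vector_derivative_curve[of "\<lambda>t. x + t *\<^sub>R v" v 0 UNIV V f f'] assms by simp
qed

text \<open>Lines inside \<open>V\<close> reach every direction of \<open>V\<close>, so the
  derivative is determined there, although not off \<open>V\<close>.\<close>

lemma has_derivative_subspace_unique:
  assumes "subspace V" "x \<in> V" "v \<in> V"
    "(f has_derivative f') (at x within V)" "(f has_derivative f'') (at x within V)"
  shows "f' v = f'' v"
  using has_derivative_line[OF assms(1-4)] has_derivative_line[OF assms(1-3,5)]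
  by (rule vector_derivative_unique_at)

lemma frechet_derivative_within_subspace:
  assumes "subspace V" "x \<in> V" "v \<in> V" "(f has_derivative f') (at x within V)"
  shows "frechet_derivative f (at x within V) v = f' v"
proof -
  have "(f has_derivative frechet_derivative f (at x within V)) (at x within V)"
    using assms(4) by (metis differentiable_def frechet_derivative_works)
  then show ?thesis using has_derivative_subspace_unique assms by blast
qed

text \<open>Replaces the existentially quantified derivative by a canonical one. Local derivatives
  then agree automatically, which is what gluing in \<open>Ck_on_local\<close> relies on.\<close>

lemma Ck_on_Suc_iff:
  assumes V: "subspace V" and S: "openin (top_of_set V) S"
  shows "Ck_on (Suc k) V S f \<longleftrightarrow> (\<forall>x\<in>S. f differentiable (at x within V)) \<and>
     (\<forall>v\<in>V. Ck_on k V S (\<lambda>x. frechet_derivative f (at x within V) v))" (is "?L \<longleftrightarrow> ?R")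
proof
  have SV: "S \<subseteq> V" using S openin_imp_subset by blast
  show "?R" if ?L
  proof -
    obtain f' where f0: "\<forall>x\<in>S. (f has_derivative f' x) (at x within S)"
      "\<forall>v\<in>V. Ck_on k V S (\<lambda>x. f' x v)" using \<open>?L\<close> by auto
    then have f': "\<forall>x\<in>S. (f has_derivative f' x) (at x within V)"
      "\<forall>v\<in>V. Ck_on k V S (\<lambda>x. f' x v)" using at_within_rel_open[OF S] by force+
    have "Ck_on k V S (\<lambda>x. frechet_derivative f (at x within V) v)" if "v \<in> V" for v
    proof -
      have "frechet_derivative f (at x within V) v = f' x v" if "x \<in> S" for x
        using frechet_derivative_within_subspace[OF V, of x v f "f' x"] that \<open>v \<in> V\<close> f' SV by auto
      then show ?thesis using f'(2) \<open>v \<in> V\<close> Ck_on_cong[of S "\<lambda>x. f' x v"] by (metis (no_types, lifting))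
    qed
    then show ?thesis using f' by (auto simp: differentiable_def)
  qed
  show ?L if ?R
  proof -
    have "\<forall>x\<in>S. (f has_derivative frechet_derivative f (at x within V)) (at x within S)"
      using that at_within_rel_open[OF S] frechet_derivative_works by metis
    then show ?thesis using that unfolding Ck_on.simps(2)
      by (intro exI[of _ "\<lambda>x. frechet_derivative f (at x within V)"]) blast
  qed
qed

lemma Ck_on_local:
  assumes V: "subspace V" and S: "openin (top_of_set V) S"
    and loc: "\<And>x. x \<in> S \<Longrightarrow> \<exists>T. x \<in> T \<and> openin (top_of_set V) T \<and> Ck_on k V T f"
  shows "Ck_on k V S f"
  using loc
proof (induction k arbitrary: f)
  case 0
  have "continuous (at x within S) f" if x: "x \<in> S" for x
  proof -
    obtain T where T: "x \<in> T" "openin (top_of_set V) T" "continuous_on T f" using 0[OF x] by auto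
    then have "continuous (at x within T) f" by (auto simp: continuous_on_eq_continuous_within)
    then show ?thesis using at_within_rel_open[OF S x] at_within_rel_open[OF T(2,1)] by simp
  qed
  then show ?case by (simp add: continuous_on_eq_continuous_within)
next
  case (Suc k)
  have "f differentiable (at x within V)" if x: "x \<in> S" for x
  proof -
    obtain T where T: "x \<in> T" "openin (top_of_set V) T" "Ck_on (Suc k) V T f" using Suc.prems[OF x] by auto
    then show ?thesis using Ck_on_Suc_iff[OF V T(2)] by auto
  qed
  moreover have "Ck_on k V S (\<lambda>x. frechet_derivative f (at x within V) v)" if v: "v \<in> V" for v
  proof (rule Suc.IH)
    fix x assume "x \<in> S"
    from Suc.prems[OF this] obtain T where T: "x \<in> T" "openin (top_of_set V) T" "Ck_on (Suc k) V T f" by auto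
    then show "\<exists>T. x \<in> T \<and> openin (top_of_set V) T \<and> Ck_on k V T (\<lambda>x. frechet_derivative f (at x within V) v)"
      using Ck_on_Suc_iff[OF V T(2)] v by blast
  qed
  ultimately show ?case using Ck_on_Suc_iff[OF V S] by blast
qed

lemma smooth_onD: "smooth_on V S f \<Longrightarrow> Ck_on k V S f"
  unfolding smooth_on_def by (rule spec)

lemma smooth_onI: "(\<And>k. Ck_on k V S f) \<Longrightarrow> smooth_on V S f"
  unfolding smooth_on_def by (rule allI)

lemma smooth_on_cong: "(\<And>x. x \<in> S \<Longrightarrow> f x = g x) \<Longrightarrow> smooth_on V S f \<longleftrightarrow> smooth_on V S g"
  unfolding smooth_on_def by (simp only: Ck_on_cong[of S f g])

lemma smooth_on_subset: "smooth_on V S f \<Longrightarrow> T \<subseteq> S \<Longrightarrow> smooth_on V T f"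
  by (rule smooth_onI, rule Ck_on_subset[OF smooth_onD])

lemma smooth_on_continuous: "smooth_on V S f \<Longrightarrow> continuous_on S f"
  by (rule Ck_on_continuous[OF smooth_onD])

lemma smooth_on_linear: "bounded_linear f \<Longrightarrow> smooth_on V S f"
  by (rule smooth_onI, rule Ck_on_bounded_linear)

lemma smooth_on_const: "smooth_on V S (\<lambda>x. c)"
  by (rule smooth_onI, rule Ck_on_const)

lemma smooth_on_linear_comp: "bounded_linear l \<Longrightarrow> smooth_on V S f \<Longrightarrow> smooth_on V S (\<lambda>x. l (f x))"
  by (rule smooth_onI, rule Ck_on_linear_comp[OF _ smooth_onD])

lemma smooth_on_add: "smooth_on V S f \<Longrightarrow> smooth_on V S g \<Longrightarrow> smooth_on V S (\<lambda>x. f x + g x)"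
  by (rule smooth_onI, rule Ck_on_add[OF smooth_onD smooth_onD])

lemma smooth_on_compose:
  "subspace W \<Longrightarrow> T \<subseteq> W \<Longrightarrow> smooth_on W T g \<Longrightarrow> smooth_on V S f \<Longrightarrow> f ` S \<subseteq> T \<Longrightarrow> smooth_on V S (\<lambda>x. g (f x))"
  by (rule smooth_onI, rule Ck_on_compose[OF _ _ smooth_onD smooth_onD])

lemma smooth_on_Pair:
  fixes f :: "'a::euclidean_space \<Rightarrow> 'b::euclidean_space" and g :: "'a \<Rightarrow> 'c::euclidean_space"
  assumes "smooth_on V S f" "smooth_on V S g" shows "smooth_on V S (\<lambda>x. (f x, g x))"
proof -
  have "bounded_linear (\<lambda>y::'b. (y, 0::'c))" "bounded_linear (\<lambda>y::'c. (0::'b, y))"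
    by (rule bounded_linear_Pair[OF bounded_linear_ident bounded_linear_zero],
        rule bounded_linear_Pair[OF bounded_linear_zero bounded_linear_ident])
  from smooth_on_add[OF smooth_on_linear_comp[OF this(1) assms(1)] smooth_on_linear_comp[OF this(2) assms(2)]]
  have "smooth_on V S (\<lambda>x. (f x, 0) + (0, g x))" .
  then show ?thesis by (simp only: add_Pair add_0_left add_0_right)
qed

lemma smooth_on_local:
  assumes "subspace V" "openin (top_of_set V) S"
    and "\<And>x. x \<in> S \<Longrightarrow> \<exists>T. x \<in> T \<and> openin (top_of_set V) T \<and> smooth_on V T f"
  shows "smooth_on V S f"
  unfolding smooth_on_def
proof
  fix k show "Ck_on k V S f"
  proof (rule Ck_on_local[OF assms(1,2)])
    fix x assume "x \<in> S"
    from assms(3)[OF this] show "\<exists>T. x \<in> T \<and> openin (top_of_set V) T \<and> Ck_on k V T f"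
      unfolding smooth_on_def by blast
  qed
qed

lemma smooth_on_differentiable:
  assumes "subspace V" "openin (top_of_set V) S" "smooth_on V S f" "x \<in> S"
  shows "(f has_derivative frechet_derivative f (at x within V)) (at x within V)"
proof -
  have "Ck_on (Suc 0) V S f" by (rule smooth_onD[OF assms(3)])
  then show ?thesis using Ck_on_Suc_iff[OF assms(1,2)] assms(4) frechet_derivative_works by blast
qed

lemma smooth_on_frechet_derivative:
  assumes "subspace V" "openin (top_of_set V) S" "smooth_on V S f" "v \<in> V"
  shows "smooth_on V S (\<lambda>x. frechet_derivative f (at x within V) v)"
  unfolding smooth_on_def
proof
  fix k
  have "Ck_on (Suc k) V S f" by (rule smooth_onD[OF assms(3)])
  from iffD1[OF Ck_on_Suc_iff[OF assms(1,2)] this]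
  show "Ck_on k V S (\<lambda>x. frechet_derivative f (at x within V) v)"
    using assms(4) by simp
qed

subsection \<open>The inverse function theorem\<close>

text \<open>As in the chain rule, the moving argument is expanded in a basis, since the regularity
  of \<open>T\<close> is known only on fixed vectors.\<close>

lemma Ck_on_blinfun_apply:
  fixes T :: "'e::euclidean_space \<Rightarrow> 'f::euclidean_space \<Rightarrow>\<^sub>L 'g::euclidean_space"
  assumes "\<And>v. Ck_on k V S (\<lambda>x. T x v)" "Ck_on k V S y"
  shows "Ck_on k V S (\<lambda>x. T x (y x))"
proof -
  have "T x (y x) = (\<Sum>c\<in>Basis. (y x \<bullet> c) *\<^sub>R T x c)" for x
    by (subst euclidean_representation[of "y x", symmetric]) (simp add: blinfun.sum_right blinfun.scaleR_right)
  moreover have "Ck_on k V S (\<lambda>x. \<Sum>c\<in>Basis. (y x \<bullet> c) *\<^sub>R T x c)"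
    by (rule Ck_on_sum, rule Ck_on_bilinear[OF bounded_bilinear_scaleR],
        rule Ck_on_linear_comp[OF bounded_linear_inner_left assms(2)], rule assms(1))
  ultimately show ?thesis by simp
qed

text \<open>Once \<open>F y\<close> is close enough to \<open>F x\<close>, it is bounded below by a
  constant independent of \<open>y\<close>, so its inverse \<open>T y\<close> is uniformly bounded.
  Then \<open>T y - T x = T y (F x - F y) T x\<close> tends to zero.\<close>

lemma continuous_on_blinfun_inverse:
  fixes F T :: "'e::euclidean_space \<Rightarrow> 'f::euclidean_space \<Rightarrow>\<^sub>L 'f"
  assumes F: "continuous_on S F" and FT: "\<And>x. x \<in> S \<Longrightarrow> F x o\<^sub>L T x = id_blinfun"
    and TF: "\<And>x. x \<in> S \<Longrightarrow> T x o\<^sub>L F x = id_blinfun"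
  shows "continuous_on S T"
proof (rule continuous_on_blinfun_componentwise)
  fix v :: 'f
  have FT': "F x (T x u) = u" and TF': "T x (F x u) = u" if "x \<in> S" for x u
    using FT[OF that] TF[OF that] by (metis blinfun_apply_blinfun_compose blinfun_apply_id_blinfun)+
  show "continuous_on S (\<lambda>x. T x v)"
    unfolding continuous_on_def
  proof
    fix x assume x: "x \<in> S"
    let ?K = "norm (T x) + 1"
    have lim: "((\<lambda>y. norm (F x - F y)) \<longlongrightarrow> 0) (at x within S)"
      using F x tendsto_norm_zero[OF LIM_zero[of F "F x" "at x within S"]]
      by (auto simp: continuous_on_def norm_minus_commute)
    have ev: "eventually (\<lambda>y. norm (F x - F y) < 1 / (2 * ?K)) (at x within S)"
      by (rule order_tendstoD(2)[OF lim]) (simp add: add_nonneg_pos)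
    have "eventually (\<lambda>y. norm (T y v - T x v) \<le> 2 * ?K * norm (F x - F y) * norm (T x v)) (at x within S)"
      using ev unfolding eventually_at_filter
    proof eventually_elim
      case (elim y)
      show ?case
      proof (intro impI)
        assume yx: "y \<noteq> x" and y: "y \<in> S"
        have bd: "norm w \<le> 2 * ?K * norm (F y w)" for w
        proof -
          have "norm w = norm (T x (F y w + (F x - F y) w))"
            using TF'[OF x, of w] by (simp add: blinfun.diff_left blinfun.add_right blinfun.diff_right)
          also have "\<dots> \<le> ?K * norm (F y w + (F x - F y) w)"
            by (rule order_trans[OF norm_blinfun]) (simp add: mult_right_mono)
          also have "\<dots> \<le> ?K * (norm (F y w) + norm (F x - F y) * norm w)"
            by (intro mult_left_mono order_trans[OF norm_triangle_ineq] add_left_mono norm_blinfun)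
              (simp add: add_nonneg_nonneg)
          also have "\<dots> \<le> ?K * (norm (F y w) + 1 / (2 * ?K) * norm w)"
            using elim yx y by (intro mult_left_mono add_left_mono mult_right_mono) (auto simp: add_nonneg_nonneg)
          also have "\<dots> = ?K * norm (F y w) + norm w / 2"
            using norm_ge_zero[of "T x"] by (simp add: field_simps add_nonneg_eq_0_iff)
          finally have "norm w \<le> 2 * (?K * norm (F y w))" by linarith
          then show ?thesis by (simp only: mult.assoc)
        qed
        have "T y v - T x v = T y ((F x - F y) (T x v))"
          using FT'[OF x, of v] TF'[OF y, of "T x v"] by (simp add: blinfun.diff_left blinfun.diff_right)
        then have "norm (T y v - T x v) \<le> 2 * ?K * norm ((F x - F y) (T x v))"
          using bd[of "T y v - T x v"] FT'[OF y] by simp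
        also have "\<dots> \<le> 2 * ?K * (norm (F x - F y) * norm (T x v))"
          by (intro mult_left_mono norm_blinfun) (simp add: add_nonneg_nonneg)
        finally show "norm (T y v - T x v) \<le> 2 * ?K * norm (F x - F y) * norm (T x v)" by (simp add: mult_ac)
      qed
    qed
    moreover have "((\<lambda>y. 2 * ?K * norm (F x - F y) * norm (T x v)) \<longlongrightarrow> 0) (at x within S)"
      by (rule tendsto_mult_left_zero[OF tendsto_mult_right_zero[OF lim]])
    ultimately have "((\<lambda>y. T y v - T x v) \<longlongrightarrow> 0) (at x within S)"
      by (rule Lim_null_comparison)
    then show "((\<lambda>y. T y v) \<longlongrightarrow> T x v) (at x within S)" by (simp add: LIM_zero_iff)
  qed
qed

text \<open>A product rule in which \<open>T\<close> is merely continuous: since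
  \<open>\<phi>\<close> vanishes at \<open>x\<close>, a derivative of \<open>T\<close> would only be
  multiplied by zero. This breaks the circle of differentiating an inverse before its
  differentiability is known.\<close>

lemma has_derivative_blinfun_vanishing:
  fixes T :: "'e::real_normed_vector \<Rightarrow> 'f::real_normed_vector \<Rightarrow>\<^sub>L 'g::real_normed_vector"
  assumes T: "(T \<longlongrightarrow> T x) (at x within S)" and \<phi>: "(\<phi> has_derivative D) (at x within S)" and 0: "\<phi> x = 0"
  shows "((\<lambda>y. T y (\<phi> y)) has_derivative (\<lambda>u. T x (D u))) (at x within S)"
  unfolding has_derivative_within
proof
  have D: "bounded_linear D" using \<phi> has_derivative_bounded_linear by blast
  show "bounded_linear (\<lambda>u. T x (D u))"
    using D by (rule bounded_linear_compose[OF blinfun.bounded_linear_right])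
  have \<phi>': "((\<lambda>y. (1 / norm (y - x)) *\<^sub>R (\<phi> y - (\<phi> x + D (y - x)))) \<longlongrightarrow> 0) (at x within S)"
    using \<phi> unfolding has_derivative_within by blast
  obtain K where K: "\<And>u. norm (D u) \<le> norm u * K"
    using bounded_linear.bounded[OF D] by blast
  have 1: "((\<lambda>y. T y ((1 / norm (y - x)) *\<^sub>R (\<phi> y - (\<phi> x + D (y - x))))) \<longlongrightarrow> T x 0) (at x within S)"
    by (rule blinfun.tendsto[OF T \<phi>'])
  have 2: "((\<lambda>y. (T y - T x) ((1 / norm (y - x)) *\<^sub>R D (y - x))) \<longlongrightarrow> 0) (at x within S)"
  proof (rule Lim_null_comparison)
    show "((\<lambda>y. norm (T y - T x) * \<bar>K\<bar>) \<longlongrightarrow> 0) (at x within S)"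
      using tendsto_mult_left_zero[OF tendsto_norm_zero[OF LIM_zero[OF T]]] .
    show "eventually (\<lambda>y. norm ((T y - T x) ((1 / norm (y - x)) *\<^sub>R D (y - x))) \<le> norm (T y - T x) * \<bar>K\<bar>) (at x within S)"
    proof (intro always_eventually allI order_trans[OF norm_blinfun] mult_left_mono norm_ge_zero)
      fix y
      have "norm (D (y - x)) \<le> norm (y - x) * \<bar>K\<bar>"
        using K[of "y - x"] by (meson abs_ge_self mult_left_mono norm_ge_zero order_trans)
      then show "norm ((1 / norm (y - x)) *\<^sub>R D (y - x)) \<le> \<bar>K\<bar>"
        by (cases "y = x") (auto simp: divide_simps mult_ac)
    qed
  qed
  have "(\<lambda>y. (1 / norm (y - x)) *\<^sub>R (T y (\<phi> y) - (T x (\<phi> x) + T x (D (y - x))))) =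
     (\<lambda>y. T y ((1 / norm (y - x)) *\<^sub>R (\<phi> y - (\<phi> x + D (y - x)))) + (T y - T x) ((1 / norm (y - x)) *\<^sub>R D (y - x)))"
    using 0 by (simp add: fun_eq_iff blinfun.diff_left blinfun.diff_right blinfun.scaleR_right algebra_simps)
  with tendsto_add[OF 1 2]
  show "((\<lambda>y. (1 / norm (y - x)) *\<^sub>R (T y (\<phi> y) - (T x (\<phi> x) + T x (D (y - x))))) \<longlongrightarrow> 0) (at x within S)"
    by simp
qed

text \<open>Freeze \<open>w = T x v\<close> and write \<open>T y v = T y (v - F y w) + w\<close>.
  The argument of \<open>T y\<close> vanishes at \<open>y = x\<close>, so
  \<open>has_derivative_blinfun_vanishing\<close> gives the familiar derivative
  \<open>- T F' T\<close>. Its ingredients are one order less regular than \<open>F\<close> and are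
  covered by the induction.\<close>

lemma Ck_on_blinfun_inverse:
  fixes F T :: "'e::euclidean_space \<Rightarrow> 'f::euclidean_space \<Rightarrow>\<^sub>L 'f"
  assumes FT: "\<And>x. x \<in> S \<Longrightarrow> F x o\<^sub>L T x = id_blinfun"
    and TF: "\<And>x. x \<in> S \<Longrightarrow> T x o\<^sub>L F x = id_blinfun"
  shows "(\<And>v. Ck_on k V S (\<lambda>x. F x v)) \<Longrightarrow> Ck_on k V S (\<lambda>x. T x v)"
proof (induction k arbitrary: v)
  case (0 v)
  then have "continuous_on S F" by (intro continuous_on_blinfun_componentwise) simp
  from continuous_on_blinfun_inverse[OF this FT TF]
  have "continuous_on S T" by simp
  then show ?case by (simp add: blinfun.continuous_on)
next
  case (Suc k)
  have FT': "F x (T x u) = u" and TF': "T x (F x u) = u" if "x \<in> S" for x u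
    using FT[OF that] TF[OF that] by (metis blinfun_apply_blinfun_compose blinfun_apply_id_blinfun)+
  have "continuous_on S F" using Suc.prems[THEN Ck_on_continuous] by (rule continuous_on_blinfun_componentwise)
  from continuous_on_blinfun_inverse[OF this FT TF] have contT: "continuous_on S T" by simp
  have "\<exists>f'. (\<forall>x\<in>S. ((\<lambda>x. F x b) has_derivative f' x) (at x within S)) \<and> (\<forall>v\<in>V. Ck_on k V S (\<lambda>x. f' x v))" for b
    using Suc.prems[of b] unfolding Ck_on.simps .
  then obtain F' where F'1: "\<And>b x. x \<in> S \<Longrightarrow> ((\<lambda>x. F x b) has_derivative F' b x) (at x within S)"
    and F'2: "\<And>b v. v \<in> V \<Longrightarrow> Ck_on k V S (\<lambda>x. F' b x v)" by metis
  have Fk: "Ck_on k V S (\<lambda>x. F x u)" for u by (rule Ck_on_SucD[OF Suc.prems])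
  have Tk: "Ck_on k V S (\<lambda>x. T x u)" for u by (rule Suc.IH[OF Fk])
  let ?D = "\<lambda>x u. - (T x (\<Sum>b\<in>Basis. (T x v \<bullet> b) *\<^sub>R F' b x u))"
  show ?case
  proof (rule Ck_on_SucI[of _ _ ?D])
    fix x assume x: "x \<in> S"
    define w where "w = T x v"
    have "((\<lambda>y. v - (\<Sum>b\<in>Basis. (w \<bullet> b) *\<^sub>R F y b)) has_derivative (\<lambda>u. 0 - (\<Sum>b\<in>Basis. (w \<bullet> b) *\<^sub>R F' b x u))) (at x within S)"
      by (intro has_derivative_diff has_derivative_const has_derivative_sum has_derivative_scaleR_right F'1 x)
    moreover have Fw: "(\<Sum>b\<in>Basis. (w \<bullet> b) *\<^sub>R F y b) = F y w" for y
      by (subst (2) euclidean_representation[of w, symmetric]) (simp add: blinfun.sum_right blinfun.scaleR_right)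
    ultimately have "((\<lambda>y. v - F y w) has_derivative (\<lambda>u. - (\<Sum>b\<in>Basis. (w \<bullet> b) *\<^sub>R F' b x u))) (at x within S)"
      by simp
    from has_derivative_blinfun_vanishing[OF _ this, of T] contT x FT'[OF x]
    have "((\<lambda>y. T y (v - F y w)) has_derivative ?D x) (at x within S)"
      by (simp add: continuous_on_def w_def blinfun.minus_right)
    then have "((\<lambda>y. T y (v - F y w) + w) has_derivative ?D x) (at x within S)"
      using has_derivative_add[OF _ has_derivative_const[of w]] by fastforce
    then show "((\<lambda>y. T y v) has_derivative ?D x) (at x within S)"
      by (rule has_derivative_transform[OF x, rotated]) (simp add: blinfun.diff_right TF')
  next
    fix u assume u: "u \<in> V"
    show "Ck_on k V S (\<lambda>x. ?D x u)"
      by (rule Ck_on_linear_comp[OF bounded_linear_minus[OF bounded_linear_ident]],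
          rule Ck_on_blinfun_apply[OF Tk], rule Ck_on_sum, rule Ck_on_bilinear[OF bounded_bilinear_scaleR],
          rule Ck_on_linear_comp[OF bounded_linear_inner_left Tk], rule F'2[OF u])
  qed
qed

text \<open>Extending \<open>f\<close> by the identity on the orthogonal complement, as
  \<open>f (\<pi> y) + (y - \<pi> y)\<close>, gives a map of the full space with invertible
  derivative, to which the C^1 inverse function theorem applies. It remains to see that the inverse
  respects \<open>V\<close> and has all higher derivatives.\<close>

theorem inverse_function_theorem_subspace:
  fixes f :: "'e::euclidean_space \<Rightarrow> 'e"
  assumes V: "subspace V" and S: "openin (top_of_set V) S" and f: "smooth_on V S f" and fV: "f ` S \<subseteq> V"
    and x0: "x0 \<in> S" and inj: "\<And>v. v \<in> V \<Longrightarrow> frechet_derivative f (at x0 within V) v = 0 \<Longrightarrow> v = 0"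
  obtains Q R g where "openin (top_of_set V) Q" "x0 \<in> Q" "Q \<subseteq> S" "openin (top_of_set V) R"
    "homeomorphism Q R f g" "smooth_on V R g"
proof -
  let ?\<pi> = "sub_proj V"
  interpret \<pi>: bounded_linear ?\<pi> by (rule bounded_linear_sub_proj)
  have SV: "S \<subseteq> V" using S openin_imp_subset by blast
  have \<pi>V: "?\<pi> x \<in> V" for x using sub_proj_in[OF V] .
  have \<pi>id: "?\<pi> x = x" if "x \<in> V" for x using sub_proj_id[OF V that] .
  have \<pi>\<pi>: "?\<pi> (x - ?\<pi> x) = 0" for x using sub_proj_eq_0_iff[OF V] .
  let ?D = "\<lambda>p. frechet_derivative f (at p within V)"
  define L where "L = (\<lambda>p v. ?\<pi> (?D p (?\<pi> v)) + (v - ?\<pi> v))"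
  have D: "(f has_derivative ?D p) (at p within V)" if "p \<in> S" for p
    using smooth_on_differentiable[OF V S f that] .
  have Dlin: "bounded_linear (?D p)" if "p \<in> S" for p
    using D[OF that] has_derivative_bounded_linear by blast
  have D\<pi>: "?\<pi> (?D p v) = ?D p v" if p: "p \<in> S" and v: "v \<in> V" for p v
  proof -
    have "(f has_derivative (\<lambda>v. ?\<pi> (?D p v))) (at p within S)"
      using has_derivative_sub_proj[OF V fV has_derivative_subset[OF D[OF p] SV] p] .
    then have "(f has_derivative (\<lambda>v. ?\<pi> (?D p v))) (at p within V)"
      using at_within_rel_open[OF S p] by simp
    from has_derivative_subspace_unique[OF V _ v this D[OF p]] p SV show ?thesis by auto
  qed
  obtain O' where O': "open O'" "S = V \<inter> O'" using S by (auto simp: openin_open)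
  define U where "U = {y. ?\<pi> y \<in> S}"
  have U_eq: "U = ?\<pi> -` O'" using O' \<pi>V by (auto simp: U_def)
  have "open U" unfolding U_eq
    by (rule open_vimage[OF O'(1)]) (rule bounded_linear.continuous_on[OF bounded_linear_sub_proj continuous_on_id])
  define F where "F = (\<lambda>y. f (?\<pi> y) + (y - ?\<pi> y))"
  have L_bl: "bounded_linear (L p)" if "p \<in> S" for p
    unfolding L_def
    by (intro bounded_linear_add bounded_linear_sub bounded_linear_ident bounded_linear_sub_proj
        bounded_linear_compose[OF bounded_linear_sub_proj] bounded_linear_compose[OF Dlin[OF that]])
  define F' where "F' = (\<lambda>y. Blinfun (L (?\<pi> y)))"
  have F'_apply: "blinfun_apply (F' y) = L (?\<pi> y)" if "y \<in> U" for y
    using L_bl that by (simp add: F'_def U_def bounded_linear_Blinfun_apply)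
  have derF: "(F has_derivative blinfun_apply (F' y)) (at y)" if y: "y \<in> U" for y
  proof -
    have p: "?\<pi> y \<in> S" using y by (simp add: U_def)
    have 1: "(?\<pi> has_derivative ?\<pi>) (at y)" by (rule bounded_linear_imp_has_derivative[OF bounded_linear_sub_proj])
    have 2: "(f has_derivative (\<lambda>v. ?\<pi> (?D (?\<pi> y) v))) (at (?\<pi> y) within V)"
      using has_derivative_sub_proj[OF V fV has_derivative_subset[OF D[OF p] SV] p]
        at_within_rel_open[OF S p] by simp
    have "((\<lambda>y. f (?\<pi> y)) has_derivative (\<lambda>v. ?\<pi> (?D (?\<pi> y) (?\<pi> v)))) (at y)"
      using diff_chain_within[OF 1 has_derivative_subset[OF 2]] \<pi>V by (auto simp: o_def)
    then show ?thesis unfolding F'_apply[OF y] F_def L_def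
      by (intro has_derivative_add has_derivative_diff has_derivative_ident 1)
  qed
  have smD: "smooth_on V S (\<lambda>p. L p v)" for v
    unfolding L_def
    by (rule smooth_on_add[OF smooth_on_linear_comp[OF bounded_linear_sub_proj
        smooth_on_frechet_derivative[OF V S f \<pi>V]] smooth_on_const])
  have contF': "continuous_on U F'"
  proof (rule continuous_on_blinfun_componentwise)
    fix i :: 'e
    have "continuous_on U (\<lambda>y. L (?\<pi> y) i)"
      by (rule continuous_on_compose2[OF smooth_on_continuous[OF smD]
        bounded_linear.continuous_on[OF bounded_linear_sub_proj continuous_on_id]]) (auto simp: U_def)
    then show "continuous_on U (\<lambda>y. F' y i)" using F'_apply by (simp cong: continuous_on_cong)
  qed
  have x0V: "x0 \<in> V" using x0 SV by auto
  have x0U: "x0 \<in> U" using x0 by (simp add: U_def \<pi>id[OF x0V])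
  \<comment> \<open>The projection of \<open>L x0 v\<close> to \<open>V\<close> recovers the
    derivative of \<open>f\<close> applied to the projection of \<open>v\<close>; once that
    projection is zero, what remains of \<open>L x0 v\<close> is \<open>v\<close> itself.\<close>
  have "inj (F' x0)"
  proof -
    have "v = 0" if "L x0 v = 0" for v
    proof -
      have "?\<pi> (L x0 v) = ?\<pi> (?D x0 (?\<pi> v))"
        unfolding L_def by (simp add: \<pi>.add \<pi>\<pi> \<pi>id[OF \<pi>V])
      then have "?D x0 (?\<pi> v) = 0" using that D\<pi>[OF x0 \<pi>V] by (simp add: \<pi>.zero)
      then have "?\<pi> v = 0" using inj[OF \<pi>V] by blast
      then show "v = 0" using that bounded_linear.linear[OF Dlin[OF x0]] by (simp add: L_def linear_0 \<pi>.zero)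
    qed
    then show ?thesis unfolding F'_apply[OF x0U] \<pi>id[OF x0V]
      using linear_injective_0[OF bounded_linear.linear[OF L_bl[OF x0]]] by blast
  qed
  then obtain h where h: "linear h" "h \<circ> F' x0 = id"
    using linear_injective_left_inverse[OF bounded_linear.linear[OF blinfun.bounded_linear_right]] by blast
  have "Blinfun h o\<^sub>L F' x0 = id_blinfun"
    using h by (intro blinfun_eqI) (auto simp: bounded_linear_Blinfun_apply linear_linear fun_eq_iff)
  from inverse_function_theorem[OF \<open>open U\<close> derF contF' x0U this]
  obtain U' V' g g' where g: "open U'" "U' \<subseteq> U" "x0 \<in> U'" "open V'" "F x0 \<in> V'" "homeomorphism U' V' F g"
    "\<And>y. y \<in> V' \<Longrightarrow> (g has_derivative g' y) (at y)" "\<And>y. y \<in> V' \<Longrightarrow> g' y = inv_into UNIV (blinfun_apply (F' (g y)))"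
    "\<And>y. y \<in> V' \<Longrightarrow> bij (blinfun_apply (F' (g y)))" by metis
  define Q where "Q = V \<inter> U'"
  define R where "R = V \<inter> V'"
  have Q: "openin (top_of_set V) Q" and R: "openin (top_of_set V) R"
    using g by (auto simp: Q_def R_def openin_open)
  have QS: "Q \<subseteq> S" using g(2) \<pi>id by (auto simp: Q_def U_def)
  have Ff: "F y = f y" if "y \<in> V" for y using \<pi>id[OF that] by (simp add: F_def)
  \<comment> \<open>The extension leaves the component orthogonal to \<open>V\<close> unchanged, so
    a preimage of a point of \<open>V\<close> lies in \<open>V\<close>.\<close>
  have gQ: "g w \<in> Q" if "w \<in> R" for w
  proof -
    have gw: "g w \<in> U'" "F (g w) = w" using that g(6) by (auto simp: homeomorphism_def R_def)
    have "?\<pi> (g w) \<in> S" using gw g(2) by (auto simp: U_def)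
    then have "f (?\<pi> (g w)) \<in> V" using fV by auto
    then have "F (g w) - ?\<pi> (F (g w)) = g w - ?\<pi> (g w)"
      by (simp add: F_def \<pi>.add \<pi>\<pi> \<pi>id)
    moreover have "F (g w) - ?\<pi> (F (g w)) = 0" using gw that by (simp add: R_def \<pi>id)
    ultimately show ?thesis using gw \<pi>V[of "g w"] by (simp add: Q_def)
  qed
  have fR: "f y \<in> R" if "y \<in> Q" for y
  proof -
    have "F y \<in> V'" using that g(6) by (auto simp: homeomorphism_def Q_def)
    moreover have "f y \<in> V" using that fV QS by auto
    ultimately show ?thesis using that Ff[of y] by (simp add: Q_def R_def)
  qed
  have hom: "homeomorphism Q R f g"
  proof (rule homeomorphismI)
    have "continuous_on Q F" using g(6) by (auto simp: homeomorphism_def Q_def intro: continuous_on_subset)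
    then show "continuous_on Q f" by (rule continuous_on_eq) (use Ff Q_def in auto)
    show "continuous_on R g" using g(6) by (auto simp: homeomorphism_def R_def intro: continuous_on_subset)
    show "f ` Q \<subseteq> R" "g ` R \<subseteq> Q" using fR gQ by auto
    show "g (f x) = x" if "x \<in> Q" for x using that Ff[of x] g(6) by (auto simp: homeomorphism_def Q_def)
    show "f (g y) = y" if "y \<in> R" for y
      using gQ[OF that] that Ff[of "g y"] g(6) by (auto simp: homeomorphism_def Q_def R_def)
  qed
  define Ti where "Ti = (\<lambda>p. Blinfun (inv_into UNIV (blinfun_apply (F' p))))"
  have bijQ: "bij (blinfun_apply (F' p))" if "p \<in> Q" for p
  proof -
    have "f p \<in> V'" "g (f p) = p" using fR[OF that] hom that by (auto simp: homeomorphism_def R_def)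
    then show ?thesis using g(9)[of "f p"] by simp
  qed
  have Ti_apply: "blinfun_apply (Ti p) = inv_into UNIV (blinfun_apply (F' p))" if "p \<in> Q" for p
  proof -
    have "bounded_linear (inv_into UNIV (blinfun_apply (F' p)))"
      by (rule inj_linear_imp_inv_bounded_linear[OF blinfun.bounded_linear_right bij_is_inj[OF bijQ[OF that]]])
    then show ?thesis unfolding Ti_def by (rule bounded_linear_Blinfun_apply)
  qed
  have QU: "Q \<subseteq> U" using g(2) by (auto simp: Q_def)
  have inv1: "F' p o\<^sub>L Ti p = id_blinfun" if "p \<in> Q" for p
    by (rule blinfun_eqI) (simp add: Ti_apply[OF that] surj_f_inv_f bij_is_surj[OF bijQ[OF that]])
  have inv2: "Ti p o\<^sub>L F' p = id_blinfun" if "p \<in> Q" for p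
    by (rule blinfun_eqI) (simp add: Ti_apply[OF that] inv_f_f bij_is_inj[OF bijQ[OF that]])
  have F'k: "Ck_on k V Q (\<lambda>x. F' x v)" for k v
  proof -
    have "Ck_on k V Q (\<lambda>p. L p v)" by (rule Ck_on_subset[OF smooth_onD[OF smD] QS])
    then show ?thesis by (subst Ck_on_cong[of Q _ "\<lambda>p. L p v"]) (use F'_apply QU \<pi>id Q_def in auto)
  qed
  have Tik: "Ck_on k V Q (\<lambda>p. Ti p v)" for k v
    by (rule Ck_on_blinfun_inverse[OF inv1 inv2 F'k])
  \<comment> \<open>Bootstrap: if \<open>g\<close> is of class C^k, so is its derivative
    \<open>Ti (g y)\<close>, because \<open>Ti\<close> is known to be of every class.\<close>
  have "Ck_on k V R g" for k
  proof (induction k)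
    case 0
    show ?case using hom by (simp add: homeomorphism_def)
  next
    case (Suc k)
    show ?case
    proof (rule Ck_on_SucI[of _ _ "\<lambda>y. blinfun_apply (Ti (g y))"])
      fix y assume y: "y \<in> R"
      then have "y \<in> V'" by (simp add: R_def)
      then show "(g has_derivative blinfun_apply (Ti (g y))) (at y within R)"
        using g(7,8)[of y] Ti_apply[OF gQ[OF y]] by (simp add: has_derivative_at_withinI)
    next
      fix v
      show "Ck_on k V R (\<lambda>y. Ti (g y) v)"
        by (rule Ck_on_compose[OF V _ Tik[of k v] Suc]) (use gQ Q_def in auto)
    qed
  qed
  then have "smooth_on V R g" by (rule smooth_onI)
  moreover have "x0 \<in> Q" using x0V g(3) by (simp add: Q_def)
  ultimately show thesis using that[OF Q _ QS R hom] by blast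
qed

section \<open>Smooth maps between manifolds\<close>

abbreviation cinv :: "('a, 'e) chart \<Rightarrow> 'e \<Rightarrow> 'a" where
  "cinv c \<equiv> inv_into (fst c) (snd c)"

text \<open>Only this part of \<^const>\<open>smooth_manifold\<close> matters for calculus, and it passes to products.\<close>

definition pre_manifold :: "('a, 'e::euclidean_space) manifold \<Rightarrow> bool" where
  "pre_manifold M \<longleftrightarrow>
     subspace (model M) \<and>
     topspace (mtop M) = (\<Union>c\<in>atlas M. fst c) \<and>
     (\<forall>c\<in>atlas M.
        openin (mtop M) (fst c) \<and>
        openin (top_of_set (model M)) (snd c ` fst c) \<and>
        homeomorphic_map (subtopology (mtop M) (fst c)) (top_of_set (snd c ` fst c)) (snd c)) \<and>
     (\<forall>c\<in>atlas M. \<forall>d\<in>atlas M. smooth_on (model M) (loc_dom c d id) (loc_rep c d id))"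

lemma smooth_manifold_pre: "smooth_manifold M \<Longrightarrow> pre_manifold M"
  unfolding smooth_manifold_def pre_manifold_def by blast

lemma smooth_manifoldI:
  "pre_manifold M \<Longrightarrow> Hausdorff_space (mtop M) \<Longrightarrow> second_countable (mtop M) \<Longrightarrow> smooth_manifold M"
  unfolding smooth_manifold_def pre_manifold_def by blast

lemma model_subspace: "pre_manifold M \<Longrightarrow> subspace (model M)"
  unfolding pre_manifold_def by blast

lemma chart_openin: "pre_manifold M \<Longrightarrow> c \<in> atlas M \<Longrightarrow> openin (mtop M) (fst c)"
  unfolding pre_manifold_def by blast

lemma chart_subset: "pre_manifold M \<Longrightarrow> c \<in> atlas M \<Longrightarrow> fst c \<subseteq> topspace (mtop M)"
  unfolding pre_manifold_def by blast

lemma ex_chart: "pre_manifold M \<Longrightarrow> x \<in> topspace (mtop M) \<Longrightarrow> \<exists>c\<in>atlas M. x \<in> fst c"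
  unfolding pre_manifold_def by blast

lemma chart_homeo:
  "pre_manifold M \<Longrightarrow> c \<in> atlas M \<Longrightarrow>
   homeomorphic_map (subtopology (mtop M) (fst c)) (top_of_set (snd c ` fst c)) (snd c)"
  unfolding pre_manifold_def by blast

lemma chart_inj: "pre_manifold M \<Longrightarrow> c \<in> atlas M \<Longrightarrow> inj_on (snd c) (fst c)"
  using homeomorphic_imp_injective_map[OF chart_homeo] chart_subset
  by (metis topspace_subtopology inf.absorb_iff2)

lemma cinv_chart [simp]: "pre_manifold M \<Longrightarrow> c \<in> atlas M \<Longrightarrow> x \<in> fst c \<Longrightarrow> cinv c (snd c x) = x"
  using chart_inj by (metis inv_into_f_f)

lemma chart_image_open:
  assumes M: "pre_manifold M" and c: "c \<in> atlas M" and Q: "openin (mtop M) Q"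
  shows "openin (top_of_set (model M)) (snd c ` (fst c \<inter> Q))"
proof -
  have "openin (subtopology (mtop M) (fst c)) (fst c \<inter> Q)"
    using Q by (auto simp: openin_subtopology)
  then have "openin (top_of_set (snd c ` fst c)) (snd c ` (fst c \<inter> Q))"
    using homeomorphic_imp_open_map[OF chart_homeo[OF M c]] by (simp add: open_map_def)
  moreover have "openin (top_of_set (model M)) (snd c ` fst c)"
    using M c unfolding pre_manifold_def by blast
  ultimately show ?thesis by (rule openin_trans)
qed

lemma chart_in_model: "pre_manifold M \<Longrightarrow> c \<in> atlas M \<Longrightarrow> x \<in> fst c \<Longrightarrow> snd c x \<in> model M"
  unfolding pre_manifold_def using openin_imp_subset by blast

lemma chart_preimage_open:
  assumes M: "pre_manifold M" and c: "c \<in> atlas M" and T: "openin (top_of_set (model M)) T"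
  shows "openin (mtop M) {x \<in> fst c. snd c x \<in> T}"
proof -
  obtain S where S: "open S" "T = model M \<inter> S" using T by (auto simp: openin_open)
  have cm: "continuous_map (subtopology (mtop M) (fst c)) (top_of_set (snd c ` fst c)) (snd c)"
    by (rule homeomorphic_imp_continuous_map[OF chart_homeo[OF M c]])
  have "openin (top_of_set (snd c ` fst c)) (snd c ` fst c \<inter> S)" using S by auto
  from openin_continuous_map_preimage[OF cm this]
  have "openin (subtopology (mtop M) (fst c)) {x \<in> topspace (mtop M) \<inter> fst c. snd c x \<in> snd c ` fst c \<inter> S}"
    by (simp add: Int_commute)
  moreover have "{x \<in> topspace (mtop M) \<inter> fst c. snd c x \<in> snd c ` fst c \<inter> S} = {x \<in> fst c. snd c x \<in> T}"
    using chart_subset[OF M c] chart_in_model[OF M c] S by auto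
  ultimately show ?thesis using openin_trans_full[OF _ chart_openin[OF M c]] by simp
qed

lemma transition_smooth:
  assumes "pre_manifold M" "c \<in> atlas M" "d \<in> atlas M"
  shows "smooth_on (model M) (snd c ` (fst c \<inter> fst d)) (\<lambda>p. snd d (cinv c p))"
proof -
  have "smooth_on (model M) (loc_dom c d id) (loc_rep c d id)"
    using assms unfolding pre_manifold_def by blast
  moreover have "loc_dom c d id = snd c ` (fst c \<inter> fst d)" unfolding loc_dom_def by auto
  moreover have "loc_rep c d id = (\<lambda>p. snd d (cinv c p))" unfolding loc_rep_def by auto
  ultimately show ?thesis by simp
qed

subsection \<open>Vector-valued smooth functions\<close>

text \<open>Maps between manifolds are handled through their coordinate functions, which live on
  open subsets only; hence a notion with an explicit open domain, tested in every chart of the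
  atlas.\<close>

definition sfun :: "('a, 'e::euclidean_space) manifold \<Rightarrow> 'a set \<Rightarrow> ('a \<Rightarrow> 'f::euclidean_space) \<Rightarrow> bool" where
  "sfun M Q f \<longleftrightarrow> openin (mtop M) Q \<and>
     (\<forall>c\<in>atlas M. smooth_on (model M) (snd c ` (fst c \<inter> Q)) (\<lambda>p. f (cinv c p)))"

lemma sfun_open: "sfun M Q f \<Longrightarrow> openin (mtop M) Q"
  unfolding sfun_def by blast

lemma sfunD: "sfun M Q f \<Longrightarrow> c \<in> atlas M \<Longrightarrow> smooth_on (model M) (snd c ` (fst c \<inter> Q)) (\<lambda>p. f (cinv c p))"
  unfolding sfun_def by blast

lemma smooth_map_iff:
  assumes M: "pre_manifold M" and N: "pre_manifold N"
  shows "smooth_map M N f \<longleftrightarrow> continuous_map (mtop M) (mtop N) f \<and>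
    (\<forall>d\<in>atlas N. sfun M {x \<in> topspace (mtop M). f x \<in> fst d} (\<lambda>x. snd d (f x)))"
proof -
  let ?I = "\<lambda>d. {x \<in> topspace (mtop M). f x \<in> fst d}"
  have 1: "loc_dom c d f = snd c ` (fst c \<inter> ?I d)" if "c \<in> atlas M" for c d
    using chart_subset[OF M that] unfolding loc_dom_def by (intro arg_cong[of _ _ "(`) (snd c)"]) auto
  have 2: "loc_rep c d f = (\<lambda>p. snd d (f (cinv c p)))" for c :: "('a, 'b) chart" and d
    unfolding loc_rep_def by auto
  have 3: "openin (mtop M) (?I d)"
    if "continuous_map (mtop M) (mtop N) f" "d \<in> atlas N" for d
    using openin_continuous_map_preimage[OF that(1) chart_openin[OF N that(2)]] .
  have 4: "smooth_on (model M) (loc_dom c d f) (loc_rep c d f) \<longleftrightarrow>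
      smooth_on (model M) (snd c ` (fst c \<inter> ?I d)) (\<lambda>p. snd d (f (cinv c p)))" if "c \<in> atlas M" for c d
    unfolding 1[OF that] 2 ..
  show ?thesis
  proof
    assume "smooth_map M N f"
    then have u: "continuous_map (mtop M) (mtop N) f \<and>
       (\<forall>c\<in>atlas M. \<forall>d\<in>atlas N. smooth_on (model M) (loc_dom c d f) (loc_rep c d f))"
      unfolding smooth_map_def .
    note c = conjunct1[OF u]
    have "smooth_on (model M) (loc_dom c d f) (loc_rep c d f)" if "c \<in> atlas M" "d \<in> atlas N" for c d
      using conjunct2[OF u] that by blast
    note s = iffD1[OF 4 this]
    show "continuous_map (mtop M) (mtop N) f \<and> (\<forall>d\<in>atlas N. sfun M (?I d) (\<lambda>x. snd d (f x)))"
      unfolding sfun_def using c 3[OF c] s by simp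
  next
    assume a: "continuous_map (mtop M) (mtop N) f \<and> (\<forall>d\<in>atlas N. sfun M (?I d) (\<lambda>x. snd d (f x)))"
    show "smooth_map M N f" unfolding smooth_map_def
    proof (intro conjI ballI)
      fix c d assume "c \<in> atlas M" "d \<in> atlas N"
      with a show "smooth_on (model M) (loc_dom c d f) (loc_rep c d f)"
        unfolding 4[OF \<open>c \<in> atlas M\<close>] using sfunD by blast
    qed (use a in blast)
  qed
qed

text \<open>Smooth transition maps let one chart around each point stand for all the charts that the
  definition quantifies over.\<close>

lemma sfunI_local:
  assumes M: "pre_manifold M" and Q: "openin (mtop M) Q"
    and loc: "\<And>x. x \<in> Q \<Longrightarrow> \<exists>c\<in>atlas M. \<exists>R. openin (mtop M) R \<and> x \<in> R \<and> x \<in> fst c \<and>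
                smooth_on (model M) (snd c ` (fst c \<inter> R)) (\<lambda>p. f (cinv c p))"
  shows "sfun M Q f"
  unfolding sfun_def
proof (intro conjI Q ballI)
  fix c assume c: "c \<in> atlas M"
  show "smooth_on (model M) (snd c ` (fst c \<inter> Q)) (\<lambda>p. f (cinv c p))"
  proof (rule smooth_on_local[OF model_subspace[OF M] chart_image_open[OF M c Q]])
    fix p assume "p \<in> snd c ` (fst c \<inter> Q)"
    then obtain x where x: "x \<in> fst c" "x \<in> Q" "p = snd c x" by auto
    from loc[OF x(2)] obtain d R where d: "d \<in> atlas M" "openin (mtop M) R" "x \<in> R" "x \<in> fst d"
      and sm: "smooth_on (model M) (snd d ` (fst d \<inter> R)) (\<lambda>p. f (cinv d p))" by blast
    let ?T = "snd c ` (fst c \<inter> (fst d \<inter> R))"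
    have "p \<in> ?T" using x d by auto
    moreover have "openin (top_of_set (model M)) ?T"
      by (rule chart_image_open[OF M c openin_Int[OF chart_openin[OF M d(1)] d(2)]])
    moreover have "smooth_on (model M) ?T (\<lambda>p. f (cinv c p))"
    proof -
      have "smooth_on (model M) ?T (\<lambda>p. f (cinv d (snd d (cinv c p))))"
      proof (rule smooth_on_compose[OF model_subspace[OF M] _ sm])
        show "snd d ` (fst d \<inter> R) \<subseteq> model M" using chart_in_model[OF M d(1)] by auto
        show "smooth_on (model M) ?T (\<lambda>p. snd d (cinv c p))"
          by (rule smooth_on_subset[OF transition_smooth[OF M c d(1)]]) auto
        show "(\<lambda>p. snd d (cinv c p)) ` ?T \<subseteq> snd d ` (fst d \<inter> R)" using M c by auto
      qed
      then show ?thesis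
        by (rule iffD1[OF smooth_on_cong, rotated]) (use M c d in auto)
    qed
    ultimately show "\<exists>T. p \<in> T \<and> openin (top_of_set (model M)) T \<and> smooth_on (model M) T (\<lambda>p. f (cinv c p))"
      by (intro exI[of _ ?T] conjI)
  qed
qed

lemma sfun_local:
  assumes M: "pre_manifold M" and loc: "\<And>x. x \<in> Q \<Longrightarrow> \<exists>R. x \<in> R \<and> R \<subseteq> Q \<and> sfun M R f"
  shows "sfun M Q f"
proof (rule sfunI_local[OF M])
  show "openin (mtop M) Q" using loc sfun_open openin_subopen[of "mtop M" Q] by meson
  fix x assume "x \<in> Q"
  from loc[OF this] obtain R where R: "x \<in> R" "sfun M R f" by blast
  then have "x \<in> topspace (mtop M)" using sfun_open openin_subset by blast
  then obtain c where c: "c \<in> atlas M" "x \<in> fst c" using ex_chart[OF M] by blast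
  show "\<exists>c\<in>atlas M. \<exists>R. openin (mtop M) R \<and> x \<in> R \<and> x \<in> fst c \<and>
      smooth_on (model M) (snd c ` (fst c \<inter> R)) (\<lambda>p. f (cinv c p))"
    by (rule bexI[OF _ c(1)], intro exI[of _ R] conjI sfun_open[OF R(2)] R(1) c(2) sfunD[OF R(2) c(1)])
qed

lemma sfun_subset:
  assumes "sfun M Q f" "openin (mtop M) R" "R \<subseteq> Q" shows "sfun M R f"
  unfolding sfun_def
proof (intro conjI assms(2) ballI)
  fix c assume "c \<in> atlas M"
  from sfunD[OF assms(1) this] show "smooth_on (model M) (snd c ` (fst c \<inter> R)) (\<lambda>p. f (cinv c p))"
    by (rule smooth_on_subset) (use assms(3) in auto)
qed

lemma sfun_cong:
  assumes M: "pre_manifold M" and f: "sfun M Q f" and "\<And>x. x \<in> Q \<Longrightarrow> f x = g x" shows "sfun M Q g"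
  unfolding sfun_def
proof (intro conjI sfun_open[OF f] ballI)
  fix c assume c: "c \<in> atlas M"
  from sfunD[OF f this] show "smooth_on (model M) (snd c ` (fst c \<inter> Q)) (\<lambda>p. g (cinv c p))"
    by (rule iffD1[OF smooth_on_cong, rotated]) (use assms c in auto)
qed

lemma sfun_chart:
  assumes M: "pre_manifold M" and c: "c \<in> atlas M" shows "sfun M (fst c) (snd c)"
  unfolding sfun_def by (intro conjI ballI chart_openin[OF M c] transition_smooth[OF M _ c])

lemma sfun_const: "openin (mtop M) Q \<Longrightarrow> sfun M Q (\<lambda>x. k)"
  unfolding sfun_def by (simp add: smooth_on_const)

lemma sfun_linear_comp: "bounded_linear l \<Longrightarrow> sfun M Q f \<Longrightarrow> sfun M Q (\<lambda>x. l (f x))"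
  unfolding sfun_def by (simp add: smooth_on_linear_comp[of l])

lemma sfun_Pair: "sfun M Q f \<Longrightarrow> sfun M Q g \<Longrightarrow> sfun M Q (\<lambda>x. (f x, g x))"
  unfolding sfun_def by (simp add: smooth_on_Pair)

lemma sfun_compose:
  assumes M: "pre_manifold M" and f: "sfun M Q f" and W: "subspace W" "T \<subseteq> W" and h: "smooth_on W T h" and "f ` Q \<subseteq> T"
  shows "sfun M Q (\<lambda>x. h (f x))"
  unfolding sfun_def
proof (intro conjI sfun_open[OF f] ballI)
  fix c assume c: "c \<in> atlas M"
  show "smooth_on (model M) (snd c ` (fst c \<inter> Q)) (\<lambda>p. h (f (cinv c p)))"
    by (rule smooth_on_compose[OF W h sfunD[OF f c]]) (use assms c in auto)
qed

lemma sfun_continuous: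
  assumes M: "pre_manifold M" and f: "sfun M Q f" and S: "open S"
  shows "openin (mtop M) {x \<in> Q. f x \<in> S}"
proof (subst openin_subopen, intro ballI)
  fix x assume x: "x \<in> {x \<in> Q. f x \<in> S}"
  have "Q \<subseteq> topspace (mtop M)" using sfun_open[OF f] openin_subset by blast
  then obtain c where c: "c \<in> atlas M" "x \<in> fst c" using x ex_chart[OF M] by blast
  let ?I = "snd c ` (fst c \<inter> Q)"
  have I: "openin (top_of_set (model M)) ?I" by (rule chart_image_open[OF M c(1) sfun_open[OF f]])
  have "openin (top_of_set ?I) (?I \<inter> (\<lambda>p. f (cinv c p)) -` S)"
    by (rule continuous_openin_preimage_gen[OF smooth_on_continuous[OF sfunD[OF f c(1)]] S])
  from openin_trans[OF this I]
  have "openin (mtop M) {x \<in> fst c. snd c x \<in> ?I \<inter> (\<lambda>p. f (cinv c p)) -` S}"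
    by (rule chart_preimage_open[OF M c(1)])
  moreover have "{x \<in> fst c. snd c x \<in> ?I \<inter> (\<lambda>p. f (cinv c p)) -` S} = {x \<in> Q. f x \<in> S} \<inter> fst c"
    using M c chart_inj[OF M c(1)] by (auto simp: inj_on_def)
  ultimately show "\<exists>T. openin (mtop M) T \<and> x \<in> T \<and> T \<subseteq> {x \<in> Q. f x \<in> S}" 
    using x c by (intro exI[of _ "{x \<in> Q. f x \<in> S} \<inter> fst c"]) simp
qed

subsection \<open>Criteria for smooth maps\<close>

lemma smooth_map_continuous: "smooth_map M N f \<Longrightarrow> continuous_map (mtop M) (mtop N) f"
  unfolding smooth_map_def by blast

lemma smooth_map_in: "smooth_map M N f \<Longrightarrow> x \<in> topspace (mtop M) \<Longrightarrow> f x \<in> topspace (mtop N)"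
  using smooth_map_continuous[of M N f] unfolding continuous_map_def by auto

lemma smooth_map_sfun:
  assumes M: "pre_manifold M" and N: "pre_manifold N" and f: "smooth_map M N f" and g: "sfun N Q g"
  shows "sfun M {x \<in> topspace (mtop M). f x \<in> Q} (\<lambda>x. g (f x))"
proof (rule sfun_local[OF M])
  fix x assume x: "x \<in> {x \<in> topspace (mtop M). f x \<in> Q}"
  have "Q \<subseteq> topspace (mtop N)" using sfun_open[OF g] openin_subset by blast
  then obtain d where d: "d \<in> atlas N" "f x \<in> fst d" using x ex_chart[OF N] by blast
  let ?R = "{x \<in> topspace (mtop M). f x \<in> fst d \<inter> Q}"
  have R: "openin (mtop M) ?R"
    by (rule openin_continuous_map_preimage[OF smooth_map_continuous[OF f]])
      (rule openin_Int[OF chart_openin[OF N d(1)] sfun_open[OF g]])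
  have "sfun M {x \<in> topspace (mtop M). f x \<in> fst d} (\<lambda>x. snd d (f x))"
    by (rule bspec[OF conjunct2[OF iffD1[OF smooth_map_iff[OF M N] f]] d(1)])
  then have df: "sfun M ?R (\<lambda>x. snd d (f x))" by (rule sfun_subset[OF _ R]) auto
  have "sfun M ?R (\<lambda>x. g (cinv d (snd d (f x))))"
    by (rule sfun_compose[OF M df model_subspace[OF N] _ sfunD[OF g d(1)]])
      (use chart_in_model[OF N d(1)] in auto)
  then have "sfun M ?R (\<lambda>x. g (f x))"
    by (rule sfun_cong[OF M]) (use N d(1) in auto)
  then show "\<exists>R. x \<in> R \<and> R \<subseteq> {x \<in> topspace (mtop M). f x \<in> Q} \<and> sfun M R (\<lambda>x. g (f x))"
    using x d by (intro exI[of _ ?R]) auto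
qed

text \<open>A single target chart near each point is enough. Continuity follows as well, because
  coordinate functions are continuous and charts are homeomorphisms onto relatively open
  sets.\<close>

lemma smooth_mapI:
  assumes M: "pre_manifold M" and N: "pre_manifold N"
    and loc: "\<And>x. x \<in> topspace (mtop M) \<Longrightarrow>
       \<exists>Q. \<exists>d\<in>atlas N. x \<in> Q \<and> f ` Q \<subseteq> fst d \<and> sfun M Q (\<lambda>x. snd d (f x))"
  shows "smooth_map M N f"
proof -
  have cont: "openin (mtop M) {x \<in> topspace (mtop M). f x \<in> W}" if W: "openin (mtop N) W" for W
  proof (subst openin_subopen, intro ballI)
    fix x assume x: "x \<in> {x \<in> topspace (mtop M). f x \<in> W}"
    then obtain Q d where d: "d \<in> atlas N" "x \<in> Q" "f ` Q \<subseteq> fst d" and s: "sfun M Q (\<lambda>x. snd d (f x))"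
      using loc by blast
    have "openin (top_of_set (model N)) (snd d ` (fst d \<inter> W))" by (rule chart_image_open[OF N d(1) W])
    then obtain S where S: "open S" "snd d ` (fst d \<inter> W) = model N \<inter> S" by (auto simp: openin_open)
    have "{y \<in> Q. snd d (f y) \<in> S} \<subseteq> {x \<in> topspace (mtop M). f x \<in> W}"
    proof safe
      fix y assume y: "y \<in> Q" "snd d (f y) \<in> S"
      then show "y \<in> topspace (mtop M)" using sfun_open[OF s] openin_subset by blast
      have fy: "f y \<in> fst d" using y d by auto
      then have "snd d (f y) \<in> snd d ` (fst d \<inter> W)" using S(2) y chart_in_model[OF N d(1)] by auto
      then show "f y \<in> W" using chart_inj[OF N d(1)] fy by (auto simp: inj_on_def)
    qed
    moreover have "snd d (f x) \<in> S" using S(2) x d by auto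
    ultimately show "\<exists>T. openin (mtop M) T \<and> x \<in> T \<and> T \<subseteq> {x \<in> topspace (mtop M). f x \<in> W}"
      using sfun_continuous[OF M s S(1)] d(2) by (intro exI[of _ "{y \<in> Q. snd d (f y) \<in> S}"]) auto
  qed
  have "f x \<in> topspace (mtop N)" if x: "x \<in> topspace (mtop M)" for x
    using loc[OF x] chart_subset[OF N] by blast
  then have "continuous_map (mtop M) (mtop N) f"
    using cont by (auto simp: continuous_map_def)
  moreover have "sfun M {x \<in> topspace (mtop M). f x \<in> fst e} (\<lambda>x. snd e (f x))" if e: "e \<in> atlas N" for e
  proof (rule sfun_local[OF M])
    fix x assume x: "x \<in> {x \<in> topspace (mtop M). f x \<in> fst e}"
    then obtain Q d where d: "d \<in> atlas N" "x \<in> Q" "f ` Q \<subseteq> fst d" and s: "sfun M Q (\<lambda>x. snd d (f x))"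
      using loc by blast
    let ?R = "Q \<inter> {x \<in> topspace (mtop M). f x \<in> fst e}"
    have "openin (mtop M) ?R"
      by (rule openin_Int[OF sfun_open[OF s] cont[OF chart_openin[OF N e]]])
    from sfun_subset[OF s this]
    have s': "sfun M ?R (\<lambda>x. snd d (f x))" by blast
    have "sfun M ?R (\<lambda>x. snd e (cinv d (snd d (f x))))"
      by (rule sfun_compose[OF M s' model_subspace[OF N] _ transition_smooth[OF N d(1) e]])
        (use chart_in_model[OF N d(1)] d in auto)
    then have "sfun M ?R (\<lambda>x. snd e (f x))"
      by (rule sfun_cong[OF M]) (use N d in auto)
    then show "\<exists>R. x \<in> R \<and> R \<subseteq> {x \<in> topspace (mtop M). f x \<in> fst e} \<and> sfun M R (\<lambda>x. snd e (f x))"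
      using x d by (intro exI[of _ ?R]) auto
  qed
  ultimately show ?thesis by (intro iffD2[OF smooth_map_iff[OF M N]] conjI ballI)
qed

lemma smooth_map_chart:
  assumes "pre_manifold M" "pre_manifold N" "smooth_map M N f" "d \<in> atlas N"
  shows "sfun M {x \<in> topspace (mtop M). f x \<in> fst d} (\<lambda>x. snd d (f x))"
  by (rule bspec[OF conjunct2[OF iffD1[OF smooth_map_iff[OF assms(1,2)] assms(3)]] assms(4)])

lemma smooth_mapI_chart:
  assumes M: "pre_manifold M" and N: "pre_manifold N"
    and im: "\<And>x. x \<in> topspace (mtop M) \<Longrightarrow> f x \<in> topspace (mtop N)"
    and loc: "\<And>x d. x \<in> topspace (mtop M) \<Longrightarrow> d \<in> atlas N \<Longrightarrow> f x \<in> fst d \<Longrightarrow>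
       \<exists>Q. x \<in> Q \<and> f ` Q \<subseteq> fst d \<and> sfun M Q (\<lambda>x. snd d (f x))"
  shows "smooth_map M N f"
proof (rule smooth_mapI[OF M N])
  fix x assume x: "x \<in> topspace (mtop M)"
  obtain d where "d \<in> atlas N" "f x \<in> fst d" using im[OF x] ex_chart[OF N] by blast
  with loc[OF x this] show "\<exists>Q. \<exists>d\<in>atlas N. x \<in> Q \<and> f ` Q \<subseteq> fst d \<and> sfun M Q (\<lambda>x. snd d (f x))" by blast
qed

lemma smooth_map_compose:
  assumes M: "pre_manifold M" and N: "pre_manifold N" and K: "pre_manifold K"
    and f: "smooth_map M N f" and g: "smooth_map N K g"
  shows "smooth_map M K (\<lambda>x. g (f x))"
proof (rule smooth_mapI_chart[OF M K])
  fix x assume x: "x \<in> topspace (mtop M)"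
  then show "g (f x) \<in> topspace (mtop K)" using f g smooth_map_in by metis
  fix d assume d: "d \<in> atlas K" "g (f x) \<in> fst d"
  from smooth_map_sfun[OF M N f smooth_map_chart[OF N K g d(1)]]
  show "\<exists>Q. x \<in> Q \<and> (\<lambda>x. g (f x)) ` Q \<subseteq> fst d \<and> sfun M Q (\<lambda>x. snd d (g (f x)))"
    using x d f smooth_map_in by (intro exI[of _ "{x \<in> topspace (mtop M). f x \<in> {x \<in> topspace (mtop N). g x \<in> fst d}}"]) auto
qed

lemma smooth_map_cong:
  assumes M: "pre_manifold M" and N: "pre_manifold N" and f: "smooth_map M N f"
    and eq: "\<And>x. x \<in> topspace (mtop M) \<Longrightarrow> f x = g x"
  shows "smooth_map M N g"
proof (rule smooth_mapI_chart[OF M N])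
  fix x assume x: "x \<in> topspace (mtop M)"
  then show "g x \<in> topspace (mtop N)" using f smooth_map_in eq by metis
  fix d assume d: "d \<in> atlas N" "g x \<in> fst d"
  have "sfun M {x \<in> topspace (mtop M). f x \<in> fst d} (\<lambda>x. snd d (g x))"
    by (rule sfun_cong[OF M smooth_map_chart[OF M N f d(1)]]) (use eq in auto)
  then show "\<exists>Q. x \<in> Q \<and> g ` Q \<subseteq> fst d \<and> sfun M Q (\<lambda>x. snd d (g x))"
    using x d eq by (intro exI[of _ "{x \<in> topspace (mtop M). f x \<in> fst d}"]) auto
qed

lemma smooth_map_const:
  assumes M: "pre_manifold M" and N: "pre_manifold N" and k: "k \<in> topspace (mtop N)"
  shows "smooth_map M N (\<lambda>x. k)"
  by (rule smooth_mapI_chart[OF M N k]) (auto intro!: exI[of _ "topspace (mtop M)"] sfun_const)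

lemma smooth_map_id:
  assumes M: "pre_manifold M" shows "smooth_map M M (\<lambda>x. x)"
  by (rule smooth_mapI_chart[OF M M]) (use sfun_chart[OF M] in blast)+

subsection \<open>Products\<close>

lemma prod_manifold_simps [simp]:
  "mtop (prod_manifold M N) = prod_topology (mtop M) (mtop N)"
  "model (prod_manifold M N) = model M \<times> model N"
  unfolding prod_manifold_def by simp_all

lemma prod_chart: "c \<in> atlas M \<Longrightarrow> d \<in> atlas N \<Longrightarrow> (fst c \<times> fst d, map_prod (snd c) (snd d)) \<in> atlas (prod_manifold M N)"
  unfolding prod_manifold_def manifold.simps by blast

lemma prod_chartE:
  assumes "c \<in> atlas (prod_manifold M N)"
  obtains d e where "d \<in> atlas M" "e \<in> atlas N" "c = (fst d \<times> fst e, map_prod (snd d) (snd e))"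
  using assms unfolding prod_manifold_def manifold.simps by blast

lemma cinv_prod:
  assumes "pre_manifold M" "pre_manifold N" "c \<in> atlas M" "d \<in> atlas N" "p \<in> snd c ` fst c" "q \<in> snd d ` fst d"
  shows "cinv (fst c \<times> fst d, map_prod (snd c) (snd d)) (p, q) = (cinv c p, cinv d q)"
proof -
  have "inj_on (map_prod (snd c) (snd d)) (fst c \<times> fst d)"
    by (intro map_prod_inj_on chart_inj[OF assms(1,3)] chart_inj[OF assms(2,4)])
  moreover have "map_prod (snd c) (snd d) (cinv c p, cinv d q) = (p, q)"
    using assms by (simp add: f_inv_into_f)
  moreover have "(cinv c p, cinv d q) \<in> fst c \<times> fst d"
    using assms by (simp add: inv_into_into)
  ultimately show ?thesis
    using inv_into_f_eq[of "map_prod (snd c) (snd d)" "fst c \<times> fst d" "(cinv c p, cinv d q)" "(p, q)"] by simp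
qed

lemma pre_manifold_prod:
  assumes M: "pre_manifold M" and N: "pre_manifold N"
  shows "pre_manifold (prod_manifold M N)"
  unfolding pre_manifold_def
proof (intro conjI ballI)
  show "subspace (model (prod_manifold M N))"
    using M N by (simp add: model_subspace subspace_Times)
  show "topspace (mtop (prod_manifold M N)) = (\<Union>c\<in>atlas (prod_manifold M N). fst c)"
  proof (intro subset_antisym subsetI)
    fix z assume "z \<in> topspace (mtop (prod_manifold M N))"
    then have "fst z \<in> topspace (mtop M)" "snd z \<in> topspace (mtop N)" by auto
    then obtain d e where "d \<in> atlas M" "e \<in> atlas N" "fst z \<in> fst d" "snd z \<in> fst e"
      using ex_chart[OF M] ex_chart[OF N] by meson
    then show "z \<in> (\<Union>c\<in>atlas (prod_manifold M N). fst c)"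
      using prod_chart[of d M e N] by (intro UN_I[of "(fst d \<times> fst e, map_prod (snd d) (snd e))"]) (auto simp: mem_Times_iff)
  next
    fix z assume "z \<in> (\<Union>c\<in>atlas (prod_manifold M N). fst c)"
    then obtain c where c: "c \<in> atlas (prod_manifold M N)" "z \<in> fst c" by blast
    from c(1) obtain d e where "d \<in> atlas M" "e \<in> atlas N" "c = (fst d \<times> fst e, map_prod (snd d) (snd e))"
      by (rule prod_chartE)
    then show "z \<in> topspace (mtop (prod_manifold M N))"
      using c(2) chart_subset[OF M, of d] chart_subset[OF N, of e] by (auto simp: mem_Times_iff)
  qed
next
  fix c assume "c \<in> atlas (prod_manifold M N)"
  then obtain d e where d: "d \<in> atlas M" and e: "e \<in> atlas N"
    and c: "c = (fst d \<times> fst e, map_prod (snd d) (snd e))" by (rule prod_chartE)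
  show "openin (mtop (prod_manifold M N)) (fst c)"
    using chart_openin[OF M d] chart_openin[OF N e] c by (simp add: openin_prod_Times_iff)
  have im: "snd c ` fst c = (snd d ` fst d) \<times> (snd e ` fst e)" using c by (auto simp: map_prod_def)
  show "openin (top_of_set (model (prod_manifold M N))) (snd c ` fst c)"
    unfolding im using chart_image_open[OF M d chart_openin[OF M d]] chart_image_open[OF N e chart_openin[OF N e]]
    by (simp add: openin_Times)
  obtain d' e' where "homeomorphic_maps (subtopology (mtop M) (fst d)) (top_of_set (snd d ` fst d)) (snd d) d'"
    "homeomorphic_maps (subtopology (mtop N) (fst e)) (top_of_set (snd e ` fst e)) (snd e) e'"
    using chart_homeo[OF M d] chart_homeo[OF N e] unfolding homeomorphic_map_maps by blast
  then have "homeomorphic_maps (prod_topology (subtopology (mtop M) (fst d)) (subtopology (mtop N) (fst e)))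
      (prod_topology (top_of_set (snd d ` fst d)) (top_of_set (snd e ` fst e)))
      (\<lambda>(x, y). (snd d x, snd e y)) (\<lambda>(x, y). (d' x, e' y))"
    unfolding homeomorphic_maps_prod by blast
  then show "homeomorphic_map (subtopology (mtop (prod_manifold M N)) (fst c)) (top_of_set (snd c ` fst c)) (snd c)"
    unfolding im homeomorphic_map_maps using c by (auto simp: subtopology_Times map_prod_def)
next
  fix c c' assume "c \<in> atlas (prod_manifold M N)" "c' \<in> atlas (prod_manifold M N)"
  then obtain d e d' e' where d: "d \<in> atlas M" "e \<in> atlas N" "d' \<in> atlas M" "e' \<in> atlas N"
    and c: "c = (fst d \<times> fst e, map_prod (snd d) (snd e))"
    and c': "c' = (fst d' \<times> fst e', map_prod (snd d') (snd e'))" by (elim prod_chartE)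
  have dom: "loc_dom c c' id = snd d ` (fst d \<inter> fst d') \<times> snd e ` (fst e \<inter> fst e')"
    using c c' by (auto simp: loc_dom_def)
  let ?V = "model M \<times> model N"
  have 1: "smooth_on ?V (loc_dom c c' id) (\<lambda>p. snd d' (cinv d (fst p)))"
    unfolding dom
    by (rule smooth_on_compose[OF model_subspace[OF M] _ transition_smooth[OF M d(1,3)] smooth_on_linear[OF bounded_linear_fst]])
      (use chart_in_model[OF M d(1)] in auto)
  have 2: "smooth_on ?V (loc_dom c c' id) (\<lambda>p. snd e' (cinv e (snd p)))"
    unfolding dom
    by (rule smooth_on_compose[OF model_subspace[OF N] _ transition_smooth[OF N d(2,4)] smooth_on_linear[OF bounded_linear_snd]])
      (use chart_in_model[OF N d(2)] in auto)
  have "loc_rep c c' id p = (snd d' (cinv d (fst p)), snd e' (cinv e (snd p)))" if "p \<in> loc_dom c c' id" for p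
    using that cinv_prod[OF M N d(1,2), of "fst p" "snd p"] unfolding dom loc_rep_def
    by (auto simp: c[symmetric] c'  simp del: prod.collapse)
  then show "smooth_on (model (prod_manifold M N)) (loc_dom c c' id) (loc_rep c c' id)"
    using iffD1[OF smooth_on_cong smooth_on_Pair[OF 1 2], of "loc_rep c c' id"] by simp
qed

lemma smooth_map_fst:
  assumes M: "pre_manifold M" and N: "pre_manifold N"
  shows "smooth_map (prod_manifold M N) M fst"
proof (rule smooth_mapI_chart[OF pre_manifold_prod[OF M N] M])
  fix x :: "'a \<times> 'c" and d assume x: "x \<in> topspace (mtop (prod_manifold M N))"
  then show "fst x \<in> topspace (mtop M)" by auto
  assume d: "d \<in> atlas M" "fst x \<in> fst d"
  let ?Q = "fst d \<times> topspace (mtop N)"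
  have Q: "openin (mtop (prod_manifold M N)) ?Q" using chart_openin[OF M d(1)] by (simp add: openin_prod_Times_iff)
  have "sfun (prod_manifold M N) ?Q (\<lambda>x. snd d (fst x))"
  proof (rule sfunI_local[OF pre_manifold_prod[OF M N] Q])
    fix y assume y: "y \<in> ?Q"
    then have "snd y \<in> topspace (mtop N)" by auto
    then obtain e where e: "e \<in> atlas N" "snd y \<in> fst e" using ex_chart[OF N] by blast
    let ?c = "(fst d \<times> fst e, map_prod (snd d) (snd e))"
    have "smooth_on (model (prod_manifold M N)) (snd ?c ` (fst ?c \<inter> ?Q)) (\<lambda>p. snd d (fst (cinv ?c p)))"
      by (rule iffD1[OF smooth_on_cong smooth_on_linear[OF bounded_linear_fst]])
        (use cinv_prod[OF M N d(1) e(1)] M d(1) in auto)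
    then show "\<exists>c\<in>atlas (prod_manifold M N). \<exists>R. openin (mtop (prod_manifold M N)) R \<and> y \<in> R \<and> y \<in> fst c \<and>
        smooth_on (model (prod_manifold M N)) (snd c ` (fst c \<inter> R)) (\<lambda>p. snd d (fst (cinv c p)))"
      using prod_chart[OF d(1) e(1)] Q y e by (intro bexI[of _ ?c] exI[of _ ?Q]) auto
  qed
  then show "\<exists>Q. x \<in> Q \<and> fst ` Q \<subseteq> fst d \<and> sfun (prod_manifold M N) Q (\<lambda>x. snd d (fst x))"
    using d x by (intro exI[of _ ?Q]) auto
qed

lemma smooth_map_snd:
  assumes M: "pre_manifold M" and N: "pre_manifold N"
  shows "smooth_map (prod_manifold M N) N snd"
proof (rule smooth_mapI_chart[OF pre_manifold_prod[OF M N] N])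
  fix x :: "'a \<times> 'c" and d assume x: "x \<in> topspace (mtop (prod_manifold M N))"
  then show "snd x \<in> topspace (mtop N)" by auto
  assume d: "d \<in> atlas N" "snd x \<in> fst d"
  let ?Q = "topspace (mtop M) \<times> fst d"
  have Q: "openin (mtop (prod_manifold M N)) ?Q" using chart_openin[OF N d(1)] by (simp add: openin_prod_Times_iff)
  have "sfun (prod_manifold M N) ?Q (\<lambda>x. snd d (snd x))"
  proof (rule sfunI_local[OF pre_manifold_prod[OF M N] Q])
    fix y assume y: "y \<in> ?Q"
    then have "fst y \<in> topspace (mtop M)" by auto
    then obtain e where e: "e \<in> atlas M" "fst y \<in> fst e" using ex_chart[OF M] by blast
    let ?c = "(fst e \<times> fst d, map_prod (snd e) (snd d))"
    have "smooth_on (model (prod_manifold M N)) (snd ?c ` (fst ?c \<inter> ?Q)) (\<lambda>p. snd d (snd (cinv ?c p)))"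
      by (rule iffD1[OF smooth_on_cong smooth_on_linear[OF bounded_linear_snd]])
        (use cinv_prod[OF M N e(1) d(1)] N d(1) in auto)
    then show "\<exists>c\<in>atlas (prod_manifold M N). \<exists>R. openin (mtop (prod_manifold M N)) R \<and> y \<in> R \<and> y \<in> fst c \<and>
        smooth_on (model (prod_manifold M N)) (snd c ` (fst c \<inter> R)) (\<lambda>p. snd d (snd (cinv c p)))"
      using prod_chart[OF e(1) d(1)] Q y e by (intro bexI[of _ ?c] exI[of _ ?Q]) auto
  qed
  then show "\<exists>Q. x \<in> Q \<and> snd ` Q \<subseteq> fst d \<and> sfun (prod_manifold M N) Q (\<lambda>x. snd d (snd x))"
    using d x by (intro exI[of _ ?Q]) auto
qed

lemma smooth_map_Pair:
  assumes K: "pre_manifold K" and M: "pre_manifold M" and N: "pre_manifold N"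
    and f: "smooth_map K M f" and g: "smooth_map K N g"
  shows "smooth_map K (prod_manifold M N) (\<lambda>x. (f x, g x))"
proof (rule smooth_mapI_chart[OF K pre_manifold_prod[OF M N]])
  fix x assume x: "x \<in> topspace (mtop K)"
  show "(f x, g x) \<in> topspace (mtop (prod_manifold M N))"
    using smooth_map_in[OF f x] smooth_map_in[OF g x] by simp
  fix c assume "c \<in> atlas (prod_manifold M N)" and xc: "(f x, g x) \<in> fst c"
  from this(1) obtain d e where d: "d \<in> atlas M" and e: "e \<in> atlas N"
    and c: "c = (fst d \<times> fst e, map_prod (snd d) (snd e))" by (rule prod_chartE)
  let ?A = "{x \<in> topspace (mtop K). f x \<in> fst d}" and ?B = "{x \<in> topspace (mtop K). g x \<in> fst e}"
  have A: "sfun K ?A (\<lambda>x. snd d (f x))" and B: "sfun K ?B (\<lambda>x. snd e (g x))"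
    using smooth_map_chart[OF K M f d] smooth_map_chart[OF K N g e] .
  have AB: "openin (mtop K) (?A \<inter> ?B)" using sfun_open[OF A] sfun_open[OF B] by (rule openin_Int)
  from sfun_Pair[OF sfun_subset[OF A AB] sfun_subset[OF B AB]]
  have "sfun K (?A \<inter> ?B) (\<lambda>x. snd c (f x, g x))" using c by simp
  then show "\<exists>Q. x \<in> Q \<and> (\<lambda>x. (f x, g x)) ` Q \<subseteq> fst c \<and> sfun K Q (\<lambda>x. snd c (f x, g x))"
    using xc x c by (intro exI[of _ "?A \<inter> ?B"]) auto
qed

section \<open>Derivatives along curves\<close>

text \<open>The velocity of a curve at time \<open>0\<close>, read in a chart. Differentiability is
  demanded at \<open>0\<close> only, so that products, images under smooth maps and curves changed
  away from \<open>0\<close> all fall under one notion.\<close>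

definition hasvel :: "('a, 'e::euclidean_space) chart \<Rightarrow> (real \<Rightarrow> 'a) \<Rightarrow> 'e \<Rightarrow> bool" where
  "hasvel c \<alpha> v \<longleftrightarrow> (\<forall>\<^sub>F t in nhds 0. \<alpha> t \<in> fst c) \<and> ((\<lambda>t. snd c (\<alpha> t)) has_vector_derivative v) (at 0)"

abbreviation fderiv ::
  "('a, 'e::euclidean_space) manifold \<Rightarrow> ('a, 'e) chart \<Rightarrow> ('a \<Rightarrow> 'f::euclidean_space) \<Rightarrow> 'a \<Rightarrow> 'e \<Rightarrow> 'f" where
  "fderiv M c f x \<equiv> frechet_derivative (\<lambda>p. f (cinv c p)) (at (snd c x) within model M)"

lemma hvd_cong:
  assumes "\<forall>\<^sub>F t in nhds a. f t = g t" "(f has_vector_derivative v) (at a)"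
  shows "(g has_vector_derivative v) (at a)"
proof -
  obtain S where "open S" "a \<in> S" "\<And>t. t \<in> S \<Longrightarrow> f t = g t" using assms(1) by (auto simp: eventually_nhds)
  then show ?thesis using has_vector_derivative_transform_within_open[OF assms(2)] by blast
qed

lemma isCont_eventually_nhds:
  assumes "isCont f a" "open S" "f a \<in> S" shows "\<forall>\<^sub>F t in nhds a. f t \<in> S"
  using assms topological_tendstoD[of f "f a" "nhds a" S] tendsto_at_iff_tendsto_nhds[of f a]
  by (simp add: isCont_def)

lemma sfun_has_derivative:
  assumes "pre_manifold M" "sfun M Q f" "x \<in> Q" "c \<in> atlas M" "x \<in> fst c"
  shows "((\<lambda>p. f (cinv c p)) has_derivative fderiv M c f x) (at (snd c x) within model M)"
  by (rule smooth_on_differentiable[OF model_subspace[OF assms(1)]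
      chart_image_open[OF assms(1,4) sfun_open[OF assms(2)]] sfunD[OF assms(2,4)]]) (use assms in auto)

lemma hasvel_0: "hasvel c \<alpha> v \<Longrightarrow> \<alpha> 0 \<in> fst c"
  unfolding hasvel_def by (auto dest: eventually_nhds_x_imp_x)

lemma hasvel_unique: "hasvel c \<alpha> v \<Longrightarrow> hasvel c \<alpha> w \<Longrightarrow> v = w"
  unfolding hasvel_def by (auto intro: vector_derivative_unique_at)

lemma hasvel_cong:
  assumes "\<forall>\<^sub>F t in nhds 0. \<alpha> t = \<beta> t" "hasvel c \<alpha> v" shows "hasvel c \<beta> v"
proof -
  have 1: "\<forall>\<^sub>F t in nhds 0. \<beta> t \<in> fst c"
    using assms by (auto simp: hasvel_def elim: eventually_elim2)
  have "\<forall>\<^sub>F t in nhds 0. snd c (\<alpha> t) = snd c (\<beta> t)" using assms(1) by eventually_elim simp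
  from hvd_cong[OF this] have "((\<lambda>t. snd c (\<beta> t)) has_vector_derivative v) (at 0)"
    using assms(2) by (simp add: hasvel_def)
  with 1 show ?thesis by (simp add: hasvel_def)
qed

lemma hasvel_eventually:
  assumes M: "pre_manifold M" and c: "c \<in> atlas M" and \<alpha>: "hasvel c \<alpha> v" and Q: "openin (mtop M) Q" "\<alpha> 0 \<in> Q"
  shows "\<forall>\<^sub>F t in nhds 0. \<alpha> t \<in> Q"
proof -
  obtain S where S: "open S" "snd c ` (fst c \<inter> Q) = model M \<inter> S"
    using chart_image_open[OF M c Q(1)] by (auto simp: openin_open)
  have "snd c (\<alpha> 0) \<in> S" using S(2) hasvel_0[OF \<alpha>] Q(2) by blast
  moreover have "isCont (\<lambda>t. snd c (\<alpha> t)) 0"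
    using \<alpha> has_vector_derivative_continuous unfolding hasvel_def by blast
  ultimately have "\<forall>\<^sub>F t in nhds 0. snd c (\<alpha> t) \<in> S"
    using S(1) by (intro isCont_eventually_nhds[where f="\<lambda>t. snd c (\<alpha> t)"])
  moreover have "\<forall>\<^sub>F t in nhds 0. \<alpha> t \<in> fst c" using \<alpha> by (simp add: hasvel_def)
  ultimately show ?thesis
  proof eventually_elim
    case (elim t)
    then have "snd c (\<alpha> t) \<in> snd c ` (fst c \<inter> Q)" using S(2) chart_in_model[OF M c] by auto
    then show ?case using elim chart_inj[OF M c] by (auto simp: inj_on_def)
  qed
qed

lemma hasvel_exists:
  assumes M: "pre_manifold M" and c: "c \<in> atlas M" and x: "x \<in> fst c" and v: "v \<in> model M"
  obtains \<alpha> where "\<alpha> 0 = x" "hasvel c \<alpha> v"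
proof
  define \<alpha> where "\<alpha> = (\<lambda>t::real. cinv c (snd c x + t *\<^sub>R v))"
  show "\<alpha> 0 = x" using M c x by (simp add: \<alpha>_def)
  obtain S where S: "open S" "snd c ` fst c = model M \<inter> S"
    using chart_image_open[OF M c chart_openin[OF M c]] by (auto simp: openin_open)
  have lin: "((\<lambda>t. snd c x + t *\<^sub>R v) has_vector_derivative v) (at 0)"
    by (auto intro!: derivative_eq_intros simp: has_vector_derivative_def)
  have "isCont (\<lambda>t. snd c x + t *\<^sub>R v) 0" by (intro continuous_intros)
  moreover have "snd c x + 0 *\<^sub>R v \<in> S" using S(2) x by auto
  ultimately have "\<forall>\<^sub>F t in nhds 0. snd c x + t *\<^sub>R v \<in> S"
    using S(1) by (intro isCont_eventually_nhds[where f="\<lambda>t. snd c x + t *\<^sub>R v"])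
  then have ev: "\<forall>\<^sub>F t in nhds 0. snd c x + t *\<^sub>R v \<in> snd c ` fst c"
    by eventually_elim (use S(2) chart_in_model[OF M c x] v model_subspace[OF M] in \<open>auto simp: subspace_add subspace_scale\<close>)
  then have 1: "\<forall>\<^sub>F t in nhds 0. \<alpha> t \<in> fst c"
    by eventually_elim (auto simp: \<alpha>_def inv_into_into)
  from ev have "\<forall>\<^sub>F t in nhds 0. snd c x + t *\<^sub>R v = snd c (\<alpha> t)"
    by eventually_elim (auto simp: \<alpha>_def f_inv_into_f)
  from hvd_cong[OF this lin] 1 show "hasvel c \<alpha> v" by (simp add: hasvel_def)
qed

lemma hasvel_sfun:
  assumes M: "pre_manifold M" and f: "sfun M Q f" and c: "c \<in> atlas M" and \<alpha>: "hasvel c \<alpha> v" and Q: "\<alpha> 0 \<in> Q"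
  shows "((\<lambda>t. f (\<alpha> t)) has_vector_derivative fderiv M c f (\<alpha> 0) v) (at 0)"
proof -
  \<comment> \<open>Away from \<open>0\<close> the curve may leave the chart. Its coordinate is
    replaced there by a constant, so that the modified curve stays in the model.\<close>
  define \<beta> where "\<beta> t = (if \<alpha> t \<in> fst c then snd c (\<alpha> t) else snd c (\<alpha> 0))" for t
  have x: "\<alpha> 0 \<in> fst c" by (rule hasvel_0[OF \<alpha>])
  have ev: "\<forall>\<^sub>F t in nhds 0. \<alpha> t \<in> fst c" using \<alpha> by (simp add: hasvel_def)
  then have "\<forall>\<^sub>F t in nhds 0. snd c (\<alpha> t) = \<beta> t" by eventually_elim (simp add: \<beta>_def)
  from hvd_cong[OF this] have \<beta>: "(\<beta> has_vector_derivative v) (at 0)" using \<alpha> by (simp add: hasvel_def)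
  have \<beta>V: "range \<beta> \<subseteq> model M" using chart_in_model[OF M c] x by (auto simp: \<beta>_def)
  have "((\<lambda>p. f (cinv c p)) has_derivative fderiv M c f (\<alpha> 0)) (at (\<beta> 0) within model M)"
    using sfun_has_derivative[OF M f Q c x] by (simp add: \<beta>_def)
  from has_vector_derivative_curve[OF \<beta> \<beta>V this]
  have "((\<lambda>t. f (cinv c (\<beta> t))) has_vector_derivative fderiv M c f (\<alpha> 0) v) (at 0)" .
  moreover have "\<forall>\<^sub>F t in nhds 0. f (cinv c (\<beta> t)) = f (\<alpha> t)"
    using ev by eventually_elim (use M c in \<open>simp add: \<beta>_def\<close>)
  ultimately show ?thesis by (rule hvd_cong[rotated])
qed

lemma hasvel_in_model:
  assumes M: "pre_manifold M" and c: "c \<in> atlas M" and \<alpha>: "hasvel c \<alpha> v"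
  shows "v \<in> model M"
proof -
  have d: "((\<lambda>t. snd c (\<alpha> t)) has_vector_derivative v) (at 0)" using \<alpha> by (simp add: hasvel_def)
  then have "((\<lambda>t. sub_proj (model M) (snd c (\<alpha> t))) has_vector_derivative sub_proj (model M) v) (at 0)"
    by (rule bounded_linear.has_vector_derivative[OF bounded_linear_sub_proj])
  moreover have "\<forall>\<^sub>F t in nhds 0. sub_proj (model M) (snd c (\<alpha> t)) = snd c (\<alpha> t)"
    using \<alpha> unfolding hasvel_def
    by (auto elim!: eventually_mono intro!: sub_proj_id model_subspace M chart_in_model[OF M c])
  ultimately have "((\<lambda>t. snd c (\<alpha> t)) has_vector_derivative sub_proj (model M) v) (at 0)"
    by (rule hvd_cong[rotated])
  from vector_derivative_unique_at[OF d this] show ?thesis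
    using sub_proj_in[OF model_subspace[OF M]] by metis
qed

section \<open>Derivatives of maps read in charts\<close>

lemma loc_deriv_eq_fderiv:
  assumes M: "pre_manifold M" and N: "pre_manifold N" and f: "smooth_map M N f"
    and c: "c \<in> atlas M" and d: "d \<in> atlas N" and x: "x \<in> fst c" "f x \<in> fst d"
  shows "loc_deriv c d f (snd c x) = fderiv M c (\<lambda>x. snd d (f x)) x"
proof -
  have "loc_dom c d f = snd c ` (fst c \<inter> {x \<in> topspace (mtop M). f x \<in> fst d})"
    using chart_subset[OF M c] unfolding loc_dom_def by (intro arg_cong[of _ _ "(`) (snd c)"]) auto
  moreover have "openin (mtop M) {x \<in> topspace (mtop M). f x \<in> fst d}"
    by (rule openin_continuous_map_preimage[OF smooth_map_continuous[OF f] chart_openin[OF N d]])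
  ultimately have "openin (top_of_set (model M)) (loc_dom c d f)" using chart_image_open[OF M c] by simp
  moreover have "snd c x \<in> loc_dom c d f" using x by (auto simp: loc_dom_def)
  ultimately have "at (snd c x) within loc_dom c d f = at (snd c x) within model M"
    by (rule at_within_rel_open)
  then show ?thesis unfolding loc_deriv_def loc_rep_def by (simp add: o_def)
qed

lemma hasvel_smooth_map:
  assumes M: "pre_manifold M" and N: "pre_manifold N" and f: "smooth_map M N f"
    and c: "c \<in> atlas M" and d: "d \<in> atlas N" and \<alpha>: "hasvel c \<alpha> v" and x: "f (\<alpha> 0) \<in> fst d"
  shows "hasvel d (\<lambda>t. f (\<alpha> t)) (loc_deriv c d f (snd c (\<alpha> 0)) v)"
proof -
  let ?Q = "{x \<in> topspace (mtop M). f x \<in> fst d}"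
  have s: "sfun M ?Q (\<lambda>x. snd d (f x))" by (rule smooth_map_chart[OF M N f d])
  have 0: "\<alpha> 0 \<in> ?Q" using x hasvel_0[OF \<alpha>] chart_subset[OF M c] by auto
  have "\<forall>\<^sub>F t in nhds 0. \<alpha> t \<in> ?Q" by (rule hasvel_eventually[OF M c \<alpha> sfun_open[OF s] 0])
  then have "\<forall>\<^sub>F t in nhds 0. f (\<alpha> t) \<in> fst d" by eventually_elim simp
  then show ?thesis
    using hasvel_sfun[OF M s c \<alpha> 0] loc_deriv_eq_fderiv[OF M N f c d hasvel_0[OF \<alpha>] x]
    by (simp add: hasvel_def)
qed

text \<open>The working rule for computing derivatives: one curve with known velocity and known
  image velocity determines the value.\<close>

lemma loc_deriv_unique:
  assumes "pre_manifold M" "pre_manifold N" "smooth_map M N f" "c \<in> atlas M" "d \<in> atlas N"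
    "hasvel c \<alpha> v" "hasvel d (\<lambda>t. f (\<alpha> t)) w" "p = snd c (\<alpha> 0)"
  shows "loc_deriv c d f p v = w"
  using hasvel_unique[OF hasvel_smooth_map[OF assms(1-6)] assms(7)] hasvel_0[OF assms(7)] assms(8) by simp

lemma loc_deriv_in:
  assumes "pre_manifold M" "pre_manifold N" "smooth_map M N f" "c \<in> atlas M" "d \<in> atlas N"
    "x \<in> fst c" "f x \<in> fst d" "v \<in> model M"
  shows "loc_deriv c d f (snd c x) v \<in> model N"
proof -
  obtain \<alpha> where \<alpha>: "\<alpha> 0 = x" "hasvel c \<alpha> v" using hasvel_exists[OF assms(1,4,6,8)] by blast
  have "hasvel d (\<lambda>t. f (\<alpha> t)) (loc_deriv c d f (snd c (\<alpha> 0)) v)"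
    by (rule hasvel_smooth_map[OF assms(1-5) \<alpha>(2)]) (use \<alpha> assms in simp)
  from hasvel_in_model[OF assms(2,5) this] show ?thesis using \<alpha>(1) by simp
qed

lemma loc_deriv_linear:
  assumes "pre_manifold M" "pre_manifold N" "smooth_map M N f" "c \<in> atlas M" "d \<in> atlas N"
    "x \<in> fst c" "f x \<in> fst d"
  shows "bounded_linear (loc_deriv c d f (snd c x))"
proof -
  have "x \<in> {x \<in> topspace (mtop M). f x \<in> fst d}" using assms chart_subset by blast
  from has_derivative_bounded_linear[OF sfun_has_derivative[OF assms(1) smooth_map_chart[OF assms(1-3,5)] this assms(4,6)]]
  show ?thesis by (simp add: loc_deriv_eq_fderiv[OF assms])
qed

lemma loc_deriv_chain:
  assumes M: "pre_manifold M" and N: "pre_manifold N" and K: "pre_manifold K"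
    and f: "smooth_map M N f" and g: "smooth_map N K g"
    and c: "c \<in> atlas M" and d: "d \<in> atlas N" and e: "e \<in> atlas K"
    and x: "x \<in> fst c" "f x \<in> fst d" "g (f x) \<in> fst e" and v: "v \<in> model M"
  shows "loc_deriv c e (\<lambda>x. g (f x)) (snd c x) v = loc_deriv d e g (snd d (f x)) (loc_deriv c d f (snd c x) v)"
proof -
  obtain \<alpha> where \<alpha>: "\<alpha> 0 = x" "hasvel c \<alpha> v" using hasvel_exists[OF M c x(1) v] by blast
  have 1: "hasvel d (\<lambda>t. f (\<alpha> t)) (loc_deriv c d f (snd c (\<alpha> 0)) v)"
    by (rule hasvel_smooth_map[OF M N f c d \<alpha>(2)]) (use \<alpha> x in simp)
  have 2: "hasvel e (\<lambda>t. g (f (\<alpha> t))) (loc_deriv d e g (snd d (f (\<alpha> 0))) (loc_deriv c d f (snd c (\<alpha> 0)) v))"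
    by (rule hasvel_smooth_map[OF N K g d e 1]) (use \<alpha> x in simp)
  show ?thesis
    using loc_deriv_unique[OF M K smooth_map_compose[OF M N K f g] c e \<alpha>(2) 2] \<alpha>(1) by simp
qed

lemma loc_deriv_id:
  assumes M: "pre_manifold M" and c: "c \<in> atlas M" and x: "x \<in> fst c" and v: "v \<in> model M"
    and f: "smooth_map M M f" "\<And>y. y \<in> topspace (mtop M) \<Longrightarrow> f y = y"
  shows "loc_deriv c c f (snd c x) v = v"
proof -
  obtain \<alpha> where \<alpha>: "\<alpha> 0 = x" "hasvel c \<alpha> v" using hasvel_exists[OF M c x v] by blast
  have "\<forall>\<^sub>F t in nhds 0. \<alpha> t = f (\<alpha> t)"
    using \<alpha>(2) unfolding hasvel_def by (auto elim!: eventually_mono simp: f(2) subsetD[OF chart_subset[OF M c]])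
  from hasvel_cong[OF this \<alpha>(2)] show ?thesis
    using loc_deriv_unique[OF M M f(1) c c \<alpha>(2)] \<alpha>(1) by simp
qed

section \<open>Embedded submanifolds\<close>

lemma embedded_submanifoldD:
  assumes "embedded_submanifold N M"
  shows "smooth_manifold N" "pre_manifold N" "topspace (mtop N) \<subseteq> topspace (mtop M)"
    "mtop N = subtopology (mtop M) (topspace (mtop N))" "smooth_map N M (\<lambda>x. x)"
  using assms smooth_manifold_pre unfolding embedded_submanifold_def id_def by auto

lemma embedded_submanifold_inj:
  assumes N: "embedded_submanifold N M" and "c \<in> atlas N" "d \<in> atlas M" "x \<in> fst c" "x \<in> fst d" "v \<in> model N"
    "loc_deriv c d (\<lambda>x. x) (snd c x) v = 0"
  shows "v = 0"
proof -
  have "snd c x \<in> loc_dom c d id" using assms by (auto simp: loc_dom_def)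
  then show ?thesis using assms unfolding embedded_submanifold_def id_def by blast
qed

lemma embedded_submanifoldI:
  assumes M: "pre_manifold M" and N: "smooth_manifold N" and sub: "topspace (mtop N) \<subseteq> topspace (mtop M)"
    and top: "mtop N = subtopology (mtop M) (topspace (mtop N))" and i: "smooth_map N M (\<lambda>x. x)"
    and inj: "\<And>c d \<alpha> v. c \<in> atlas N \<Longrightarrow> d \<in> atlas M \<Longrightarrow> hasvel c \<alpha> v \<Longrightarrow> hasvel d \<alpha> 0 \<Longrightarrow> v = 0"
  shows "embedded_submanifold N M"
  unfolding embedded_submanifold_def id_def
proof (intro conjI N sub top i ballI impI)
  have N': "pre_manifold N" by (rule smooth_manifold_pre[OF N])
  fix c d p v assume c: "c \<in> atlas N" and d: "d \<in> atlas M" and p: "p \<in> loc_dom c d (\<lambda>x. x)" and v: "v \<in> model N"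
    and 0: "loc_deriv c d (\<lambda>x. x) p v = 0"
  obtain x where x: "x \<in> fst c" "x \<in> fst d" "p = snd c x" using p by (auto simp: loc_dom_def)
  obtain \<alpha> where \<alpha>: "\<alpha> 0 = x" "hasvel c \<alpha> v" using hasvel_exists[OF N' c x(1) v] by blast
  have "hasvel d \<alpha> 0"
    using hasvel_smooth_map[OF N' M i c d \<alpha>(2)] \<alpha>(1) x 0 by simp
  with inj[OF c d \<alpha>(2)] show "v = 0" .
qed

text \<open>The derivative of a smooth retraction is a left inverse of the derivative of the
  inclusion, so the inclusion is an immersion.\<close>

lemma embedded_submanifold_retract:
  assumes M: "pre_manifold M" and N: "smooth_manifold N" and sub: "topspace (mtop N) \<subseteq> topspace (mtop M)"
    and top: "mtop N = subtopology (mtop M) (topspace (mtop N))" and i: "smooth_map N M (\<lambda>x. x)"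
    and r: "smooth_map M N r" "\<And>x. x \<in> topspace (mtop N) \<Longrightarrow> r x = x"
  shows "embedded_submanifold N M"
proof (rule embedded_submanifoldI[OF M N sub top i])
  have N': "pre_manifold N" by (rule smooth_manifold_pre[OF N])
  fix c d \<alpha> v assume c: "c \<in> atlas N" and d: "d \<in> atlas M" and \<alpha>: "hasvel c \<alpha> v" "hasvel d \<alpha> 0"
  have in_N: "x \<in> topspace (mtop N)" if "x \<in> fst c" for x using chart_subset[OF N' c] that by auto
  have \<alpha>0: "\<alpha> 0 \<in> fst c" "\<alpha> 0 \<in> fst d" "r (\<alpha> 0) = \<alpha> 0" using hasvel_0[OF \<alpha>(1)] hasvel_0[OF \<alpha>(2)] r(2) in_N by auto
  have "hasvel c (\<lambda>t. r (\<alpha> t)) (loc_deriv d c r (snd d (\<alpha> 0)) 0)"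
    by (rule hasvel_smooth_map[OF M N' r(1) d c \<alpha>(2)]) (use \<alpha>0 in simp)
  moreover have "loc_deriv d c r (snd d (\<alpha> 0)) 0 = 0"
    using loc_deriv_linear[OF M N' r(1) d c \<alpha>0(2)] \<alpha>0 by (simp add: linear_simps)
  moreover have "\<forall>\<^sub>F t in nhds 0. \<alpha> t = r (\<alpha> t)"
    using \<alpha>(1) unfolding hasvel_def by (auto elim!: eventually_mono simp: r(2) in_N)
  ultimately show "v = 0" using hasvel_unique[OF hasvel_cong[OF _ \<alpha>(1), of "\<lambda>t. r (\<alpha> t)"]] by simp
qed

text \<open>Locally the coordinates of \<open>N\<close> are smooth functions of the coordinates of
  \<open>M\<close>: compose the inclusion with a linear left inverse \<open>\<Lambda>\<close> of its
  derivative and invert the result by the inverse function theorem. Continuity into \<open>N\<close>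
  comes from the subspace topology.\<close>

theorem smooth_map_into_embedded:
  assumes K: "pre_manifold K" and M: "pre_manifold M" and N: "embedded_submanifold N M"
    and f: "smooth_map K M f" and fN: "\<And>x. x \<in> topspace (mtop K) \<Longrightarrow> f x \<in> topspace (mtop N)"
  shows "smooth_map K N f"
proof -
  note N' = embedded_submanifoldD[OF N]
  have VN: "subspace (model N)" by (rule model_subspace[OF N'(2)])
  have fc: "continuous_map (mtop K) (mtop N) f"
    by (subst N'(4)) (use fN smooth_map_continuous[OF f] in \<open>auto simp: continuous_map_in_subtopology\<close>)
  show ?thesis
  proof (rule smooth_mapI[OF K N'(2)])
    fix x assume x: "x \<in> topspace (mtop K)"
    have y: "f x \<in> topspace (mtop N)" by (rule fN[OF x])
    then obtain c where c: "c \<in> atlas N" "f x \<in> fst c" using ex_chart[OF N'(2)] by blast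
    obtain d where d: "d \<in> atlas M" "f x \<in> fst d" using ex_chart[OF M] y N'(3) by blast
    let ?I = "{y \<in> topspace (mtop N). y \<in> fst d}"
    have J: "sfun N ?I (snd d)"
      using smooth_map_chart[OF N'(2) M N'(5) d(1)] by simp
    define S where "S = snd c ` (fst c \<inter> ?I)"
    have S: "openin (top_of_set (model N)) S" unfolding S_def by (rule chart_image_open[OF N'(2) c(1) sfun_open[OF J]])
    have p: "snd c (f x) \<in> S" using c d y by (auto simp: S_def)
    let ?D = "loc_deriv c d (\<lambda>x. x) (snd c (f x))"
    have D: "bounded_linear ?D" by (rule loc_deriv_linear[OF N'(2) M N'(5) c(1) d(1) c(2) d(2)])
    have Dd: "((\<lambda>p. snd d (cinv c p)) has_derivative ?D) (at (snd c (f x)) within model N)"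
      using sfun_has_derivative[OF N'(2) J _ c] y d(2) loc_deriv_eq_fderiv[OF N'(2) M N'(5) c(1) d(1) c(2) d(2)] by simp
    have "inj_on ?D (model N)"
      using embedded_submanifold_inj[OF N c(1) d(1) c(2) d(2)] linear_inj_on_iff_eq_0[OF bounded_linear.linear[OF D] VN]
      by blast
    then obtain \<Lambda> where \<Lambda>: "range \<Lambda> \<subseteq> model N" "linear \<Lambda>" "\<And>v. v \<in> model N \<Longrightarrow> \<Lambda> (?D v) = v"
      using linear_exists_left_inverse_on[OF bounded_linear.linear[OF D] VN] by blast
    have \<Lambda>b: "bounded_linear \<Lambda>" using \<Lambda>(2) by (simp add: linear_linear)
    define F where "F = (\<lambda>p. \<Lambda> (snd d (cinv c p)))"
    have F: "smooth_on (model N) S F"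
      unfolding F_def S_def by (rule smooth_on_linear_comp[OF \<Lambda>b sfunD[OF J c(1)]])
    have FV: "F ` S \<subseteq> model N" using \<Lambda>(1) by (auto simp: F_def)
    have Fd: "(F has_derivative (\<lambda>v. \<Lambda> (?D v))) (at (snd c (f x)) within model N)"
      unfolding F_def by (rule bounded_linear.has_derivative[OF \<Lambda>b Dd])
    have "v = 0" if "v \<in> model N" "frechet_derivative F (at (snd c (f x)) within model N) v = 0" for v
      using that frechet_derivative_within_subspace[OF VN _ that(1) Fd] chart_in_model[OF N'(2) c] \<Lambda>(3) by simp
    from inverse_function_theorem_subspace[OF VN S F FV p this]
    obtain Q R g where g: "openin (top_of_set (model N)) Q" "snd c (f x) \<in> Q" "Q \<subseteq> S" "openin (top_of_set (model N)) R"
      "homeomorphism Q R F g" "smooth_on (model N) R g" by blast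
    define T where "T = {y \<in> fst c. snd c y \<in> Q}"
    have "openin (mtop N) T" unfolding T_def by (rule chart_preimage_open[OF N'(2) c(1) g(1)])
    from openin_continuous_map_preimage[OF fc this]
    have U: "openin (mtop K) {z \<in> topspace (mtop K). f z \<in> T}" (is "openin _ ?U") .
    have Td: "y \<in> fst d" if "y \<in> T" for y
    proof -
      have "snd c y \<in> S" using that g(3) by (auto simp: T_def)
      then obtain y' where "y' \<in> fst c" "y' \<in> fst d" "snd c y = snd c y'" unfolding S_def by blast
      then show ?thesis using that chart_inj[OF N'(2) c(1)] by (auto simp: inj_on_def T_def)
    qed
    have eq: "F (snd c y) = \<Lambda> (snd d y)" if "y \<in> T" for y
      using that N'(2) c(1) by (simp add: F_def T_def)
    have 1: "sfun K ?U (\<lambda>z. snd d (f z))"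
      by (rule sfun_subset[OF smooth_map_chart[OF K M f d(1)] U]) (use Td in auto)
    have 2: "sfun K ?U (\<lambda>z. g (\<Lambda> (snd d (f z))))"
    proof (rule sfun_compose[OF K sfun_linear_comp[OF \<Lambda>b 1] VN _ g(6)])
      show "R \<subseteq> model N" using g(4) openin_imp_subset by blast
      show "(\<lambda>z. \<Lambda> (snd d (f z))) ` ?U \<subseteq> R"
      proof safe
        fix z assume z: "f z \<in> T"
        have "F (snd c (f z)) \<in> R" using z g(5) by (auto simp: T_def homeomorphism_def)
        then show "\<Lambda> (snd d (f z)) \<in> R" by (simp add: eq[OF z])
      qed
    qed
    have 3: "sfun K ?U (\<lambda>z. snd c (f z))"
    proof (rule sfun_cong[OF K 2])
      fix z assume "z \<in> ?U"
      then have "f z \<in> T" by simp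
      then show "g (\<Lambda> (snd d (f z))) = snd c (f z)" using eq[of "f z"] g(5) by (auto simp: T_def homeomorphism_def)
    qed
    show "\<exists>Q. \<exists>d\<in>atlas N. x \<in> Q \<and> f ` Q \<subseteq> fst d \<and> sfun K Q (\<lambda>x. snd d (f x))"
      by (rule exI[of _ ?U], rule bexI[OF _ c(1)], intro conjI 3) (use x c g(2) in \<open>auto simp: T_def\<close>)
  qed
qed

subsection \<open>Fixed points of an involution\<close>

lemma smooth_on_submodel:
  assumes "smooth_on V S f" "W \<subseteq> V" shows "smooth_on W S f"
proof (rule smooth_onI)
  fix k
  have *: "Ck_on k V S f \<Longrightarrow> Ck_on k W S f" for f :: "'a \<Rightarrow> 'b"
  proof (induction k arbitrary: f)
    case (Suc k)
    from Suc.prems obtain f' where f': "\<And>x. x\<in>S \<Longrightarrow> (f has_derivative f' x) (at x within S)"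
      "\<And>v. v\<in>V \<Longrightarrow> Ck_on k V S (\<lambda>x. f' x v)" by (rule Ck_on_SucE) iprover
    show ?case by (rule Ck_on_SucI[OF f'(1)], assumption, rule Suc.IH[OF f'(2)]) (use assms(2) in blast)
  qed simp
  show "Ck_on k W S f" by (rule *[OF smooth_onD[OF assms(1)]])
qed

text \<open>
  Near a fixed point \<open>p\<^sub>0\<close> the map \<open>\<psi> = \<phi> + A \<circ> \<phi> \<circ> s\<close>, with \<open>\<phi>\<close> a chart centred at \<open>p\<^sub>0\<close> and \<open>A\<close> the derivative
  of \<open>s\<close> there, is a chart in which \<open>s\<close> is linear. Homogeneity transports it to all fixed points, which makes
  the fixed-point set equidimensional.
\<close>

locale homogeneous_involution =
  fixes M :: "('a, 'e::euclidean_space) manifold" and s :: "'a \<Rightarrow> 'a" and p0 :: 'a and F :: "'a set"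
  assumes SM: "smooth_manifold M" and s: "smooth_map M M s"
    and ss: "\<And>x. x \<in> topspace (mtop M) \<Longrightarrow> s (s x) = x"
    and F_def: "F = {x \<in> topspace (mtop M). s x = x}" and p0: "p0 \<in> F"
    and homog: "\<And>p. p \<in> F \<Longrightarrow> \<exists>f g. smooth_map M M f \<and> smooth_map M M g \<and>
       (\<forall>x\<in>topspace (mtop M). g (f x) = x) \<and> (\<forall>x\<in>topspace (mtop M). f (g x) = x) \<and>
       (\<forall>x\<in>topspace (mtop M). f (s x) = s (f x)) \<and> f p0 = p"
begin

lemma M: "pre_manifold M" by (rule smooth_manifold_pre[OF SM])

abbreviation "V \<equiv> model M"
abbreviation "T \<equiv> topspace (mtop M)"

lemma V: "subspace V" by (rule model_subspace[OF M])

lemma linearizing_chart: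
  obtains Q \<psi> \<psi>i A where
    "openin (mtop M) Q" "p0 \<in> Q" "sfun M Q \<psi>" "\<psi> ` Q \<subseteq> V" "inj_on \<psi> Q"
    "\<forall>x\<in>Q. \<psi>i (\<psi> x) = x"
    "\<forall>R. openin (mtop M) R \<longrightarrow> R \<subseteq> Q \<longrightarrow> openin (top_of_set V) (\<psi> ` R)"
    "\<forall>R (k :: 'a \<Rightarrow> 'e). sfun M R k \<longrightarrow> R \<subseteq> Q \<longrightarrow> smooth_on V (\<psi> ` R) (\<lambda>w. k (\<psi>i w))"
    "bounded_linear A" "\<forall>x\<in>Q. s x = x \<longleftrightarrow> A (\<psi> x) = \<psi> x"
proof -
  have p0T: "p0 \<in> T" and sp0: "s p0 = p0" using p0 by (auto simp: F_def)
  obtain c where c: "c \<in> atlas M" "p0 \<in> fst c" using ex_chart[OF M p0T] by blast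
  define q0 where "q0 = snd c p0"
  define A where "A = loc_deriv c c s q0"
  have q0V: "q0 \<in> V" unfolding q0_def by (rule chart_in_model[OF M c])
  have A: "bounded_linear A"
    unfolding A_def q0_def by (rule loc_deriv_linear[OF M M s c(1) c]) (simp add: sp0 c)
  interpret A: bounded_linear A by (rule A)
  have AV: "A v \<in> V" if "v \<in> V" for v
    unfolding A_def q0_def by (rule loc_deriv_in[OF M M s c(1) c _ that]) (simp add: sp0 c)
  have AA: "A (A v) = v" if "v \<in> V" for v
  proof -
    have "loc_deriv c c (\<lambda>x. s (s x)) (snd c p0) v = v"
      by (rule loc_deriv_id[OF M c that smooth_map_compose[OF M M M s s] ss])
    moreover have "loc_deriv c c (\<lambda>x. s (s x)) (snd c p0) v = A (A v)"
      using loc_deriv_chain[OF M M M s s c(1) c(1) c(1) c(2) _ _ that] by (simp add: sp0 c A_def q0_def)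
    ultimately show ?thesis by simp
  qed
  let ?I = "{x \<in> T. s x \<in> fst c}"
  have sc: "sfun M ?I (\<lambda>x. snd c (s x))" by (rule smooth_map_chart[OF M M s c(1)])
  define S where "S = snd c ` (fst c \<inter> ?I)"
  have S: "openin (top_of_set V) S" unfolding S_def by (rule chart_image_open[OF M c(1) sfun_open[OF sc]])
  have q0S: "q0 \<in> S" using c p0T sp0 by (auto simp: S_def q0_def)
  have SV: "S \<subseteq> V" using S openin_imp_subset by blast
  define \<Psi> where "\<Psi> = (\<lambda>p. (p + (- q0)) + A (snd c (s (cinv c p)) + (- q0)))"
  have st: "smooth_on V S (\<lambda>p. snd c (s (cinv c p)))" unfolding S_def by (rule sfunD[OF sc c(1)])
  have \<Psi>: "smooth_on V S \<Psi>"
    unfolding \<Psi>_def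
    by (rule smooth_on_add[OF smooth_on_add[OF smooth_on_linear[OF bounded_linear_ident] smooth_on_const]
        smooth_on_linear_comp[OF A smooth_on_add[OF st smooth_on_const]]])
  have stV: "snd c (s (cinv c p)) \<in> V" if "p \<in> S" for p
    using that chart_in_model[OF M c(1)] M c(1) by (auto simp: S_def)
  have \<Psi>V: "\<Psi> ` S \<subseteq> V"
  proof safe
    fix p assume p: "p \<in> S"
    have "p - q0 \<in> V" "snd c (s (cinv c p)) - q0 \<in> V"
      using stV[OF p] p SV q0V V by (auto intro: subspace_diff)
    then show "\<Psi> p \<in> V" using AV V by (simp add: \<Psi>_def subspace_add)
  qed
  have std: "((\<lambda>p. snd c (s (cinv c p))) has_derivative A) (at q0 within V)"
    using sfun_has_derivative[OF M sc _ c] p0T sp0 c loc_deriv_eq_fderiv[OF M M s c(1) c(1) c(2)]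
    by (simp add: A_def q0_def)
  \<comment> \<open>Since \<open>A\<close> is an involution on the model, this derivative is twice
    the identity there.\<close>
  have "(\<Psi> has_derivative (\<lambda>v. (v + 0) + A (A v + 0))) (at q0 within V)"
    unfolding \<Psi>_def
    by (intro has_derivative_add has_derivative_ident has_derivative_const bounded_linear.has_derivative[OF A] std)
  then have "frechet_derivative \<Psi> (at q0 within V) v = v + A (A v)" if "v \<in> V" for v
    using frechet_derivative_within_subspace[OF V q0V that] by fastforce
  then have "v = 0" if "v \<in> V" "frechet_derivative \<Psi> (at q0 within V) v = 0" for v
    using that AA by (simp add: scaleR_2[symmetric])
  from inverse_function_theorem_subspace[OF V S \<Psi> \<Psi>V q0S this]
  obtain Q1 R h where h: "openin (top_of_set V) Q1" "q0 \<in> Q1" "Q1 \<subseteq> S" "openin (top_of_set V) R"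
    "homeomorphism Q1 R \<Psi> h" "smooth_on V R h" by blast
  have h\<Psi>: "h (\<Psi> p) = p" if "p \<in> Q1" for p using h(5) that by (auto simp: homeomorphism_def)
  have \<Psi>R: "\<Psi> p \<in> R" if "p \<in> Q1" for p using h(5) that by (auto simp: homeomorphism_def)
  define Q2 where "Q2 = {x \<in> fst c. snd c x \<in> Q1}"
  have Q2: "openin (mtop M) Q2" unfolding Q2_def by (rule chart_preimage_open[OF M c(1) h(1)])
  \<comment> \<open>Intersecting with the preimage under \<open>s\<close> makes the domain
    invariant, so that \<open>\<psi>\<close> can also be evaluated at \<open>s x\<close>.\<close>
  define Q where "Q = Q2 \<inter> {x \<in> T. s x \<in> Q2}"
  have Q: "openin (mtop M) Q" unfolding Q_def
    by (rule openin_Int[OF Q2 openin_continuous_map_preimage[OF smooth_map_continuous[OF s] Q2]])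
  define \<psi> where "\<psi> = (\<lambda>x. \<Psi> (snd c x))"
  define \<psi>i where "\<psi>i = (\<lambda>w. cinv c (h w))"
  have Qc: "x \<in> fst c" "snd c x \<in> Q1" "x \<in> T" "s x \<in> fst c" "snd c (s x) \<in> Q1" if "x \<in> Q" for x
    using that by (auto simp: Q_def Q2_def)
  have sQ: "s x \<in> Q" if "x \<in> Q" for x
    using that Qc(3)[OF that] ss smooth_map_in[OF s] by (auto simp: Q_def)
  have inv: "\<psi>i (\<psi> x) = x" if "x \<in> Q" for x
    using Qc[OF that] h\<Psi> M c(1) by (simp add: \<psi>_def \<psi>i_def)
  have inj: "inj_on \<psi> Q" using inv by (metis inj_onI)
  have 1: "sfun M Q \<psi>"
    unfolding \<psi>_def
  proof (rule sfun_compose[OF M _ V _ smooth_on_subset[OF \<Psi> h(3)]])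
    show "sfun M Q (snd c)" by (rule sfun_subset[OF sfun_chart[OF M c(1)] Q]) (use Qc in auto)
    show "Q1 \<subseteq> V" using h(3) SV by blast
    show "snd c ` Q \<subseteq> Q1" using Qc by auto
  qed
  have 2: "\<psi> ` Q \<subseteq> V"
  proof safe
    fix x assume "x \<in> Q"
    then have "snd c x \<in> S" using Qc(2) h(3) by blast
    then show "\<psi> x \<in> V" using \<Psi>V by (auto simp: \<psi>_def)
  qed
  have cQ: "snd c ` R' \<subseteq> Q1" if "R' \<subseteq> Q" for R' using Qc that by auto
  have opn: "openin (top_of_set V) (\<psi> ` R')" if R': "openin (mtop M) R'" "R' \<subseteq> Q" for R'
  proof -
    have "fst c \<inter> R' = R'" using R'(2) Qc by auto
    then have "openin (top_of_set V) (snd c ` R')" using chart_image_open[OF M c(1) R'(1)] by simp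
    then have "openin (top_of_set Q1) (snd c ` R')"
      by (rule openin_subset_trans[OF _ cQ[OF R'(2)] order_trans[OF h(3) SV]])
    then have "openin (top_of_set R) (\<Psi> ` snd c ` R')"
      by (rule homeomorphism_imp_open_map[OF h(5)])
    then show ?thesis using openin_trans[OF _ h(4)] by (simp add: image_image \<psi>_def)
  qed
  have smo: "smooth_on V (\<psi> ` R') (\<lambda>w. k (\<psi>i w))" if k: "sfun M R' k" "R' \<subseteq> Q" for R' and k :: "'a \<Rightarrow> 'e"
  proof -
    have im: "\<psi> ` R' \<subseteq> R" using k(2) Qc \<Psi>R by (auto simp: \<psi>_def)
    have R'c: "fst c \<inter> R' = R'" using k(2) Qc by auto
    show ?thesis unfolding \<psi>i_def
    proof (rule smooth_on_compose[OF V _ _ smooth_on_subset[OF h(6) im]])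
      show "smooth_on V (snd c ` R') (\<lambda>p. k (cinv c p))" using sfunD[OF k(1) c(1)] R'c by simp
      show "snd c ` R' \<subseteq> V" using cQ[OF k(2)] h(3) SV by blast
      show "h ` \<psi> ` R' \<subseteq> snd c ` R'" using k(2) Qc(2) h\<Psi> by (auto simp: \<psi>_def)
    qed
  qed
  have fixed: "s x = x \<longleftrightarrow> A (\<psi> x) = \<psi> x" if x: "x \<in> Q" for x
  proof -
    have v: "snd c x - q0 \<in> V" "snd c (s x) - q0 \<in> V"
      using chart_in_model[OF M c(1)] Qc[OF x] q0V V by (auto intro: subspace_diff)
    have e1: "\<psi> x = (snd c x - q0) + A (snd c (s x) - q0)"
      using Qc[OF x] M c(1) by (simp add: \<psi>_def \<Psi>_def)
    have e2: "\<psi> (s x) = (snd c (s x) - q0) + A (snd c x - q0)"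
      using Qc[OF x] M c(1) ss[of x] by (simp add: \<psi>_def \<Psi>_def)
    \<comment> \<open>\<open>A\<close> exchanges the two summands of \<open>\<psi> x\<close>,
      exactly as \<open>s\<close> does; in the new coordinates \<open>s\<close> therefore is the
      linear map \<open>A\<close>.\<close>
    have "A (\<psi> x) = \<psi> (s x)" unfolding e1 e2 by (simp add: A.add AA[OF v(2)] add.commute)
    then show ?thesis using inj x sQ[OF x] by (auto simp: inj_on_def)
  qed
  have "p0 \<in> Q" using c p0T sp0 h(2) by (auto simp: Q_def Q2_def q0_def)
  show thesis
    by (rule that[of Q \<psi> \<psi>i A, OF Q \<open>p0 \<in> Q\<close> 1 2 inj _ _ _ A]) (simp_all add: inv opn smo fixed)
qed

theorem fixed_point_submanifold:
  "\<exists>N :: ('a, 'e) manifold. embedded_submanifold N M \<and> topspace (mtop N) = F"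
proof -
  obtain Q \<psi> \<psi>i A where Q: "openin (mtop M) Q" "p0 \<in> Q" and \<psi>: "sfun M Q \<psi>" "\<psi> ` Q \<subseteq> V" "inj_on \<psi> Q"
    and *: "\<forall>x\<in>Q. \<psi>i (\<psi> x) = x"
      "\<forall>R. openin (mtop M) R \<longrightarrow> R \<subseteq> Q \<longrightarrow> openin (top_of_set V) (\<psi> ` R)"
      "\<forall>R (k :: 'a \<Rightarrow> 'e). sfun M R k \<longrightarrow> R \<subseteq> Q \<longrightarrow> smooth_on V (\<psi> ` R) (\<lambda>w. k (\<psi>i w))"
    and A: "bounded_linear A" and **: "\<forall>x\<in>Q. s x = x \<longleftrightarrow> A (\<psi> x) = \<psi> x"
    by (rule linearizing_chart)
  note \<psi>i = bspec[OF *(1)] and opn = *(2)[rule_format] and smo = *(3)[rule_format] and fixed = bspec[OF **]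
  have QT: "Q \<subseteq> T" using Q(1) openin_subset by blast
  have FT: "F \<subseteq> T" by (auto simp: F_def)
  obtain f g where fg: "\<And>p. p \<in> F \<Longrightarrow> smooth_map M M (f p) \<and> smooth_map M M (g p) \<and>
       (\<forall>x\<in>T. g p (f p x) = x) \<and> (\<forall>x\<in>T. f p (g p x) = x) \<and> (\<forall>x\<in>T. f p (s x) = s (f p x)) \<and> f p p0 = p"
    using homog by metis
  have f: "smooth_map M M (f p)" and g: "smooth_map M M (g p)" and fp0: "f p p0 = p" if "p \<in> F" for p
    using fg[OF that] by auto
  have gf: "g p (f p x) = x" and fg': "f p (g p x) = x" and fs: "f p (s x) = s (f p x)" if "p \<in> F" "x \<in> T" for p x
    using fg[OF that(1)] that(2) by auto
  have fT: "f p x \<in> T" and gT: "g p x \<in> T" if "p \<in> F" "x \<in> T" for p x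
    using smooth_map_in[OF f] smooth_map_in[OF g] that by auto
  have gs: "g p (s x) = s (g p x)" if "p \<in> F" "x \<in> T" for p x
    using fs[OF that(1) gT[OF that]] fg'[OF that] gf[OF that(1), of "s (g p x)"] smooth_map_in[OF s gT[OF that]] by simp
  have gF: "g p x \<in> F" if "p \<in> F" "x \<in> F" for p x
    using gs[OF that(1), of x] gT[OF that(1), of x] that(2) by (auto simp: F_def)
  have fF: "f p x \<in> F" if "p \<in> F" "x \<in> F" for p x
    using fs[OF that(1), of x] fT[OF that(1), of x] that(2) by (auto simp: F_def)
  define W where "W = {v \<in> V. A v = v}"
  have W: "subspace W" using V bounded_linear.linear[OF A]
    by (auto simp: W_def subspace_def linear_add linear_cmul linear_0)
  have WV: "W \<subseteq> V" by (auto simp: W_def)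
  have \<psi>W: "\<psi> x \<in> W \<longleftrightarrow> x \<in> F" if "x \<in> Q" for x
    using fixed[OF that] \<psi>(2) that QT by (auto simp: W_def F_def)
  define D where "D p = {x \<in> T. g p x \<in> Q}" for p
  have D: "openin (mtop M) (D p)" if "p \<in> F" for p
    unfolding D_def by (rule openin_continuous_map_preimage[OF smooth_map_continuous[OF g[OF that]] Q(1)])
  define \<kappa> where "\<kappa> p x = \<psi> (g p x)" for p x
  have \<kappa>: "sfun M (D p) (\<kappa> p)" if "p \<in> F" for p
    unfolding \<kappa>_def D_def by (rule smooth_map_sfun[OF M M g[OF that] \<psi>(1)])
  have \<kappa>W: "\<kappa> p x \<in> W \<longleftrightarrow> x \<in> F" if "p \<in> F" "x \<in> D p" for p x
  proof -
    have x: "x \<in> T" "g p x \<in> Q" using that(2) by (auto simp: D_def)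
    have "g p x \<in> F \<longleftrightarrow> x \<in> F" using gF[OF that(1)] fF[OF that(1), of "g p x"] fg'[OF that(1) x(1)] by auto
    then show ?thesis using \<psi>W[OF x(2)] by (simp add: \<kappa>_def)
  qed
  have \<kappa>_inv: "f p (\<psi>i (\<kappa> p x)) = x" if "p \<in> F" "x \<in> D p" for p x
    using \<psi>i[of "g p x"] that fg'[OF that(1), of x] by (auto simp: D_def \<kappa>_def)
  have \<kappa>_inj: "inj_on (\<kappa> p) (D p)" if "p \<in> F" for p by (metis \<kappa>_inv[OF that] inj_onI)
  have \<kappa>_open: "openin (top_of_set W) (\<kappa> p ` (R \<inter> F))" if p: "p \<in> F" and R: "openin (mtop M) R" "R \<subseteq> D p" for p R
  proof -
    have R': "openin (mtop M) {y \<in> T. f p y \<in> R}"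
      by (rule openin_continuous_map_preimage[OF smooth_map_continuous[OF f[OF p]] R(1)])
    have RT: "R \<subseteq> T" using R(1) openin_subset by blast
    have eq: "g p ` R = {y \<in> T. f p y \<in> R}"
      using gf[OF p] fg'[OF p] gT[OF p] RT by (auto simp: image_iff) (metis subsetD)+
    have "g p ` R \<subseteq> Q" using R(2) by (auto simp: D_def)
    with opn[of "g p ` R"] R' eq have "openin (top_of_set V) (\<psi> ` g p ` R)" by simp
    moreover have "\<kappa> p ` (R \<inter> F) = \<psi> ` g p ` R \<inter> W"
      using \<kappa>W[OF p] R(2) by (auto simp: \<kappa>_def image_image)
    ultimately obtain S where S: "open S" "\<psi> ` g p ` R = V \<inter> S" "\<kappa> p ` (R \<inter> F) = \<psi> ` g p ` R \<inter> W"
      unfolding openin_open by auto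
    then have "\<kappa> p ` (R \<inter> F) = W \<inter> S" using WV by auto
    with S(1) show ?thesis by auto
  qed
  define N :: "('a, 'e) manifold" where
    "N = \<lparr>mtop = subtopology (mtop M) F, model = W, atlas = {(D p \<inter> F, \<kappa> p) | p. p \<in> F}\<rparr>"
  have N_simps: "mtop N = subtopology (mtop M) F" "model N = W" "atlas N = {(D p \<inter> F, \<kappa> p) | p. p \<in> F}"
    by (simp_all add: N_def)
  have topN: "topspace (mtop N) = F" using FT by (auto simp: N_simps)
  have \<kappa>_inj': "inj_on (\<kappa> p) (D p \<inter> F)" if "p \<in> F" for p
    by (rule inj_on_subset[OF \<kappa>_inj[OF that]]) simp
  have cinv_N: "cinv (D p \<inter> F, \<kappa> p) (\<kappa> p x) = x" if "p \<in> F" "x \<in> D p \<inter> F" for p x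
    using inv_into_f_f[OF \<kappa>_inj'[OF that(1)] that(2)] by simp
  \<comment> \<open>Reading a function on \<open>M\<close> in a chart of \<open>N\<close> amounts to
    pulling it back by \<open>f p\<close> to the neighbourhood of \<open>p0\<close> and restricting
    it to \<open>W\<close>. Both the transition maps of \<open>N\<close> and the inclusion into
    \<open>M\<close> are instances.\<close>
  have coord: "smooth_on W (\<kappa> p ` (R \<inter> F)) (\<lambda>w. k (cinv (D p \<inter> F, \<kappa> p) w))"
    if p: "p \<in> F" and R: "R \<subseteq> D p" and k: "sfun M R k" for p R and k :: "'a \<Rightarrow> 'e"
  proof -
    have RT: "R \<subseteq> T" using R by (auto simp: D_def)
    let ?R = "{y \<in> T. f p y \<in> R}"
    have RQ: "?R \<subseteq> Q"
    proof safe
      fix y assume "y \<in> T" "f p y \<in> R"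
      then show "y \<in> Q" using R gf[OF p, of y] by (auto simp: D_def)
    qed
    have k': "sfun M ?R (\<lambda>y. k (f p y))" by (rule smooth_map_sfun[OF M M f[OF p] k])
    have "smooth_on V (\<psi> ` ?R) (\<lambda>w. k (f p (\<psi>i w)))"
      by (rule smo[OF k' RQ])
    then have "smooth_on W (\<psi> ` ?R) (\<lambda>w. k (f p (\<psi>i w)))" by (rule smooth_on_submodel[OF _ WV])
    moreover have "\<kappa> p ` (R \<inter> F) \<subseteq> \<psi> ` ?R"
      using RT gT[OF p] fg'[OF p] by (auto simp: \<kappa>_def)
    ultimately have "smooth_on W (\<kappa> p ` (R \<inter> F)) (\<lambda>w. k (f p (\<psi>i w)))" by (rule smooth_on_subset)
    then show ?thesis
      by (rule iffD1[OF smooth_on_cong, rotated]) (use R \<kappa>_inv[OF p] cinv_N[OF p] in auto)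
  qed
  have N: "pre_manifold N"
    unfolding pre_manifold_def
  proof (intro conjI ballI)
    show "subspace (model N)" using W by (simp add: N_simps)
    show "topspace (mtop N) = (\<Union>c\<in>atlas N. fst c)"
    proof -
      have "p \<in> D p" if "p \<in> F" for p
        using gf[OF that, of p0] fp0[OF that] Q(2) QT FT that by (auto simp: D_def)
      then show ?thesis unfolding topN by (auto simp: N_simps)
    qed
  next
    fix c assume "c \<in> atlas N"
    then obtain p where p: "p \<in> F" "c = (D p \<inter> F, \<kappa> p)" by (auto simp: N_simps)
    show "openin (mtop N) (fst c)" using D[OF p(1)] p(2) by (auto simp: N_simps openin_subtopology)
    show im: "openin (top_of_set (model N)) (snd c ` fst c)"
      using \<kappa>_open[OF p(1) D[OF p(1)]] p(2) by (simp add: N_simps)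
    have top_c: "subtopology (mtop N) (fst c) = subtopology (mtop M) (D p \<inter> F)"
      using p(2) by (simp add: N_simps subtopology_subtopology inf.absorb2 Int_ac)
    have tsp: "topspace (subtopology (mtop M) (D p \<inter> F)) = D p \<inter> F" by (auto simp: D_def)
    show "homeomorphic_map (subtopology (mtop N) (fst c)) (top_of_set (snd c ` fst c)) (snd c)"
      unfolding top_c
    proof (rule bijective_open_imp_homeomorphic_map)
      show "continuous_map (subtopology (mtop M) (D p \<inter> F)) (top_of_set (snd c ` fst c)) (snd c)"
        unfolding continuous_map_in_subtopology
      proof
        show "continuous_map (subtopology (mtop M) (D p \<inter> F)) euclidean (snd c)"
          unfolding continuous_map_def
        proof (intro conjI allI impI)
          fix U :: "'e set" assume "openin euclidean U"
          then have "openin (mtop M) {x \<in> D p. \<kappa> p x \<in> U}" using sfun_continuous[OF M \<kappa>[OF p(1)]] by simp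
          then have "openin (subtopology (mtop M) (D p \<inter> F)) ({x \<in> D p. \<kappa> p x \<in> U} \<inter> (D p \<inter> F))"
            unfolding openin_subtopology by blast
          moreover have "{x \<in> D p. \<kappa> p x \<in> U} \<inter> (D p \<inter> F) = {x \<in> D p \<inter> F. snd c x \<in> U}" using p(2) by auto
          ultimately show "openin (subtopology (mtop M) (D p \<inter> F)) {x \<in> topspace (subtopology (mtop M) (D p \<inter> F)). snd c x \<in> U}"
            unfolding tsp by simp
        qed simp
        show "snd c \<in> topspace (subtopology (mtop M) (D p \<inter> F)) \<rightarrow> snd c ` fst c"
          unfolding tsp using p(2) by auto
      qed
      show "open_map (subtopology (mtop M) (D p \<inter> F)) (top_of_set (snd c ` fst c)) (snd c)"
        unfolding open_map_def
      proof (intro allI impI)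
        fix X assume "openin (subtopology (mtop M) (D p \<inter> F)) X"
        then obtain X' where X': "openin (mtop M) X'" "X = X' \<inter> (D p \<inter> F)" by (auto simp: openin_subtopology)
        have "openin (top_of_set W) (\<kappa> p ` (X' \<inter> D p \<inter> F))"
          by (rule \<kappa>_open[OF p(1) openin_Int[OF X'(1) D[OF p(1)]]]) auto
        then have "openin (top_of_set W) (snd c ` X)" using X'(2) p(2) by (simp add: Int_assoc)
        moreover have "snd c ` X \<subseteq> snd c ` fst c" using X'(2) p(2) by auto
        moreover have "snd c ` fst c \<subseteq> W" using openin_imp_subset[OF im] by (simp add: N_simps)
        ultimately show "openin (top_of_set (snd c ` fst c)) (snd c ` X)" by (rule openin_subset_trans)
      qed
      show "snd c ` topspace (subtopology (mtop M) (D p \<inter> F)) = topspace (top_of_set (snd c ` fst c))"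
        unfolding tsp using p(2) by simp
      show "inj_on (snd c) (topspace (subtopology (mtop M) (D p \<inter> F)))"
        unfolding tsp using p(2) \<kappa>_inj'[OF p(1)] by simp
    qed
  next
    fix c d assume "c \<in> atlas N" "d \<in> atlas N"
    then obtain p q where p: "p \<in> F" "c = (D p \<inter> F, \<kappa> p)" and q: "q \<in> F" "d = (D q \<inter> F, \<kappa> q)"
      by (auto simp: N_simps)
    have "sfun M (D p \<inter> D q) (\<kappa> q)"
      by (rule sfun_subset[OF \<kappa>[OF q(1)] openin_Int[OF D[OF p(1)] D[OF q(1)]]]) auto
    from coord[OF p(1) _ this]
    have "smooth_on W (\<kappa> p ` (D p \<inter> D q \<inter> F)) (\<lambda>w. \<kappa> q (cinv c w))" using p(2) by simp
    moreover have "loc_dom c d id = \<kappa> p ` (D p \<inter> D q \<inter> F)"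
      unfolding loc_dom_def p(2) q(2) by (intro arg_cong2[of _ _ _ _ "(`)"]) auto
    moreover have "loc_rep c d id = (\<lambda>w. \<kappa> q (cinv c w))" unfolding loc_rep_def q(2) by auto
    ultimately show "smooth_on (model N) (loc_dom c d id) (loc_rep c d id)" by (simp add: N_simps)
  qed
  have SN: "smooth_manifold N"
    using SM by (intro smooth_manifoldI N) (auto simp: N_simps smooth_manifold_def Hausdorff_space_subtopology second_countable_subtopology)
  have "embedded_submanifold N M"
  proof (rule embedded_submanifoldI[OF M SN])
    show "topspace (mtop N) \<subseteq> T" using FT topN by simp
    show "mtop N = subtopology (mtop M) (topspace (mtop N))" unfolding topN by (simp add: N_simps)
    show i: "smooth_map N M (\<lambda>x. x)"
    proof (rule smooth_mapI_chart[OF N M])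
      fix x d assume x: "x \<in> topspace (mtop N)"
      then show "x \<in> T" using topN FT by auto
      assume d: "d \<in> atlas M" "x \<in> fst d"
      have "sfun N (fst d \<inter> F) (snd d)"
        unfolding sfun_def
      proof (intro conjI ballI)
        show "openin (mtop N) (fst d \<inter> F)" using chart_openin[OF M d(1)] by (auto simp: N_simps openin_subtopology)
        fix c assume "c \<in> atlas N"
        then obtain p where p: "p \<in> F" "c = (D p \<inter> F, \<kappa> p)" by (auto simp: N_simps)
        have "sfun M (D p \<inter> fst d) (snd d)"
          by (rule sfun_subset[OF sfun_chart[OF M d(1)] openin_Int[OF D[OF p(1)] chart_openin[OF M d(1)]]]) auto
        from coord[OF p(1) _ this]
        have "smooth_on W (\<kappa> p ` (D p \<inter> fst d \<inter> F)) (\<lambda>w. snd d (cinv c w))" using p(2) by simp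
        moreover have "fst c \<inter> (fst d \<inter> F) = D p \<inter> fst d \<inter> F" using p(2) by auto
        ultimately show "smooth_on (model N) (snd c ` (fst c \<inter> (fst d \<inter> F))) (\<lambda>w. snd d (cinv c w))"
          using p(2) by (simp add: N_simps)
      qed
      then show "\<exists>Q. x \<in> Q \<and> (\<lambda>x. x) ` Q \<subseteq> fst d \<and> sfun N Q (\<lambda>x. snd d x)"
        using x d topN by (intro exI[of _ "fst d \<inter> F"]) auto
    qed
    \<comment> \<open>A chart of \<open>N\<close> is the restriction of \<open>\<kappa> p\<close>,
      which is smooth on an open subset of \<open>M\<close>. A curve with zero velocity in
      \<open>M\<close> hence has zero velocity in \<open>N\<close>.\<close>
    fix c d \<alpha> v assume c: "c \<in> atlas N" and d: "d \<in> atlas M" and \<alpha>: "hasvel c \<alpha> v" "hasvel d \<alpha> 0"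
    obtain p where p: "p \<in> F" "c = (D p \<inter> F, \<kappa> p)" using c by (auto simp: N_simps)
    have x: "\<alpha> 0 \<in> D p" using hasvel_0[OF \<alpha>(1)] p(2) by auto
    from hasvel_sfun[OF M \<kappa>[OF p(1)] d \<alpha>(2) x]
    have "((\<lambda>t. \<kappa> p (\<alpha> t)) has_vector_derivative fderiv M d (\<kappa> p) (\<alpha> 0) 0) (at 0)" .
    moreover have "fderiv M d (\<kappa> p) (\<alpha> 0) 0 = 0"
      using has_derivative_bounded_linear[OF sfun_has_derivative[OF M \<kappa>[OF p(1)] x d hasvel_0[OF \<alpha>(2)]]]
      by (simp add: linear_simps)
    ultimately show "v = 0"
      using \<alpha>(1) p(2) vector_derivative_unique_at by (fastforce simp: hasvel_def)
  qed
  then show ?thesis using topN by blast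
qed

end

section \<open>Lie groups\<close>

lemma lie_groupD:
  assumes "lie_group G"
  shows "group G" "smooth_manifold (mfd G)" "pre_manifold (mfd G)" "topspace (mtop (mfd G)) = carrier G"
    "smooth_map (prod_manifold (mfd G) (mfd G)) (mfd G) (\<lambda>(x, y). x \<otimes>\<^bsub>G\<^esub> y)"
    "smooth_map (mfd G) (mfd G) (m_inv G)"
  using assms smooth_manifold_pre unfolding lie_group_def by blast+

lemma id_chart:
  assumes G: "lie_group G"
  shows "id_chart G \<in> atlas (mfd G)" "\<one>\<^bsub>G\<^esub> \<in> fst (id_chart G)"
proof -
  interpret group G by (rule lie_groupD(1)[OF G])
  have "\<exists>c. c \<in> atlas (mfd G) \<and> \<one>\<^bsub>G\<^esub> \<in> fst c"
    using ex_chart[OF lie_groupD(3)[OF G], of "\<one>\<^bsub>G\<^esub>"] lie_groupD(4)[OF G] by auto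
  from someI_ex[OF this] show "id_chart G \<in> atlas (mfd G)" "\<one>\<^bsub>G\<^esub> \<in> fst (id_chart G)"
    unfolding id_chart_def by auto
qed

lemma hasvel_const: "x \<in> fst c \<Longrightarrow> hasvel c (\<lambda>t. x) 0"
  unfolding hasvel_def by (auto intro: has_vector_derivative_const)

lemma hasvel_Pair:
  assumes "hasvel c \<alpha> v" "hasvel d \<beta> w"
  shows "hasvel (fst c \<times> fst d, map_prod (snd c) (snd d)) (\<lambda>t. (\<alpha> t, \<beta> t)) (v, w)"
  using assms unfolding hasvel_def
  by (auto intro: has_vector_derivative_Pair elim: eventually_elim2)

lemma smooth_map_mult:
  assumes G: "lie_group G" and K: "pre_manifold K" and f: "smooth_map K (mfd G) f" and g: "smooth_map K (mfd G) g"
  shows "smooth_map K (mfd G) (\<lambda>x. f x \<otimes>\<^bsub>G\<^esub> g x)"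
proof -
  note M = lie_groupD(3)[OF G]
  have "smooth_map K (mfd G) (\<lambda>x. (\<lambda>(x, y). x \<otimes>\<^bsub>G\<^esub> y) (f x, g x))"
    by (rule smooth_map_compose[OF K pre_manifold_prod[OF M M] M smooth_map_Pair[OF K M M f g] lie_groupD(5)[OF G]])
  then show ?thesis by simp
qed

lemma smooth_map_inv:
  assumes G: "lie_group G" and K: "pre_manifold K" and f: "smooth_map K (mfd G) f"
  shows "smooth_map K (mfd G) (\<lambda>x. inv\<^bsub>G\<^esub> f x)"
  by (rule smooth_map_compose[OF K lie_groupD(3)[OF G] lie_groupD(3)[OF G] f lie_groupD(6)[OF G]])

lemma smooth_map_const':
  assumes G: "lie_group G" and K: "pre_manifold K" and "g \<in> carrier G"
  shows "smooth_map K (mfd G) (\<lambda>x. g)"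
  by (rule smooth_map_const[OF K lie_groupD(3)[OF G]]) (simp add: lie_groupD(4)[OF G] assms)

lemma smooth_map_left_mult:
  assumes G: "lie_group G" and g: "g \<in> carrier G"
  shows "smooth_map (mfd G) (mfd G) (\<lambda>x. g \<otimes>\<^bsub>G\<^esub> x)"
  by (rule smooth_map_mult[OF G _ smooth_map_const'[OF G _ g] smooth_map_id])
    (rule lie_groupD(3)[OF G])+

lemma smooth_map_conj:
  assumes G: "lie_group G" and g: "g \<in> carrier G"
  shows "smooth_map (mfd G) (mfd G) (conj_by G g)"
proof -
  interpret group G by (rule lie_groupD(1)[OF G])
  note M = lie_groupD(3)[OF G]
  have "smooth_map (mfd G) (mfd G) (\<lambda>x. g \<otimes>\<^bsub>G\<^esub> x \<otimes>\<^bsub>G\<^esub> inv\<^bsub>G\<^esub> g)"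
    by (rule smooth_map_mult[OF G M smooth_map_left_mult[OF G g] smooth_map_const'[OF G M inv_closed[OF g]]])
  then show ?thesis by (simp add: conj_by_def[abs_def])
qed

subsection \<open>Tangent vectors at the identity\<close>

definition tan1 :: "('a, 'e::euclidean_space) lie_group \<Rightarrow> (real \<Rightarrow> 'a) \<Rightarrow> 'e \<Rightarrow> bool" where
  "tan1 G \<alpha> X \<longleftrightarrow> \<alpha> 0 = \<one>\<^bsub>G\<^esub> \<and> hasvel (id_chart G) \<alpha> X"

lemma tan1_exists:
  assumes "lie_group G" "X \<in> lie_algebra G"
  obtains \<alpha> where "tan1 G \<alpha> X"
  using hasvel_exists[OF lie_groupD(3)[OF assms(1)] id_chart[OF assms(1)] assms(2)] unfolding tan1_def by metis

lemma tan1_in: "lie_group G \<Longrightarrow> tan1 G \<alpha> X \<Longrightarrow> X \<in> lie_algebra G"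
  unfolding tan1_def using hasvel_in_model[OF lie_groupD(3) id_chart(1)] by blast

lemma tan1_unique: "tan1 G \<alpha> X \<Longrightarrow> tan1 G \<alpha> Y \<Longrightarrow> X = Y"
  unfolding tan1_def using hasvel_unique by blast

lemma tan1_cong:
  assumes "\<forall>\<^sub>F t in nhds 0. \<alpha> t = \<beta> t" "tan1 G \<alpha> X" shows "tan1 G \<beta> X"
proof -
  have "hasvel (id_chart G) \<beta> X"
    by (rule hasvel_cong[OF assms(1)]) (use assms(2) in \<open>simp add: tan1_def\<close>)
  then show ?thesis using eventually_nhds_x_imp_x[OF assms(1)] assms(2) by (simp add: tan1_def)
qed

lemma tan1_eventually:
  assumes "lie_group G" "tan1 G \<alpha> X" "openin (mtop (mfd G)) Q" "\<one>\<^bsub>G\<^esub> \<in> Q"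
  shows "\<forall>\<^sub>F t in nhds 0. \<alpha> t \<in> Q"
  using hasvel_eventually[OF lie_groupD(3)[OF assms(1)] id_chart(1)[OF assms(1)] _ assms(3)] assms(2,4)
  unfolding tan1_def by auto

lemma tan1_carrier:
  assumes "lie_group G" "tan1 G \<alpha> X" shows "\<forall>\<^sub>F t in nhds 0. \<alpha> t \<in> carrier G"
proof -
  interpret group G by (rule lie_groupD(1)[OF assms(1)])
  have "openin (mtop (mfd G)) (carrier G)" using lie_groupD(4)[OF assms(1)] openin_topspace by metis
  from tan1_eventually[OF assms this] show ?thesis by simp
qed

lemma tan1_const: "lie_group G \<Longrightarrow> tan1 G (\<lambda>t. \<one>\<^bsub>G\<^esub>) 0"
  unfolding tan1_def using hasvel_const id_chart(2) by metis

lemma tan1_map: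
  assumes K: "lie_group K" and G: "lie_group G" and f: "smooth_map (mfd K) (mfd G) f" "f \<one>\<^bsub>K\<^esub> = \<one>\<^bsub>G\<^esub>"
    and \<alpha>: "tan1 K \<alpha> X"
  shows "tan1 G (\<lambda>t. f (\<alpha> t)) (diff_one K G f X)"
proof -
  have a: "\<alpha> 0 = \<one>\<^bsub>K\<^esub>" "hasvel (id_chart K) \<alpha> X" using \<alpha> by (auto simp: tan1_def)
  have "hasvel (id_chart G) (\<lambda>t. f (\<alpha> t)) (loc_deriv (id_chart K) (id_chart G) f (snd (id_chart K) (\<alpha> 0)) X)"
    by (rule hasvel_smooth_map[OF lie_groupD(3)[OF K] lie_groupD(3)[OF G] f(1) id_chart(1)[OF K] id_chart(1)[OF G] a(2)])
      (simp add: a(1) f(2) id_chart(2)[OF G])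
  then show ?thesis unfolding tan1_def diff_one_def by (simp add: a(1) f(2))
qed

lemma diff_one_eq:
  assumes "lie_group K" "lie_group G" "smooth_map (mfd K) (mfd G) f" "f \<one>\<^bsub>K\<^esub> = \<one>\<^bsub>G\<^esub>"
    "tan1 K \<alpha> X" "tan1 G (\<lambda>t. f (\<alpha> t)) Y"
  shows "diff_one K G f X = Y"
  using tan1_unique[OF tan1_map[OF assms(1-5)] assms(6)] .

lemma diff_one_in:
  assumes "lie_group K" "lie_group G" "smooth_map (mfd K) (mfd G) f" "f \<one>\<^bsub>K\<^esub> = \<one>\<^bsub>G\<^esub>" "X \<in> lie_algebra K"
  shows "diff_one K G f X \<in> lie_algebra G"
proof -
  obtain \<alpha> where \<alpha>: "tan1 K \<alpha> X" using tan1_exists[OF assms(1,5)] .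
  show ?thesis by (rule tan1_in[OF assms(2) tan1_map[OF assms(1-4) \<alpha>]])
qed

lemma bounded_linear_diff_one:
  assumes K: "lie_group K" and G: "lie_group G" and f: "smooth_map (mfd K) (mfd G) f" "f \<one>\<^bsub>K\<^esub> = \<one>\<^bsub>G\<^esub>"
  shows "bounded_linear (diff_one K G f)"
  unfolding diff_one_def[abs_def]
  by (rule loc_deriv_linear[OF lie_groupD(3)[OF K] lie_groupD(3)[OF G] f(1) id_chart(1)[OF K] id_chart(1)[OF G] id_chart(2)[OF K]])
    (simp add: f(2) id_chart(2)[OF G])

lemma diff_one_comp:
  assumes H: "lie_group H" and K: "lie_group K" and G: "lie_group G"
    and f: "smooth_map (mfd H) (mfd K) f" "f \<one>\<^bsub>H\<^esub> = \<one>\<^bsub>K\<^esub>" and g: "smooth_map (mfd K) (mfd G) g" "g \<one>\<^bsub>K\<^esub> = \<one>\<^bsub>G\<^esub>"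
    and X: "X \<in> lie_algebra H"
  shows "diff_one H G (\<lambda>x. g (f x)) X = diff_one K G g (diff_one H K f X)"
proof -
  obtain \<alpha> where \<alpha>: "tan1 H \<alpha> X" using tan1_exists[OF H X] .
  show ?thesis
    by (rule diff_one_eq[OF H G smooth_map_compose[OF lie_groupD(3)[OF H] lie_groupD(3)[OF K] lie_groupD(3)[OF G] f(1) g(1)] _ \<alpha>
        tan1_map[OF K G g tan1_map[OF H K f \<alpha>]]]) (simp add: f g)
qed

text \<open>The derivative of multiplication at the identity is linear, and curves that are constant
  in one factor determine it on each summand: it is addition.\<close>

lemma tan1_mult:
  assumes G: "lie_group G" and \<alpha>: "tan1 G \<alpha> X" and \<beta>: "tan1 G \<beta> Y"
  shows "tan1 G (\<lambda>t. \<alpha> t \<otimes>\<^bsub>G\<^esub> \<beta> t) (X + Y)"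
proof -
  interpret group G by (rule lie_groupD(1)[OF G])
  note M = lie_groupD(3)[OF G]
  note MM = pre_manifold_prod[OF M M]
  let ?c = "id_chart G"
  let ?e = "(fst ?c \<times> fst ?c, map_prod (snd ?c) (snd ?c))"
  let ?m = "\<lambda>(x, y). x \<otimes>\<^bsub>G\<^esub> y"
  let ?D = "loc_deriv ?e ?c ?m (snd ?e (\<one>\<^bsub>G\<^esub>, \<one>\<^bsub>G\<^esub>))"
  note c = id_chart[OF G]
  have e: "?e \<in> atlas (prod_manifold (mfd G) (mfd G))" by (rule prod_chart[OF c(1) c(1)])
  have vel: "hasvel ?c (\<lambda>t. a t \<otimes>\<^bsub>G\<^esub> b t) (?D (A, B))" if "tan1 G a A" "tan1 G b B" for a b A B
  proof -
    have 0: "a 0 = \<one>\<^bsub>G\<^esub>" "b 0 = \<one>\<^bsub>G\<^esub>" and "hasvel ?c a A" "hasvel ?c b B" using that by (auto simp: tan1_def)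
    then have "hasvel ?e (\<lambda>t. (a t, b t)) (A, B)" using hasvel_Pair by blast
    from hasvel_smooth_map[OF MM M lie_groupD(5)[OF G] e c(1) this]
    show ?thesis using 0 c(2) by simp
  qed
  interpret D: bounded_linear ?D
    using loc_deriv_linear[OF MM M lie_groupD(5)[OF G] e c(1), of "(\<one>\<^bsub>G\<^esub>, \<one>\<^bsub>G\<^esub>)"] c(2) by simp
  have "tan1 G (\<lambda>t. \<alpha> t \<otimes>\<^bsub>G\<^esub> \<one>\<^bsub>G\<^esub>) X"
    by (rule tan1_cong[OF _ \<alpha>]) (use tan1_carrier[OF G \<alpha>] in \<open>eventually_elim, simp\<close>)
  then have DX: "?D (X, 0) = X" using vel[OF \<alpha> tan1_const[OF G]] by (auto simp: tan1_def intro: hasvel_unique)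
  have "tan1 G (\<lambda>t. \<one>\<^bsub>G\<^esub> \<otimes>\<^bsub>G\<^esub> \<beta> t) Y"
    by (rule tan1_cong[OF _ \<beta>]) (use tan1_carrier[OF G \<beta>] in \<open>eventually_elim, simp\<close>)
  then have DY: "?D (0, Y) = Y" using vel[OF tan1_const[OF G] \<beta>] by (auto simp: tan1_def intro: hasvel_unique)
  have "?D (X, Y) = X + Y" using D.add[of "(X, 0)" "(0, Y)"] DX DY by simp
  with vel[OF \<alpha> \<beta>] show ?thesis using \<alpha> \<beta> by (simp add: tan1_def)
qed

text \<open>Multiplying the curve by its pointwise inverse gives a constant curve, whose velocity is
  zero.\<close>

lemma tan1_inv:
  assumes G: "lie_group G" and \<alpha>: "tan1 G \<alpha> X"
  shows "tan1 G (\<lambda>t. inv\<^bsub>G\<^esub> \<alpha> t) (- X)"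
proof -
  interpret group G by (rule lie_groupD(1)[OF G])
  let ?Y = "diff_one G G (m_inv G) X"
  have Y: "tan1 G (\<lambda>t. inv\<^bsub>G\<^esub> \<alpha> t) ?Y"
    by (rule tan1_map[OF G G lie_groupD(6)[OF G] _ \<alpha>]) simp
  have "tan1 G (\<lambda>t. \<one>\<^bsub>G\<^esub>) (X + ?Y)"
    by (rule tan1_cong[OF _ tan1_mult[OF G \<alpha> Y]]) (use tan1_carrier[OF G \<alpha>] in \<open>eventually_elim, simp\<close>)
  from tan1_unique[OF this tan1_const[OF G]] have "X + ?Y = 0" .
  then have "?Y = - X" by (simp add: eq_neg_iff_add_eq_0 add.commute)
  with Y show ?thesis by simp
qed

subsection \<open>Adjoint representation and bracket\<close>

lemma conj_by_one: "group G \<Longrightarrow> g \<in> carrier G \<Longrightarrow> conj_by G g \<one>\<^bsub>G\<^esub> = \<one>\<^bsub>G\<^esub>"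
  unfolding conj_by_def by (simp add: group.r_inv group.is_monoid monoid.r_one)

lemma tan1_Ad:
  assumes G: "lie_group G" and g: "g \<in> carrier G" and \<alpha>: "tan1 G \<alpha> X"
  shows "tan1 G (\<lambda>t. conj_by G g (\<alpha> t)) (Ad G g X)"
  unfolding Ad_def
  by (rule tan1_map[OF G G smooth_map_conj[OF G g] conj_by_one[OF lie_groupD(1)[OF G] g] \<alpha>])

lemma Ad_in:
  assumes "lie_group G" "g \<in> carrier G" "X \<in> lie_algebra G" shows "Ad G g X \<in> lie_algebra G"
proof -
  obtain \<alpha> where \<alpha>: "tan1 G \<alpha> X" using tan1_exists[OF assms(1,3)] .
  show ?thesis by (rule tan1_in[OF assms(1) tan1_Ad[OF assms(1,2) \<alpha>]])
qed

lemma bounded_linear_Ad: "lie_group G \<Longrightarrow> g \<in> carrier G \<Longrightarrow> bounded_linear (Ad G g)"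
  unfolding Ad_def[abs_def]
  by (rule bounded_linear_diff_one[OF _ _ smooth_map_conj conj_by_one[OF lie_groupD(1)]])

lemma conj_by_mult:
  assumes "group G" "g \<in> carrier G" "h \<in> carrier G" "x \<in> carrier G"
  shows "conj_by G (g \<otimes>\<^bsub>G\<^esub> h) x = conj_by G g (conj_by G h x)"
proof -
  interpret group G by (rule assms(1))
  show ?thesis using assms by (simp add: conj_by_def inv_mult_group m_assoc)
qed

lemma conj_by_hom:
  assumes "group G" "g \<in> carrier G" "x \<in> carrier G" "y \<in> carrier G"
  shows "conj_by G g (x \<otimes>\<^bsub>G\<^esub> y) = conj_by G g x \<otimes>\<^bsub>G\<^esub> conj_by G g y"
proof -
  interpret group G by (rule assms(1))
  have "inv\<^bsub>G\<^esub> g \<otimes>\<^bsub>G\<^esub> (g \<otimes>\<^bsub>G\<^esub> (y \<otimes>\<^bsub>G\<^esub> inv\<^bsub>G\<^esub> g)) = y \<otimes>\<^bsub>G\<^esub> inv\<^bsub>G\<^esub> g"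
    using assms by (simp add: m_assoc[symmetric])
  then show ?thesis using assms by (simp add: conj_by_def m_assoc)
qed

lemma conj_by_closed: "group G \<Longrightarrow> g \<in> carrier G \<Longrightarrow> x \<in> carrier G \<Longrightarrow> conj_by G g x \<in> carrier G"
  unfolding conj_by_def by (simp add: group.is_monoid monoid.m_closed group.inv_closed)

lemma Ad_mult:
  assumes G: "lie_group G" and g: "g \<in> carrier G" and h: "h \<in> carrier G" and X: "X \<in> lie_algebra G"
  shows "Ad G (g \<otimes>\<^bsub>G\<^esub> h) X = Ad G g (Ad G h X)"
proof -
  interpret group G by (rule lie_groupD(1)[OF G])
  obtain \<alpha> where \<alpha>: "tan1 G \<alpha> X" using tan1_exists[OF G X] .
  have "tan1 G (\<lambda>t. conj_by G (g \<otimes>\<^bsub>G\<^esub> h) (\<alpha> t)) (Ad G g (Ad G h X))"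
    by (rule tan1_cong[OF _ tan1_Ad[OF G g tan1_Ad[OF G h \<alpha>]]])
      (use tan1_carrier[OF G \<alpha>] in \<open>eventually_elim, simp add: conj_by_mult[OF is_group g h]\<close>)
  from tan1_unique[OF tan1_Ad[OF G m_closed[OF g h] \<alpha>] this] show ?thesis .
qed

lemma Ad_one:
  assumes G: "lie_group G" and X: "X \<in> lie_algebra G"
  shows "Ad G \<one>\<^bsub>G\<^esub> X = X"
proof -
  interpret group G by (rule lie_groupD(1)[OF G])
  obtain \<alpha> where \<alpha>: "tan1 G \<alpha> X" using tan1_exists[OF G X] .
  have "tan1 G (\<lambda>t. conj_by G \<one>\<^bsub>G\<^esub> (\<alpha> t)) X"
    by (rule tan1_cong[OF _ \<alpha>]) (use tan1_carrier[OF G \<alpha>] in \<open>eventually_elim, simp add: conj_by_def\<close>)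
  from tan1_unique[OF tan1_Ad[OF G one_closed \<alpha>] this] show ?thesis .
qed

lemma Ad_inv_cancel:
  assumes G: "lie_group G" and g: "g \<in> carrier G" and X: "X \<in> lie_algebra G"
  shows "Ad G g (Ad G (inv\<^bsub>G\<^esub> g) X) = X" "Ad G (inv\<^bsub>G\<^esub> g) (Ad G g X) = X"
proof -
  interpret group G by (rule lie_groupD(1)[OF G])
  show "Ad G g (Ad G (inv\<^bsub>G\<^esub> g) X) = X" "Ad G (inv\<^bsub>G\<^esub> g) (Ad G g X) = X"
    using Ad_mult[OF G g inv_closed[OF g] X] Ad_mult[OF G inv_closed[OF g] g X] g Ad_one[OF G X] by simp_all
qed

lemma diff_one_Ad:
  assumes K: "lie_group K" and G: "lie_group G" and f: "smooth_map (mfd K) (mfd G) f" "f \<in> hom K G"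
    and g: "g \<in> carrier K" and X: "X \<in> lie_algebra K"
  shows "diff_one K G f (Ad K g X) = Ad G (f g) (diff_one K G f X)"
proof -
  interpret f: group_hom K G f
    using lie_groupD(1)[OF K] lie_groupD(1)[OF G] f(2) by (simp add: group_hom_def group_hom_axioms_def)
  obtain \<alpha> where \<alpha>: "tan1 K \<alpha> X" using tan1_exists[OF K X] .
  have 1: "tan1 G (\<lambda>t. f (conj_by K g (\<alpha> t))) (diff_one K G f (Ad K g X))"
    by (rule tan1_map[OF K G f(1) f.hom_one tan1_Ad[OF K g \<alpha>]])
  have 2: "tan1 G (\<lambda>t. conj_by G (f g) (f (\<alpha> t))) (Ad G (f g) (diff_one K G f X))"
    by (rule tan1_Ad[OF G f.hom_closed[OF g] tan1_map[OF K G f(1) f.hom_one \<alpha>]])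
  have "\<forall>\<^sub>F t in nhds 0. conj_by G (f g) (f (\<alpha> t)) = f (conj_by K g (\<alpha> t))"
    using tan1_carrier[OF K \<alpha>] by eventually_elim (use g in \<open>simp add: conj_by_def\<close>)
  from tan1_unique[OF 1 tan1_cong[OF this 2]] show ?thesis .
qed

text \<open>The partial derivative of \<open>C\<close> in its second argument at the identity. The
  chart chosen around \<open>g\<close> does not influence the value, because the velocity in the
  first factor is zero.\<close>

definition pderiv1 :: "('a, 'e::euclidean_space) lie_group \<Rightarrow> ('a \<times> 'a \<Rightarrow> 'a) \<Rightarrow> ('a, 'e) chart \<Rightarrow> 'a \<Rightarrow> 'e \<Rightarrow> 'e" where
  "pderiv1 G C d g Y =
     (let c = (SOME c. c \<in> atlas (mfd G) \<and> g \<in> fst c); e = (fst c \<times> fst (id_chart G), map_prod (snd c) (snd (id_chart G))) in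
        loc_deriv e d C (snd e (g, \<one>\<^bsub>G\<^esub>)) (0, Y))"

lemma hasvel_pderiv1:
  assumes G: "lie_group G" and C: "smooth_map (prod_manifold (mfd G) (mfd G)) (mfd G) C" and d: "d \<in> atlas (mfd G)"
    and g: "g \<in> carrier G" and Cd: "C (g, \<one>\<^bsub>G\<^esub>) \<in> fst d" and \<beta>: "tan1 G \<beta> Y"
  shows "hasvel d (\<lambda>t. C (g, \<beta> t)) (pderiv1 G C d g Y)"
proof -
  note M = lie_groupD(3)[OF G]
  define c where "c = (SOME c. c \<in> atlas (mfd G) \<and> g \<in> fst c)"
  have "\<exists>c. c \<in> atlas (mfd G) \<and> g \<in> fst c" using ex_chart[OF M, of g] g lie_groupD(4)[OF G] by auto
  from someI_ex[OF this] have c: "c \<in> atlas (mfd G)" "g \<in> fst c" unfolding c_def by auto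
  let ?e = "(fst c \<times> fst (id_chart G), map_prod (snd c) (snd (id_chart G)))"
  have e: "?e \<in> atlas (prod_manifold (mfd G) (mfd G))" by (rule prod_chart[OF c(1) id_chart(1)[OF G]])
  have \<beta>': "\<beta> 0 = \<one>\<^bsub>G\<^esub>" "hasvel (id_chart G) \<beta> Y" using \<beta> by (auto simp: tan1_def)
  have "hasvel ?e (\<lambda>t. (g, \<beta> t)) (0, Y)" by (rule hasvel_Pair[OF hasvel_const[OF c(2)] \<beta>'(2)])
  from hasvel_smooth_map[OF pre_manifold_prod[OF M M] M C e d this]
  have "hasvel d (\<lambda>t. C (g, \<beta> t)) (loc_deriv ?e d C (snd ?e (g, \<one>\<^bsub>G\<^esub>)) (0, Y))" using \<beta>'(1) Cd by simp
  then show ?thesis unfolding pderiv1_def c_def[symmetric] Let_def .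
qed

text \<open>Near \<open>g\<close> one fixed chart replaces the pointwise choices. In it the
  expression is a directional derivative of a smooth map of two variables, restricted to the slice
  where the second variable is the identity.\<close>

lemma sfun_pderiv1:
  assumes G: "lie_group G" and C: "smooth_map (prod_manifold (mfd G) (mfd G)) (mfd G) C" and d: "d \<in> atlas (mfd G)"
    and Q: "openin (mtop (mfd G)) Q" and Cd: "\<And>g. g \<in> Q \<Longrightarrow> C (g, \<one>\<^bsub>G\<^esub>) \<in> fst d" and Y: "Y \<in> lie_algebra G"
  shows "sfun (mfd G) Q (\<lambda>g. pderiv1 G C d g Y)"
proof (rule sfunI_local[OF lie_groupD(3)[OF G] Q])
  interpret group G by (rule lie_groupD(1)[OF G])
  note M = lie_groupD(3)[OF G]
  note MM = pre_manifold_prod[OF M M]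
  fix g assume g: "g \<in> Q"
  have QG: "Q \<subseteq> carrier G" using Q openin_subset lie_groupD(4)[OF G] by blast
  have "g \<in> topspace (mtop (mfd G))" using g QG lie_groupD(4)[OF G] by auto
  then obtain c where c: "c \<in> atlas (mfd G)" "g \<in> fst c" using ex_chart[OF M] by blast
  let ?c0 = "id_chart G"
  note c0 = id_chart[OF G]
  let ?e = "(fst c \<times> fst ?c0, map_prod (snd c) (snd ?c0))"
  have e: "?e \<in> atlas (prod_manifold (mfd G) (mfd G))" by (rule prod_chart[OF c(1) c0(1)])
  let ?V = "lie_algebra G"
  let ?q = "snd ?c0 \<one>\<^bsub>G\<^esub>"
  let ?I = "{x \<in> topspace (mtop (prod_manifold (mfd G) (mfd G))). C x \<in> fst d}"
  have sC: "sfun (prod_manifold (mfd G) (mfd G)) ?I (\<lambda>x. snd d (C x))" by (rule smooth_map_chart[OF MM M C d])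
  define S where "S = snd ?e ` (fst ?e \<inter> ?I)"
  have S: "openin (top_of_set (?V \<times> ?V)) S"
    using chart_image_open[OF MM e sfun_open[OF sC]] unfolding S_def by simp
  have V: "subspace ?V" by (rule model_subspace[OF M])
  have VV: "subspace (?V \<times> ?V)" using V by (simp add: subspace_Times)
  have \<Phi>: "smooth_on (?V \<times> ?V) S (\<lambda>p. snd d (C (cinv ?e p)))"
    using sfunD[OF sC e] unfolding S_def by simp
  have 0: "0 \<in> ?V" using V by (simp add: subspace_0)
  have sm: "smooth_on (?V \<times> ?V) S (\<lambda>p. frechet_derivative (\<lambda>p. snd d (C (cinv ?e p))) (at p within ?V \<times> ?V) (0, Y))"
    by (rule smooth_on_frechet_derivative[OF VV S \<Phi>]) (use 0 Y in simp)
  have inS: "(snd c h, ?q) \<in> S" if "h \<in> fst c \<inter> Q" for h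
  proof -
    have "(h, \<one>\<^bsub>G\<^esub>) \<in> fst ?e \<inter> ?I" using that c0(2) Cd[of h] QG lie_groupD(4)[OF G] by auto
    then have "snd ?e (h, \<one>\<^bsub>G\<^esub>) \<in> S" unfolding S_def by (rule imageI)
    then show ?thesis by simp
  qed
  have "smooth_on ?V (snd c ` (fst c \<inter> Q))
     (\<lambda>p. frechet_derivative (\<lambda>p. snd d (C (cinv ?e p))) (at (p, ?q) within ?V \<times> ?V) (0, Y))"
  proof (rule smooth_on_compose[OF VV _ sm])
    show "S \<subseteq> ?V \<times> ?V" using S openin_imp_subset by blast
    show "smooth_on ?V (snd c ` (fst c \<inter> Q)) (\<lambda>p. (p, ?q))"
      by (rule smooth_on_Pair[OF smooth_on_linear[OF bounded_linear_ident] smooth_on_const])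
    show "(\<lambda>p. (p, ?q)) ` snd c ` (fst c \<inter> Q) \<subseteq> S" using inS by auto
  qed
  moreover have "frechet_derivative (\<lambda>p. snd d (C (cinv ?e p))) (at (snd c h, ?q) within ?V \<times> ?V) (0, Y) = pderiv1 G C d h Y"
    if h: "h \<in> fst c \<inter> Q" for h
  proof -
    obtain \<beta> where \<beta>: "tan1 G \<beta> Y" using tan1_exists[OF G Y] .
    then have \<beta>': "\<beta> 0 = \<one>\<^bsub>G\<^esub>" "hasvel ?c0 \<beta> Y" by (auto simp: tan1_def)
    have vel: "hasvel ?e (\<lambda>t. (h, \<beta> t)) (0, Y)" by (rule hasvel_Pair[OF hasvel_const \<beta>'(2)]) (use h in simp)
    have "(h, \<beta> 0) \<in> ?I" using h Cd[of h] QG lie_groupD(4)[OF G] \<beta>'(1) by auto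
    from hasvel_sfun[OF MM sC e vel this]
    have "((\<lambda>t. snd d (C (h, \<beta> t))) has_vector_derivative
      frechet_derivative (\<lambda>p. snd d (C (cinv ?e p))) (at (snd c h, ?q) within ?V \<times> ?V) (0, Y)) (at 0)"
      using \<beta>'(1) by simp
    moreover have "((\<lambda>t. snd d (C (h, \<beta> t))) has_vector_derivative pderiv1 G C d h Y) (at 0)"
      using hasvel_pderiv1[OF G C d _ Cd \<beta>, of h] h QG by (auto simp: hasvel_def)
    ultimately show ?thesis by (rule vector_derivative_unique_at)
  qed
  ultimately have "smooth_on ?V (snd c ` (fst c \<inter> Q)) (\<lambda>p. pderiv1 G C d (cinv c p) Y)"
    by (elim iffD1[OF smooth_on_cong, rotated]) (use M c(1) in auto)
  then show "\<exists>c\<in>atlas (mfd G). \<exists>R. openin (mtop (mfd G)) R \<and> g \<in> R \<and> g \<in> fst c \<and>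
      smooth_on ?V (snd c ` (fst c \<inter> R)) (\<lambda>p. pderiv1 G C d (cinv c p) Y)"
    by (intro bexI[OF _ c(1)] exI[of _ Q] conjI Q g c(2))
qed

text \<open>Conjugation, as a map of two variables, sends \<open>(g, \<one>)\<close> to the identity
  for every \<open>g\<close>. One target chart therefore serves the whole group, and
  \<open>Ad\<close> is a partial derivative.\<close>

lemma sfun_Ad:
  assumes G: "lie_group G" and Y: "Y \<in> lie_algebra G"
  shows "sfun (mfd G) (carrier G) (\<lambda>g. Ad G g Y)"
proof -
  interpret group G by (rule lie_groupD(1)[OF G])
  note M = lie_groupD(3)[OF G]
  note MM = pre_manifold_prod[OF M M]
  let ?C = "\<lambda>x. fst x \<otimes>\<^bsub>G\<^esub> snd x \<otimes>\<^bsub>G\<^esub> inv\<^bsub>G\<^esub> fst x"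
  have f: "smooth_map (prod_manifold (mfd G) (mfd G)) (mfd G) fst" and s: "smooth_map (prod_manifold (mfd G) (mfd G)) (mfd G) snd"
    by (rule smooth_map_fst[OF M M], rule smooth_map_snd[OF M M])
  have C: "smooth_map (prod_manifold (mfd G) (mfd G)) (mfd G) ?C"
    by (rule smooth_map_mult[OF G MM smooth_map_mult[OF G MM f s] smooth_map_inv[OF G MM f]])
  have op: "openin (mtop (mfd G)) (carrier G)" using lie_groupD(4)[OF G] openin_topspace by metis
  have C1: "?C (g, \<one>\<^bsub>G\<^esub>) \<in> fst (id_chart G)" if "g \<in> carrier G" for g using that id_chart(2)[OF G] by simp
  have eq: "pderiv1 G ?C (id_chart G) g Y = Ad G g Y" if g: "g \<in> carrier G" for g
  proof -
    obtain \<beta> where \<beta>: "tan1 G \<beta> Y" using tan1_exists[OF G Y] .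
    have "hasvel (id_chart G) (\<lambda>t. ?C (g, \<beta> t)) (pderiv1 G ?C (id_chart G) g Y)"
      by (rule hasvel_pderiv1[OF G C id_chart(1)[OF G] g C1[OF g] \<beta>])
    moreover have "hasvel (id_chart G) (\<lambda>t. ?C (g, \<beta> t)) (Ad G g Y)"
      using tan1_Ad[OF G g \<beta>] by (simp add: tan1_def conj_by_def)
    ultimately show ?thesis by (rule hasvel_unique)
  qed
  show ?thesis by (rule sfun_cong[OF M sfun_pderiv1[OF G C id_chart(1)[OF G] op C1 Y] eq])
qed

section \<open>The bracket as derivative of the adjoint representation\<close>

lemma hvd_in_subspace:
  fixes V :: "'e::euclidean_space set"
  assumes V: "subspace V" and f: "(f has_vector_derivative v) (at a)" and ev: "\<forall>\<^sub>F t in nhds a. f t \<in> V"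
  shows "v \<in> V"
proof -
  have "((\<lambda>t. sub_proj V (f t)) has_vector_derivative sub_proj V v) (at a)"
    by (rule bounded_linear.has_vector_derivative[OF bounded_linear_sub_proj f])
  moreover have "\<forall>\<^sub>F t in nhds a. sub_proj V (f t) = f t" using ev by eventually_elim (rule sub_proj_id[OF V])
  ultimately have "(f has_vector_derivative sub_proj V v) (at a)" by (rule hvd_cong[rotated])
  from vector_derivative_unique_at[OF f this] show ?thesis using sub_proj_in[OF V] by metis
qed

lemma bracket_eq:
  assumes G: "lie_group G"
  shows "bracket G X Y = fderiv (mfd G) (id_chart G) (\<lambda>g. Ad G g Y) \<one>\<^bsub>G\<^esub> X"
proof -
  note M = lie_groupD(3)[OF G]
  note c = id_chart[OF G]
  have "openin (top_of_set (lie_algebra G)) (snd (id_chart G) ` fst (id_chart G))"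
    using chart_image_open[OF M c(1) chart_openin[OF M c(1)]] by simp
  from at_within_rel_open[OF this, of "snd (id_chart G) \<one>\<^bsub>G\<^esub>"] c(2)
  show ?thesis unfolding bracket_def by (simp add: case_prod_beta)
qed

text \<open>The bracket is defined by a derivative in one chart; by the chain rule any curve through
  the identity with velocity \<open>X\<close> computes it. Together with uniqueness of velocities
  this replaces the definition from here on.\<close>

lemma tan1_bracket:
  assumes G: "lie_group G" and \<alpha>: "tan1 G \<alpha> X" and Y: "Y \<in> lie_algebra G"
  shows "((\<lambda>t. Ad G (\<alpha> t) Y) has_vector_derivative bracket G X Y) (at 0)"
proof -
  interpret group G by (rule lie_groupD(1)[OF G])
  have a: "\<alpha> 0 = \<one>\<^bsub>G\<^esub>" "hasvel (id_chart G) \<alpha> X" using \<alpha> by (auto simp: tan1_def)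
  from hasvel_sfun[OF lie_groupD(3)[OF G] sfun_Ad[OF G Y] id_chart(1)[OF G] a(2)] show ?thesis
    by (simp add: bracket_eq[OF G] a(1))
qed

lemma bracket_unique:
  assumes "lie_group G" "tan1 G \<alpha> X" "Y \<in> lie_algebra G" "((\<lambda>t. Ad G (\<alpha> t) Y) has_vector_derivative Z) (at 0)"
  shows "bracket G X Y = Z"
  using vector_derivative_unique_at[OF tan1_bracket[OF assms(1-3)] assms(4)] .

lemma bracket_in:
  assumes G: "lie_group G" and X: "X \<in> lie_algebra G" and Y: "Y \<in> lie_algebra G"
  shows "bracket G X Y \<in> lie_algebra G"
proof -
  obtain \<alpha> where \<alpha>: "tan1 G \<alpha> X" using tan1_exists[OF G X] .
  show ?thesis
    by (rule hvd_in_subspace[OF model_subspace[OF lie_groupD(3)[OF G]] tan1_bracket[OF G \<alpha> Y]])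
      (use tan1_carrier[OF G \<alpha>] in \<open>eventually_elim, simp add: Ad_in[OF G _ Y]\<close>)
qed

lemma bracket_linear_left:
  assumes G: "lie_group G" and Y: "Y \<in> lie_algebra G"
  shows "bounded_linear (\<lambda>X. bracket G X Y)"
proof -
  interpret group G by (rule lie_groupD(1)[OF G])
  show ?thesis unfolding bracket_eq[OF G]
    by (rule has_derivative_bounded_linear[OF sfun_has_derivative[OF lie_groupD(3)[OF G] sfun_Ad[OF G Y] one_closed id_chart[OF G]]])
qed

lemma bracket_add_right:
  assumes G: "lie_group G" and X: "X \<in> lie_algebra G" and Y: "Y \<in> lie_algebra G" and Z: "Z \<in> lie_algebra G"
  shows "bracket G X (Y + Z) = bracket G X Y + bracket G X Z"
proof -
  note V = model_subspace[OF lie_groupD(3)[OF G]]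
  obtain \<alpha> where \<alpha>: "tan1 G \<alpha> X" using tan1_exists[OF G X] .
  have "\<forall>\<^sub>F t in nhds 0. Ad G (\<alpha> t) Y + Ad G (\<alpha> t) Z = Ad G (\<alpha> t) (Y + Z)"
    using tan1_carrier[OF G \<alpha>] by eventually_elim (simp add: linear_add bounded_linear.linear[OF bounded_linear_Ad[OF G]])
  from hvd_cong[OF this has_vector_derivative_add[OF tan1_bracket[OF G \<alpha> Y] tan1_bracket[OF G \<alpha> Z]]]
  show ?thesis by (rule bracket_unique[OF G \<alpha> subspace_add[OF V Y Z]])
qed

lemma bracket_scale_right:
  assumes G: "lie_group G" and X: "X \<in> lie_algebra G" and Y: "Y \<in> lie_algebra G"
  shows "bracket G X (r *\<^sub>R Y) = r *\<^sub>R bracket G X Y"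
proof -
  note V = model_subspace[OF lie_groupD(3)[OF G]]
  obtain \<alpha> where \<alpha>: "tan1 G \<alpha> X" using tan1_exists[OF G X] .
  have "\<forall>\<^sub>F t in nhds 0. r *\<^sub>R Ad G (\<alpha> t) Y = Ad G (\<alpha> t) (r *\<^sub>R Y)"
    using tan1_carrier[OF G \<alpha>] by eventually_elim (simp add: linear_cmul bounded_linear.linear[OF bounded_linear_Ad[OF G]])
  from hvd_cong[OF this bounded_linear.has_vector_derivative[OF bounded_linear_scaleR_right tan1_bracket[OF G \<alpha> Y]]]
  show ?thesis by (rule bracket_unique[OF G \<alpha> subspace_scale[OF V Y]])
qed

text \<open>Differentiate the equivariance \<open>diff_one_Ad\<close> along a curve with velocity
  \<open>X\<close>.\<close>

lemma diff_one_bracket: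
  assumes K: "lie_group K" and G: "lie_group G" and f: "smooth_map (mfd K) (mfd G) f" "f \<in> hom K G"
    and X: "X \<in> lie_algebra K" and Y: "Y \<in> lie_algebra K"
  shows "diff_one K G f (bracket K X Y) = bracket G (diff_one K G f X) (diff_one K G f Y)"
proof -
  interpret f: group_hom K G f
    using lie_groupD(1)[OF K] lie_groupD(1)[OF G] f(2) by (simp add: group_hom_def group_hom_axioms_def)
  obtain \<alpha> where \<alpha>: "tan1 K \<alpha> X" using tan1_exists[OF K X] .
  have "((\<lambda>t. diff_one K G f (Ad K (\<alpha> t) Y)) has_vector_derivative diff_one K G f (bracket K X Y)) (at 0)"
    by (rule bounded_linear.has_vector_derivative[OF bounded_linear_diff_one[OF K G f(1) f.hom_one] tan1_bracket[OF K \<alpha> Y]])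
  moreover have "\<forall>\<^sub>F t in nhds 0. diff_one K G f (Ad K (\<alpha> t) Y) = Ad G (f (\<alpha> t)) (diff_one K G f Y)"
    using tan1_carrier[OF K \<alpha>] by eventually_elim (rule diff_one_Ad[OF K G f _ Y])
  ultimately have "((\<lambda>t. Ad G (f (\<alpha> t)) (diff_one K G f Y)) has_vector_derivative diff_one K G f (bracket K X Y)) (at 0)"
    by (rule hvd_cong[rotated])
  from bracket_unique[OF G tan1_map[OF K G f(1) f.hom_one \<alpha>] diff_one_in[OF K G f(1) f.hom_one Y] this]
  show ?thesis by simp
qed

lemma conj_by_in_hom: "group G \<Longrightarrow> g \<in> carrier G \<Longrightarrow> conj_by G g \<in> hom G G"
  by (auto simp: hom_def conj_by_hom conj_by_closed)

lemma Ad_bracket: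
  assumes "lie_group G" "g \<in> carrier G" "X \<in> lie_algebra G" "Y \<in> lie_algebra G"
  shows "Ad G g (bracket G X Y) = bracket G (Ad G g X) (Ad G g Y)"
  unfolding Ad_def
  by (rule diff_one_bracket[OF assms(1,1) smooth_map_conj[OF assms(1,2)] conj_by_in_hom[OF lie_groupD(1)[OF assms(1)] assms(2)] assms(3,4)])

section \<open>One-parameter subgroups\<close>

subsection \<open>Local solutions of autonomous differential equations\<close>

text \<open>On a compact set the derivative is bounded along each vector of an orthonormal basis,
  hence in operator norm; convexity turns this into a mean value estimate.\<close>

lemma lipschitz_on_compact:
  fixes F :: "'e::euclidean_space \<Rightarrow> 'f::euclidean_space"
  assumes V: "subspace V" and S: "openin (top_of_set V) S" and F: "smooth_on V S F"
    and K: "compact K" "convex K" "K \<subseteq> S"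
  obtains L where "0 \<le> L" "\<And>x y. x \<in> K \<Longrightarrow> y \<in> K \<Longrightarrow> norm (F x - F y) \<le> L * norm (x - y)"
proof -
  have SV: "S \<subseteq> V" using S openin_imp_subset by blast
  let ?D = "\<lambda>p. frechet_derivative F (at p within V)"
  have "\<exists>B\<ge>0. \<forall>p\<in>K. norm (?D p b) \<le> B" if b: "b \<in> onb V" for b
  proof -
    have "b \<in> V" using b onb(1)[OF V] by auto
    then have "continuous_on K (\<lambda>p. ?D p b)"
      by (rule continuous_on_subset[OF smooth_on_continuous[OF smooth_on_frechet_derivative[OF V S F]] K(3)])
    then have "bounded ((\<lambda>p. ?D p b) ` K)" using K(1) compact_continuous_image compact_imp_bounded by blast
    then obtain B where "\<forall>p\<in>K. norm (?D p b) \<le> B" unfolding bounded_iff by auto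
    then show ?thesis by (intro exI[of _ "max B 0"]) (auto simp: le_max_iff_disj)
  qed
  then obtain B where B: "\<And>b. b \<in> onb V \<Longrightarrow> 0 \<le> B b" "\<And>b p. b \<in> onb V \<Longrightarrow> p \<in> K \<Longrightarrow> norm (?D p b) \<le> B b"
    by metis
  let ?L = "\<Sum>b\<in>onb V. B b"
  have der: "(F has_derivative (\<lambda>v. ?D p (sub_proj V v))) (at p within K)" if p: "p \<in> K" for p
  proof -
    have pV: "p \<in> V" using p K(3) SV by auto
    have 1: "(sub_proj V has_derivative sub_proj V) (at p within V)"
      by (rule bounded_linear_imp_has_derivative[OF bounded_linear_sub_proj])
    have D: "(F has_derivative ?D p) (at p within V)"
      by (rule smooth_on_differentiable[OF V S F]) (use p K(3) in auto)
    have 2: "(F has_derivative ?D p) (at (sub_proj V p) within sub_proj V ` V)"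
      unfolding sub_proj_id[OF V pV] by (rule has_derivative_subset[OF D]) (use sub_proj_in[OF V] in auto)
    have "((\<lambda>x. F (sub_proj V x)) has_derivative (\<lambda>v. ?D p (sub_proj V v))) (at p within V)"
      using diff_chain_within[OF 1 2] by (simp add: o_def)
    then have "(F has_derivative (\<lambda>v. ?D p (sub_proj V v))) (at p within V)"
      by (rule has_derivative_transform[OF pV, rotated]) (simp add: sub_proj_id[OF V])
    then show ?thesis by (rule has_derivative_subset) (use K(3) SV in auto)
  qed
  have bd: "onorm (\<lambda>v. ?D p (sub_proj V v)) \<le> ?L" if p: "p \<in> K" for p
  proof (rule onorm_le)
    fix v
    interpret D: bounded_linear "?D p"
      by (rule has_derivative_bounded_linear[OF smooth_on_differentiable[OF V S F]]) (use p K(3) in auto)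
    have "norm (?D p (sub_proj V v)) = norm (\<Sum>b\<in>onb V. (v \<bullet> b) *\<^sub>R ?D p b)"
      by (simp add: sub_proj_def D.sum D.scaleR)
    also have "\<dots> \<le> (\<Sum>b\<in>onb V. norm ((v \<bullet> b) *\<^sub>R ?D p b))" by (rule norm_sum)
    also have "\<dots> \<le> (\<Sum>b\<in>onb V. norm v * B b)"
    proof (rule sum_mono)
      fix b assume b: "b \<in> onb V"
      have "\<bar>v \<bullet> b\<bar> \<le> norm v" using Cauchy_Schwarz_ineq2[of v b] onb(3)[OF V b] by simp
      then show "norm ((v \<bullet> b) *\<^sub>R ?D p b) \<le> norm v * B b"
        using B(2)[OF b p] by (simp add: mult_mono)
    qed
    finally show "norm (?D p (sub_proj V v)) \<le> ?L * norm v" by (simp add: sum_distrib_left mult.commute)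
  qed
  show thesis
  proof (rule that[of ?L])
    show "0 \<le> ?L" using B(1) by (simp add: sum_nonneg)
    show "norm (F x - F y) \<le> ?L * norm (x - y)" if "x \<in> K" "y \<in> K" for x y
      by (rule differentiable_bound[OF K(2) der bd that])
  qed
qed

text \<open>Differentiating the integral gives a bound that does not care which of \<open>u\<close>
  and \<open>w\<close> is larger, as needed for times on both sides of \<open>0\<close>.\<close>

lemma integral_increment_bound:
  fixes g :: "real \<Rightarrow> 'e::euclidean_space"
  assumes g: "continuous_on UNIV g" and M: "\<And>t. norm (g t) \<le> M" and u: "u \<in> {a..b}" "w \<in> {a..b}"
  shows "norm (integral {a..u} g - integral {a..w} g) \<le> M * norm (u - w)"
proof (rule differentiable_bound[OF convex_real_interval(5)[of a b]])
  show "((\<lambda>u. integral {a..u} g) has_derivative (\<lambda>h. h *\<^sub>R g x)) (at x within {a..b})" if "x \<in> {a..b}" for x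
    using integral_has_vector_derivative[OF continuous_on_subset[OF g] that] by (simp add: has_vector_derivative_def)
  show "onorm (\<lambda>h. h *\<^sub>R g x) \<le> M" for x
    by (rule onorm_le) (simp add: mult.commute[of M] mult_left_mono M)
qed (use u in auto)

text \<open>Picard iteration on bounded continuous curves with values in a closed ball of the model.
  Since the ball is taken inside \<open>V\<close>, the solution never leaves the model, and its
  smoothness follows from the equation.\<close>

lemma ode_local:
  fixes F :: "'e::euclidean_space \<Rightarrow> 'e"
  assumes V: "subspace V" and S: "openin (top_of_set V) S" and F: "smooth_on V S F" and FV: "F ` S \<subseteq> V" and x0: "x0 \<in> S"
  obtains \<epsilon> x where "0 < \<epsilon>" "x 0 = x0" "smooth_on UNIV {-\<epsilon><..<\<epsilon>} x"
    "\<And>t. \<bar>t\<bar> < \<epsilon> \<Longrightarrow> x t \<in> S" "\<And>t. \<bar>t\<bar> < \<epsilon> \<Longrightarrow> (x has_vector_derivative F (x t)) (at t)"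
proof -
  have SV: "S \<subseteq> V" using S openin_imp_subset by blast
  obtain O' where O': "open O'" "S = V \<inter> O'" using S by (auto simp: openin_open)
  obtain r where r: "0 < r" "cball x0 r \<subseteq> O'" using O' x0 open_contains_cball by blast
  define K where "K = cball x0 r \<inter> V"
  have "compact K" unfolding K_def by (rule compact_Int_closed[OF compact_cball closed_subspace[OF V]])
  moreover have "convex K" unfolding K_def by (rule convex_Int[OF convex_cball subspace_imp_convex[OF V]])
  moreover have "K \<subseteq> S" unfolding K_def using r O' by auto
  ultimately have K: "compact K" "convex K" "K \<subseteq> S" by simp_all
  have x0K: "x0 \<in> K" using x0 SV r by (auto simp: K_def)
  obtain L where L: "0 \<le> L" "\<And>x y. x \<in> K \<Longrightarrow> y \<in> K \<Longrightarrow> norm (F x - F y) \<le> L * norm (x - y)"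
    using lipschitz_on_compact[OF V S F K] by blast
  have Fc: "continuous_on K F" by (rule continuous_on_subset[OF smooth_on_continuous[OF F] K(3)])
  then have "bounded (F ` K)" using K(1) compact_continuous_image compact_imp_bounded by blast
  then obtain M0 where M0: "\<And>p. p \<in> K \<Longrightarrow> norm (F p) \<le> M0" unfolding bounded_iff by auto
  define M where "M = max M0 0 + 1"
  have M: "0 < M" "\<And>p. p \<in> K \<Longrightarrow> norm (F p) \<le> M" using M0 by (fastforce simp: M_def)+
  \<comment> \<open>The first bound keeps the iterates in the ball of radius \<open>r\<close>; the
    second makes the iteration a contraction with factor \<open>1/2\<close>.\<close>
  define \<epsilon> where "\<epsilon> = min (r / M) (1 / (2 * (L + 1)))"
  have \<epsilon>: "0 < \<epsilon>" "M * \<epsilon> \<le> r" "L * \<epsilon> \<le> 1 / 2"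
  proof -
    show "0 < \<epsilon>" using r M L by (simp add: \<epsilon>_def)
    have "\<epsilon> \<le> r / M" by (simp add: \<epsilon>_def)
    then show "M * \<epsilon> \<le> r" using M(1) by (simp add: pos_le_divide_eq mult.commute)
    have "\<epsilon> \<le> 1 / (2 * (L + 1))" by (simp add: \<epsilon>_def)
    then have "L * \<epsilon> \<le> L * (1 / (2 * (L + 1)))" using L(1) by (rule mult_left_mono)
    also have "\<dots> \<le> 1 / 2" using L(1) by (simp add: field_simps)
    finally show "L * \<epsilon> \<le> 1 / 2" .
  qed
  \<comment> \<open>Clamping time lets all curves be defined on the whole line, where the bounded
    continuous functions form a complete space.\<close>
  define c where "c t = max (-\<epsilon>) (min \<epsilon> t)" for t :: real
  have c: "c t \<in> {-\<epsilon>..\<epsilon>}" "norm (c t - 0) \<le> \<epsilon>" for t using \<epsilon>(1) by (auto simp: c_def)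
  have c_id: "c t = t" if "\<bar>t\<bar> < \<epsilon>" for t using that by (auto simp: c_def)
  have c_cont: "continuous_on UNIV c" unfolding c_def by (intro continuous_intros)
  have z: "(0::real) \<in> {-\<epsilon>..\<epsilon>}" using \<epsilon>(1) by auto
  define X where "X = (PiC UNIV (\<lambda>_. K) :: (real \<Rightarrow>\<^sub>C 'e) set)"
  have XK: "x \<in> X \<longleftrightarrow> (\<forall>t. apply_bcontfun x t \<in> K)" for x by (auto simp: X_def mem_PiC_iff)
  have XF: "continuous_on UNIV (\<lambda>t. F (apply_bcontfun x t))" if "x \<in> X" for x
    by (rule continuous_on_compose2[OF Fc]) (use that XK in \<open>auto intro: continuous_on_apply_bcontfun\<close>)
  have integ: "(\<lambda>t. F (apply_bcontfun x t)) integrable_on {a..b}" if "x \<in> X" for x a b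
    by (rule integrable_continuous_real[OF continuous_on_subset[OF XF[OF that]]]) simp
  \<comment> \<open>The integral from \<open>0\<close> to \<open>c t\<close> is written as a
    difference of two integrals from \<open>- \<epsilon>\<close>, so that negative times need no
    separate treatment.\<close>
  define \<Psi> where "\<Psi> x t = x0 + (integral {-\<epsilon>..c t} (\<lambda>s. F (apply_bcontfun x s)) - integral {-\<epsilon>..0} (\<lambda>s. F (apply_bcontfun x s)))"
    for x :: "real \<Rightarrow>\<^sub>C 'e" and t
  have \<Psi>K: "\<Psi> x t \<in> K" if x: "x \<in> X" for x t
  proof -
    have "norm (integral {-\<epsilon>..c t} (\<lambda>s. F (apply_bcontfun x s)) - integral {-\<epsilon>..0} (\<lambda>s. F (apply_bcontfun x s)))
        \<le> M * norm (c t - 0)"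
      by (rule integral_increment_bound[OF XF[OF x] _ c(1) z]) (use M(2) x XK in auto)
    also have "\<dots> \<le> M * \<epsilon>" using c(2)[of t] M(1) by (intro mult_left_mono) auto
    also have "\<dots> \<le> r" by (rule \<epsilon>(2))
    finally have "dist (\<Psi> x t) x0 \<le> r" by (simp add: \<Psi>_def dist_norm)
    then have "\<Psi> x t \<in> cball x0 r" by (simp add: dist_commute)
    moreover have "integral {a..b} (\<lambda>s. F (apply_bcontfun x s)) \<in> V" for a b
    proof -
      have "integral {a..b} (sub_proj V \<circ> (\<lambda>s. F (apply_bcontfun x s))) = sub_proj V (integral {a..b} (\<lambda>s. F (apply_bcontfun x s)))"
        by (rule integral_linear[OF integ[OF x] bounded_linear_sub_proj])
      moreover have "sub_proj V \<circ> (\<lambda>s. F (apply_bcontfun x s)) = (\<lambda>s. F (apply_bcontfun x s))"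
      proof
        fix s
        have "apply_bcontfun x s \<in> S" using x XK K(3) by blast
        then have "F (apply_bcontfun x s) \<in> V" using FV by blast
        then show "(sub_proj V \<circ> (\<lambda>s. F (apply_bcontfun x s))) s = F (apply_bcontfun x s)"
          by (simp add: sub_proj_id[OF V])
      qed
      ultimately show ?thesis using sub_proj_in[OF V] by metis
    qed
    then have "\<Psi> x t \<in> V" unfolding \<Psi>_def using V x0 SV by (auto intro!: subspace_add subspace_diff)
    ultimately show ?thesis by (simp add: K_def)
  qed
  have \<Psi>c: "\<Psi> x \<in> bcontfun" if x: "x \<in> X" for x
  proof (rule bcontfun_normI)
    have "continuous_on UNIV (\<lambda>t. integral {-\<epsilon>..c t} (\<lambda>s. F (apply_bcontfun x s)))"
      by (rule continuous_on_compose2[OF indefinite_integral_continuous_1[OF integ[OF x, of "-\<epsilon>" \<epsilon>]] c_cont]) (use c(1) in auto)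
    then show "continuous_on UNIV (\<Psi> x)" unfolding \<Psi>_def[abs_def] by (intro continuous_intros)
    show "norm (\<Psi> x t) \<le> norm x0 + r" for t
    proof -
      have "dist x0 (\<Psi> x t) \<le> r" using \<Psi>K[OF x, of t] by (simp add: K_def)
      then show ?thesis using norm_triangle_ineq2[of "\<Psi> x t" x0] by (simp add: dist_norm norm_minus_commute)
    qed
  qed
  define \<Phi> where "\<Phi> x = Bcontfun (\<Psi> x)" for x
  have \<Phi>: "apply_bcontfun (\<Phi> x) = \<Psi> x" if "x \<in> X" for x
    unfolding \<Phi>_def by (rule Bcontfun_inverse[OF \<Psi>c[OF that]])
  have "\<exists>!x. x \<in> X \<and> \<Phi> x = x"
  proof (rule Banach_fix[where c = "1/2"])
    show "complete X" unfolding X_def complete_eq_closed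
      by (rule closed_PiC) (use K(1) compact_imp_closed in auto)
    have "const_bcontfun x0 \<in> X" using x0K by (simp add: XK)
    then show "X \<noteq> {}" by auto
    show "0 \<le> (1/2::real)" "(1/2::real) < 1" by auto
    show "\<Phi> ` X \<subseteq> X" using \<Phi> \<Psi>K by (auto simp: XK)
    show "dist (\<Phi> x) (\<Phi> y) \<le> 1/2 * dist x y" if x: "x \<in> X" and y: "y \<in> X" for x y
    proof (rule dist_bound)
      fix t
      let ?g = "\<lambda>s. F (apply_bcontfun x s) - F (apply_bcontfun y s)"
      have e: "\<Psi> x t - \<Psi> y t = integral {-\<epsilon>..c t} ?g - integral {-\<epsilon>..0} ?g"
        using integral_diff[OF integ[OF x] integ[OF y]] by (simp add: \<Psi>_def)
      have "norm (\<Psi> x t - \<Psi> y t) \<le> (L * dist x y) * norm (c t - 0)"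
        unfolding e
      proof (rule integral_increment_bound[OF _ _ c(1) z])
        show "continuous_on UNIV ?g" by (intro continuous_on_diff XF x y)
        fix s
        have "norm (?g s) \<le> L * norm (apply_bcontfun x s - apply_bcontfun y s)"
          by (rule L(2)) (use x y XK in auto)
        also have "\<dots> \<le> L * dist x y" using dist_bounded[of x s y] L(1) by (intro mult_left_mono) (auto simp: dist_norm)
        finally show "norm (?g s) \<le> L * dist x y" .
      qed
      moreover have "(L * dist x y) * norm (c t - 0) \<le> (L * dist x y) * \<epsilon>"
        using c(2)[of t] L(1) by (intro mult_left_mono) auto
      moreover have "(L * dist x y) * \<epsilon> = (L * \<epsilon>) * dist x y" by simp
      moreover have "(L * \<epsilon>) * dist x y \<le> 1/2 * dist x y" by (rule mult_right_mono[OF \<epsilon>(3)]) simp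
      ultimately have "norm (\<Psi> x t - \<Psi> y t) \<le> 1/2 * dist x y" by linarith
      then show "dist (apply_bcontfun (\<Phi> x) t) (apply_bcontfun (\<Phi> y) t) \<le> 1/2 * dist x y"
        by (simp add: \<Phi>[OF x] \<Phi>[OF y] dist_norm)
    qed
  qed
  then obtain xb where xb: "xb \<in> X" "\<Phi> xb = xb" by blast
  define x where "x = apply_bcontfun xb"
  have fix_eq: "x t = x0 + (integral {-\<epsilon>..c t} (\<lambda>s. F (x s)) - integral {-\<epsilon>..0} (\<lambda>s. F (x s)))" for t
    using fun_cong[OF \<Phi>[OF xb(1)], of t] unfolding xb(2) x_def \<Psi>_def .
  have xK: "x t \<in> K" for t using xb(1) by (simp add: x_def XK)
  have cF: "continuous_on UNIV (\<lambda>s. F (x s))" using XF[OF xb(1)] by (simp add: x_def)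
  have der: "(x has_vector_derivative F (x t)) (at t)" if t: "\<bar>t\<bar> < \<epsilon>" for t
  proof -
    have "((\<lambda>u. integral {-\<epsilon>..u} (\<lambda>s. F (x s))) has_vector_derivative F (x t)) (at t within {-\<epsilon>..\<epsilon>})"
      by (rule integral_has_vector_derivative[OF continuous_on_subset[OF cF]]) (use t in auto)
    then have "((\<lambda>u. integral {-\<epsilon>..u} (\<lambda>s. F (x s))) has_vector_derivative F (x t)) (at t)"
      using at_within_interior[of t "{-\<epsilon>..\<epsilon>}"] t by (simp add: abs_less_iff)
    then have d: "((\<lambda>u. x0 + (integral {-\<epsilon>..u} (\<lambda>s. F (x s)) - integral {-\<epsilon>..0} (\<lambda>s. F (x s)))) has_vector_derivative F (x t)) (at t)"
      by (auto intro!: derivative_eq_intros)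
    show ?thesis
    proof (rule has_vector_derivative_transform_within_open[OF d, of "{-\<epsilon><..<\<epsilon>}"])
      show "x0 + (integral {-\<epsilon>..u} (\<lambda>s. F (x s)) - integral {-\<epsilon>..0} (\<lambda>s. F (x s))) = x u"
        if "u \<in> {-\<epsilon><..<\<epsilon>}" for u
        using fix_eq[of u] c_id[of u] that by (simp add: abs_less_iff)
    qed (use t in auto)
  qed
  \<comment> \<open>Bootstrap through the differential equation: a solution of class C^k has a
    derivative \<open>F (x t)\<close> of class C^k.\<close>
  have "Ck_on k UNIV {-\<epsilon><..<\<epsilon>} x" for k
  proof (induction k)
    case 0
    show ?case by (auto simp: x_def intro: continuous_on_subset[OF continuous_on_apply_bcontfun])
  next
    case (Suc k)
    have F': "Ck_on k UNIV {-\<epsilon><..<\<epsilon>} (\<lambda>t. F (x t))"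
      by (rule Ck_on_compose[OF V SV smooth_onD[OF F] Suc]) (use xK K(3) in auto)
    show ?case
    proof (rule Ck_on_SucI[of _ _ "\<lambda>t h. h *\<^sub>R F (x t)"])
      show "(x has_derivative (\<lambda>h. h *\<^sub>R F (x t))) (at t within {-\<epsilon><..<\<epsilon>})" if "t \<in> {-\<epsilon><..<\<epsilon>}" for t
        using der[of t] that by (auto simp: has_vector_derivative_def intro: has_derivative_at_withinI)
      show "Ck_on k UNIV {-\<epsilon><..<\<epsilon>} (\<lambda>t. v *\<^sub>R F (x t))" for v
        by (rule Ck_on_linear_comp[OF bounded_linear_scaleR_right F'])
    qed
  qed
  then have sm: "smooth_on UNIV {-\<epsilon><..<\<epsilon>} x" by (rule smooth_onI)
  have "x 0 = x0" using fix_eq[of 0] c_id[of 0] \<epsilon>(1) by simp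
  with that[OF \<epsilon>(1) this sm] der xK K(3) show thesis by blast
qed

subsection \<open>Left-invariant curves\<close>

text \<open>The left logarithmic derivative of \<open>\<alpha>\<close> at \<open>t\<close> equals
  \<open>X\<close>. Translating back to the identity before differentiating avoids tangent spaces at
  other points.\<close>

definition left_inv_at :: "('a, 'e::euclidean_space) lie_group \<Rightarrow> 'e \<Rightarrow> (real \<Rightarrow> 'a) \<Rightarrow> real \<Rightarrow> bool" where
  "left_inv_at G X \<alpha> t \<longleftrightarrow> tan1 G (\<lambda>h. inv\<^bsub>G\<^esub> (\<alpha> t) \<otimes>\<^bsub>G\<^esub> \<alpha> (t + h)) X"

lemma hvd_shift:
  assumes "((\<lambda>h. f (s + h)) has_vector_derivative v) (at 0)" shows "(f has_vector_derivative v) (at s)"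
proof -
  have "((\<lambda>u. u - s) has_vector_derivative 1) (at s)"
    by (auto intro!: derivative_eq_intros)
  from vector_diff_chain_at[OF this, of "\<lambda>h. f (s + h)" v] assms show ?thesis by (simp add: o_def)
qed

text \<open>The quotient at time \<open>t + h\<close> is a fixed two-sided translate of
  \<open>?a h\<close> times the inverse of \<open>?b h\<close>. Both curves start at the identity
  with velocity \<open>X\<close>, so the product has velocity \<open>X - X\<close>.\<close>

lemma left_inv_quotient:
  assumes G: "lie_group G" and \<alpha>: "\<And>t. \<alpha> t \<in> carrier G" and \<beta>: "\<And>t. \<beta> t \<in> carrier G"
    and LI: "left_inv_at G X \<alpha> t" "left_inv_at G X \<beta> t"
    and d: "d \<in> atlas (mfd G)" "\<alpha> t \<otimes>\<^bsub>G\<^esub> inv\<^bsub>G\<^esub> (\<beta> t) \<in> fst d"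
  shows "hasvel d (\<lambda>h. \<alpha> (t + h) \<otimes>\<^bsub>G\<^esub> inv\<^bsub>G\<^esub> (\<beta> (t + h))) 0"
proof -
  interpret group G by (rule lie_groupD(1)[OF G])
  note M = lie_groupD(3)[OF G]
  let ?a = "\<lambda>h. inv\<^bsub>G\<^esub> (\<alpha> t) \<otimes>\<^bsub>G\<^esub> \<alpha> (t + h)" and ?b = "\<lambda>h. inv\<^bsub>G\<^esub> (\<beta> t) \<otimes>\<^bsub>G\<^esub> \<beta> (t + h)"
  let ?f = "\<lambda>x. \<alpha> t \<otimes>\<^bsub>G\<^esub> x \<otimes>\<^bsub>G\<^esub> inv\<^bsub>G\<^esub> (\<beta> t)"
  have c: "tan1 G (\<lambda>h. ?a h \<otimes>\<^bsub>G\<^esub> inv\<^bsub>G\<^esub> (?b h)) (X + - X)"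
    using tan1_mult[OF G _ tan1_inv[OF G]] LI unfolding left_inv_at_def by blast
  have f: "smooth_map (mfd G) (mfd G) ?f"
    by (rule smooth_map_mult[OF G M smooth_map_left_mult[OF G \<alpha>] smooth_map_const'[OF G M inv_closed[OF \<beta>]]])
  have vel: "hasvel (id_chart G) (\<lambda>h. ?a h \<otimes>\<^bsub>G\<^esub> inv\<^bsub>G\<^esub> (?b h)) 0" using c by (simp add: tan1_def)
  have f0: "?f (?a 0 \<otimes>\<^bsub>G\<^esub> inv\<^bsub>G\<^esub> (?b 0)) \<in> fst d" using \<alpha> \<beta> d(2) by simp
  from hasvel_smooth_map[OF M M f id_chart(1)[OF G] d(1) vel f0]
  have "hasvel d (\<lambda>h. ?f (?a h \<otimes>\<^bsub>G\<^esub> inv\<^bsub>G\<^esub> (?b h)))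
     (loc_deriv (id_chart G) d ?f (snd (id_chart G) (?a 0 \<otimes>\<^bsub>G\<^esub> inv\<^bsub>G\<^esub> (?b 0))) 0)" .
  moreover have "loc_deriv (id_chart G) d ?f (snd (id_chart G) (?a 0 \<otimes>\<^bsub>G\<^esub> inv\<^bsub>G\<^esub> (?b 0))) 0 = 0"
    by (rule linear_0[OF bounded_linear.linear[OF loc_deriv_linear[OF M M f id_chart(1)[OF G] d(1) hasvel_0[OF vel] f0]]])
  moreover have "?f (?a h \<otimes>\<^bsub>G\<^esub> inv\<^bsub>G\<^esub> (?b h)) = \<alpha> (t + h) \<otimes>\<^bsub>G\<^esub> inv\<^bsub>G\<^esub> (\<beta> (t + h))" for h
  proof -
    have "\<alpha> t \<otimes>\<^bsub>G\<^esub> (inv\<^bsub>G\<^esub> (\<alpha> t) \<otimes>\<^bsub>G\<^esub> \<alpha> (t + h)) = \<alpha> (t + h)"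
      using \<alpha> by (simp add: m_assoc[symmetric])
    then show ?thesis using \<alpha> \<beta> by (simp add: inv_mult_group m_assoc[symmetric])
      (simp add: m_assoc)
  qed
  ultimately show ?thesis by simp
qed

text \<open>The quotient of the two curves has zero velocity at every time, so it is locally
  constant in charts and hence constant on the connected set \<open>I\<close>.\<close>

lemma left_inv_unique:
  assumes G: "lie_group G" and \<alpha>: "\<And>t. \<alpha> t \<in> carrier G" and \<beta>: "\<And>t. \<beta> t \<in> carrier G"
    and I: "connected I" "open I" and LI: "\<And>t. t \<in> I \<Longrightarrow> left_inv_at G X \<alpha> t" "\<And>t. t \<in> I \<Longrightarrow> left_inv_at G X \<beta> t"
    and t0: "t0 \<in> I" "\<alpha> t0 = \<beta> t0" and t: "t \<in> I"
  shows "\<alpha> t = \<beta> t"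
proof -
  interpret group G by (rule lie_groupD(1)[OF G])
  note M = lie_groupD(3)[OF G]
  define \<eta> where "\<eta> = (\<lambda>t. \<alpha> t \<otimes>\<^bsub>G\<^esub> inv\<^bsub>G\<^esub> (\<beta> t))"
  have "\<eta> t0 = \<eta> t"
  proof (rule connected_local_const[OF I(1) t0(1) t], rule ballI)
    fix s assume s: "s \<in> I"
    have "\<eta> s \<in> topspace (mtop (mfd G))" using \<alpha> \<beta> lie_groupD(4)[OF G] by (simp add: \<eta>_def)
    then obtain d where d: "d \<in> atlas (mfd G)" "\<eta> s \<in> fst d" using ex_chart[OF M] by blast
    have vel: "hasvel d (\<lambda>h. \<eta> (u + h)) 0" if "u \<in> I" "\<eta> u \<in> fst d" for u
      using left_inv_quotient[OF G \<alpha> \<beta> LI(1)[OF that(1)] LI(2)[OF that(1)] d(1)] that(2) by (simp add: \<eta>_def)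
    have "\<forall>\<^sub>F h in nhds 0. \<eta> (s + h) \<in> fst d" using vel[OF s d(2)] by (simp add: hasvel_def)
    then obtain e1 where e1: "0 < e1" "\<And>h. \<bar>h\<bar> < e1 \<Longrightarrow> \<eta> (s + h) \<in> fst d"
      unfolding eventually_nhds_metric by (auto simp: dist_real_def)
    obtain e2 where e2: "0 < e2" "ball s e2 \<subseteq> I" using I(2) s open_contains_ball by blast
    define J where "J = ball s (min e1 e2)"
    have J: "convex J" "s \<in> J" "open J" using e1(1) e2(1) by (auto simp: J_def)
    have JI: "u \<in> I" "\<eta> u \<in> fst d" if "u \<in> J" for u
      using that e2(2) e1(2)[of "u - s"] by (auto simp: J_def dist_real_def)
    have "((\<lambda>u. snd d (\<eta> u)) has_vector_derivative 0) (at u within J)" if u: "u \<in> J" for u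
      using vel[OF JI[OF u]] hvd_shift[of "\<lambda>u. snd d (\<eta> u)" u 0]
      by (auto simp: hasvel_def intro: has_vector_derivative_at_within)
    from has_vector_derivative_zero_constant[OF J(1) this]
    obtain k where k: "\<And>u. u \<in> J \<Longrightarrow> snd d (\<eta> u) = k" by blast
    have eq: "\<eta> s = \<eta> u" if "u \<in> J" for u
      using inj_onD[OF chart_inj[OF M d(1)], of "\<eta> s" "\<eta> u"] k[OF J(2)] k[OF that] JI[OF that] d(2) by simp
    show "\<forall>\<^sub>F u in at s within I. \<eta> s = \<eta> u"
      unfolding eventually_at_topological by (intro exI[of _ J] conjI J ballI impI) (rule eq)
  qed
  moreover have "\<eta> t0 = \<one>\<^bsub>G\<^esub>" using t0(2) \<beta> by (simp add: \<eta>_def)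
  ultimately have "\<alpha> t \<otimes>\<^bsub>G\<^esub> inv\<^bsub>G\<^esub> (\<beta> t) = \<one>\<^bsub>G\<^esub>" by (simp add: \<eta>_def)
  then show ?thesis using \<alpha> \<beta> inv_equality[of "\<alpha> t" "inv\<^bsub>G\<^esub> (\<beta> t)"] by simp
qed

lemma left_inv_translate:
  assumes G: "lie_group G" and \<alpha>: "\<And>t. \<alpha> t \<in> carrier G" and g: "g \<in> carrier G" and LI: "left_inv_at G X \<alpha> t"
  shows "left_inv_at G X (\<lambda>t. g \<otimes>\<^bsub>G\<^esub> \<alpha> t) t"
proof -
  interpret group G by (rule lie_groupD(1)[OF G])
  have "inv\<^bsub>G\<^esub> (g \<otimes>\<^bsub>G\<^esub> \<alpha> t) \<otimes>\<^bsub>G\<^esub> (g \<otimes>\<^bsub>G\<^esub> \<alpha> (t + h)) = inv\<^bsub>G\<^esub> (\<alpha> t) \<otimes>\<^bsub>G\<^esub> \<alpha> (t + h)" for h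
  proof -
    have "inv\<^bsub>G\<^esub> g \<otimes>\<^bsub>G\<^esub> (g \<otimes>\<^bsub>G\<^esub> \<alpha> (t + h)) = \<alpha> (t + h)" using g \<alpha> by (simp add: m_assoc[symmetric])
    then show ?thesis using g \<alpha> by (simp add: inv_mult_group m_assoc)
  qed
  then show ?thesis using LI by (simp add: left_inv_at_def)
qed

lemma left_inv_shift: "left_inv_at G X \<alpha> (s + t) \<Longrightarrow> left_inv_at G X (\<lambda>t. \<alpha> (s + t)) t"
  by (simp add: left_inv_at_def add.assoc)

text \<open>In a chart, left invariance is an autonomous equation. Its vector field assigns to
  \<open>g\<close> the velocity of the curve \<open>g \<otimes> \<beta> h\<close>, where
  \<open>\<beta>\<close> is any curve with velocity \<open>X\<close>; as a partial derivative of
  multiplication it is smooth.\<close>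

lemma left_inv_local:
  assumes G: "lie_group G" and X: "X \<in> lie_algebra G"
  obtains \<epsilon> \<gamma> x where "0 < \<epsilon>" "\<gamma> 0 = \<one>\<^bsub>G\<^esub>" "\<forall>t. \<gamma> t \<in> carrier G" "\<forall>t. \<bar>t\<bar> < \<epsilon> \<longrightarrow> left_inv_at G X \<gamma> t"
    "smooth_on UNIV {-\<epsilon><..<\<epsilon>} x" "\<forall>t. \<bar>t\<bar> < \<epsilon> \<longrightarrow> \<gamma> t \<in> fst (id_chart G) \<and> snd (id_chart G) (\<gamma> t) = x t"
proof -
  interpret group G by (rule lie_groupD(1)[OF G])
  note M = lie_groupD(3)[OF G]
  note V = model_subspace[OF M]
  let ?c = "id_chart G"
  note c = id_chart[OF G]
  let ?m = "\<lambda>(x, y). x \<otimes>\<^bsub>G\<^esub> y"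
  note m = lie_groupD(5)[OF G]
  have cG: "g \<in> carrier G" if "g \<in> fst ?c" for g using chart_subset[OF M c(1)] that lie_groupD(4)[OF G] by auto
  have m1: "?m (g, \<one>\<^bsub>G\<^esub>) \<in> fst ?c" if "g \<in> fst ?c" for g using that cG[OF that] by simp
  define F where "F = (\<lambda>p. pderiv1 G ?m ?c (cinv ?c p) X)"
  define S where "S = snd ?c ` fst ?c"
  have S: "openin (top_of_set (lie_algebra G)) S"
    using chart_image_open[OF M c(1) chart_openin[OF M c(1)]] by (simp add: S_def)
  have "smooth_on (lie_algebra G) (snd ?c ` (fst ?c \<inter> fst ?c)) F"
    unfolding F_def by (rule sfunD[OF sfun_pderiv1[OF G m c(1) chart_openin[OF M c(1)] m1 X] c(1)])
  then have F: "smooth_on (lie_algebra G) S F" by (simp add: S_def)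
  obtain \<beta> where \<beta>: "tan1 G \<beta> X" using tan1_exists[OF G X] .
  have Fvel: "hasvel ?c (\<lambda>h. g \<otimes>\<^bsub>G\<^esub> \<beta> h) (F (snd ?c g))" if "g \<in> fst ?c" for g
    using hasvel_pderiv1[OF G m c(1) cG[OF that] m1[OF that] \<beta>] M c(1) that by (simp add: F_def)
  have FV: "F ` S \<subseteq> lie_algebra G" using hasvel_in_model[OF M c(1) Fvel] by (auto simp: S_def)
  have "snd ?c \<one>\<^bsub>G\<^esub> \<in> S" using c(2) by (simp add: S_def)
  from ode_local[OF V S F FV this] obtain \<epsilon> x where x: "0 < \<epsilon>" "x 0 = snd ?c \<one>\<^bsub>G\<^esub>" "smooth_on UNIV {-\<epsilon><..<\<epsilon>} x"
    "\<And>t. \<bar>t\<bar> < \<epsilon> \<Longrightarrow> x t \<in> S" "\<And>t. \<bar>t\<bar> < \<epsilon> \<Longrightarrow> (x has_vector_derivative F (x t)) (at t)" by metis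
  \<comment> \<open>The identity is a default value that keeps \<open>\<gamma>\<close> in the
    carrier for all times; the equation is claimed only for
    \<open>\<bar>t\<bar> < \<epsilon>\<close>.\<close>
  define \<gamma> where "\<gamma> t = (if \<bar>t\<bar> < \<epsilon> then cinv ?c (x t) else \<one>\<^bsub>G\<^esub>)" for t
  have \<gamma>: "\<gamma> t \<in> fst ?c" "snd ?c (\<gamma> t) = x t" if "\<bar>t\<bar> < \<epsilon>" for t
    using x(4)[OF that] that by (auto simp: \<gamma>_def S_def inv_into_into f_inv_into_f)
  have \<gamma>G: "\<gamma> t \<in> carrier G" for t using \<gamma>(1)[of t, THEN cG] by (cases "\<bar>t\<bar> < \<epsilon>") (auto simp: \<gamma>_def)
  have "left_inv_at G X \<gamma> t" if t: "\<bar>t\<bar> < \<epsilon>" for t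
  proof -
    let ?g = "\<gamma> t"
    have ev: "\<forall>\<^sub>F h in nhds 0. \<bar>t + h\<bar> < \<epsilon>"
      using isCont_eventually_nhds[where f = "\<lambda>h. t + h" and a = 0 and S = "{-\<epsilon><..<\<epsilon>}"] t by (auto simp: abs_less_iff elim!: eventually_mono)
    have "((\<lambda>h. x (t + h)) has_vector_derivative F (x t)) (at 0)"
    proof -
      have "((\<lambda>h. t + h) has_vector_derivative 1) (at 0)" by (auto intro!: derivative_eq_intros)
      from vector_diff_chain_at[OF this, of x "F (x t)"] x(5)[OF t] show ?thesis by (simp add: o_def)
    qed
    moreover have "\<forall>\<^sub>F h in nhds 0. x (t + h) = snd ?c (\<gamma> (t + h))" using ev by eventually_elim (simp add: \<gamma>(2))
    ultimately have "((\<lambda>h. snd ?c (\<gamma> (t + h))) has_vector_derivative F (x t)) (at 0)" by (rule hvd_cong[rotated])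
    moreover have "\<forall>\<^sub>F h in nhds 0. \<gamma> (t + h) \<in> fst ?c" using ev by eventually_elim (simp add: \<gamma>(1))
    ultimately have v1: "hasvel ?c (\<lambda>h. \<gamma> (t + h)) (F (x t))" by (simp add: hasvel_def)
    have v2: "hasvel ?c (\<lambda>h. ?g \<otimes>\<^bsub>G\<^esub> \<beta> h) (F (x t))" using Fvel[OF \<gamma>(1)[OF t]] \<gamma>(2)[OF t] by simp
    let ?L = "\<lambda>x. inv\<^bsub>G\<^esub> ?g \<otimes>\<^bsub>G\<^esub> x"
    have L: "smooth_map (mfd G) (mfd G) ?L" by (rule smooth_map_left_mult[OF G inv_closed[OF \<gamma>G]])
    have \<beta>0: "\<beta> 0 = \<one>\<^bsub>G\<^esub>" using \<beta> by (simp add: tan1_def)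
    have w1: "hasvel ?c (\<lambda>h. ?L (\<gamma> (t + h))) (loc_deriv ?c ?c ?L (snd ?c (\<gamma> (t + 0))) (F (x t)))"
      by (rule hasvel_smooth_map[OF M M L c(1) c(1) v1]) (use \<gamma>G c(2) in simp)
    have w2: "hasvel ?c (\<lambda>h. ?L (?g \<otimes>\<^bsub>G\<^esub> \<beta> h)) (loc_deriv ?c ?c ?L (snd ?c (?g \<otimes>\<^bsub>G\<^esub> \<beta> 0)) (F (x t)))"
      by (rule hasvel_smooth_map[OF M M L c(1) c(1) v2]) (use \<gamma>G c(2) \<beta>0 in simp)
    have "\<forall>\<^sub>F h in nhds 0. ?L (?g \<otimes>\<^bsub>G\<^esub> \<beta> h) = \<beta> h"
      using tan1_carrier[OF G \<beta>] by eventually_elim (simp add: \<gamma>G m_assoc[symmetric])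
    from hasvel_unique[OF hasvel_cong[OF this w2]] have "loc_deriv ?c ?c ?L (snd ?c ?g) (F (x t)) = X"
      using \<beta> \<beta>0 \<gamma>G by (simp add: tan1_def)
    then show ?thesis using w1 \<gamma>G by (simp add: left_inv_at_def tan1_def)
  qed
  moreover have "\<gamma> 0 = \<one>\<^bsub>G\<^esub>" using x(1,2) M c by (simp add: \<gamma>_def)
  ultimately show thesis by (intro that[of \<epsilon> \<gamma> x] x(1,3)) (simp_all add: \<gamma>G \<gamma>)
qed

subsection \<open>Existence and uniqueness of one-parameter subgroups\<close>

lemma real_line_simps [simp]: "mtop real_line = euclidean" "model real_line = UNIV" "atlas real_line = {(UNIV, id)}"
  by (simp_all add: real_line_def)

lemma pre_manifold_real_line: "pre_manifold real_line"
  unfolding pre_manifold_def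
proof (intro conjI ballI)
  fix c d :: "(real, real) chart" assume "c \<in> atlas real_line" "d \<in> atlas real_line"
  then have "loc_rep c d id = (\<lambda>x. x)" by (auto simp: loc_rep_def)
  then show "smooth_on (model real_line) (loc_dom c d id) (loc_rep c d id)"
    using smooth_on_linear[OF bounded_linear_ident] by simp
next
  fix c :: "(real, real) chart" assume c: "c \<in> atlas real_line"
  show "homeomorphic_map (subtopology (mtop real_line) (fst c)) (top_of_set (snd c ` fst c)) (snd c)"
    using c by (simp add: homeomorphic_map_id)
qed auto

lemma sfun_real_lineI: "open Q \<Longrightarrow> smooth_on UNIV Q f \<Longrightarrow> sfun real_line Q f"
  unfolding sfun_def by simp

lemma one_paramD:
  assumes G: "lie_group G" and \<gamma>: "one_parameter_subgroup G X \<gamma>"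
  shows "\<And>t. \<gamma> t \<in> carrier G" "\<And>s t. \<gamma> (s + t) = \<gamma> s \<otimes>\<^bsub>G\<^esub> \<gamma> t" "\<gamma> 0 = \<one>\<^bsub>G\<^esub>" "tan1 G \<gamma> X"
    "\<And>t. left_inv_at G X \<gamma> t" "smooth_map real_line (mfd G) \<gamma>" "\<And>t. \<gamma> (- t) = inv\<^bsub>G\<^esub> (\<gamma> t)"
proof -
  interpret group G by (rule lie_groupD(1)[OF G])
  note M = lie_groupD(3)[OF G]
  show sm: "smooth_map real_line (mfd G) \<gamma>" using \<gamma> by (simp add: one_parameter_subgroup_def)
  show c: "\<gamma> t \<in> carrier G" for t using smooth_map_in[OF sm, of t] lie_groupD(4)[OF G] by simp
  show h: "\<gamma> (s + t) = \<gamma> s \<otimes>\<^bsub>G\<^esub> \<gamma> t" for s t using \<gamma> unfolding one_parameter_subgroup_def by blast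
  have "inv\<^bsub>G\<^esub> \<gamma> 0 \<otimes>\<^bsub>G\<^esub> (\<gamma> 0 \<otimes>\<^bsub>G\<^esub> \<gamma> 0) = inv\<^bsub>G\<^esub> \<gamma> 0 \<otimes>\<^bsub>G\<^esub> \<gamma> 0" using h[of 0 0] by simp
  then show 0: "\<gamma> 0 = \<one>\<^bsub>G\<^esub>" using c[of 0] by (simp add: m_assoc[symmetric])
  have "open {t. \<gamma> t \<in> fst (id_chart G)}"
    using openin_continuous_map_preimage[OF smooth_map_continuous[OF sm] chart_openin[OF M id_chart(1)[OF G]]] by simp
  then have "\<forall>\<^sub>F t in nhds 0. \<gamma> t \<in> fst (id_chart G)"
    using eventually_nhds_in_open[of "{t. \<gamma> t \<in> fst (id_chart G)}" 0] 0 id_chart(2)[OF G] by simp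
  then show tan: "tan1 G \<gamma> X"
    using \<gamma> 0 by (simp add: tan1_def hasvel_def one_parameter_subgroup_def o_def)
  have "inv\<^bsub>G\<^esub> (\<gamma> t) \<otimes>\<^bsub>G\<^esub> \<gamma> (t + h) = \<gamma> h" for t h using c h[of t] by (simp add: m_assoc[symmetric])
  then show "left_inv_at G X \<gamma> t" for t using tan by (simp add: left_inv_at_def)
  show "\<gamma> (- t) = inv\<^bsub>G\<^esub> (\<gamma> t)" for t
    using inv_equality[of "\<gamma> (-t)" "\<gamma> t"] h[of "-t" t] c 0 by simp
qed

lemma one_param_unique:
  assumes G: "lie_group G" and "one_parameter_subgroup G X \<gamma>" "one_parameter_subgroup G X \<delta>"
  shows "\<gamma> = \<delta>"
proof
  fix t
  note \<gamma> = one_paramD[OF G assms(2)] and \<delta> = one_paramD[OF G assms(3)]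
  show "\<gamma> t = \<delta> t"
    by (rule left_inv_unique[OF G \<gamma>(1) \<delta>(1) connected_UNIV open_UNIV \<gamma>(5) \<delta>(5), of 0]) (simp_all add: \<gamma>(3) \<delta>(3))
qed

text \<open>A local solution is a local homomorphism by uniqueness. The power
  \<open>\<gamma> (t / n)^n\<close> extends it to all times; common multiples of two subdivisions
  show that the choice of \<open>n\<close> is immaterial once
  \<open>\<bar>t\<bar> < n \<epsilon>\<close>. Smoothness at \<open>t0\<close> is reduced to
  smoothness near \<open>0\<close> by a left translation.\<close>

lemma one_param_exists:
  assumes G: "lie_group G" and X: "X \<in> lie_algebra G"
  obtains \<gamma> where "one_parameter_subgroup G X \<gamma>"
proof -
  interpret group G by (rule lie_groupD(1)[OF G])
  note M = lie_groupD(3)[OF G]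
  let ?c = "id_chart G"
  note c = id_chart[OF G]
  obtain \<epsilon> \<gamma> x where \<epsilon>: "0 < \<epsilon>" and \<gamma>0: "\<gamma> 0 = \<one>\<^bsub>G\<^esub>" and *: "\<forall>t. \<gamma> t \<in> carrier G"
    "\<forall>t. \<bar>t\<bar> < \<epsilon> \<longrightarrow> left_inv_at G X \<gamma> t" and x: "smooth_on UNIV {-\<epsilon><..<\<epsilon>} x"
    and **: "\<forall>t. \<bar>t\<bar> < \<epsilon> \<longrightarrow> \<gamma> t \<in> fst ?c \<and> snd ?c (\<gamma> t) = x t"
    by (rule left_inv_local[OF G X])
  note \<gamma>G = *(1)[rule_format] and LI = *(2)[rule_format] and \<gamma>x = mp[OF spec[OF **]]
  \<comment> \<open>Both sides are left invariant in \<open>t\<close> and agree at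
    \<open>t = 0\<close>. The interval consists of the times for which \<open>t\<close> and
    \<open>s + t\<close> both have absolute value below \<open>\<epsilon>\<close>.\<close>
  have loc: "\<gamma> (s + t) = \<gamma> s \<otimes>\<^bsub>G\<^esub> \<gamma> t" if s: "\<bar>s\<bar> < \<epsilon>" and t: "\<bar>t\<bar> < \<epsilon>" and st: "\<bar>s + t\<bar> < \<epsilon>" for s t
  proof (rule left_inv_unique[OF G, where I = "{max (-\<epsilon>) (-\<epsilon> - s)<..<min \<epsilon> (\<epsilon> - s)}" and ?t0.0 = 0 and t = t])
    show "left_inv_at G X (\<lambda>t. \<gamma> (s + t)) u" if "u \<in> {max (-\<epsilon>) (-\<epsilon> - s)<..<min \<epsilon> (\<epsilon> - s)}" for u
      by (rule left_inv_shift[OF LI]) (use that in \<open>auto simp: abs_less_iff\<close>)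
    show "left_inv_at G X (\<lambda>t. \<gamma> s \<otimes>\<^bsub>G\<^esub> \<gamma> t) u" if "u \<in> {max (-\<epsilon>) (-\<epsilon> - s)<..<min \<epsilon> (\<epsilon> - s)}" for u
      by (rule left_inv_translate[OF G \<gamma>G \<gamma>G LI]) (use that in \<open>auto simp: abs_less_iff\<close>)
  qed (use s t st \<gamma>G \<gamma>0 \<epsilon> in \<open>auto simp: abs_less_iff\<close>)
  have pow: "\<gamma> (real n * u) = \<gamma> u [^]\<^bsub>G\<^esub> n" if "real n * \<bar>u\<bar> < \<epsilon>" for n u
    using that
  proof (induction n)
    case 0 then show ?case by (simp add: \<gamma>0)
  next
    case (Suc n)
    have b: "real n * \<bar>u\<bar> < \<epsilon>" "\<bar>u\<bar> < \<epsilon>"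
      using Suc.prems by (auto simp: algebra_simps) (smt (verit) mult_nonneg_nonneg of_nat_0_le_iff)+
    have "\<gamma> (real n * u + u) = \<gamma> (real n * u) \<otimes>\<^bsub>G\<^esub> \<gamma> u"
    proof (rule loc)
      show "\<bar>real n * u\<bar> < \<epsilon>" using b(1) by (simp add: abs_mult)
      have "real n * u + u = real (Suc n) * u" by (simp add: algebra_simps)
      then have "\<bar>real n * u + u\<bar> = real (Suc n) * \<bar>u\<bar>" by (simp only: abs_mult abs_of_nat)
      then show "\<bar>real n * u + u\<bar> < \<epsilon>" using Suc.prems by simp
    qed (rule b(2))
    then show ?case using Suc.IH[OF b(1)] by (simp add: algebra_simps)
  qed
  \<comment> \<open>The successor makes \<open>N t\<close> positive and the inequality
    \<open>\<bar>t\<bar> < N t * \<epsilon>\<close> strict.\<close>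
  define N where "N t = Suc (nat \<lceil>\<bar>t\<bar> / \<epsilon>\<rceil>)" for t
  have N: "\<bar>t\<bar> < real (N t) * \<epsilon>" for t
  proof -
    have "\<bar>t\<bar> / \<epsilon> \<le> real_of_int \<lceil>\<bar>t\<bar> / \<epsilon>\<rceil>" by (rule le_of_int_ceiling)
    also have "\<dots> \<le> real (nat \<lceil>\<bar>t\<bar> / \<epsilon>\<rceil>)" by simp
    also have "\<dots> < real (N t)" by (simp add: N_def)
    finally show ?thesis using \<epsilon> by (simp add: pos_divide_less_eq)
  qed
  define \<Gamma> where "\<Gamma> t = \<gamma> (t / real (N t)) [^]\<^bsub>G\<^esub> N t" for t
  have refine: "\<gamma> (t / real n) [^]\<^bsub>G\<^esub> n = \<gamma> (t / real (n * m)) [^]\<^bsub>G\<^esub> (n * m)"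
    if "0 < n" "0 < m" "\<bar>t\<bar> < real n * \<epsilon>" for t n m
  proof -
    have "real m * \<bar>t / real (n * m)\<bar> < \<epsilon>" using that by (simp add: divide_simps mult.commute)
    from pow[OF this] have "\<gamma> (t / real n) = \<gamma> (t / real (n * m)) [^]\<^bsub>G\<^esub> m" using that by simp
    then show ?thesis using nat_pow_pow[OF \<gamma>G, of "t / real (n * m)" m n] by (simp add: mult.commute)
  qed
  have \<Gamma>: "\<Gamma> t = \<gamma> (t / real n) [^]\<^bsub>G\<^esub> n" if "0 < n" "\<bar>t\<bar> < real n * \<epsilon>" for t n
    using refine[OF that(1) _ that(2), of "N t"] refine[of "N t" n t] N[of t] that(1)
    by (simp add: \<Gamma>_def N_def mult.commute)
  have \<Gamma>G: "\<Gamma> t \<in> carrier G" for t by (simp add: \<Gamma>_def \<gamma>G)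
  have \<Gamma>\<gamma>: "\<Gamma> t = \<gamma> t" if "\<bar>t\<bar> < \<epsilon>" for t using \<Gamma>[of 1 t] that \<gamma>G by simp
  have hom: "\<Gamma> (s + t) = \<Gamma> s \<otimes>\<^bsub>G\<^esub> \<Gamma> t" for s t
  proof -
    \<comment> \<open>One subdivision fine enough for \<open>s\<close>, \<open>t\<close> and
      \<open>s + t\<close> at once; the sum is a convenient common bound.\<close>
    define n where "n = N s + N t + N (s + t)"
    have n: "0 < n" by (simp add: n_def N_def)
    have le: "real (N s) * \<epsilon> \<le> real n * \<epsilon>" "real (N t) * \<epsilon> \<le> real n * \<epsilon>" "real (N (s + t)) * \<epsilon> \<le> real n * \<epsilon>"
      using \<epsilon> by (auto simp: n_def)
    have b: "\<bar>s\<bar> < real n * \<epsilon>" "\<bar>t\<bar> < real n * \<epsilon>" "\<bar>s + t\<bar> < real n * \<epsilon>"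
      using le N[of s] N[of t] N[of "s + t"] by linarith+
    have b': "\<bar>s / real n\<bar> < \<epsilon>" "\<bar>t / real n\<bar> < \<epsilon>" "\<bar>s / real n + t / real n\<bar> < \<epsilon>" "\<bar>t / real n + s / real n\<bar> < \<epsilon>"
      using b n by (auto simp: add_divide_distrib[symmetric] pos_divide_less_eq mult.commute add.commute)
    \<comment> \<open>The two orders of summation show that the small elements commute, which the
      power of a product requires.\<close>
    have e1: "\<gamma> (s / real n + t / real n) = \<gamma> (s / real n) \<otimes>\<^bsub>G\<^esub> \<gamma> (t / real n)" by (rule loc[OF b'(1-3)])
    have e2: "\<gamma> (t / real n + s / real n) = \<gamma> (t / real n) \<otimes>\<^bsub>G\<^esub> \<gamma> (s / real n)" by (rule loc[OF b'(2,1,4)])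
    have "\<Gamma> (s + t) = (\<gamma> (s / real n) \<otimes>\<^bsub>G\<^esub> \<gamma> (t / real n)) [^]\<^bsub>G\<^esub> n"
      unfolding \<Gamma>[OF n b(3)] by (simp add: add_divide_distrib e1)
    also have "\<dots> = \<gamma> (s / real n) [^]\<^bsub>G\<^esub> n \<otimes>\<^bsub>G\<^esub> \<gamma> (t / real n) [^]\<^bsub>G\<^esub> n"
      by (rule pow_mult_distrib[OF _ \<gamma>G \<gamma>G]) (use e1 e2 in \<open>simp add: add.commute\<close>)
    also have "\<dots> = \<Gamma> s \<otimes>\<^bsub>G\<^esub> \<Gamma> t" by (simp only: \<Gamma>[OF n b(1)] \<Gamma>[OF n b(2)])
    finally show ?thesis .
  qed
  have sm: "smooth_map real_line (mfd G) \<Gamma>"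
  proof (rule smooth_mapI_chart[OF pre_manifold_real_line M])
    fix t0 :: real show "\<Gamma> t0 \<in> topspace (mtop (mfd G))" using \<Gamma>G lie_groupD(4)[OF G] by simp
    fix d assume d: "d \<in> atlas (mfd G)" "\<Gamma> t0 \<in> fst d"
    let ?L = "\<lambda>g. \<Gamma> t0 \<otimes>\<^bsub>G\<^esub> g"
    let ?I = "{g \<in> topspace (mtop (mfd G)). ?L g \<in> fst d}"
    have L: "sfun (mfd G) ?I (\<lambda>g. snd d (?L g))"
      by (rule smooth_map_chart[OF M M smooth_map_left_mult[OF G \<Gamma>G] d(1)])
    define W where "W = snd ?c ` (fst ?c \<inter> ?I)"
    have W: "openin (top_of_set (lie_algebra G)) W" unfolding W_def by (rule chart_image_open[OF M c(1) sfun_open[OF L]])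
    obtain O' where O': "open O'" "W = lie_algebra G \<inter> O'" using W by (auto simp: openin_open)
    have xc: "continuous_on {-\<epsilon><..<\<epsilon>} x" by (rule smooth_on_continuous[OF x])
    define T where "T = {u \<in> {-\<epsilon><..<\<epsilon>}. x u \<in> O'}"
    have T: "open T" unfolding T_def using continuous_open_preimage[OF xc open_greaterThanLessThan O'(1)]
      by (simp add: vimage_def Int_def)
    have TW: "x u \<in> W" "\<Gamma> (t0 + u) \<in> fst d" if "u \<in> T" for u
    proof -
      have u: "\<bar>u\<bar> < \<epsilon>" "x u \<in> O'" using that by (auto simp: T_def)
      have "x u \<in> lie_algebra G" using \<gamma>x[OF u(1)] chart_in_model[OF M c(1)] by metis
      then show xW: "x u \<in> W" using u(2) O'(2) by auto
      then obtain g where g: "g \<in> fst ?c" "g \<in> ?I" "x u = snd ?c g" by (auto simp: W_def)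
      have "g = \<gamma> u"
        by (rule inj_onD[OF chart_inj[OF M c(1)] _ g(1)]) (use g(3) \<gamma>x[OF u(1)] in auto)
      then show "\<Gamma> (t0 + u) \<in> fst d" using g(2) hom[of t0 u] \<Gamma>\<gamma>[OF u(1)] by simp
    qed
    have "\<one>\<^bsub>G\<^esub> \<in> ?I" using d(2) \<Gamma>G lie_groupD(4)[OF G] by simp
    then have "snd ?c \<one>\<^bsub>G\<^esub> \<in> W" using c(2) unfolding W_def by blast
    then have "x 0 \<in> W" using \<gamma>x[of 0] \<epsilon> \<gamma>0 by simp
    then have 0: "0 \<in> T" using O'(2) \<epsilon> by (auto simp: T_def)
    let ?Q = "(\<lambda>t. t - t0) -` T"
    have Q: "open ?Q" by (rule open_vimage[OF T]) (intro continuous_intros)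
    have lin: "smooth_on UNIV ?Q (\<lambda>t. t - t0)"
      using smooth_on_add[OF smooth_on_linear[OF bounded_linear_ident] smooth_on_const[of UNIV ?Q "- t0"]] by simp
    have xs: "smooth_on UNIV ?Q (\<lambda>t. x (t - t0))"
      by (rule smooth_on_compose[OF subspace_UNIV _ x lin]) (auto simp: T_def)
    have "smooth_on UNIV ?Q (\<lambda>t. snd d (?L (cinv ?c (x (t - t0)))))"
      by (rule smooth_on_compose[OF model_subspace[OF M] _ sfunD[OF L c(1)] xs])
        (use TW(1) chart_in_model[OF M c(1)] in \<open>auto simp: W_def\<close>)
    moreover have "snd d (?L (cinv ?c (x (t - t0)))) = snd d (\<Gamma> t)" if "t \<in> ?Q" for t
    proof -
      have u: "\<bar>t - t0\<bar> < \<epsilon>" using that by (auto simp: T_def)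
      have "cinv ?c (x (t - t0)) = \<gamma> (t - t0)" using cinv_chart[OF M c(1)] \<gamma>x[OF u] by metis
      then show ?thesis using hom[of t0 "t - t0"] \<Gamma>\<gamma>[OF u] by simp
    qed
    ultimately have "smooth_on UNIV ?Q (\<lambda>t. snd d (\<Gamma> t))"
      by (rule iffD1[OF smooth_on_cong, rotated])
    from sfun_real_lineI[OF Q this] show "\<exists>Q. t0 \<in> Q \<and> \<Gamma> ` Q \<subseteq> fst d \<and> sfun real_line Q (\<lambda>t. snd d (\<Gamma> t))"
    proof (intro exI[of _ ?Q] conjI)
      show "\<Gamma> ` ?Q \<subseteq> fst d"
      proof safe
        fix t assume "t - t0 \<in> T" from TW(2)[OF this] show "\<Gamma> t \<in> fst d" by simp
      qed
    qed (use 0 in simp)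
  qed
  have "left_inv_at G X \<gamma> 0" using LI[of 0] \<epsilon> by simp
  then have "tan1 G (\<lambda>h. inv\<^bsub>G\<^esub> \<gamma> 0 \<otimes>\<^bsub>G\<^esub> \<gamma> (0 + h)) X" unfolding left_inv_at_def .
  then have tg: "tan1 G \<gamma> X" using \<gamma>0 \<gamma>G by simp
  have "\<forall>\<^sub>F t in nhds 0. \<gamma> t = \<Gamma> t"
    using eventually_nhds_in_open[of "{-\<epsilon><..<\<epsilon>}" 0] \<epsilon> by (auto elim!: eventually_mono simp: \<Gamma>\<gamma> abs_less_iff)
  from tan1_cong[OF this tg] have "((\<lambda>t. snd ?c (\<Gamma> t)) has_vector_derivative X) (at 0)" by (simp add: tan1_def hasvel_def)
  then have "one_parameter_subgroup G X \<Gamma>"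
    unfolding one_parameter_subgroup_def using sm hom by (simp add: o_def)
  then show thesis by (rule that)
qed

subsection \<open>The exponential map\<close>

lemma one_paramI:
  assumes "smooth_map real_line (mfd G) \<gamma>" "\<And>s t. \<gamma> (s + t) = \<gamma> s \<otimes>\<^bsub>G\<^esub> \<gamma> t" "tan1 G \<gamma> X"
  shows "one_parameter_subgroup G X \<gamma>"
  using assms unfolding one_parameter_subgroup_def by (simp add: tan1_def hasvel_def o_def)

lemma lie_exp_eq:
  assumes G: "lie_group G" and \<gamma>: "one_parameter_subgroup G X \<gamma>"
  shows "lie_exp G X = \<gamma> 1"
  unfolding lie_exp_def
proof (rule the_equality)
  show "\<exists>\<delta>. one_parameter_subgroup G X \<delta> \<and> \<gamma> 1 = \<delta> 1" using \<gamma> by blast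
  fix g assume "\<exists>\<delta>. one_parameter_subgroup G X \<delta> \<and> g = \<delta> 1"
  then obtain \<delta> where \<delta>: "one_parameter_subgroup G X \<delta>" "g = \<delta> 1" by blast
  show "g = \<gamma> 1" using one_param_unique[OF G \<delta>(1) \<gamma>] \<delta>(2) by simp
qed

lemma smooth_map_real_line_mult: "smooth_map real_line real_line (\<lambda>t. r * t)"
proof (rule smooth_mapI[OF pre_manifold_real_line pre_manifold_real_line])
  fix x :: real
  have "sfun real_line UNIV (\<lambda>t::real. r * t)"
    by (rule sfun_real_lineI[OF open_UNIV smooth_on_linear[OF bounded_linear_mult_right]])
  then show "\<exists>Q. \<exists>d\<in>atlas real_line. x \<in> Q \<and> (\<lambda>t. r * t) ` Q \<subseteq> fst d \<and> sfun real_line Q (\<lambda>x. snd d (r * x))"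
    by (intro exI[of _ UNIV]) simp
qed

lemma one_param_scale:
  assumes G: "lie_group G" and \<gamma>: "one_parameter_subgroup G X \<gamma>"
  shows "one_parameter_subgroup G (r *\<^sub>R X) (\<lambda>t. \<gamma> (r * t))"
proof -
  note \<gamma>' = one_paramD[OF G \<gamma>]
  have d: "((\<lambda>t. r * t) has_vector_derivative r) (at 0)" by (auto intro!: derivative_eq_intros)
  have "((snd (id_chart G) \<circ> \<gamma>) has_vector_derivative X) (at (r * 0))"
    using \<gamma> by (simp add: one_parameter_subgroup_def)
  from vector_diff_chain_at[OF d this]
  have "((snd (id_chart G) \<circ> (\<lambda>t. \<gamma> (r * t))) has_vector_derivative r *\<^sub>R X) (at 0)" by (simp add: o_def)
  moreover have "smooth_map real_line (mfd G) (\<lambda>t. \<gamma> (r * t))"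
    by (rule smooth_map_compose[OF pre_manifold_real_line pre_manifold_real_line lie_groupD(3)[OF G] smooth_map_real_line_mult \<gamma>'(6)])
  ultimately show ?thesis unfolding one_parameter_subgroup_def using \<gamma>'(2) by (simp add: distrib_left)
qed

lemma one_param_exp:
  assumes G: "lie_group G" and X: "X \<in> lie_algebra G"
  shows "one_parameter_subgroup G X (\<lambda>t. lie_exp G (t *\<^sub>R X))"
proof -
  obtain \<gamma> where \<gamma>: "one_parameter_subgroup G X \<gamma>" using one_param_exists[OF G X] .
  have "lie_exp G (t *\<^sub>R X) = \<gamma> t" for t using lie_exp_eq[OF G one_param_scale[OF G \<gamma>, of t]] by simp
  then show ?thesis using \<gamma> by simp
qed

lemma lie_exp_closed: "lie_group G \<Longrightarrow> X \<in> lie_algebra G \<Longrightarrow> lie_exp G X \<in> carrier G"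
  using one_paramD(1)[OF _ one_param_exp, of G X 1] by simp

lemma lie_exp_zero: assumes G: "lie_group G" shows "lie_exp G 0 = \<one>\<^bsub>G\<^esub>"
  using one_paramD(3)[OF G one_param_exp[OF G subspace_0[OF model_subspace[OF lie_groupD(3)[OF G]]]]] by simp

lemma lie_exp_add:
  "lie_group G \<Longrightarrow> X \<in> lie_algebra G \<Longrightarrow> lie_exp G ((s + t) *\<^sub>R X) = lie_exp G (s *\<^sub>R X) \<otimes>\<^bsub>G\<^esub> lie_exp G (t *\<^sub>R X)"
  by (rule one_paramD(2)[OF _ one_param_exp])

lemma lie_exp_neg: "lie_group G \<Longrightarrow> X \<in> lie_algebra G \<Longrightarrow> lie_exp G (- X) = inv\<^bsub>G\<^esub> (lie_exp G X)"
  using one_paramD(7)[OF _ one_param_exp, of G X 1] by simp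

lemma lie_exp_pow:
  assumes G: "lie_group G" and X: "X \<in> lie_algebra G"
  shows "lie_exp G (real n *\<^sub>R X) = lie_exp G X [^]\<^bsub>G\<^esub> n"
proof -
  interpret group G by (rule lie_groupD(1)[OF G])
  show ?thesis
  proof (induction n)
    case 0 then show ?case by (simp add: lie_exp_zero[OF G])
  next
    case (Suc n)
    have "lie_exp G ((real n + 1) *\<^sub>R X) = lie_exp G (real n *\<^sub>R X) \<otimes>\<^bsub>G\<^esub> lie_exp G (1 *\<^sub>R X)"
      by (rule lie_exp_add[OF G X])
    then show ?case using Suc by (simp add: add.commute)
  qed
qed

lemma one_param_hom:
  assumes K: "lie_group K" and G: "lie_group G" and f: "smooth_map (mfd K) (mfd G) f" "f \<in> hom K G"
    and \<gamma>: "one_parameter_subgroup K X \<gamma>"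
  shows "one_parameter_subgroup G (diff_one K G f X) (\<lambda>t. f (\<gamma> t))"
proof -
  interpret f: group_hom K G f
    using lie_groupD(1)[OF K] lie_groupD(1)[OF G] f(2) by (simp add: group_hom_def group_hom_axioms_def)
  note \<gamma>' = one_paramD[OF K \<gamma>]
  show ?thesis
    by (rule one_paramI[OF smooth_map_compose[OF pre_manifold_real_line lie_groupD(3)[OF K] lie_groupD(3)[OF G] \<gamma>'(6) f(1)]
        _ tan1_map[OF K G f(1) f.hom_one \<gamma>'(4)]]) (simp add: \<gamma>'(1,2))
qed

lemma lie_exp_hom:
  assumes K: "lie_group K" and G: "lie_group G" and f: "smooth_map (mfd K) (mfd G) f" "f \<in> hom K G" and X: "X \<in> lie_algebra K"
  shows "f (lie_exp K X) = lie_exp G (diff_one K G f X)"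
  using lie_exp_eq[OF G one_param_hom[OF K G f one_param_exp[OF K X]]] by simp

lemma lie_exp_Ad:
  assumes "lie_group G" "g \<in> carrier G" "X \<in> lie_algebra G"
  shows "conj_by G g (lie_exp G X) = lie_exp G (Ad G g X)"
  unfolding Ad_def
  by (rule lie_exp_hom[OF assms(1,1) smooth_map_conj[OF assms(1,2)] conj_by_in_hom[OF lie_groupD(1)[OF assms(1)] assms(2)] assms(3)])

lemma Ad_one_param_derivative:
  assumes G: "lie_group G" and \<gamma>: "one_parameter_subgroup G X \<gamma>" and X: "X \<in> lie_algebra G" and Y: "Y \<in> lie_algebra G"
  shows "((\<lambda>t. Ad G (\<gamma> t) Y) has_vector_derivative Ad G (\<gamma> t) (bracket G X Y)) (at t)"
proof -
  note \<gamma>' = one_paramD[OF G \<gamma>]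
  have "((\<lambda>h. Ad G (\<gamma> t) (Ad G (\<gamma> h) Y)) has_vector_derivative Ad G (\<gamma> t) (bracket G X Y)) (at 0)"
    by (rule bounded_linear.has_vector_derivative[OF bounded_linear_Ad[OF G \<gamma>'(1)] tan1_bracket[OF G \<gamma>'(4) Y]])
  then have "((\<lambda>h. Ad G (\<gamma> (t + h)) Y) has_vector_derivative Ad G (\<gamma> t) (bracket G X Y)) (at 0)"
    by (simp add: \<gamma>'(2) Ad_mult[OF G \<gamma>'(1) \<gamma>'(1) Y])
  then show ?thesis by (rule hvd_shift)
qed

text \<open>The curve \<open>w t = Ad (exp (t X)) Y\<close> solves \<open>w' = k w\<close>, so
  \<open>exp (- k t) w t\<close> is constant.\<close>

lemma Ad_exp_eigenvector:
  assumes G: "lie_group G" and X: "X \<in> lie_algebra G" and Y: "Y \<in> lie_algebra G" and eig: "bracket G X Y = k *\<^sub>R Y"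
  shows "Ad G (lie_exp G (t *\<^sub>R X)) Y = exp (k * t) *\<^sub>R Y"
proof -
  note op = one_param_exp[OF G X]
  note op' = one_paramD[OF G op]
  define w where "w = (\<lambda>t. Ad G (lie_exp G (t *\<^sub>R X)) Y)"
  have w: "(w has_vector_derivative k *\<^sub>R w s) (at s)" for s
    using Ad_one_param_derivative[OF G op X Y, of s] bounded_linear.linear[OF bounded_linear_Ad[OF G op'(1)], of s]
    by (simp add: w_def eig linear_cmul)
  have "((\<lambda>s. exp (- (k * s)) *\<^sub>R w s) has_vector_derivative 0) (at s within UNIV)" for s
  proof -
    have "((\<lambda>s. exp (- (k * s))) has_real_derivative (- k * exp (- (k * s)))) (at s)"
      by (auto intro!: derivative_eq_intros)
    from has_vector_derivative_scaleR[OF this w]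
    show ?thesis by (simp add: mult.commute)
  qed
  from has_vector_derivative_zero_constant[OF convex_UNIV this]
  obtain c where c: "\<And>s. exp (- (k * s)) *\<^sub>R w s = c" by auto
  have "w 0 = Y" using Ad_one[OF G Y] lie_exp_zero[OF G] by (simp add: w_def)
  then have "exp (- (k * t)) *\<^sub>R w t = Y" using c[of 0] c[of t] by simp
  then have "exp (k * t) *\<^sub>R (exp (- (k * t)) *\<^sub>R w t) = exp (k * t) *\<^sub>R Y" by simp
  then show ?thesis by (simp add: w_def exp_add[symmetric] mult_exp_exp)
qed

subsection \<open>Lie algebra axioms\<close>

text \<open>A one-parameter subgroup is commutative: conjugation by its elements fixes the curve, so
  \<open>Ad\<close> of them fixes its velocity \<open>X\<close>.\<close>

lemma bracket_self:
  assumes G: "lie_group G" and X: "X \<in> lie_algebra G"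
  shows "bracket G X X = 0"
proof -
  interpret group G by (rule lie_groupD(1)[OF G])
  note op = one_param_exp[OF G X]
  note op' = one_paramD[OF G op]
  let ?\<gamma> = "\<lambda>t. lie_exp G (t *\<^sub>R X)"
  have "Ad G (?\<gamma> s) X = X" for s
  proof -
    have "conj_by G (?\<gamma> s) (?\<gamma> t) = ?\<gamma> t" for t
    proof -
      have "?\<gamma> s \<otimes>\<^bsub>G\<^esub> ?\<gamma> t = ?\<gamma> t \<otimes>\<^bsub>G\<^esub> ?\<gamma> s" using op'(2)[of s t] op'(2)[of t s] by (simp add: add.commute)
      then show ?thesis using op'(1) by (simp add: conj_by_def m_assoc)
    qed
    then have "tan1 G ?\<gamma> (Ad G (?\<gamma> s) X)" using tan1_Ad[OF G op'(1)[of s] op'(4)] by simp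
    from tan1_unique[OF this op'(4)] show ?thesis .
  qed
  then have "((\<lambda>t. Ad G (?\<gamma> t) X) has_vector_derivative 0) (at 0)" by simp
  from bracket_unique[OF G op'(4) X this] show ?thesis .
qed

lemma bracket_add_left:
  "lie_group G \<Longrightarrow> Y \<in> lie_algebra G \<Longrightarrow> bracket G (X + X') Y = bracket G X Y + bracket G X' Y"
  by (rule linear_add[OF bounded_linear.linear[OF bracket_linear_left]])

lemma bracket_scale_left:
  "lie_group G \<Longrightarrow> Y \<in> lie_algebra G \<Longrightarrow> bracket G (r *\<^sub>R X) Y = r *\<^sub>R bracket G X Y"
  by (rule linear_cmul[OF bounded_linear.linear[OF bracket_linear_left]])

lemma bracket_antisym:
  assumes G: "lie_group G" and X: "X \<in> lie_algebra G" and Y: "Y \<in> lie_algebra G"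
  shows "bracket G Y X = - bracket G X Y"
proof -
  have XY: "X + Y \<in> lie_algebra G" using subspace_add[OF model_subspace[OF lie_groupD(3)[OF G]] X Y] .
  have "0 = bracket G (X + Y) (X + Y)" using bracket_self[OF G XY] by simp
  also have "\<dots> = bracket G X Y + bracket G Y X"
    by (simp add: bracket_add_left[OF G XY] bracket_add_right[OF G X X Y] bracket_add_right[OF G Y X Y]
        bracket_self[OF G X] bracket_self[OF G Y])
  finally have "0 = bracket G X Y + bracket G Y X" .
  then show ?thesis by (metis add.commute neg_eq_iff_add_eq_0)
qed

text \<open>Differentiate \<open>Ad g [Y, Z] = [Ad g Y, Ad g Z]\<close> along a curve with velocity
  \<open>X\<close>. The projection extends the bracket to a bilinear map on the whole space, as the
  product rule demands.\<close>

lemma bracket_jacobi: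
  assumes G: "lie_group G" and X: "X \<in> lie_algebra G" and Y: "Y \<in> lie_algebra G" and Z: "Z \<in> lie_algebra G"
  shows "bracket G X (bracket G Y Z) = bracket G (bracket G X Y) Z + bracket G Y (bracket G X Z)"
proof -
  note V = model_subspace[OF lie_groupD(3)[OF G]]
  let ?\<pi> = "sub_proj (lie_algebra G)"
  let ?b = "\<lambda>X Y. bracket G (?\<pi> X) (?\<pi> Y)"
  have \<pi>V: "?\<pi> v \<in> lie_algebra G" for v by (rule sub_proj_in[OF V])
  have lin\<pi>: "linear ?\<pi>" by (rule bounded_linear.linear[OF bounded_linear_sub_proj])
  have "bilinear ?b"
    unfolding bilinear_def linear_iff
    by (simp add: linear_add[OF lin\<pi>] linear_cmul[OF lin\<pi>] bracket_add_left[OF G] bracket_scale_left[OF G]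
        bracket_add_right[OF G] bracket_scale_right[OF G] \<pi>V)
  then have bb: "bounded_bilinear ?b" by (rule bilinear_conv_bounded_bilinear[THEN iffD1])
  obtain \<alpha> where \<alpha>: "tan1 G \<alpha> X" using tan1_exists[OF G X] .
  have \<alpha>0: "\<alpha> 0 = \<one>\<^bsub>G\<^esub>" using \<alpha> by (simp add: tan1_def)
  have dY: "((\<lambda>t. Ad G (\<alpha> t) Y) has_vector_derivative bracket G X Y) (at 0)" by (rule tan1_bracket[OF G \<alpha> Y])
  have dZ: "((\<lambda>t. Ad G (\<alpha> t) Z) has_vector_derivative bracket G X Z) (at 0)" by (rule tan1_bracket[OF G \<alpha> Z])
  have "((\<lambda>t. ?b (Ad G (\<alpha> t) Y) (Ad G (\<alpha> t) Z)) has_vector_derivative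
      ?b (Ad G (\<alpha> 0) Y) (bracket G X Z) + ?b (bracket G X Y) (Ad G (\<alpha> 0) Z)) (at 0)"
    by (rule bounded_bilinear.has_vector_derivative[OF bb dY dZ])
  moreover have "\<forall>\<^sub>F t in nhds 0. ?b (Ad G (\<alpha> t) Y) (Ad G (\<alpha> t) Z) = Ad G (\<alpha> t) (bracket G Y Z)"
    using tan1_carrier[OF G \<alpha>]
    by eventually_elim (simp add: Ad_bracket[OF G _ Y Z] sub_proj_id[OF V] Ad_in[OF G _ Y] Ad_in[OF G _ Z])
  ultimately have d: "((\<lambda>t. Ad G (\<alpha> t) (bracket G Y Z)) has_vector_derivative
      ?b (Ad G (\<alpha> 0) Y) (bracket G X Z) + ?b (bracket G X Y) (Ad G (\<alpha> 0) Z)) (at 0)"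
    by (rule hvd_cong[rotated])
  from bracket_unique[OF G \<alpha> bracket_in[OF G Y Z] d] show ?thesis
    using X Y Z by (simp add: \<alpha>0 Ad_one[OF G] sub_proj_id[OF V] bracket_in[OF G] add.commute)
qed

subsection \<open>Commuting exponentials\<close>

text \<open>A vanishing bracket makes \<open>Y\<close> an eigenvector of \<open>ad X\<close> for the
  eigenvalue \<open>0\<close>, so \<open>Ad (exp (s X))\<close> fixes it and the exponentials
  commute. The product of the two one-parameter subgroups is then itself one, with velocity
  \<open>X + Y\<close>.\<close>

lemma lie_exp_commute:
  assumes G: "lie_group G" and X: "X \<in> lie_algebra G" and Y: "Y \<in> lie_algebra G" and 0: "bracket G X Y = 0"
  shows "lie_exp G X \<otimes>\<^bsub>G\<^esub> lie_exp G Y = lie_exp G Y \<otimes>\<^bsub>G\<^esub> lie_exp G X"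
    "lie_exp G (X + Y) = lie_exp G X \<otimes>\<^bsub>G\<^esub> lie_exp G Y"
proof -
  interpret group G by (rule lie_groupD(1)[OF G])
  note V = model_subspace[OF lie_groupD(3)[OF G]]
  let ?x = "\<lambda>t. lie_exp G (t *\<^sub>R X)" and ?y = "\<lambda>t. lie_exp G (t *\<^sub>R Y)"
  note x = one_paramD[OF G one_param_exp[OF G X]] and y = one_paramD[OF G one_param_exp[OF G Y]]
  have comm: "?x s \<otimes>\<^bsub>G\<^esub> ?y t = ?y t \<otimes>\<^bsub>G\<^esub> ?x s" for s t
  proof -
    have tY: "t *\<^sub>R Y \<in> lie_algebra G" by (rule subspace_scale[OF V Y])
    have "bracket G X (t *\<^sub>R Y) = 0 *\<^sub>R (t *\<^sub>R Y)" using bracket_scale_right[OF G X Y, of t] 0 by simp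
    from Ad_exp_eigenvector[OF G X tY this, of s] have "Ad G (?x s) (t *\<^sub>R Y) = t *\<^sub>R Y" by simp
    with lie_exp_Ad[OF G x(1) tY, of s] have "conj_by G (?x s) (?y t) = ?y t" by simp
    then have "?x s \<otimes>\<^bsub>G\<^esub> ?y t \<otimes>\<^bsub>G\<^esub> inv\<^bsub>G\<^esub> ?x s \<otimes>\<^bsub>G\<^esub> ?x s = ?y t \<otimes>\<^bsub>G\<^esub> ?x s" by (simp add: conj_by_def)
    then show ?thesis using x(1) y(1) by (simp add: m_assoc)
  qed
  show "lie_exp G X \<otimes>\<^bsub>G\<^esub> lie_exp G Y = lie_exp G Y \<otimes>\<^bsub>G\<^esub> lie_exp G X" using comm[of 1 1] by simp
  have "one_parameter_subgroup G (X + Y) (\<lambda>t. ?x t \<otimes>\<^bsub>G\<^esub> ?y t)"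
  proof (rule one_paramI[OF smooth_map_mult[OF G pre_manifold_real_line x(6) y(6)] _ tan1_mult[OF G x(4) y(4)]])
    fix s t
    have "?x t \<otimes>\<^bsub>G\<^esub> (?y s \<otimes>\<^bsub>G\<^esub> ?y t) = ?y s \<otimes>\<^bsub>G\<^esub> (?x t \<otimes>\<^bsub>G\<^esub> ?y t)"
      using comm[of t s] x(1) y(1) by (simp add: m_assoc[symmetric])
    then show "?x (s + t) \<otimes>\<^bsub>G\<^esub> ?y (s + t) = (?x s \<otimes>\<^bsub>G\<^esub> ?y s) \<otimes>\<^bsub>G\<^esub> (?x t \<otimes>\<^bsub>G\<^esub> ?y t)"
      using x(1) y(1) by (simp add: x(2)[of s t] y(2)[of s t] m_assoc)
  qed
  from lie_exp_eq[OF G this] show "lie_exp G (X + Y) = lie_exp G X \<otimes>\<^bsub>G\<^esub> lie_exp G Y" by simp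
qed

subsection \<open>Central directions in connected groups\<close>

text \<open>By left translation, the derivative of the function \<open>Ad h Y\<close> of
  \<open>h\<close> is, at every point, \<open>Ad h\<close> applied to a bracket with
  \<open>Y\<close>, hence zero. The function is locally constant, and connectedness compares it with
  its value at the identity.\<close>

lemma Ad_central:
  assumes G: "lie_group G" and conn: "connected_space (mtop (mfd G))" and Y: "Y \<in> lie_algebra G"
    and 0: "\<And>X. X \<in> lie_algebra G \<Longrightarrow> bracket G X Y = 0" and g: "g \<in> carrier G"
  shows "Ad G g Y = Y"
proof -
  interpret group G by (rule lie_groupD(1)[OF G])
  note M = lie_groupD(3)[OF G]
  note V = model_subspace[OF M]
  note top = lie_groupD(4)[OF G]
  have loc: "\<exists>Q. openin (mtop (mfd G)) Q \<and> g \<in> Q \<and> (\<forall>h\<in>Q. Ad G h Y = Ad G g Y)" if g: "g \<in> carrier G" for g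
  proof -
    obtain c where c: "c \<in> atlas (mfd G)" "g \<in> fst c" using ex_chart[OF M] g top by blast
    have cG: "h \<in> carrier G" if "h \<in> fst c" for h using chart_subset[OF M c(1)] that top by auto
    let ?f = "\<lambda>p. Ad G (cinv c p) Y"
    have S: "openin (top_of_set (lie_algebra G)) (snd c ` fst c)"
      using chart_image_open[OF M c(1) chart_openin[OF M c(1)]] by simp
    then obtain O' where O': "open O'" "snd c ` fst c = lie_algebra G \<inter> O'" by (auto simp: openin_open)
    have "snd c g \<in> O'" using O'(2) c(2) by blast
    then obtain r where r: "0 < r" "ball (snd c g) r \<subseteq> O'" using O'(1) open_contains_ball by blast
    define B where "B = ball (snd c g) r \<inter> lie_algebra G"
    have BS: "B \<subseteq> snd c ` fst c" using r O' by (auto simp: B_def)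
    have cvx: "convex B" unfolding B_def by (rule convex_Int[OF convex_ball subspace_imp_convex[OF V]])
    have der: "(?f has_derivative (\<lambda>h. 0)) (at p within B)" if p: "p \<in> B" for p
    proof -
      obtain h where h: "h \<in> fst c" "p = snd c h" using p BS by auto
      have pV: "p \<in> lie_algebra G" using p by (simp add: B_def)
      let ?D = "fderiv (mfd G) c (\<lambda>g. Ad G g Y) h"
      have D: "(?f has_derivative ?D) (at p within lie_algebra G)"
        using sfun_has_derivative[OF M sfun_Ad[OF G Y] cG[OF h(1)] c(1) h(1)] h(2) by simp
      have D0: "?D v = 0" if v: "v \<in> lie_algebra G" for v
      proof -
        obtain \<alpha> where \<alpha>: "\<alpha> 0 = h" "hasvel c \<alpha> v" using hasvel_exists[OF M c(1) h(1) v] .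
        let ?L = "\<lambda>x. inv\<^bsub>G\<^esub> h \<otimes>\<^bsub>G\<^esub> x"
        have L: "smooth_map (mfd G) (mfd G) ?L" by (rule smooth_map_left_mult[OF G inv_closed[OF cG[OF h(1)]]])
        have "?L (\<alpha> 0) \<in> fst (id_chart G)" using \<alpha>(1) cG[OF h(1)] id_chart(2)[OF G] by simp
        from hasvel_smooth_map[OF M M L c(1) id_chart(1)[OF G] \<alpha>(2) this]
        obtain X where "hasvel (id_chart G) (\<lambda>t. ?L (\<alpha> t)) X" by blast
        then have X: "tan1 G (\<lambda>t. ?L (\<alpha> t)) X" using \<alpha>(1) cG[OF h(1)] by (simp add: tan1_def)
        have d1: "((\<lambda>t. Ad G h (Ad G (?L (\<alpha> t)) Y)) has_vector_derivative Ad G h (bracket G X Y)) (at 0)"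
          by (rule bounded_linear.has_vector_derivative[OF bounded_linear_Ad[OF G cG[OF h(1)]] tan1_bracket[OF G X Y]])
        have d0: "Ad G h (bracket G X Y) = 0"
          using 0[OF tan1_in[OF G X]] linear_0[OF bounded_linear.linear[OF bounded_linear_Ad[OF G cG[OF h(1)]]]] by simp
        have ev: "\<forall>\<^sub>F t in nhds 0. Ad G h (Ad G (?L (\<alpha> t)) Y) = Ad G (\<alpha> t) Y"
        proof -
          have "\<forall>\<^sub>F t in nhds 0. \<alpha> t \<in> fst c" using \<alpha>(2) by (simp add: hasvel_def)
          then show ?thesis
          proof eventually_elim
            case (elim t)
            have "h \<otimes>\<^bsub>G\<^esub> ?L (\<alpha> t) = \<alpha> t" using cG[OF h(1)] cG[OF elim] by (simp add: m_assoc[symmetric])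
            then show ?case using Ad_mult[OF G cG[OF h(1)] _ Y, of "?L (\<alpha> t)"] cG[OF h(1)] cG[OF elim] by simp
          qed
        qed
        have "((\<lambda>t. Ad G (\<alpha> t) Y) has_vector_derivative 0) (at 0)" using hvd_cong[OF ev d1] unfolding d0 .
        moreover have "((\<lambda>t. Ad G (\<alpha> t) Y) has_vector_derivative ?D v) (at 0)"
          using hasvel_sfun[OF M sfun_Ad[OF G Y] c(1) \<alpha>(2)] \<alpha>(1) cG[OF h(1)] by simp
        ultimately show ?thesis by (rule vector_derivative_unique_at[symmetric])
      qed
      have 1: "(sub_proj (lie_algebra G) has_derivative sub_proj (lie_algebra G)) (at p within lie_algebra G)"
        by (rule bounded_linear_imp_has_derivative[OF bounded_linear_sub_proj])
      have 2: "(?f has_derivative ?D) (at (sub_proj (lie_algebra G) p) within sub_proj (lie_algebra G) ` lie_algebra G)"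
        unfolding sub_proj_id[OF V pV] by (rule has_derivative_subset[OF D]) (use sub_proj_in[OF V] in auto)
      have "((\<lambda>x. ?f (sub_proj (lie_algebra G) x)) has_derivative (\<lambda>v. 0)) (at p within lie_algebra G)"
        using diff_chain_within[OF 1 2] D0 sub_proj_in[OF V] by (simp add: o_def)
      then have "(?f has_derivative (\<lambda>v. 0)) (at p within lie_algebra G)"
        by (rule has_derivative_transform[OF pV, rotated]) (simp add: sub_proj_id[OF V])
      then show ?thesis by (rule has_derivative_subset) (auto simp: B_def)
    qed
    from has_derivative_zero_constant[OF cvx der]
    obtain k where k: "\<And>p. p \<in> B \<Longrightarrow> ?f p = k" by blast
    define Q where "Q = {h \<in> fst c. snd c h \<in> B}"
    have "openin (top_of_set (lie_algebra G)) B" by (auto simp: B_def openin_open)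
    then have "openin (mtop (mfd G)) Q" unfolding Q_def by (rule chart_preimage_open[OF M c(1)])
    moreover have gQ: "g \<in> Q" using c(2) r(1) chart_in_model[OF M c] by (simp add: Q_def B_def)
    moreover have "Ad G h Y = k" if "h \<in> Q" for h using k[of "snd c h"] that M c(1) by (simp add: Q_def)
    then have "\<forall>h\<in>Q. Ad G h Y = Ad G g Y" using gQ by simp
    ultimately show ?thesis by blast
  qed
  let ?E = "{h \<in> carrier G. Ad G h Y = Y}" and ?E' = "{h \<in> carrier G. Ad G h Y \<noteq> Y}"
  \<comment> \<open>For a locally constant function every predicate cuts out an open set, so the set
    where \<open>Ad h Y = Y\<close> and its complement are both open.\<close>
  have opn: "openin (mtop (mfd G)) {h \<in> carrier G. P (Ad G h Y)}" for P
  proof (subst openin_subopen, intro ballI)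
    fix h assume "h \<in> {h \<in> carrier G. P (Ad G h Y)}"
    then have h: "h \<in> carrier G" "P (Ad G h Y)" by auto
    from loc[OF h(1)] obtain Q where Q: "openin (mtop (mfd G)) Q" "h \<in> Q" "\<forall>k\<in>Q. Ad G k Y = Ad G h Y" by blast
    have QG: "Q \<subseteq> carrier G" using openin_subset[OF Q(1)] top by simp
    show "\<exists>T. openin (mtop (mfd G)) T \<and> h \<in> T \<and> T \<subseteq> {h \<in> carrier G. P (Ad G h Y)}"
    proof (intro exI[of _ Q] conjI Q(1,2) subsetI)
      fix k assume k: "k \<in> Q"
      then have e: "Ad G k Y = Ad G h Y" using Q(3) by blast
      show "k \<in> {h \<in> carrier G. P (Ad G h Y)}" using QG k h(2) unfolding mem_Collect_eq e by blast
    qed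
  qed
  have "?E' = {}"
  proof (rule ccontr)
    assume "?E' \<noteq> {}"
    moreover have "?E \<noteq> {}" using Ad_one[OF G Y] by auto
    moreover have "openin (mtop (mfd G)) ?E" by (rule opn)
    moreover have "openin (mtop (mfd G)) ?E'" by (rule opn)
    moreover have "topspace (mtop (mfd G)) \<subseteq> ?E \<union> ?E'" "?E \<inter> ?E' = {}" using top by auto
    ultimately show False using conn unfolding connected_space_def by blast
  qed
  then show ?thesis using g by blast
qed

subsection \<open>Lie subgroups\<close>

lemma lie_subgroupD:
  assumes "lie_subgroup K G" and G: "lie_group G"
  shows "lie_group K" "subgroup (carrier K) G" "embedded_submanifold (mfd K) (mfd G)"
    "\<And>x y. x \<in> carrier K \<Longrightarrow> y \<in> carrier K \<Longrightarrow> x \<otimes>\<^bsub>K\<^esub> y = x \<otimes>\<^bsub>G\<^esub> y" "\<one>\<^bsub>K\<^esub> = \<one>\<^bsub>G\<^esub>"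
    "smooth_map (mfd K) (mfd G) (\<lambda>x. x)" "(\<lambda>x. x) \<in> hom K G" "\<And>x. x \<in> carrier K \<Longrightarrow> inv\<^bsub>K\<^esub> x = inv\<^bsub>G\<^esub> x"
    "carrier K \<subseteq> carrier G"
proof -
  show K: "lie_group K" and s: "subgroup (carrier K) G" and e: "embedded_submanifold (mfd K) (mfd G)"
    and m: "\<And>x y. x \<in> carrier K \<Longrightarrow> y \<in> carrier K \<Longrightarrow> x \<otimes>\<^bsub>K\<^esub> y = x \<otimes>\<^bsub>G\<^esub> y"
    using assms unfolding lie_subgroup_def by blast+
  show "smooth_map (mfd K) (mfd G) (\<lambda>x. x)" by (rule embedded_submanifoldD(5)[OF e])
  show sub: "carrier K \<subseteq> carrier G" by (rule subgroup.subset[OF s])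
  show hom: "(\<lambda>x. x) \<in> hom K G" using sub m by (auto simp: hom_def)
  interpret group_hom K G "\<lambda>x. x"
    using lie_groupD(1)[OF K] lie_groupD(1)[OF G] hom by (simp add: group_hom_def group_hom_axioms_def)
  show "\<one>\<^bsub>K\<^esub> = \<one>\<^bsub>G\<^esub>" by (rule hom_one)
  show "inv\<^bsub>K\<^esub> x = inv\<^bsub>G\<^esub> x" if "x \<in> carrier K" for x by (rule hom_inv[OF that])
qed

lemma lie_subgroup_inj:
  assumes K: "lie_subgroup K G" and G: "lie_group G" and X: "X \<in> lie_algebra K" "diff_one K G (\<lambda>x. x) X = 0"
  shows "X = 0"
proof -
  note K' = lie_subgroupD[OF K G]
  show ?thesis
    by (rule embedded_submanifold_inj[OF K'(3) id_chart(1)[OF K'(1)] id_chart(1)[OF G] id_chart(2)[OF K'(1)] _ X(1)])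
      (use X(2) id_chart(2)[OF G] K'(5) in \<open>simp_all add: diff_one_def\<close>)
qed

text \<open>A one-parameter subgroup of \<open>G\<close> with values in \<open>K\<close> is smooth
  into \<open>K\<close>, because \<open>K\<close> is embedded. Exponentials thus decide which
  vectors belong to the Lie algebra of \<open>K\<close>.\<close>

lemma one_param_subgroup_lift:
  assumes K: "lie_subgroup K G" and G: "lie_group G" and \<gamma>: "one_parameter_subgroup G X \<gamma>" "\<And>t. \<gamma> t \<in> carrier K"
  obtains Y where "Y \<in> lie_algebra K" "diff_one K G (\<lambda>x. x) Y = X" "one_parameter_subgroup K Y \<gamma>"
proof -
  note K' = lie_subgroupD[OF K G]
  note \<gamma>' = one_paramD[OF G \<gamma>(1)]
  have sm: "smooth_map real_line (mfd K) \<gamma>"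
    by (rule smooth_map_into_embedded[OF pre_manifold_real_line lie_groupD(3)[OF G] K'(3) \<gamma>'(6)])
      (simp add: lie_groupD(4)[OF K'(1)] \<gamma>(2))
  have t: "hasvel (UNIV, id) (\<lambda>t::real. t) 1"
    unfolding hasvel_def by (auto intro!: derivative_eq_intros)
  have 1: "\<gamma> 0 \<in> fst (id_chart K)" using \<gamma>'(3) K'(5) id_chart(2)[OF K'(1)] by simp
  obtain Y where Y: "hasvel (id_chart K) \<gamma> Y"
    using hasvel_smooth_map[OF pre_manifold_real_line lie_groupD(3)[OF K'(1)] sm _ id_chart(1)[OF K'(1)] t 1] by auto
  then have tY: "tan1 K \<gamma> Y" using \<gamma>'(3) K'(5) by (simp add: tan1_def)
  have op: "one_parameter_subgroup K Y \<gamma>" by (rule one_paramI[OF sm _ tY]) (simp add: \<gamma>'(2) K'(4) \<gamma>(2))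
  have "diff_one K G (\<lambda>x. x) Y = X" by (rule diff_one_eq[OF K'(1) G K'(6) K'(5) tY \<gamma>'(4)])
  with that[OF tan1_in[OF K'(1) tY] _ op] show thesis by blast
qed

section \<open>Linear algebra\<close>

subsection \<open>The spectral theorem on a subspace\<close>

text \<open>Bilinearity is imposed on the whole type so that general rules apply, but symmetry and
  positivity on \<open>V\<close> alone: the forms used below either factor through a projection or
  degenerate outside a subspace.\<close>

locale ip_space =
  fixes V :: "'e::euclidean_space set" and ip :: "'e \<Rightarrow> 'e \<Rightarrow> real"
  assumes V: "subspace V" and ip: "bilinear ip"
    and ip_sym: "\<And>x y. x \<in> V \<Longrightarrow> y \<in> V \<Longrightarrow> ip x y = ip y x"
    and ip_pos: "\<And>x. x \<in> V \<Longrightarrow> x \<noteq> 0 \<Longrightarrow> 0 < ip x x"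
begin

lemma ip_simps:
  "ip (x + y) z = ip x z + ip y z" "ip x (y + z) = ip x y + ip x z"
  "ip (r *\<^sub>R x) z = r * ip x z" "ip x (r *\<^sub>R z) = r * ip x z"
  "ip (x - y) z = ip x z - ip y z" "ip x (y - z) = ip x y - ip x z"
  "ip 0 z = 0" "ip x 0 = 0" "ip (- x) z = - ip x z" "ip x (- z) = - ip x z"
  using ip by (simp_all add: bilinear_ladd bilinear_radd bilinear_lmul bilinear_rmul bilinear_lsub bilinear_rsub
      bilinear_lzero bilinear_rzero bilinear_lneg bilinear_rneg)

lemma ip_sum: "ip (\<Sum>i\<in>I. f i) z = (\<Sum>i\<in>I. ip (f i) z)"
  using ip linear_sum[of "\<lambda>x. ip x z" f I] by (simp add: bilinear_def)

lemma ip_eq_0: "x \<in> V \<Longrightarrow> (\<And>y. y \<in> V \<Longrightarrow> ip x y = 0) \<Longrightarrow> x = 0"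
  using ip_pos by force

text \<open>The Rayleigh quotient attains its maximum \<open>k\<close> on the Euclidean unit sphere
  of \<open>W\<close>. The form \<open>H\<close>, which is \<open>k\<close> times \<open>ip\<close>
  minus the form of \<open>F\<close>, is then positive semidefinite on \<open>W\<close> and vanishes
  at the maximiser, so the maximiser lies in its kernel.\<close>

lemma symmetric_eigenvector:
  assumes W: "subspace W" "W \<subseteq> V" "W \<noteq> {0}" and F: "linear F" "F ` W \<subseteq> W"
    and sym: "\<And>x y. x \<in> W \<Longrightarrow> y \<in> W \<Longrightarrow> ip (F x) y = ip x (F y)"
  obtains x k where "x \<in> W" "x \<noteq> 0" "F x = k *\<^sub>R x"
proof -
  let ?K = "W \<inter> sphere 0 1"
  have bb: "bounded_bilinear ip" using ip by (rule bilinear_conv_bounded_bilinear[THEN iffD1])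
  have contF: "continuous_on ?K F" using F(1) by (simp add: linear_continuous_on linear_linear)
  obtain w where w: "w \<in> W" "w \<noteq> 0" using W(1,3) subspace_0 by blast
  have "compact ?K" using W(1) by (simp add: closed_Int_compact closed_subspace)
  moreover have "w /\<^sub>R norm w \<in> ?K" using w W(1) by (auto intro: subspace_scale)
  moreover have "continuous_on ?K (\<lambda>x. ip (F x) x / ip x x)"
  proof (intro continuous_on_divide bounded_bilinear.continuous_on[OF bb] contF continuous_on_id ballI)
    fix x assume "x \<in> ?K"
    then have "x \<in> V" "x \<noteq> 0" using W(2) by auto
    then show "ip x x \<noteq> 0" using ip_pos by force
  qed
  ultimately obtain x where x: "x \<in> ?K" and max: "\<And>y. y \<in> ?K \<Longrightarrow> ip (F y) y / ip y y \<le> ip (F x) x / ip x x"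
    using continuous_attains_sup[of ?K "\<lambda>x. ip (F x) x / ip x x"] by blast
  have xW: "x \<in> W" "x \<noteq> 0" "x \<in> V" using x W(2) by auto
  define k where "k = ip (F x) x / ip x x"
  define H where "H y z = k * ip y z - ip (F y) z" for y z
  have Hnn: "0 \<le> H y y" if y: "y \<in> W" for y
  proof (cases "y = 0")
    case False
    let ?u = "y /\<^sub>R norm y"
    have "?u \<in> ?K" using y False W(1) by (auto intro: subspace_scale)
    from max[OF this] have "ip (F ?u) ?u / ip ?u ?u \<le> k" by (simp add: k_def)
    then have "ip (F y) y / ip y y \<le> k" using False by (simp add: linear_cmul[OF F(1)] ip_simps)
    then show ?thesis using ip_pos[of y] y W(2) False by (auto simp: H_def pos_divide_le_eq)
  qed (simp add: H_def ip_simps)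
  have Hxx: "H x x = 0" using ip_pos[OF xW(3,2)] by (simp add: H_def k_def)
  have "H x z = 0" if z: "z \<in> W" for z
  proof (rule ccontr)
    assume ne: "H x z \<noteq> 0"
    have Hexp: "H (x + t *\<^sub>R z) (x + t *\<^sub>R z) = 2 * t * H x z + t\<^sup>2 * H z z" for t
    proof -
      have "ip z x = ip x z" using ip_sym z xW W(2) by blast
      moreover have "ip (F z) x = ip (F x) z"
        using sym[OF z xW(1)] ip_sym[of z "F x"] z xW(1) F(2) W(2) by auto
      ultimately have "H z x = H x z" by (simp add: H_def)
      moreover have "H (x + t *\<^sub>R z) (x + t *\<^sub>R z) = H x x + t * H x z + t * H z x + t * t * H z z"
        by (simp add: H_def ip_simps linear_add[OF F(1)] linear_cmul[OF F(1)] algebra_simps)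
      ultimately show ?thesis using Hxx by (simp add: power2_eq_square)
    qed
    have zz: "0 \<le> H z z" by (rule Hnn[OF z])
    \<comment> \<open>The minimiser of the quadratic polynomial would divide by
      \<open>H z z\<close>, which may be zero. Adding \<open>1\<close> still produces a negative
      value.\<close>
    define t where "t = - H x z / (H z z + 1)"
    have "0 \<le> 2 * t * H x z + t\<^sup>2 * H z z"
      using Hnn[of "x + t *\<^sub>R z"] Hexp[of t] xW(1) z W(1) by (simp add: subspace_add subspace_scale)
    moreover have "2 * t * H x z + t\<^sup>2 * H z z = - ((H x z)\<^sup>2 * (H z z + 2) / (H z z + 1)\<^sup>2)"
      using zz by (simp add: t_def field_simps power2_eq_square add_nonneg_eq_0_iff)
    moreover have "0 < (H x z)\<^sup>2 * (H z z + 2) / (H z z + 1)\<^sup>2"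
      using ne zz by (intro divide_pos_pos mult_pos_pos) auto
    ultimately show False by linarith
  qed
  then have 0: "ip (k *\<^sub>R x - F x) z = 0" if "z \<in> W" for z using that by (simp add: H_def ip_simps)
  have "k *\<^sub>R x - F x \<in> W" using xW(1) F(2) W(1) by (auto intro!: subspace_diff subspace_scale)
  with 0[OF this] have "k *\<^sub>R x - F x = 0" using ip_pos W(2) by force
  then show thesis using that[OF xW(1,2), of k] by simp
qed

definition orthonormal :: "'e set \<Rightarrow> bool" where
  "orthonormal E \<longleftrightarrow> finite E \<and> E \<subseteq> V \<and> (\<forall>e\<in>E. \<forall>f\<in>E. ip e f = (if e = f then 1 else 0))"

text \<open>Induction on the dimension: split off one normalised eigenvector and continue in its
  orthogonal complement, which \<open>F\<close> preserves by symmetry.\<close>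

theorem spectral:
  assumes F: "linear F"
  shows "subspace W \<Longrightarrow> W \<subseteq> V \<Longrightarrow> F ` W \<subseteq> W \<Longrightarrow>
    (\<And>x y. x \<in> W \<Longrightarrow> y \<in> W \<Longrightarrow> ip (F x) y = ip x (F y)) \<Longrightarrow>
    \<exists>E. orthonormal E \<and> E \<subseteq> W \<and> (\<forall>e\<in>E. \<exists>k. F e = k *\<^sub>R e) \<and> (\<forall>x\<in>W. x = (\<Sum>e\<in>E. ip x e *\<^sub>R e))"
proof (induction "dim W" arbitrary: W rule: less_induct)
  case less
  show ?case
  proof (cases "W = {0}")
    case True
    then show ?thesis by (intro exI[of _ "{}"]) (auto simp: orthonormal_def)
  next
    case False
    obtain x k where x: "x \<in> W" "x \<noteq> 0" "F x = k *\<^sub>R x"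
      using symmetric_eigenvector[OF less.prems(1,2) False F less.prems(3,4)] .
    have xx: "0 < ip x x" using ip_pos x less.prems(2) by blast
    define e where "e = (1 / sqrt (ip x x)) *\<^sub>R x"
    have e: "e \<in> W" "F e = k *\<^sub>R e" "ip e e = 1"
      using x xx less.prems(1) by (auto simp: e_def subspace_scale linear_cmul[OF F] ip_simps)
    have eV: "e \<in> V" using e less.prems(2) by auto
    define W' where "W' = {y \<in> W. ip y e = 0}"
    have W': "subspace W'" "W' \<subseteq> W"
      using less.prems(1) by (auto simp: W'_def subspace_def ip_simps)
    have "e \<notin> W'" using e by (simp add: W'_def)
    then have "W' \<subset> W" using W'(2) e(1) by blast
    then have dim: "dim W' < dim W"
      using dim_psubset[of W' W] W'(1) less.prems(1) by (simp add: span_eq_iff[THEN iffD2])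
    have FW: "F ` W' \<subseteq> W'"
    proof safe
      fix y assume y: "y \<in> W'"
      then have "ip (F y) e = ip y (F e)" using less.prems(4)[of y e] e(1) by (simp add: W'_def)
      then show "F y \<in> W'" using y less.prems(3) e(2) by (auto simp: W'_def ip_simps)
    qed
    have sym: "ip (F x) y = ip x (F y)" if "x \<in> W'" "y \<in> W'" for x y
      using less.prems(4)[of x y] that by (simp add: W'_def)
    obtain E where E: "orthonormal E" "E \<subseteq> W'" "\<forall>e\<in>E. \<exists>k. F e = k *\<^sub>R e" "\<forall>x\<in>W'. x = (\<Sum>e\<in>E. ip x e *\<^sub>R e)"
      using less.hyps[OF dim W'(1) order_trans[OF W'(2) less.prems(2)] FW sym] by blast
    have eE: "e \<notin> E" using E(2) \<open>e \<notin> W'\<close> by blast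
    have orth: "ip f e = 0" "ip e f = 0" if "f \<in> E" for f
    proof -
      show "ip f e = 0" using that E(2) by (auto simp: W'_def)
      then show "ip e f = 0" using ip_sym[of e f] eV that E(2) W'(2) less.prems(2) by auto
    qed
    have "orthonormal (insert e E)"
      using E(1) eV orth e(3) eE by (auto simp: orthonormal_def)
    moreover have "y = (\<Sum>f\<in>insert e E. ip y f *\<^sub>R f)" if y: "y \<in> W" for y
    proof -
      let ?y = "y - ip y e *\<^sub>R e"
      have "?y \<in> W'" using y e less.prems(1) by (auto simp: W'_def ip_simps intro!: subspace_diff subspace_scale)
      then have "?y = (\<Sum>f\<in>E. ip ?y f *\<^sub>R f)" using E(4) by blast
      also have "\<dots> = (\<Sum>f\<in>E. ip y f *\<^sub>R f)" by (intro sum.cong refl) (simp add: ip_simps orth)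
      finally show ?thesis using E(1) eE by (simp add: orthonormal_def algebra_simps)
    qed
    ultimately show ?thesis using E(2,3) W'(2) e(1,2) by (intro exI[of _ "insert e E"]) auto
  qed
qed

text \<open>The spectral theorem for the identity map supplies an orthonormal basis of
  \<open>W\<close>; the projection is written in it.\<close>

lemma orthogonal_split:
  assumes W: "subspace W" "W \<subseteq> V" and x: "x \<in> V"
  obtains v w where "v \<in> W" "w \<in> V" "x = v + w" "\<forall>d\<in>W. ip d w = 0"
proof -
  obtain E where E: "orthonormal E" "E \<subseteq> W" "\<forall>x\<in>W. x = (\<Sum>e\<in>E. ip x e *\<^sub>R e)"
    using spectral[OF linear_ident W _ refl] by (metis image_ident order_refl)
  define v where "v = (\<Sum>e\<in>E. ip x e *\<^sub>R e)"
  define w where "w = x - v"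
  have v: "v \<in> W" unfolding v_def using E(2) W(1) by (intro subspace_sum subspace_scale) auto
  have wV: "w \<in> V" using x v W(2) V by (auto simp: w_def intro: subspace_diff)
  have 0: "ip w e = 0" if e: "e \<in> E" for e
  proof -
    have "ip v e = (\<Sum>f\<in>E. if f = e then ip x e else 0)"
      unfolding v_def ip_sum using E(1) e by (intro sum.cong refl) (auto simp: ip_simps orthonormal_def)
    also have "\<dots> = ip x e" using E(1) e by (simp add: orthonormal_def)
    finally show ?thesis by (simp add: w_def ip_simps)
  qed
  have "\<forall>d\<in>W. ip d w = 0"
  proof
    fix d assume d: "d \<in> W"
    have "ip d w = (\<Sum>e\<in>E. ip d e * ip e w)"
      using bspec[OF E(3) d] ip_sum[of "\<lambda>e. ip d e *\<^sub>R e" E w] by (simp add: ip_simps)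
    also have "\<dots> = 0" using 0 ip_sym[OF _ wV] E(2) W(2) by (intro sum.neutral) auto
    finally show "ip d w = 0" .
  qed
  from that[OF v wV _ this] show thesis by (simp add: w_def)
qed

definition onbasis :: "'e set" where
  "onbasis = (SOME E. orthonormal E \<and> (\<forall>x\<in>V. x = (\<Sum>e\<in>E. ip x e *\<^sub>R e)))"

lemma onbasis: "orthonormal onbasis" "\<And>x. x \<in> V \<Longrightarrow> x = (\<Sum>e\<in>onbasis. ip x e *\<^sub>R e)"
proof -
  have "\<exists>E. orthonormal E \<and> (\<forall>x\<in>V. x = (\<Sum>e\<in>E. ip x e *\<^sub>R e))"
    using spectral[of "\<lambda>x. x" V] V linear_ident by auto
  from someI_ex[OF this] show "orthonormal onbasis" "\<And>x. x \<in> V \<Longrightarrow> x = (\<Sum>e\<in>onbasis. ip x e *\<^sub>R e)"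
    unfolding onbasis_def[symmetric] by auto
qed

lemma onbasis_V: "e \<in> onbasis \<Longrightarrow> e \<in> V"
  using onbasis(1) by (auto simp: orthonormal_def)

text \<open>The trace of an endomorphism of \<open>V\<close>, from which the Killing form is
  built.\<close>

definition tr :: "('e \<Rightarrow> 'e) \<Rightarrow> real" where
  "tr F = (\<Sum>e\<in>onbasis. ip (F e) e)"

lemma tr_cong: "(\<And>v. v \<in> V \<Longrightarrow> F v = G v) \<Longrightarrow> tr F = tr G"
  unfolding tr_def by (intro sum.cong refl) (simp add: onbasis_V)

lemma tr_simps:
  "tr (\<lambda>v. F v + G v) = tr F + tr G" "tr (\<lambda>v. F v - G v) = tr F - tr G" "tr (\<lambda>v. r *\<^sub>R F v) = r * tr F" "tr (\<lambda>v. 0) = 0"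
  by (simp_all add: tr_def ip_simps sum.distrib sum_subtractf sum_distrib_left)

lemma tr_cyclic:
  assumes F: "linear F" "\<And>v. v \<in> V \<Longrightarrow> F v \<in> V" and G: "linear G" "\<And>v. v \<in> V \<Longrightarrow> G v \<in> V"
  shows "tr (\<lambda>v. F (G v)) = tr (\<lambda>v. G (F v))"
proof -
  have expand: "tr (\<lambda>v. F (G v)) = (\<Sum>e\<in>onbasis. \<Sum>f\<in>onbasis. ip (G e) f * ip (F f) e)"
    if F: "linear F" and G: "\<And>v. v \<in> V \<Longrightarrow> G v \<in> V" for F G
    unfolding tr_def
  proof (intro sum.cong refl)
    fix e assume "e \<in> onbasis"
    then have "G e = (\<Sum>f\<in>onbasis. ip (G e) f *\<^sub>R f)" by (intro onbasis(2) G onbasis_V)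
    then have "F (G e) = F (\<Sum>f\<in>onbasis. ip (G e) f *\<^sub>R f)" by (rule arg_cong)
    also have "\<dots> = (\<Sum>f\<in>onbasis. ip (G e) f *\<^sub>R F f)" by (simp add: linear_sum[OF F] linear_cmul[OF F])
    finally show "ip (F (G e)) e = (\<Sum>f\<in>onbasis. ip (G e) f * ip (F f) e)" by (simp add: ip_sum ip_simps)
  qed
  have "tr (\<lambda>v. F (G v)) = (\<Sum>e\<in>onbasis. \<Sum>f\<in>onbasis. ip (G e) f * ip (F f) e)" by (rule expand[OF F(1) G(2)])
  also have "\<dots> = (\<Sum>e\<in>onbasis. \<Sum>f\<in>onbasis. ip (F e) f * ip (G f) e)"
    by (subst sum.swap) (simp add: mult.commute)
  also have "\<dots> = tr (\<lambda>v. G (F v))" by (rule expand[OF G(1) F(2), symmetric])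
  finally show ?thesis .
qed

end

subsection \<open>Positive automorphisms of a reductive Lie algebra\<close>

text \<open>\<open>ip_br\<close> says that the adjoint of \<open>br x\<close> is minus
  \<open>br (\<tau> x)\<close>. It is the defining feature of a Cartan involution, and it makes
  orthogonal complements of ideals ideals.\<close>

locale reductive_algebra = ip_space V ip
  for V :: "'e::euclidean_space set" and ip +
  fixes br :: "'e \<Rightarrow> 'e \<Rightarrow> 'e" and \<tau> :: "'e \<Rightarrow> 'e"
  assumes br: "bilinear br" and br_V: "\<And>x y. x \<in> V \<Longrightarrow> y \<in> V \<Longrightarrow> br x y \<in> V"
    and br_anti: "\<And>x y. x \<in> V \<Longrightarrow> y \<in> V \<Longrightarrow> br y x = - br x y"
    and jacobi: "\<And>x y z. x \<in> V \<Longrightarrow> y \<in> V \<Longrightarrow> z \<in> V \<Longrightarrow> br x (br y z) = br (br x y) z + br y (br x z)"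
    and \<tau>: "linear \<tau>" "\<And>x. x \<in> V \<Longrightarrow> \<tau> x \<in> V" "\<And>x. x \<in> V \<Longrightarrow> \<tau> (\<tau> x) = x"
    "\<And>x y. x \<in> V \<Longrightarrow> y \<in> V \<Longrightarrow> \<tau> (br x y) = br (\<tau> x) (\<tau> y)"
    and ip_br: "\<And>x y z. x \<in> V \<Longrightarrow> y \<in> V \<Longrightarrow> z \<in> V \<Longrightarrow> ip (br x y) z = - ip y (br (\<tau> x) z)"
begin

lemma br_simps:
  "br (x + y) z = br x z + br y z" "br x (y + z) = br x y + br x z"
  "br (r *\<^sub>R x) z = r *\<^sub>R br x z" "br x (r *\<^sub>R z) = r *\<^sub>R br x z"
  "br (x - y) z = br x z - br y z" "br x (y - z) = br x y - br x z"
  "br 0 z = 0" "br x 0 = 0" "br (- x) z = - br x z" "br x (- z) = - br x z"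
  using br by (simp_all add: bilinear_ladd bilinear_radd bilinear_lmul bilinear_rmul bilinear_lsub bilinear_rsub
      bilinear_lzero bilinear_rzero bilinear_lneg bilinear_rneg)

lemma linear_br: "linear (br x)"
  using br by (simp add: bilinear_def)

section \<open>Centre and derived algebra\<close>

definition centre :: "'e set" where
  "centre = {x \<in> V. \<forall>y\<in>V. br x y = 0}"

definition derived :: "'e set" where
  "derived = span {br x y | x y. x \<in> V \<and> y \<in> V}"

lemma centreD: "w \<in> centre \<Longrightarrow> w \<in> V" "w \<in> centre \<Longrightarrow> y \<in> V \<Longrightarrow> br w y = 0" "w \<in> centre \<Longrightarrow> y \<in> V \<Longrightarrow> br y w = 0"
  using br_anti[of w y] by (simp_all add: centre_def)

lemma derived_V: "derived \<subseteq> V"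
  unfolding derived_def using V br_V by (intro span_minimal) auto

lemma subspace_derived: "subspace derived"
  unfolding derived_def by simp

lemma br_derived: "x \<in> V \<Longrightarrow> y \<in> V \<Longrightarrow> br x y \<in> derived"
  unfolding derived_def by (intro span_base) blast

lemma centre_orth_derived:
  assumes w: "w \<in> centre" and x: "x \<in> derived" shows "ip x w = 0"
proof -
  have "derived \<subseteq> {x. ip x w = 0}"
    unfolding derived_def
  proof (rule span_minimal)
    show "{br x y | x y. x \<in> V \<and> y \<in> V} \<subseteq> {x. ip x w = 0}"
      using ip_br centreD[OF w] \<tau>(2) by (auto simp: ip_simps)
    show "subspace {x. ip x w = 0}" by (auto simp: subspace_def ip_simps)
  qed
  then show ?thesis using x by blast
qed

lemma centre_derived: "x \<in> centre \<Longrightarrow> x \<in> derived \<Longrightarrow> x = 0"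
  using centre_orth_derived[of x x] ip_pos[of x] centreD(1) by force

text \<open>The orthogonal complement of the derived algebra is central, because the adjoint of
  \<open>br a\<close> is, up to sign, again a bracket with an element of \<open>V\<close>.\<close>

lemma centre_plus_derived:
  assumes x: "x \<in> V"
  obtains w v where "w \<in> centre" "v \<in> derived" "x = w + v"
proof -
  obtain v w where v: "v \<in> derived" and wV: "w \<in> V" and xvw: "x = v + w" and orth: "\<forall>d\<in>derived. ip d w = 0"
    by (rule orthogonal_split[OF subspace_derived derived_V x])
  have "br a w = 0" if a: "a \<in> V" for a
  proof (rule ip_eq_0[OF br_V[OF a wV]])
    fix b assume b: "b \<in> V"
    have "ip (br (\<tau> a) b) w = - ip b (br a w)" using ip_br[OF \<tau>(2)[OF a] b wV] \<tau>(3)[OF a] by simp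
    then show "ip (br a w) b = 0" using bspec[OF orth br_derived[OF \<tau>(2)[OF a] b]] ip_sym[OF b br_V[OF a wV]] by simp
  qed
  then have "br w a = 0" if "a \<in> V" for a using br_anti[OF that wV] that by simp
  then have "w \<in> centre" using wV by (simp add: centre_def)
  then show thesis using that[OF _ v] xvw by (simp add: add.commute)
qed

section \<open>The Killing form, its twist by \<open>\<tau>\<close>, and inner derivations\<close>

definition \<kappa> :: "'e \<Rightarrow> 'e \<Rightarrow> real" where
  "\<kappa> x y = tr (\<lambda>v. br x (br y v))"

lemma bilinear_\<kappa>: "bilinear \<kappa>"
  unfolding bilinear_def linear_iff \<kappa>_def by (simp add: br_simps tr_simps)

lemma \<kappa>_sym: "x \<in> V \<Longrightarrow> y \<in> V \<Longrightarrow> \<kappa> x y = \<kappa> y x"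
  unfolding \<kappa>_def by (rule tr_cyclic[OF linear_br br_V linear_br br_V])

text \<open>An automorphism conjugates \<open>br x\<close> into \<open>br (S x)\<close>, and traces
  are cyclic; \<open>ip\<close> has no such invariance. As \<open>S\<close> is an involution,
  invariance takes the form of self-adjointness.\<close>

lemma \<kappa>_automorphism:
  assumes S: "linear S" "\<And>x. x \<in> V \<Longrightarrow> S x \<in> V" "\<And>x. x \<in> V \<Longrightarrow> S (S x) = x"
    "\<And>x y. x \<in> V \<Longrightarrow> y \<in> V \<Longrightarrow> S (br x y) = br (S x) (S y)" and x: "x \<in> V" and y: "y \<in> V"
  shows "\<kappa> (S x) y = \<kappa> x (S y)"
proof -
  let ?F = "\<lambda>v. br x (br (S y) v)"
  have lF: "linear ?F" using linear_compose[OF linear_br linear_br] by (simp add: o_def)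
  have FV: "?F v \<in> V" if "v \<in> V" for v using x y S(2) br_V that by auto
  have lFS: "linear (\<lambda>v. ?F (S v))" using linear_compose[OF S(1) lF] by (simp add: o_def)
  have "\<kappa> (S x) y = tr (\<lambda>v. S (?F (S v)))"
    unfolding \<kappa>_def
  proof (rule tr_cong)
    fix v assume v: "v \<in> V"
    show "br (S x) (br y v) = S (?F (S v))" using x y v by (simp add: S br_V)
  qed
  also have "\<dots> = tr (\<lambda>v. ?F (S (S v)))" by (rule tr_cyclic[OF S(1,2) lFS]) (use FV S(2) in auto)
  also have "\<dots> = \<kappa> x (S y)" unfolding \<kappa>_def by (rule tr_cong) (simp add: S(3))
  finally show ?thesis .
qed

definition q :: "'e \<Rightarrow> 'e \<Rightarrow> real" where
  "q x y = - \<kappa> x (\<tau> y)"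

lemma bilinear_q: "bilinear q"
  using bilinear_\<kappa> \<tau>(1) unfolding bilinear_def q_def linear_iff by simp

lemma q_sym: "x \<in> V \<Longrightarrow> y \<in> V \<Longrightarrow> q x y = q y x"
  unfolding q_def using \<kappa>_automorphism[OF \<tau>, of x y] \<kappa>_sym[of "\<tau> x" y] \<tau>(2) by simp

text \<open>Because minus \<open>br (\<tau> x)\<close> is the adjoint of \<open>br x\<close>, the
  value \<open>q x x\<close> is the sum of the squared lengths of \<open>br (\<tau> x) e\<close>
  over an orthonormal basis. It vanishes only if \<open>\<tau> x\<close>, and with it
  \<open>x\<close>, is central.\<close>

lemma q_nonneg: assumes x: "x \<in> V" shows "0 \<le> q x x" "q x x = 0 \<Longrightarrow> x \<in> centre"
proof -
  let ?y = "\<tau> x"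
  have y: "?y \<in> V" by (rule \<tau>(2)[OF x])
  have eq: "q x x = (\<Sum>e\<in>onbasis. ip (br ?y e) (br ?y e))"
    unfolding q_def \<kappa>_def tr_def
    by (simp add: sum_negf[symmetric] ip_br[OF x] br_V[OF y] onbasis_V)
  have nn: "0 \<le> ip (br ?y e) (br ?y e)" if "e \<in> onbasis" for e
    using ip_pos[of "br ?y e"] br_V[OF y onbasis_V[OF that]] by (cases "br ?y e = 0") (auto simp: ip_simps)
  show "0 \<le> q x x" unfolding eq by (rule sum_nonneg[OF nn])
  assume "q x x = 0"
  then have 0: "br ?y e = 0" if "e \<in> onbasis" for e
    using sum_nonneg_eq_0_iff[of onbasis "\<lambda>e. ip (br ?y e) (br ?y e)"] nn onbasis(1) that
      ip_pos[of "br ?y e"] br_V[OF y onbasis_V[OF that]] unfolding eq orthonormal_def by force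
  have "br ?y v = 0" if "v \<in> V" for v
  proof -
    have "br ?y v = br ?y (\<Sum>e\<in>onbasis. ip v e *\<^sub>R e)" using onbasis(2)[OF that] by simp
    also have "\<dots> = 0" by (simp add: linear_sum[OF linear_br] br_simps 0)
    finally show ?thesis .
  qed
  then have "br x v = 0" if "v \<in> V" for v
    using \<tau>(3,4)[of x] \<tau>(4)[of ?y "\<tau> v"] \<tau>(2,3) x y that linear_0[OF \<tau>(1)] by metis
  then show "x \<in> centre" using x by (simp add: centre_def)
qed

lemma \<kappa>_centre: "w \<in> centre \<Longrightarrow> \<kappa> w y = 0 " if "y \<in> V"
proof -
  assume w: "w \<in> centre"
  have "\<kappa> w y = tr (\<lambda>v. 0)" unfolding \<kappa>_def by (rule tr_cong) (simp add: centreD[OF w] br_V that)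
  then show ?thesis by (simp add: tr_simps)
qed

text \<open>The classical argument for semisimple algebras: represent the functional
  \<open>tr (D ad y)\<close> of \<open>y\<close> by some \<open>Z\<close> through the Killing form.
  The remainder \<open>R = D - ad Z\<close> is a derivation all of whose values are orthogonal to
  \<open>V\<close> for the Killing form, hence central; therefore \<open>R\<close> kills all
  brackets. On the centre, which the Killing form does not see, the assumption \<open>D0\<close>
  takes over.\<close>

lemma derivation_inner:
  assumes D: "linear D" "\<And>x. x \<in> V \<Longrightarrow> D x \<in> V" "\<And>x y. x \<in> V \<Longrightarrow> y \<in> V \<Longrightarrow> D (br x y) = br (D x) y + br x (D y)"
    and D0: "\<And>w. w \<in> centre \<Longrightarrow> D w = 0"
  obtains Z where "Z \<in> V" "\<And>v. v \<in> V \<Longrightarrow> br Z v = D v"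
proof -
  interpret q: ip_space derived q
  proof
    show "subspace derived" by (rule subspace_derived)
    show "bilinear q" by (rule bilinear_q)
    show "q x y = q y x" if "x \<in> derived" "y \<in> derived" for x y using q_sym derived_V that by blast
    show "0 < q x x" if "x \<in> derived" "x \<noteq> 0" for x
      using q_nonneg[of x] centre_derived[of x] that derived_V by force
  qed
  let ?E = q.onbasis
  define T where "T y = tr (\<lambda>v. D (br y v))" for y
  define s where "s = (\<Sum>e\<in>?E. T e *\<^sub>R e)"
  \<comment> \<open>\<open>s\<close> represents the functional for \<open>q\<close> on the derived
    algebra. Since \<open>q s v = \<kappa> (- \<tau> s) v\<close>, the twist turns this into a
    representation for the Killing form.\<close>
  define Z where "Z = - \<tau> s"
  have EV: "e \<in> V" if "e \<in> ?E" for e using q.onbasis_V[OF that] derived_V by auto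
  have sV: "s \<in> V" unfolding s_def using V EV by (intro subspace_sum subspace_scale)
  have Z: "Z \<in> V" using V \<tau>(2)[OF sV] by (simp add: Z_def subspace_neg)
  have \<kappa>Z: "\<kappa> Z y = T y" if y: "y \<in> V" for y
  proof -
    obtain w v where wv: "w \<in> centre" "v \<in> derived" "y = w + v" using centre_plus_derived[OF y] .
    have vV: "v \<in> V" using wv derived_V by auto
    have lT: "linear T" unfolding linear_iff T_def by (simp add: br_simps linear_add[OF D(1)] linear_cmul[OF D(1)] tr_simps)
    have "T w = tr (\<lambda>v. 0)" unfolding T_def by (rule tr_cong) (simp add: centreD(2)[OF wv(1)] linear_0[OF D(1)])
    then have Tw: "T w = 0" by (simp add: tr_simps)
    have "\<kappa> Z w = 0" using \<kappa>_centre[OF Z wv(1)] \<kappa>_sym[OF Z centreD(1)[OF wv(1)]] by simp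
    then have "\<kappa> Z y = \<kappa> Z v" using bilinear_radd[OF bilinear_\<kappa>] wv(3) by simp
    also have "\<dots> = q s v"
      by (simp add: Z_def bilinear_lneg[OF bilinear_\<kappa>] \<kappa>_automorphism[OF \<tau> sV vV] q_def)
    also have "\<dots> = (\<Sum>e\<in>?E. T e * q v e)"
      unfolding s_def q.ip_sum by (intro sum.cong refl) (simp add: q.ip_simps q_sym[OF vV EV])
    also have "\<dots> = T (\<Sum>e\<in>?E. q v e *\<^sub>R e)" by (simp add: linear_sum[OF lT] linear_cmul[OF lT] mult.commute)
    also have "\<dots> = T v" using q.onbasis(2)[OF wv(2)] by simp
    also have "\<dots> = T y" using wv(3) Tw linear_add[OF lT] by simp
    finally show ?thesis .
  qed
  define R where "R x = D x - br Z x" for x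
  have lR: "linear R" unfolding R_def by (intro linear_compose_sub D(1) linear_br)
  have RV: "R x \<in> V" if "x \<in> V" for x using D(2) br_V[OF Z] V that by (simp add: R_def subspace_diff)
  have Rder: "R (br x y) = br (R x) y + br x (R y)" if "x \<in> V" "y \<in> V" for x y
    using D(3)[OF that] jacobi[OF Z that] by (simp add: R_def br_simps)
  have trR: "tr (\<lambda>v. R (br y v)) = 0" if "y \<in> V" for y
    using \<kappa>Z[OF that] by (simp add: R_def tr_simps T_def \<kappa>_def)
  have \<kappa>R: "\<kappa> (R y) w = 0" if y: "y \<in> V" and w: "w \<in> V" for y w
  proof -
    have l: "linear (\<lambda>v. R (br w v))" using linear_compose[OF linear_br lR] by (simp add: o_def)
    \<comment> \<open>For a derivation, \<open>br (R y)\<close> is the commutator of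
      \<open>R\<close> with \<open>br y\<close>. Cycling the trace collects everything into
      \<open>R\<close> composed with the bracket by \<open>br y w\<close>, where \<open>trR\<close>
      applies.\<close>
    have "\<kappa> (R y) w = tr (\<lambda>v. R (br y (br w v)) - br y (R (br w v)))"
      unfolding \<kappa>_def by (rule tr_cong) (simp add: Rder y br_V w)
    also have "\<dots> = tr (\<lambda>v. R (br y (br w v))) - tr (\<lambda>v. R (br w (br y v)))"
      unfolding tr_simps using tr_cyclic[OF linear_br br_V[OF y] l] RV br_V[OF w] by simp
    also have "\<dots> = tr (\<lambda>v. R (br y (br w v)) - R (br w (br y v)))" by (simp add: tr_simps)
    also have "\<dots> = tr (\<lambda>v. R (br (br y w) v))"
      by (rule tr_cong) (simp add: jacobi[OF y w] linear_add[OF lR])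
    also have "\<dots> = 0" by (rule trR[OF br_V[OF y w]])
    finally show ?thesis .
  qed
  have Rc: "R y \<in> centre" if y: "y \<in> V" for y
    by (rule q_nonneg(2)[OF RV[OF y]]) (simp add: q_def \<kappa>R[OF y \<tau>(2)[OF RV[OF y]]])
  have "R x = 0" if xV: "x \<in> V" for x
  proof -
    obtain w v where wv: "w \<in> centre" "v \<in> derived" "x = w + v" using centre_plus_derived[OF xV] .
    have "R w = 0" using D0[OF wv(1)] centreD(3)[OF wv(1) Z] by (simp add: R_def)
    moreover have "derived \<subseteq> {x. R x = 0}"
      unfolding derived_def
    proof (rule span_minimal)
      show "{br x y | x y. x \<in> V \<and> y \<in> V} \<subseteq> {x. R x = 0}"
        using Rder centreD(2,3)[OF Rc] by auto
      show "subspace {x. R x = 0}" by (simp add: subspace_def linear_0[OF lR] linear_add[OF lR] linear_cmul[OF lR])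
    qed
    ultimately show ?thesis using wv linear_add[OF lR] by auto
  qed
  then show thesis using that[OF Z] by (simp add: R_def)
qed

text \<open>\<open>A = \<tau>S\<tau>S\<close> is the identity on the centre, and on the derived
  algebra it is symmetric and positive for \<open>q\<close>, since
  \<open>q (A e) e = q (S e) (S e)\<close>. The logarithm is described by its effect on eigenvectors
  together with the fact that these span, which is the form in which \<open>Z\<close> is used
  later.\<close>

theorem log_automorphism:
  assumes S: "linear S" "\<And>x. x \<in> V \<Longrightarrow> S x \<in> V" "\<And>x. x \<in> V \<Longrightarrow> S (S x) = x"
    "\<And>x y. x \<in> V \<Longrightarrow> y \<in> V \<Longrightarrow> S (br x y) = br (S x) (S y)"
    and comm: "\<And>w. w \<in> centre \<Longrightarrow> S (\<tau> w) = \<tau> (S w)"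
  obtains Z where "Z \<in> V" "\<And>v k. v \<in> V \<Longrightarrow> 0 < k \<Longrightarrow> \<tau> (S (\<tau> (S v))) = k *\<^sub>R v \<Longrightarrow> br Z v = ln k *\<^sub>R v"
    "V \<subseteq> span {v \<in> V. \<exists>k>0. \<tau> (S (\<tau> (S v))) = k *\<^sub>R v}"
proof -
  define A where "A v = \<tau> (S (\<tau> (S v)))" for v
  have lA: "linear A"
    using linear_compose[OF S(1) linear_compose[OF \<tau>(1) linear_compose[OF S(1) \<tau>(1)]]] by (simp add: A_def[abs_def] o_def)
  have AV: "A v \<in> V" if "v \<in> V" for v using that S(2) \<tau>(2) by (simp add: A_def)
  have Abr: "A (br x y) = br (A x) (A y)" if "x \<in> V" "y \<in> V" for x y
    using that by (simp add: A_def S \<tau>(2,4))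
  have Sc: "S w \<in> centre" if w: "w \<in> centre" for w
  proof -
    have "br (S w) y = 0" if y: "y \<in> V" for y
    proof -
      have "br (S w) y = S (br w (S y))" using S(3,4) S(2)[OF y] centreD(1)[OF w] y by simp
      also have "\<dots> = 0" using centreD(2)[OF w S(2)[OF y]] linear_0[OF S(1)] by simp
      finally show ?thesis .
    qed
    then show ?thesis using S(2)[OF centreD(1)[OF w]] by (simp add: centre_def)
  qed
  \<comment> \<open>On the centre the commutation hypothesis brings the two copies of
    \<open>S\<close>, and then those of \<open>\<tau>\<close>, together.\<close>
  have Aw: "A w = w" if w: "w \<in> centre" for w
    using comm[OF Sc[OF w]] S(3) \<tau>(2,3) centreD(1)[OF w] by (simp add: A_def)
  have Ader: "A ` derived \<subseteq> derived"
  proof -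
    have "derived \<subseteq> {x. A x \<in> derived}"
      unfolding derived_def
    proof (rule span_minimal)
      show "{br x y | x y. x \<in> V \<and> y \<in> V} \<subseteq> {x. A x \<in> span {br x y | x y. x \<in> V \<and> y \<in> V}}"
        unfolding derived_def[symmetric] using Abr AV br_derived by auto
      show "subspace {x. A x \<in> span {br x y | x y. x \<in> V \<and> y \<in> V}}"
        unfolding derived_def[symmetric] using subspace_derived
        by (simp add: subspace_def linear_0[OF lA] linear_add[OF lA] linear_cmul[OF lA])
    qed
    then show ?thesis by auto
  qed
  interpret q: ip_space derived q
  proof
    show "subspace derived" by (rule subspace_derived)
    show "bilinear q" by (rule bilinear_q)
    show "q x y = q y x" if "x \<in> derived" "y \<in> derived" for x y using q_sym derived_V that by blast
    show "0 < q x x" if "x \<in> derived" "x \<noteq> 0" for x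
      using q_nonneg[of x] centre_derived[of x] that derived_V by force
  qed
  have qA: "q (A x) y = - \<kappa> (S (\<tau> (S x))) y" if "x \<in> V" "y \<in> V" for x y
    using \<kappa>_automorphism[OF \<tau>, of "S (\<tau> (S x))" "\<tau> y"] that S(2) \<tau>(2,3) by (simp add: q_def A_def)
  have Asym: "q (A x) y = q x (A y)" if "x \<in> V" "y \<in> V" for x y
  proof -
    have "\<kappa> (S (\<tau> (S x))) y = \<kappa> x (S (\<tau> (S y)))"
      using \<kappa>_automorphism[OF S, of "\<tau> (S x)" y] \<kappa>_automorphism[OF \<tau>, of "S x" "S y"]
        \<kappa>_automorphism[OF S, of x "\<tau> (S y)"] that S(2) \<tau>(2) by simp
    then show ?thesis using qA[OF that] that S(2) \<tau>(2,3) by (simp add: q_def A_def)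
  qed
  have Asym': "q (A x) y = q x (A y)" if "x \<in> derived" "y \<in> derived" for x y
    using Asym derived_V that by blast
  obtain E where E: "q.orthonormal E" "E \<subseteq> derived" "\<forall>e\<in>E. \<exists>k. A e = k *\<^sub>R e"
    "\<forall>x\<in>derived. x = (\<Sum>e\<in>E. q x e *\<^sub>R e)"
    using q.spectral[OF lA subspace_derived order_refl Ader Asym'] by blast
  from E(3) obtain a where a: "\<And>e. e \<in> E \<Longrightarrow> A e = a e *\<^sub>R e" by metis
  have EV: "e \<in> V" if "e \<in> E" for e using E(2) derived_V that by auto
  have a_pos: "0 < a e" if e: "e \<in> E" for e
  proof -
    have ee: "q e e = 1" using E(1) e by (simp add: q.orthonormal_def)
    have "a e = q (A e) e" using a[OF e] ee by (simp add: q.ip_simps)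
    also have "\<dots> = - \<kappa> (\<tau> (S e)) (S e)"
      using qA[OF EV[OF e] EV[OF e]] \<kappa>_automorphism[OF S, of "\<tau> (S e)" e] EV[OF e] S(2) \<tau>(2) by simp
    also have "\<dots> = q (S e) (S e)"
      using \<kappa>_sym[of "\<tau> (S e)" "S e"] EV[OF e] S(2) \<tau>(2) by (simp add: q_def)
    finally have 1: "a e = q (S e) (S e)" .
    have "S e \<notin> centre"
    proof
      assume "S e \<in> centre"
      from Sc[OF this] have "e \<in> centre" using S(3)[OF EV[OF e]] by simp
      then have "e = 0" using centre_derived e E(2) by auto
      then show False using ee by (simp add: q.ip_simps)
    qed
    then show ?thesis using q_nonneg[of "S e"] S(2)[OF EV[OF e]] 1 by force
  qed
  define D where "D v = (\<Sum>e\<in>E. (ln (a e) * q v e) *\<^sub>R e)" for v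
  have lD: "linear D"
    unfolding linear_iff D_def by (simp add: q.ip_simps distrib_left scaleR_add_left sum.distrib scaleR_sum_right mult_ac)
  have DV: "D v \<in> V" for v unfolding D_def using V EV by (intro subspace_sum subspace_scale)
  have qw: "q w e = 0" if "w \<in> centre" "e \<in> V" for w e using \<kappa>_centre[OF \<tau>(2)[OF that(2)] that(1)] by (simp add: q_def)
  have D0: "D w = 0" if "w \<in> centre" for w using qw[OF that EV] by (simp add: D_def)
  \<comment> \<open>An arbitrary eigenvector may mix a central and a derived part. The central part
    can be nonzero only for \<open>k = 1\<close>, and there the logarithm is zero.\<close>
  have Deig: "D v = ln k *\<^sub>R v" if v: "v \<in> V" and k: "0 < k" and Av: "A v = k *\<^sub>R v" for v k
  proof -
    obtain w d where wd: "w \<in> centre" "d \<in> derived" "v = w + d" using centre_plus_derived[OF v] .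
    have dV: "d \<in> V" using wd derived_V by auto
    have "w + A d = k *\<^sub>R w + k *\<^sub>R d" using Av wd(3) linear_add[OF lA] Aw[OF wd(1)] by (simp add: scaleR_add_right)
    then have eq: "(1 - k) *\<^sub>R w = k *\<^sub>R d - A d" by (simp add: algebra_simps)
    have "k *\<^sub>R d - A d \<in> derived" using wd(2) Ader subspace_derived by (auto intro!: subspace_diff subspace_scale)
    moreover have "(1 - k) *\<^sub>R w \<in> centre" using wd(1) V by (auto simp: centre_def br_simps subspace_scale)
    ultimately have z: "(1 - k) *\<^sub>R w = 0" by (intro centre_derived) (simp_all only: eq)
    then have "k *\<^sub>R d - A d = 0" unfolding eq .
    then have Ad: "A d = k *\<^sub>R d" by simp
    have "D d = (\<Sum>e\<in>E. (ln k * q d e) *\<^sub>R e)"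
      unfolding D_def
    proof (intro sum.cong refl)
      fix e assume e: "e \<in> E"
      \<comment> \<open>Eigenvectors for different eigenvalues are orthogonal for \<open>q\<close>,
        so only basis vectors with \<open>a e = k\<close> contribute.\<close>
      have "k * q d e = a e * q d e" using Asym[OF dV EV[OF e]] a[OF e] Ad by (simp add: q.ip_simps)
      then show "(ln (a e) * q d e) *\<^sub>R e = (ln k * q d e) *\<^sub>R e" by (cases "q d e = 0") auto
    qed
    also have "\<dots> = ln k *\<^sub>R (\<Sum>e\<in>E. q d e *\<^sub>R e)" by (simp add: scaleR_sum_right)
    also have "\<dots> = ln k *\<^sub>R d" using E(4) wd(2) by simp
    finally have "D v = ln k *\<^sub>R d" using wd D0 linear_add[OF lD] by simp
    moreover have "ln k *\<^sub>R w = 0" using z k by (cases "k = 1") auto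
    ultimately show ?thesis using wd(3) by (simp add: scaleR_add_right)
  qed
  have span: "V \<subseteq> span (E \<union> centre)"
  proof
    fix v assume "v \<in> V"
    then obtain w d where wd: "w \<in> centre" "d \<in> derived" "v = w + d" by (rule centre_plus_derived)
    have "(\<Sum>e\<in>E. q d e *\<^sub>R e) \<in> span (E \<union> centre)" by (intro span_sum span_scale span_base) auto
    then have "d \<in> span (E \<union> centre)" using E(4) wd(2) by simp
    moreover have "w \<in> span (E \<union> centre)" using wd(1) by (intro span_base) simp
    ultimately show "v \<in> span (E \<union> centre)" unfolding wd(3) by (intro span_add)
  qed
  \<comment> \<open>By bilinearity the derivation rule may be tested on eigenvectors. There
    \<open>br x y\<close> belongs to the product of the two eigenvalues, and the logarithm turns
    that product into a sum.\<close>
  have Dder: "D (br x y) = br (D x) y + br x (D y)" if "x \<in> V" "y \<in> V" for x y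
  proof (rule bilinear_eq[of "\<lambda>x y. D (br x y)" "\<lambda>x y. br (D x) y + br x (D y)" V "E \<union> centre" V "E \<union> centre"])
    show "bilinear (\<lambda>x y. D (br x y))" "bilinear (\<lambda>x y. br (D x) y + br x (D y))"
      unfolding bilinear_def linear_iff
      by (simp_all add: br_simps linear_add[OF lD] linear_cmul[OF lD] scaleR_add_right)
    fix x y assume xy: "x \<in> E \<union> centre" "y \<in> E \<union> centre"
    have V': "x \<in> V" "y \<in> V" using xy EV centreD(1) by auto
    consider "x \<in> centre" | "y \<in> centre" | "x \<in> E" "y \<in> E" using xy by blast
    then show "D (br x y) = br (D x) y + br x (D y)"
    proof cases
      case 1
      then show ?thesis using V' DV by (simp add: centreD(2) D0 br_simps linear_0[OF lD])
    next
      case 2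
      then show ?thesis using V' DV by (simp add: centreD(3) D0 br_simps linear_0[OF lD])
    next
      case 3
      have "D (br x y) = ln (a x * a y) *\<^sub>R br x y"
        using 3 V' a a_pos by (intro Deig br_V) (simp_all add: Abr br_simps mult.commute)
      moreover have "D x = ln (a x) *\<^sub>R x" "D y = ln (a y) *\<^sub>R y" using 3 V' a a_pos by (simp_all add: Deig)
      ultimately show ?thesis using a_pos[OF 3(1)] a_pos[OF 3(2)] by (simp add: ln_mult br_simps scaleR_add_left)
    qed
  qed (use span that in auto)
  obtain Z where Z: "Z \<in> V" "\<And>v. v \<in> V \<Longrightarrow> br Z v = D v"
    using derivation_inner[OF lD DV Dder D0] by metis
  have "E \<union> centre \<subseteq> {v \<in> V. \<exists>k>0. A v = k *\<^sub>R v}"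
    using EV a a_pos centreD(1) Aw by (auto intro: exI[of _ 1])
  then have sp: "V \<subseteq> span {v \<in> V. \<exists>k>0. A v = k *\<^sub>R v}" using span span_mono by blast
  show thesis
  proof (rule that[OF Z(1)])
    fix v k assume "v \<in> V" "0 < k" "\<tau> (S (\<tau> (S v))) = k *\<^sub>R v"
    then show "br Z v = ln k *\<^sub>R v" using Z(2) Deig by (simp add: A_def)
  qed (use sp in \<open>simp add: A_def\<close>)
qed

end

section \<open>Cartan data\<close>

lemma closure_of_subgroup:
  assumes G: "lie_group G" and S: "subgroup S G"
  shows "subgroup (mtop (mfd G) closure_of S) G"
proof -
  interpret group G by (rule lie_groupD(1)[OF G])
  note top = lie_groupD(4)[OF G]
  let ?C = "mtop (mfd G) closure_of S"
  have SC: "S \<subseteq> ?C" using closure_of_subset subgroup.subset[OF S] top by metis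
  show ?thesis
  proof
    show "?C \<subseteq> carrier G" using closure_of_subset_topspace[of "mtop (mfd G)" S] top by simp
    show "\<one>\<^bsub>G\<^esub> \<in> ?C" using SC subgroup.one_closed[OF S] by blast
    fix x y assume xy: "x \<in> ?C" "y \<in> ?C"
    have "continuous_map (prod_topology (mtop (mfd G)) (mtop (mfd G))) (mtop (mfd G)) (\<lambda>(x, y). x \<otimes>\<^bsub>G\<^esub> y)"
      using smooth_map_continuous[OF lie_groupD(5)[OF G]] by simp
    from continuous_map_image_closure_subset[OF this, of "S \<times> S"]
    have "(\<lambda>(x, y). x \<otimes>\<^bsub>G\<^esub> y) ` (?C \<times> ?C) \<subseteq> mtop (mfd G) closure_of ((\<lambda>(x, y). x \<otimes>\<^bsub>G\<^esub> y) ` (S \<times> S))"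
      by (simp add: closure_of_Times)
    also have "\<dots> \<subseteq> ?C" using subgroup.m_closed[OF S] by (intro closure_of_mono) auto
    finally show "x \<otimes>\<^bsub>G\<^esub> y \<in> ?C" using xy by auto
  next
    fix x assume x: "x \<in> ?C"
    have "m_inv G ` ?C \<subseteq> mtop (mfd G) closure_of (m_inv G ` S)"
      by (rule continuous_map_image_closure_subset[OF smooth_map_continuous[OF lie_groupD(6)[OF G]]])
    also have "\<dots> \<subseteq> ?C" using subgroup.m_inv_closed[OF S] by (intro closure_of_mono) auto
    finally show "inv\<^bsub>G\<^esub> x \<in> ?C" using x by auto
  qed
qed

lemma compactin_mult:
  assumes G: "lie_group G" and K: "compactin (mtop (mfd G)) K" "compactin (mtop (mfd G)) K'"
  shows "compactin (mtop (mfd G)) ((\<lambda>(x, y). x \<otimes>\<^bsub>G\<^esub> y) ` (K \<times> K'))"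
proof (rule image_compactin)
  show "continuous_map (prod_topology (mtop (mfd G)) (mtop (mfd G))) (mtop (mfd G)) (\<lambda>(x, y). x \<otimes>\<^bsub>G\<^esub> y)"
    using smooth_map_continuous[OF lie_groupD(5)[OF G]] by simp
  show "compactin (prod_topology (mtop (mfd G)) (mtop (mfd G))) (K \<times> K')"
    using K by (simp add: compactin_Times)
qed

text \<open>\<open>L\<close>, \<open>P\<close> and \<open>\<nu>\<close> are fixed witnesses for the
  existential clauses inside \<open>cartan_data\<close> and \<open>diffeomorphism\<close>;
  \<open>\<nu>\<close> takes an element to the two factors of its polar decomposition.\<close>

locale cartan_group =
  fixes G :: "('a, 'e::euclidean_space) lie_group" and U :: "'a set" and \<tau> :: "'e \<Rightarrow> 'e" and B :: "'e \<Rightarrow> 'e \<Rightarrow> real"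
    and L :: "('a, 'e) lie_group" and P :: "('a, 'e) manifold" and \<nu> :: "'a \<Rightarrow> 'a \<times> 'a"
  assumes G: "lie_group G" and conn: "connected_space (mtop (mfd G))"
    and maxc: "maximal_compact_subgroup G U"
    and inv: "lie_algebra_involution G \<tau>" and cf: "cartan_form G \<tau> B"
    and L: "lie_subgroup L G" "carrier L = U" "diff_one L G (\<lambda>x. x) ` lie_algebra L = plus_space G \<tau>"
    and P: "embedded_submanifold P (mfd G)" "topspace (mtop P) = lie_exp G ` minus_space G \<tau>"
    and mult_smooth: "smooth_map (prod_manifold (mfd L) P) (mfd G) (\<lambda>(h, p). h \<otimes>\<^bsub>G\<^esub> p)"
    and \<nu>: "smooth_map (mfd G) (prod_manifold (mfd L) P) \<nu>"
    and \<nu>_mult: "\<And>h p. h \<in> U \<Longrightarrow> p \<in> lie_exp G ` minus_space G \<tau> \<Longrightarrow> \<nu> (h \<otimes>\<^bsub>G\<^esub> p) = (h, p)"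
    and mult_\<nu>: "\<And>g. g \<in> carrier G \<Longrightarrow> fst (\<nu> g) \<otimes>\<^bsub>G\<^esub> snd (\<nu> g) = g"
begin

sublocale group G by (rule lie_groupD(1)[OF G])

abbreviation "V \<equiv> lie_algebra G"
abbreviation "\<uu> \<equiv> plus_space G \<tau>"
abbreviation "\<mm> \<equiv> minus_space G \<tau>"

lemmas M = lie_groupD(3)[OF G]
lemmas top = lie_groupD(4)[OF G]

lemma V: "subspace V" by (rule model_subspace[OF M])

lemma \<tau>_V: "X \<in> V \<Longrightarrow> \<tau> X \<in> V" and \<tau>_add: "X \<in> V \<Longrightarrow> Y \<in> V \<Longrightarrow> \<tau> (X + Y) = \<tau> X + \<tau> Y"
  and \<tau>_scale: "X \<in> V \<Longrightarrow> \<tau> (r *\<^sub>R X) = r *\<^sub>R \<tau> X" and \<tau>_\<tau>: "X \<in> V \<Longrightarrow> \<tau> (\<tau> X) = X"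
  and \<tau>_br: "X \<in> V \<Longrightarrow> Y \<in> V \<Longrightarrow> \<tau> (bracket G X Y) = bracket G (\<tau> X) (\<tau> Y)"
  using inv unfolding lie_algebra_involution_def linear_between_def by blast+

lemma \<tau>_minus: "X \<in> V \<Longrightarrow> \<tau> (- X) = - \<tau> X"
  using \<tau>_scale[of X "- 1"] by simp

lemma \<tau>_diff: "X \<in> V \<Longrightarrow> Y \<in> V \<Longrightarrow> \<tau> (X - Y) = \<tau> X - \<tau> Y"
  using \<tau>_add[of X "- Y"] \<tau>_minus[of Y] subspace_neg[OF V] by simp

lemma uu: "X \<in> \<uu> \<longleftrightarrow> X \<in> V \<and> \<tau> X = X" and mm: "X \<in> \<mm> \<longleftrightarrow> X \<in> V \<and> \<tau> X = - X"
  by (simp_all add: plus_space_def minus_space_def)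

lemma mm_V: "X \<in> \<mm> \<Longrightarrow> X \<in> V" and uu_V: "X \<in> \<uu> \<Longrightarrow> X \<in> V"
  by (simp_all add: uu mm)

lemma mm_scale: "X \<in> \<mm> \<Longrightarrow> r *\<^sub>R X \<in> \<mm>" and mm_diff: "X \<in> \<mm> \<Longrightarrow> Y \<in> \<mm> \<Longrightarrow> X - Y \<in> \<mm>" and zero_mm: "0 \<in> \<mm>"
  and uu_scale: "X \<in> \<uu> \<Longrightarrow> r *\<^sub>R X \<in> \<uu>"
  using V \<tau>_scale[of 0 0] by (auto simp: mm uu \<tau>_scale \<tau>_diff subspace_scale subspace_diff subspace_0)

lemma decompose:
  assumes "X \<in> V"
  defines "H \<equiv> (1/2) *\<^sub>R (X + \<tau> X)" and "N \<equiv> (1/2) *\<^sub>R (X - \<tau> X)"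
  shows "H \<in> \<uu>" "N \<in> \<mm>" "X = H + N" "\<tau> X = H - N"
proof -
  have sV: "X + \<tau> X \<in> V" "X - \<tau> X \<in> V" using assms(1) \<tau>_V V by (auto intro: subspace_add subspace_diff)
  show "H \<in> \<uu>" "N \<in> \<mm>"
    using assms(1) sV \<tau>_V V
    by (auto simp: H_def N_def uu mm \<tau>_scale \<tau>_add \<tau>_diff \<tau>_\<tau> subspace_scale scaleR_minus_right[symmetric] add.commute
        simp del: scaleR_minus_right)
  show "X = H + N" "\<tau> X = H - N"
    by (simp_all add: H_def N_def scaleR_add_right[symmetric] scaleR_diff_right[symmetric] scaleR_2[symmetric] del: scaleR_add_right)
qed

lemma B_left: "Y \<in> V \<Longrightarrow> X \<in> V \<Longrightarrow> X' \<in> V \<Longrightarrow> B (X + X') Y = B X Y + B X' Y" "Y \<in> V \<Longrightarrow> X \<in> V \<Longrightarrow> B (r *\<^sub>R X) Y = r * B X Y"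
  and B_right: "X \<in> V \<Longrightarrow> Y \<in> V \<Longrightarrow> Y' \<in> V \<Longrightarrow> B X (Y + Y') = B X Y + B X Y'" "X \<in> V \<Longrightarrow> Y \<in> V \<Longrightarrow> B X (r *\<^sub>R Y) = r * B X Y"
  and B_\<tau>: "X \<in> V \<Longrightarrow> Y \<in> V \<Longrightarrow> B (\<tau> X) (\<tau> Y) = B X Y"
  and B_Ad: "g \<in> carrier G \<Longrightarrow> X \<in> V \<Longrightarrow> Y \<in> V \<Longrightarrow> B (Ad G g X) (Ad G g Y) = B X Y"
  and B_orth: "X \<in> \<uu> \<Longrightarrow> Y \<in> \<mm> \<Longrightarrow> B X Y = 0" "X \<in> \<uu> \<Longrightarrow> Y \<in> \<mm> \<Longrightarrow> B Y X = 0"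
  and B_neg: "X \<in> \<uu> \<Longrightarrow> X \<noteq> 0 \<Longrightarrow> B X X < 0" and B_pos: "X \<in> \<mm> \<Longrightarrow> X \<noteq> 0 \<Longrightarrow> 0 < B X X"
  using cf unfolding cartan_form_def linear_between_def by (simp_all add: real_scaleR_def)

definition \<pi> :: "'e \<Rightarrow> 'e" where "\<pi> = sub_proj V"

lemma \<pi>: "\<pi> X \<in> V" "X \<in> V \<Longrightarrow> \<pi> X = X" "\<pi> (X + Y) = \<pi> X + \<pi> Y" "\<pi> (r *\<^sub>R X) = r *\<^sub>R \<pi> X"
  using sub_proj_in[OF V] sub_proj_id[OF V] linear_add[OF bounded_linear.linear[OF bounded_linear_sub_proj]]
    linear_cmul[OF bounded_linear.linear[OF bounded_linear_sub_proj]] by (auto simp: \<pi>_def)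

text \<open>Differentiate the invariance of \<open>B\<close> under \<open>Ad\<close> along a curve
  with velocity \<open>X\<close>. The projection \<open>\<pi>\<close> makes \<open>B\<close>
  bilinear on the whole space, as the product rule demands.\<close>

lemma B_br:
  assumes "X \<in> V" "Y \<in> V" "Z \<in> V" shows "B (bracket G X Y) Z = - B Y (bracket G X Z)"
proof -
  have "bilinear (\<lambda>X Y. B (\<pi> X) (\<pi> Y))"
    unfolding bilinear_def linear_iff by (simp add: \<pi> B_left B_right)
  then have bb: "bounded_bilinear (\<lambda>X Y. B (\<pi> X) (\<pi> Y))" by (rule bilinear_conv_bounded_bilinear[THEN iffD1])
  obtain \<alpha> where \<alpha>: "tan1 G \<alpha> X" using tan1_exists[OF G assms(1)] .
  have \<alpha>0: "\<alpha> 0 = \<one>\<^bsub>G\<^esub>" using \<alpha> by (simp add: tan1_def)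
  have "((\<lambda>t. B (\<pi> (Ad G (\<alpha> t) Y)) (\<pi> (Ad G (\<alpha> t) Z))) has_vector_derivative
      B (\<pi> (Ad G (\<alpha> 0) Y)) (\<pi> (bracket G X Z)) + B (\<pi> (bracket G X Y)) (\<pi> (Ad G (\<alpha> 0) Z))) (at 0)"
    by (rule bounded_bilinear.has_vector_derivative[OF bb tan1_bracket[OF G \<alpha> assms(2)] tan1_bracket[OF G \<alpha> assms(3)]])
  moreover have "\<forall>\<^sub>F t in nhds 0. B (\<pi> (Ad G (\<alpha> t) Y)) (\<pi> (Ad G (\<alpha> t) Z)) = B Y Z"
    using tan1_carrier[OF G \<alpha>] by eventually_elim (simp add: \<pi> Ad_in[OF G] assms B_Ad)
  ultimately have "((\<lambda>t. B Y Z) has_vector_derivative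
      B (\<pi> (Ad G (\<alpha> 0) Y)) (\<pi> (bracket G X Z)) + B (\<pi> (bracket G X Y)) (\<pi> (Ad G (\<alpha> 0) Z))) (at 0)"
    by (rule hvd_cong[rotated])
  from vector_derivative_unique_at[OF this has_vector_derivative_const]
  show ?thesis using assms by (simp add: \<alpha>0 Ad_one[OF G] \<pi> bracket_in[OF G])
qed

text \<open>The sign conditions on the two eigenspaces make \<open>- B X (\<tau> X)\<close> positive
  for nonzero \<open>X\<close>; averaging the two orders of the arguments makes the form
  symmetric.\<close>

definition ipB :: "'e \<Rightarrow> 'e \<Rightarrow> real" where
  "ipB X Y = - (B (\<pi> X) (\<tau> (\<pi> Y)) + B (\<tau> (\<pi> Y)) (\<pi> X)) / 2"

text \<open>Extended through the projection because \<open>reductive_algebra\<close> asks for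
  bilinearity on the whole type, whereas \<open>bracket\<close> is controlled on the Lie algebra
  only.\<close>

definition brV :: "'e \<Rightarrow> 'e \<Rightarrow> 'e" where "brV X Y = bracket G (\<pi> X) (\<pi> Y)"

definition \<tau>V :: "'e \<Rightarrow> 'e" where "\<tau>V X = \<tau> (\<pi> X)"

lemma brV: "X \<in> V \<Longrightarrow> Y \<in> V \<Longrightarrow> brV X Y = bracket G X Y" and \<tau>V: "X \<in> V \<Longrightarrow> \<tau>V X = \<tau> X"
  by (simp_all add: brV_def \<tau>V_def \<pi>)

sublocale ra: reductive_algebra V ipB brV \<tau>V
proof (intro reductive_algebra.intro ip_space.intro reductive_algebra_axioms.intro)
  show "subspace V" by (rule V)
  show "bilinear ipB"
    unfolding bilinear_def linear_iff ipB_def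
    by (simp add: \<pi> B_left B_right \<tau>_V \<tau>_add \<tau>_scale field_simps)
  show "ipB X Y = ipB Y X" if "X \<in> V" "Y \<in> V" for X Y
    using B_\<tau>[OF that(1) \<tau>_V[OF that(2)]] B_\<tau>[OF \<tau>_V[OF that(2)] that(1)] that by (simp add: ipB_def \<pi> \<tau>_\<tau> \<tau>_V)
  show "0 < ipB X X" if X: "X \<in> V" "X \<noteq> 0" for X
  proof -
    define H N where "H = (1/2) *\<^sub>R (X + \<tau> X)" and "N = (1/2) *\<^sub>R (X - \<tau> X)"
    have HN: "H \<in> \<uu>" "N \<in> \<mm>" "X = H + N" "\<tau> X = H - N" using decompose[OF X(1)] unfolding H_def N_def by auto
    note HV = uu_V[OF HN(1)] and NV = mm_V[OF HN(2)]
    have NV': "(- 1) *\<^sub>R N \<in> V" using NV V subspace_scale by blast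
    have X_eq: "H - N = H + (-1) *\<^sub>R N" by simp
    have "B (H + N) (H + (- 1) *\<^sub>R N) = B H H - B N N" "B (H + (- 1) *\<^sub>R N) (H + N) = B H H - B N N"
      using HN(1,2) HV NV NV' B_left(2)[OF HV NV, of "- 1"] B_left(2)[OF NV NV, of "- 1"] B_right(2)[OF HV NV, of "- 1"] B_right(2)[OF NV NV, of "- 1"]
      by (simp_all only: B_left(1) B_right(1) B_orth subspace_add[OF V])
    then have "B X (\<tau> X) = B H H - B N N" "B (\<tau> X) X = B H H - B N N"
      using HN(4) X_eq by (simp_all only: HN(3)[symmetric])
    moreover have "B H H - B N N < 0"
    proof (cases "H = 0")
      case True
      then have "N \<noteq> 0" using X(2) HN(3) by simp
      moreover have "B H H = 0" using B_left(2)[OF HV HV, of 0] True by simp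
      ultimately show ?thesis using B_pos[OF HN(2)] by simp
    next
      case False
      have "0 \<le> B N N"
        using B_pos[OF HN(2)] B_left(2)[OF NV NV, of 0] by (cases "N = 0") auto
      then show ?thesis using B_neg[OF HN(1) False] by simp
    qed
    ultimately show ?thesis using X(1) by (simp add: ipB_def \<pi>)
  qed
  show "bilinear brV"
    unfolding bilinear_def linear_iff brV_def
    by (simp add: \<pi> bracket_add_left[OF G] bracket_scale_left[OF G] bracket_add_right[OF G] bracket_scale_right[OF G])
  show "brV X Y \<in> V" if "X \<in> V" "Y \<in> V" for X Y by (simp add: brV[OF that] bracket_in[OF G that])
  show "brV Y X = - brV X Y" if "X \<in> V" "Y \<in> V" for X Y by (simp add: brV that bracket_antisym[OF G that])
  show "brV X (brV Y Z) = brV (brV X Y) Z + brV Y (brV X Z)" if "X \<in> V" "Y \<in> V" "Z \<in> V" for X Y Z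
    using bracket_jacobi[OF G that] that by (simp only: brV bracket_in[OF G])
  show "linear \<tau>V" unfolding linear_iff by (simp add: \<tau>V_def \<pi> \<tau>_add \<tau>_scale)
  show "\<tau>V X \<in> V" "\<tau>V (\<tau>V X) = X" if "X \<in> V" for X using that by (simp_all add: \<tau>V \<tau>_V \<tau>_\<tau>)
  show "\<tau>V (brV X Y) = brV (\<tau>V X) (\<tau>V Y)" if "X \<in> V" "Y \<in> V" for X Y
    using that by (simp add: \<tau>V \<tau>_V brV bracket_in[OF G] \<tau>_br)
  show "ipB (brV X Y) Z = - ipB Y (brV (\<tau>V X) Z)" if "X \<in> V" "Y \<in> V" "Z \<in> V" for X Y Z
  proof -
    have 1: "\<tau> (bracket G (\<tau> X) Z) = bracket G X (\<tau> Z)" using that by (simp add: \<tau>_br \<tau>_V \<tau>_\<tau>)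
    have 2: "B (bracket G X Y) (\<tau> Z) = - B Y (bracket G X (\<tau> Z))" by (rule B_br[OF that(1,2) \<tau>_V[OF that(3)]])
    have 3: "B (bracket G X (\<tau> Z)) Y = - B (\<tau> Z) (bracket G X Y)" by (rule B_br[OF that(1) \<tau>_V[OF that(3)] that(2)])
    have 4: "brV X Y = bracket G X Y" "brV (\<tau>V X) Z = bracket G (\<tau> X) Z" using that by (simp_all only: brV \<tau>V \<tau>_V)
    have 5: "\<pi> (bracket G X Y) = bracket G X Y" "\<pi> (bracket G (\<tau> X) Z) = bracket G (\<tau> X) Z" "\<pi> Y = Y" "\<pi> Z = Z"
      using that by (simp_all only: \<pi>(2) \<tau>_V bracket_in[OF G])
    show ?thesis unfolding ipB_def 4 5 1 2 3 by argo
  qed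
qed

lemma centreI: "X \<in> V \<Longrightarrow> (\<And>Y. Y \<in> V \<Longrightarrow> bracket G X Y = 0) \<Longrightarrow> X \<in> ra.centre"
  by (simp add: ra.centre_def brV)

lemma centreD: "X \<in> ra.centre \<Longrightarrow> X \<in> V" "X \<in> ra.centre \<Longrightarrow> Y \<in> V \<Longrightarrow> bracket G X Y = 0" "X \<in> ra.centre \<Longrightarrow> Y \<in> V \<Longrightarrow> bracket G Y X = 0"
  using ra.centreD[of X] brV[of X Y] brV[of Y X] by auto

subsection \<open>Exponentials of the two eigenspaces\<close>

lemma U: "subgroup U G" "compactin (mtop (mfd G)) U"
  using maxc by (auto simp: maximal_compact_subgroup_def)

lemma U_sub: "U \<subseteq> carrier G" by (rule subgroup.subset[OF U(1)])

lemmas L' = lie_subgroupD[OF L(1) G]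

lemma exp_uu: assumes "X \<in> \<uu>" shows "lie_exp G X \<in> U"
proof -
  obtain X' where X': "X' \<in> lie_algebra L" "X = diff_one L G (\<lambda>x. x) X'" using assms L(3) by blast
  show ?thesis
    using lie_exp_hom[OF L'(1) G L'(6,7) X'(1)] lie_exp_closed[OF L'(1) X'(1)] X'(2) L(2) by simp
qed

lemma exp_closed: "X \<in> V \<Longrightarrow> lie_exp G X \<in> carrier G" by (rule lie_exp_closed[OF G])

lemma polar_unique:
  assumes "h \<in> U" "h' \<in> U" "X \<in> \<mm>" "X' \<in> \<mm>" "h \<otimes>\<^bsub>G\<^esub> lie_exp G X = h' \<otimes>\<^bsub>G\<^esub> lie_exp G X'"
  shows "h = h'" "lie_exp G X = lie_exp G X'"
proof -
  have "(h, lie_exp G X) = (h', lie_exp G X')"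
    using \<nu>_mult[OF assms(1) imageI[OF assms(3)]] \<nu>_mult[OF assms(2) imageI[OF assms(4)]] assms(5) by (simp only:)
  then show "h = h'" "lie_exp G X = lie_exp G X'" by simp_all
qed

lemma polar:
  assumes "g \<in> carrier G" obtains h X where "h \<in> U" "X \<in> \<mm>" "g = h \<otimes>\<^bsub>G\<^esub> lie_exp G X"
proof -
  have "\<nu> g \<in> topspace (mtop (prod_manifold (mfd L) P))" using smooth_map_in[OF \<nu>] assms top by simp
  then have "fst (\<nu> g) \<in> U" "snd (\<nu> g) \<in> lie_exp G ` \<mm>" using L(2) lie_groupD(4)[OF L'(1)] P(2) by auto
  then show thesis using mult_\<nu>[OF assms] that by (metis imageE)
qed

text \<open>For \<open>X\<close> in \<open>\<mm>\<close> the adjoint of \<open>ad X\<close> is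
  \<open>- ad (\<tau> X) = ad X\<close>, so the spectral theorem applies.\<close>

lemma ad_mm_diagonalizable:
  assumes X: "X \<in> \<mm>"
  obtains E k where "ra.orthonormal E" "E \<subseteq> V" "\<forall>e\<in>E. bracket G X e = k e *\<^sub>R e" "\<forall>v\<in>V. v = (\<Sum>e\<in>E. ipB v e *\<^sub>R e)"
proof -
  note XV = mm_V[OF X]
  have sym: "ipB (brV X v) w = ipB v (brV X w)" if "v \<in> V" "w \<in> V" for v w
    using ra.ip_br[OF XV that] X \<tau>V[OF XV] by (simp add: mm ra.br_simps ra.ip_simps)
  have im: "brV X ` V \<subseteq> V" using ra.br_V[OF XV] by auto
  obtain E where E: "ra.orthonormal E" "E \<subseteq> V" "\<forall>e\<in>E. \<exists>k. brV X e = k *\<^sub>R e" "\<forall>x\<in>V. x = (\<Sum>e\<in>E. ipB x e *\<^sub>R e)"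
    using ra.spectral[OF ra.linear_br V order_refl im sym] by blast
  obtain k where k: "\<And>e. e \<in> E \<Longrightarrow> brV X e = k e *\<^sub>R e" using E(3) by metis
  have "\<forall>e\<in>E. bracket G X e = k e *\<^sub>R e"
  proof
    fix e assume "e \<in> E"
    with k[OF this] brV[OF XV, of e] E(2) show "bracket G X e = k e *\<^sub>R e" by (simp add: subset_iff)
  qed
  from that[OF E(1,2) this E(4)] show thesis .
qed

lemma Ad_eigen: "X \<in> V \<Longrightarrow> v \<in> V \<Longrightarrow> bracket G X v = k *\<^sub>R v \<Longrightarrow> Ad G (lie_exp G X) v = exp k *\<^sub>R v"
  using Ad_exp_eigenvector[OF G, of X v k 1] by simp

lemma bracket_vanish:
  assumes X: "X \<in> V" and E: "ra.orthonormal E" "E \<subseteq> V" "\<forall>v\<in>V. v = (\<Sum>e\<in>E. ipB v e *\<^sub>R e)"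
    and 0: "\<And>e. e \<in> E \<Longrightarrow> bracket G X e = 0"
  shows "X \<in> ra.centre"
proof (rule centreI[OF X])
  fix v assume v: "v \<in> V"
  have "bracket G X v = brV X (\<Sum>e\<in>E. ipB v e *\<^sub>R e)" using bspec[OF E(3) v] brV[OF X v] by simp
  also have "\<dots> = (\<Sum>e\<in>E. ipB v e *\<^sub>R brV X e)" by (simp add: linear_sum[OF ra.linear_br] ra.br_simps)
  also have "\<dots> = 0" using 0 brV[OF X] E(2) by (intro sum.neutral) auto
  finally show "bracket G X v = 0" .
qed

text \<open>On a connected group \<open>Ad\<close> acts trivially on the centre of the Lie algebra,
  so conjugation fixes the exponentials of central vectors.\<close>

lemma centre_exp_commute:
  assumes "Y \<in> ra.centre" "g \<in> carrier G"
  shows "g \<otimes>\<^bsub>G\<^esub> lie_exp G Y = lie_exp G Y \<otimes>\<^bsub>G\<^esub> g"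
proof -
  note YV = centreD(1)[OF assms(1)]
  have "Ad G g Y = Y" by (rule Ad_central[OF G conn YV _ assms(2)]) (rule centreD(3)[OF assms(1)])
  then have "conj_by G g (lie_exp G Y) = lie_exp G Y" using lie_exp_Ad[OF G assms(2) YV] by simp
  then have "g \<otimes>\<^bsub>G\<^esub> lie_exp G Y \<otimes>\<^bsub>G\<^esub> inv\<^bsub>G\<^esub> g \<otimes>\<^bsub>G\<^esub> g = lie_exp G Y \<otimes>\<^bsub>G\<^esub> g" by (simp add: conj_by_def)
  then show ?thesis using assms(2) exp_closed[OF YV] by (simp add: m_assoc)
qed

lemma centre_scale: "Y \<in> ra.centre \<Longrightarrow> r *\<^sub>R Y \<in> ra.centre"
  using V by (auto simp: ra.centre_def ra.br_simps subspace_scale)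

text \<open>
  A relatively compact central one-parameter subgroup generates together with \<open>U\<close> a compact group, so by
  maximality it lies in \<open>U\<close>, where the polar decomposition makes it trivial.
\<close>

lemma central_bounded_zero:
  assumes Y: "Y \<in> \<mm>" "Y \<in> ra.centre" and K: "compactin (mtop (mfd G)) K" "\<And>n::nat. lie_exp G (real n *\<^sub>R Y) \<in> K"
  shows "Y = 0"
proof -
  note YV = mm_V[OF Y(1)]
  let ?\<gamma> = "\<lambda>t. lie_exp G (t *\<^sub>R Y)"
  note \<gamma> = one_paramD[OF G one_param_exp[OF G YV]]
  note haus = lie_groupD(2)[OF G, unfolded smooth_manifold_def, THEN conjunct1]
  \<comment> \<open>Only natural multiples of \<open>Y\<close> are assumed to stay in
    \<open>K\<close>. Adding inverses covers the integers, and a further factor from the unit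
    interval covers all real times.\<close>
  let ?K1 = "K \<union> m_inv G ` K"
  have K1: "compactin (mtop (mfd G)) ?K1"
    by (rule compactin_Un[OF K(1) image_compactin[OF K(1) smooth_map_continuous[OF lie_groupD(6)[OF G]]]])
  have K1i: "?\<gamma> (of_int i) \<in> ?K1" for i :: int
  proof (cases "0 \<le> i")
    case True
    then show ?thesis using K(2)[of "nat i"] by simp
  next
    case False
    then have i: "of_int i = - real (nat (- i))" by simp
    have "?\<gamma> (- real (nat (- i))) \<in> m_inv G ` K"
      unfolding \<gamma>(7)[of "real (nat (- i))"] by (rule imageI[OF K(2)])
    then show ?thesis unfolding i by (rule UnI2)
  qed
  let ?J = "?\<gamma> ` {0..1}"
  have J: "compactin (mtop (mfd G)) ?J"
    using image_compactin[of euclidean "{0..1::real}" "mtop (mfd G)" ?\<gamma>] smooth_map_continuous[OF \<gamma>(6)] by simp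
  let ?K2 = "(\<lambda>(x, y). x \<otimes>\<^bsub>G\<^esub> y) ` (?K1 \<times> ?J)"
  have \<gamma>K2: "?\<gamma> t \<in> ?K2" for t
  proof -
    have "?\<gamma> t = ?\<gamma> (of_int \<lfloor>t\<rfloor>) \<otimes>\<^bsub>G\<^esub> ?\<gamma> (frac t)" using \<gamma>(2)[of "of_int \<lfloor>t\<rfloor>" "frac t"] by (simp add: frac_def)
    moreover have "?\<gamma> (frac t) \<in> ?J" using frac_ge_0[of t] frac_lt_1[of t] by (intro imageI) simp
    ultimately show ?thesis using K1i[of "\<lfloor>t\<rfloor>"] by (intro image_eqI[of _ _ "(?\<gamma> (of_int \<lfloor>t\<rfloor>), ?\<gamma> (frac t))"]) auto
  qed
  let ?K3 = "(\<lambda>(x, y). x \<otimes>\<^bsub>G\<^esub> y) ` (U \<times> ?K2)"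
  have K3: "compactin (mtop (mfd G)) ?K3"
    by (rule compactin_mult[OF G U(2) compactin_mult[OF G K1 J]])
  have comm: "g \<otimes>\<^bsub>G\<^esub> ?\<gamma> t = ?\<gamma> t \<otimes>\<^bsub>G\<^esub> g" if "g \<in> carrier G" for g t
    by (rule centre_exp_commute[OF centre_scale[OF Y(2)] that])
  define H where "H = {x \<otimes>\<^bsub>G\<^esub> ?\<gamma> t | x t. x \<in> U}"
  have H: "subgroup H G"
  proof
    show "H \<subseteq> carrier G" using U_sub \<gamma>(1) by (auto simp: H_def)
    show "\<one>\<^bsub>G\<^esub> \<in> H"
      unfolding H_def using subgroup.one_closed[OF U(1)] \<gamma>(3) by (intro CollectI exI[of _ "\<one>\<^bsub>G\<^esub>"] exI[of _ 0]) simp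
    fix a assume "a \<in> H"
    then obtain x t where x: "x \<in> U" "a = x \<otimes>\<^bsub>G\<^esub> ?\<gamma> t" by (auto simp: H_def)
    have xG: "x \<in> carrier G" using x(1) U_sub by auto
    have "inv\<^bsub>G\<^esub> a = inv\<^bsub>G\<^esub> x \<otimes>\<^bsub>G\<^esub> ?\<gamma> (- t)"
      using x(2) xG \<gamma>(1,7) comm[OF inv_closed[OF xG], of "- t"] by (simp add: inv_mult_group)
    then show "inv\<^bsub>G\<^esub> a \<in> H"
      unfolding H_def using subgroup.m_inv_closed[OF U(1) x(1)] by (intro CollectI exI conjI)
    fix b assume "b \<in> H"
    then obtain y s where y: "y \<in> U" "b = y \<otimes>\<^bsub>G\<^esub> ?\<gamma> s" by (auto simp: H_def)
    have yG: "y \<in> carrier G" using y(1) U_sub by auto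
    have "a \<otimes>\<^bsub>G\<^esub> b = x \<otimes>\<^bsub>G\<^esub> (?\<gamma> t \<otimes>\<^bsub>G\<^esub> y) \<otimes>\<^bsub>G\<^esub> ?\<gamma> s" using x y xG yG \<gamma>(1) by (simp add: m_assoc)
    also have "\<dots> = (x \<otimes>\<^bsub>G\<^esub> y) \<otimes>\<^bsub>G\<^esub> ?\<gamma> (t + s)" unfolding comm[OF yG, of t, symmetric] using \<gamma>(2)[of t s] xG yG \<gamma>(1) by (simp add: m_assoc)
    finally show "a \<otimes>\<^bsub>G\<^esub> b \<in> H"
      unfolding H_def using subgroup.m_closed[OF U(1) x(1) y(1)] by (intro CollectI exI conjI)
  qed
  have HK3: "H \<subseteq> ?K3"
  proof
    fix a assume "a \<in> H"
    then obtain x t where x: "x \<in> U" "a = x \<otimes>\<^bsub>G\<^esub> ?\<gamma> t" by (auto simp: H_def)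
    then show "a \<in> ?K3" using \<gamma>K2[of t] by (intro image_eqI[of _ _ "(x, ?\<gamma> t)"]) auto
  qed
  \<comment> \<open>\<open>H\<close> itself need not be closed; its closure is a closed subset of
    the compact set \<open>?K3\<close> and still a subgroup.\<close>
  let ?C = "mtop (mfd G) closure_of H"
  have "?C \<subseteq> ?K3" by (rule closure_of_minimal[OF HK3 compactin_imp_closedin[OF haus K3]])
  then have C: "compactin (mtop (mfd G)) ?C" by (rule closed_compactin[OF K3 _ closedin_closure_of])
  have HC: "H \<subseteq> ?C" using closure_of_subset subgroup.subset[OF H] top by metis
  have "U \<subseteq> H"
  proof
    fix x assume "x \<in> U"
    then show "x \<in> H" unfolding H_def using \<gamma>(3) U_sub by (intro CollectI exI[of _ x] exI[of _ 0]) auto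
  qed
  with HC have "U \<subseteq> ?C" by blast
  with maxc C closure_of_subgroup[OF G H] have CU: "?C = U" unfolding maximal_compact_subgroup_def by blast
  have "?\<gamma> t = \<one>\<^bsub>G\<^esub>" for t
  proof -
    have "?\<gamma> t \<in> H" unfolding H_def using subgroup.one_closed[OF U(1)] \<gamma>(1) by (intro CollectI exI[of _ "\<one>\<^bsub>G\<^esub>"] exI[of _ t]) simp
    then have "?\<gamma> t \<in> U" using HC CU by blast
    from polar_unique(1)[OF this subgroup.one_closed[OF U(1)] zero_mm mm_scale[OF Y(1), of t]]
    show ?thesis using lie_exp_zero[OF G] \<gamma>(1) by simp
  qed
  then have "tan1 G (\<lambda>t. \<one>\<^bsub>G\<^esub>) Y" using \<gamma>(4) by simp
  from tan1_unique[OF this tan1_const[OF G]] show ?thesis .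
qed

text \<open>A nonzero eigenvalue of \<open>ad Y\<close> would make the operators
  \<open>Ad (exp (n Y))\<close> unbounded as \<open>n\<close> runs to one of the two infinities,
  although \<open>Ad\<close> is bounded on a compact set. So \<open>Y\<close> is central and
  \<open>central_bounded_zero\<close> applies.\<close>

lemma bounded_zero:
  assumes Y: "Y \<in> \<mm>" and K: "compactin (mtop (mfd G)) K" "\<And>n::int. lie_exp G (of_int n *\<^sub>R Y) \<in> K"
  shows "Y = 0"
proof -
  note YV = mm_V[OF Y]
  obtain E k where E: "ra.orthonormal E" "E \<subseteq> V" and k: "\<forall>e\<in>E. bracket G Y e = k e *\<^sub>R e"
    and exp: "\<forall>v\<in>V. v = (\<Sum>e\<in>E. ipB v e *\<^sub>R e)" by (rule ad_mm_diagonalizable[OF Y])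
  have "k e = 0" if e: "e \<in> E" for e
  proof (rule ccontr)
    assume ne: "k e \<noteq> 0"
    have eV: "e \<in> V" using E(2) e by auto
    have "ipB e e = 1" using E(1) e by (simp add: ra.orthonormal_def)
    then have e0: "e \<noteq> 0" using ra.ip_simps(7)[of 0] by (intro notI) simp
    have "continuous_map (mtop (mfd G)) euclidean (\<lambda>g. Ad G g e)"
      unfolding continuous_map_def using sfun_continuous[OF M sfun_Ad[OF G eV]] top by auto
    from image_compactin[OF K(1) this] have "bounded ((\<lambda>g. Ad G g e) ` K)" by (simp add: compact_imp_bounded)
    then obtain C where C: "\<And>g. g \<in> K \<Longrightarrow> norm (Ad G g e) \<le> C" unfolding bounded_iff by auto
    have bd: "exp (k e * of_int n) * norm e \<le> C" for n :: int
      using C[OF K(2)[of n]] Ad_exp_eigenvector[OF G YV eV bspec[OF k e], of "of_int n"] by simp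
    obtain N :: nat where N: "C / (\<bar>k e\<bar> * norm e) < real N" using reals_Archimedean2 by blast
    \<comment> \<open>The sign makes \<open>k e * n\<close> nonnegative; for negative
      \<open>k e\<close> it selects a negative multiple.\<close>
    define n where "n = (if 0 < k e then int N else - int N)"
    have "k e * of_int n = \<bar>k e\<bar> * real N" using ne by (auto simp: n_def)
    then have "(1 + \<bar>k e\<bar> * real N) * norm e \<le> C"
      using bd[of n] exp_ge_add_one_self[of "\<bar>k e\<bar> * real N"] by (smt (verit) mult_right_mono norm_ge_zero)
    moreover have "C < real N * (\<bar>k e\<bar> * norm e)"
      using N ne e0 by (simp add: pos_divide_less_eq)
    ultimately show False using e0 by (simp add: algebra_simps) (smt (verit) zero_less_norm_iff)
  qed
  then have "Y \<in> ra.centre" using bracket_vanish[OF YV E exp] k by simp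
  moreover have "lie_exp G (real n *\<^sub>R Y) \<in> K" for n using K(2)[of "int n"] by simp
  ultimately show ?thesis by (rule central_bounded_zero[OF Y _ K(1)])
qed

text \<open>\<open>exp X\<close> determines \<open>Ad (exp X)\<close>, whose eigenvalues are
  positive and have unique real logarithms; hence \<open>ad X = ad Y\<close>. The difference is then
  central with trivial exponential, and \<open>central_bounded_zero\<close> applies with the
  identity as compact set.\<close>

lemma exp_mm_inj:
  assumes X: "X \<in> \<mm>" and Y: "Y \<in> \<mm>" and eq: "lie_exp G X = lie_exp G Y"
  shows "X = Y"
proof -
  note XV = mm_V[OF X] and YV = mm_V[OF Y]
  obtain E k where E: "ra.orthonormal E" "E \<subseteq> V" and k: "\<forall>e\<in>E. bracket G X e = k e *\<^sub>R e"
    and expX: "\<forall>v\<in>V. v = (\<Sum>e\<in>E. ipB v e *\<^sub>R e)" by (rule ad_mm_diagonalizable[OF X])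
  obtain F l where F: "ra.orthonormal F" "F \<subseteq> V" and l: "\<forall>e\<in>F. bracket G Y e = l e *\<^sub>R e"
    and expY: "\<forall>v\<in>V. v = (\<Sum>e\<in>F. ipB v e *\<^sub>R e)" by (rule ad_mm_diagonalizable[OF Y])
  let ?W = "X - Y"
  have WV: "?W \<in> V" using XV YV V by (simp add: subspace_diff)
  have "bracket G ?W v = 0" if v: "v \<in> E" for v
  proof -
    have vV: "v \<in> V" using v E(2) by auto
    have adlin: "linear (Ad G (lie_exp G Y))" by (rule bounded_linear.linear[OF bounded_linear_Ad[OF G exp_closed[OF YV]]])
    have "exp (k v) *\<^sub>R v = Ad G (lie_exp G Y) v" using Ad_eigen[OF XV vV bspec[OF k v]] eq by simp
    also have "\<dots> = Ad G (lie_exp G Y) (\<Sum>e\<in>F. ipB v e *\<^sub>R e)" using bspec[OF expY vV] by simp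
    also have "\<dots> = (\<Sum>e\<in>F. (ipB v e * exp (l e)) *\<^sub>R e)"
      unfolding linear_sum[OF adlin] 
    proof (intro sum.cong refl)
      fix e assume "e \<in> F"
      with l F(2) have "Ad G (lie_exp G Y) e = exp (l e) *\<^sub>R e" by (intro Ad_eigen[OF YV]) auto
      then show "Ad G (lie_exp G Y) (ipB v e *\<^sub>R e) = (ipB v e * exp (l e)) *\<^sub>R e" by (simp add: linear_cmul[OF adlin])
    qed
    finally have eqv: "exp (k v) *\<^sub>R v = (\<Sum>e\<in>F. (ipB v e * exp (l e)) *\<^sub>R e)" .
    \<comment> \<open>Comparing coefficients and using injectivity of the real exponential: an
      eigenvector of \<open>ad X\<close> has components only along eigenvectors of
      \<open>ad Y\<close> with the same eigenvalue.\<close>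
    have coeff: "ipB v f * l f = ipB v f * k v" if f: "f \<in> F" for f
    proof -
      have "exp (k v) * ipB v f = ipB (exp (k v) *\<^sub>R v) f" by (simp add: ra.ip_simps)
      also have "\<dots> = (\<Sum>e\<in>F. if e = f then ipB v f * exp (l f) else 0)"
        unfolding eqv ra.ip_sum using F(1) f by (intro sum.cong refl) (auto simp: ra.ip_simps ra.orthonormal_def)
      also have "\<dots> = ipB v f * exp (l f)" using F(1) f by (simp add: ra.orthonormal_def)
      finally show ?thesis by (cases "ipB v f = 0") auto
    qed
    have "bracket G Y v = brV Y (\<Sum>e\<in>F. ipB v e *\<^sub>R e)" using bspec[OF expY vV] brV[OF YV vV] by simp
    also have "\<dots> = (\<Sum>e\<in>F. ipB v e *\<^sub>R (l e *\<^sub>R e))"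
      unfolding linear_sum[OF ra.linear_br] using F(2) l brV[OF YV] by (intro sum.cong refl) (auto simp: ra.br_simps)
    also have "\<dots> = (\<Sum>e\<in>F. k v *\<^sub>R (ipB v e *\<^sub>R e))"
      using coeff by (intro sum.cong refl) (simp add: mult.commute)
    also have "\<dots> = k v *\<^sub>R v" unfolding scaleR_sum_right[symmetric] using bspec[OF expY vV] by (rule arg_cong[OF sym])
    finally have "bracket G Y v = bracket G X v" using bspec[OF k v] by simp
    then show ?thesis using ra.br_simps(5)[of X Y v] brV XV YV vV WV by simp
  qed
  then have Wc: "?W \<in> ra.centre" by (rule bracket_vanish[OF WV E expX])
  have "bracket G X (- Y) = 0"
  proof -
    have "bracket G X Y = 0"
      using centreD(2)[OF Wc YV] ra.br_simps(5)[of X Y Y] brV XV YV WV bracket_self[OF G YV] by simp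
    then show ?thesis using bracket_scale_right[OF G XV YV, of "- 1"] by simp
  qed
  from lie_exp_commute(2)[OF G XV _ this]
  have "lie_exp G ?W = \<one>\<^bsub>G\<^esub>"
    using V YV eq exp_closed[OF YV] by (simp add: lie_exp_neg[OF G YV] subspace_neg)
  then have "lie_exp G (real n *\<^sub>R ?W) \<in> {\<one>\<^bsub>G\<^esub>}" for n using lie_exp_pow[OF G WV, of n] by simp
  from central_bounded_zero[OF mm_diff[OF X Y] Wc _ this] top have "?W = 0" by simp
  then show ?thesis by simp
qed

text \<open>\<open>Ad u\<close> preserves \<open>\<uu>\<close>, the Lie algebra of \<open>U\<close>,
  and by invariance of \<open>B\<close> also its orthogonal complement \<open>\<mm>\<close>.\<close>

lemma Ad_U_commutes:
  assumes u: "u \<in> U" and X: "X \<in> V" shows "Ad G u (\<tau> X) = \<tau> (Ad G u X)"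
proof -
  have uG: "u \<in> carrier G" if "u \<in> U" for u using that U_sub by auto
  have uu: "Ad G u H \<in> \<uu>" if H: "H \<in> \<uu>" and u: "u \<in> U" for H u
  proof -
    obtain H' where H': "H' \<in> lie_algebra L" "H = diff_one L G (\<lambda>x. x) H'" using H L(3) by blast
    have "Ad G u H = diff_one L G (\<lambda>x. x) (Ad L u H')"
      unfolding H'(2) using diff_one_Ad[OF L'(1) G L'(6,7) _ H'(1), of u] u L(2) by simp
    moreover have "Ad L u H' \<in> lie_algebra L" using Ad_in[OF L'(1) _ H'(1)] u L(2) by simp
    ultimately show ?thesis using L(3) by blast
  qed
  \<comment> \<open>By invariance the \<open>\<uu>\<close>-component \<open>H\<close> of
    \<open>Ad u N\<close> satisfies \<open>B H H = 0\<close>, while \<open>B\<close> is negative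
    definite on \<open>\<uu>\<close>.\<close>
  have mm: "Ad G u N \<in> \<mm>" if N: "N \<in> \<mm>" for N
  proof -
    note NV = mm_V[OF N]
    have AV: "Ad G u N \<in> V" by (rule Ad_in[OF G uG[OF u] NV])
    define H K where "H = (1/2) *\<^sub>R (Ad G u N + \<tau> (Ad G u N))" and "K = (1/2) *\<^sub>R (Ad G u N - \<tau> (Ad G u N))"
    have HK: "H \<in> \<uu>" "K \<in> \<mm>" "Ad G u N = H + K" using decompose[OF AV] unfolding H_def K_def by auto
    have "B (Ad G u N) H = B N (Ad G (inv\<^bsub>G\<^esub> u) H)"
      using B_Ad[OF uG[OF u] NV Ad_in[OF G inv_closed[OF uG[OF u]] uu_V[OF HK(1)]]]
        Ad_inv_cancel(1)[OF G uG[OF u] uu_V[OF HK(1)]] by simp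
    also have "\<dots> = 0" by (rule B_orth(2)[OF uu[OF HK(1) subgroup.m_inv_closed[OF U(1) u]] N])
    finally have "B H H = 0" unfolding HK(3) using B_left(1) B_orth(2)[OF HK(1,2)] uu_V[OF HK(1)] mm_V[OF HK(2)] by simp
    then have "H = 0" using B_neg[OF HK(1)] by force
    then show ?thesis using HK by simp
  qed
  define H N where "H = (1/2) *\<^sub>R (X + \<tau> X)" and "N = (1/2) *\<^sub>R (X - \<tau> X)"
  have HN: "H \<in> \<uu>" "N \<in> \<mm>" "X = H + N" "\<tau> X = H - N" using decompose[OF X] unfolding H_def N_def by auto
  have lin: "linear (Ad G u)" by (rule bounded_linear.linear[OF bounded_linear_Ad[OF G uG[OF u]]])
  have 1: "Ad G u H \<in> V" "\<tau> (Ad G u H) = Ad G u H" using uu[OF HN(1) u] by (auto simp: plus_space_def)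
  have 2: "Ad G u N \<in> V" "\<tau> (Ad G u N) = - Ad G u N" using mm[OF HN(2)] by (auto simp: minus_space_def)
  have "Ad G u X = Ad G u H + Ad G u N" "Ad G u (\<tau> X) = Ad G u H - Ad G u N"
    unfolding HN(4) by (simp_all add: HN(3)[symmetric] linear_add[OF lin, symmetric] linear_diff[OF lin])
  then show ?thesis using 1 2 \<tau>_add by simp
qed

end

section \<open>Involutions of a group with Cartan data\<close>

locale cartan_involution = cartan_group G U \<tau> B L P \<nu>
  for G :: "('a, 'e::euclidean_space) lie_group" and U \<tau> B L P \<nu> +
  fixes s :: "'a \<Rightarrow> 'a"
  assumes s: "smooth_map (mfd G) (mfd G) s" "s \<in> hom G G" and ss: "\<And>x. x \<in> carrier G \<Longrightarrow> s (s x) = x"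
begin

abbreviation "S \<equiv> diff_one G G s"

lemma s_closed: "x \<in> carrier G \<Longrightarrow> s x \<in> carrier G" and s_mult: "x \<in> carrier G \<Longrightarrow> y \<in> carrier G \<Longrightarrow> s (x \<otimes>\<^bsub>G\<^esub> y) = s x \<otimes>\<^bsub>G\<^esub> s y"
  using s(2) by (auto simp: hom_def)

lemma s_hom: "group_hom G G s"
  using s(2) is_group by (simp add: group_hom_def group_hom_axioms_def)

lemma s_one: "s \<one>\<^bsub>G\<^esub> = \<one>\<^bsub>G\<^esub>" by (rule group_hom.hom_one[OF s_hom])

lemma linear_S: "linear S" by (rule bounded_linear.linear[OF bounded_linear_diff_one[OF G G s(1) s_one]])

lemma S_V: "X \<in> V \<Longrightarrow> S X \<in> V" by (rule diff_one_in[OF G G s(1) s_one])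

lemma S_S: assumes "X \<in> V" shows "S (S X) = X"
proof -
  obtain \<alpha> where \<alpha>: "tan1 G \<alpha> X" by (rule tan1_exists[OF G assms])
  have "tan1 G (\<lambda>t. s (s (\<alpha> t))) (S (S X))" by (rule tan1_map[OF G G s(1) s_one tan1_map[OF G G s(1) s_one \<alpha>]])
  moreover have "\<forall>\<^sub>F t in nhds 0. s (s (\<alpha> t)) = \<alpha> t" using tan1_carrier[OF G \<alpha>] by eventually_elim (rule ss)
  ultimately have "tan1 G \<alpha> (S (S X))" by (rule tan1_cong[rotated])
  then show ?thesis by (rule tan1_unique[OF _ \<alpha>])
qed

lemma S_br: "X \<in> V \<Longrightarrow> Y \<in> V \<Longrightarrow> S (bracket G X Y) = bracket G (S X) (S Y)"
  by (rule diff_one_bracket[OF G G s])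

lemma s_exp: "X \<in> V \<Longrightarrow> s (lie_exp G X) = lie_exp G (S X)"
  by (rule lie_exp_hom[OF G G s])

lemma compact_U_sU: "compactin (mtop (mfd G)) ((\<lambda>(x, y). x \<otimes>\<^bsub>G\<^esub> y) ` (U \<times> s ` U))"
  by (rule compactin_mult[OF G U(2) image_compactin[OF U(2) smooth_map_continuous[OF s(1)]]])

lemma centre_S: assumes "w \<in> ra.centre" shows "S w \<in> ra.centre"
proof (rule centreI)
  show "S w \<in> V" by (rule S_V[OF centreD(1)[OF assms]])
  fix Y assume Y: "Y \<in> V"
  have "bracket G (S w) (S (S Y)) = S (bracket G w (S Y))" by (rule S_br[OF centreD(1)[OF assms] S_V[OF Y], symmetric])
  also have "\<dots> = 0" unfolding centreD(2)[OF assms S_V[OF Y]] by (rule linear_0[OF linear_S])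
  finally show "bracket G (S w) Y = 0" unfolding S_S[OF Y] .
qed

lemma centre_\<tau>: assumes "w \<in> ra.centre" shows "\<tau> w \<in> ra.centre"
proof (rule centreI)
  note wV = centreD(1)[OF assms]
  show "\<tau> w \<in> V" by (rule \<tau>_V[OF wV])
  fix Y assume Y: "Y \<in> V"
  have "bracket G (\<tau> w) (\<tau> (\<tau> Y)) = \<tau> (bracket G w (\<tau> Y))" by (rule \<tau>_br[OF wV \<tau>_V[OF Y], symmetric])
  also have "\<dots> = 0" unfolding centreD(2)[OF assms \<tau>_V[OF Y]] using \<tau>_scale[OF wV, of 0] by simp
  finally show "bracket G (\<tau> w) Y = 0" unfolding \<tau>_\<tau>[OF Y] .
qed

lemma centre_add: "w \<in> ra.centre \<Longrightarrow> v \<in> ra.centre \<Longrightarrow> w + v \<in> ra.centre"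
  using V by (simp add: ra.centre_def ra.br_simps subspace_add)

lemma centre_diff: "w \<in> ra.centre \<Longrightarrow> v \<in> ra.centre \<Longrightarrow> w - v \<in> ra.centre"
  using V by (simp add: ra.centre_def ra.br_simps subspace_diff)

lemma centre_decompose:
  assumes "w \<in> ra.centre"
  obtains H N where "H \<in> \<uu>" "H \<in> ra.centre" "N \<in> \<mm>" "N \<in> ra.centre" "w = H + N" "\<tau> w = H - N"
proof
  note wV = centreD(1)[OF assms]
  show "(1/2) *\<^sub>R (w + \<tau> w) \<in> \<uu>" "(1/2) *\<^sub>R (w - \<tau> w) \<in> \<mm>" "w = (1/2) *\<^sub>R (w + \<tau> w) + (1/2) *\<^sub>R (w - \<tau> w)"
    "\<tau> w = (1/2) *\<^sub>R (w + \<tau> w) - (1/2) *\<^sub>R (w - \<tau> w)" by (rule decompose[OF wV])+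
  show "(1/2) *\<^sub>R (w + \<tau> w) \<in> ra.centre" by (rule centre_scale[OF centre_add[OF assms centre_\<tau>[OF assms]]])
  show "(1/2) *\<^sub>R (w - \<tau> w) \<in> ra.centre" by (rule centre_scale[OF centre_diff[OF assms centre_\<tau>[OF assms]]])
qed

text \<open>
  The exponentials of the multiples of \<open>S w\<close> stay in the compact set \<open>s ` U\<close>, hence those of its \<open>\<mm>\<close>-part in
  the product of \<open>U\<close> and \<open>s ` U\<close>.
\<close>

lemma centre_uu: assumes w: "w \<in> ra.centre" "w \<in> \<uu>" shows "S w \<in> \<uu>"
proof -
  note wV = centreD(1)[OF w(1)]
  obtain H N where HN: "H \<in> \<uu>" "H \<in> ra.centre" "N \<in> \<mm>" "N \<in> ra.centre" "S w = H + N"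
    by (rule centre_decompose[OF centre_S[OF w(1)]])
  note HV = uu_V[OF HN(1)] and NV = mm_V[OF HN(3)]
  have "lie_exp G (real n *\<^sub>R N) \<in> (\<lambda>(x, y). x \<otimes>\<^bsub>G\<^esub> y) ` (U \<times> s ` U)" for n
  proof -
    let ?h = "lie_exp G (real n *\<^sub>R H)" and ?n = "lie_exp G (real n *\<^sub>R N)"
    have V': "real n *\<^sub>R H \<in> V" "real n *\<^sub>R N \<in> V" "real n *\<^sub>R w \<in> V" using HV NV wV V by (auto intro: subspace_scale)
    have 1: "?h \<in> U" "lie_exp G (real n *\<^sub>R w) \<in> U" by (intro exp_uu uu_scale HN(1) w(2))+
    have "bracket G (real n *\<^sub>R H) (real n *\<^sub>R N) = 0" by (rule centreD(2)[OF centre_scale[OF HN(2)] V'(2)])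
    from lie_exp_commute(2)[OF G V'(1,2) this]
    have "?h \<otimes>\<^bsub>G\<^esub> ?n = lie_exp G (real n *\<^sub>R S w)" unfolding HN(5) scaleR_add_right by (rule sym)
    also have "\<dots> = s (lie_exp G (real n *\<^sub>R w))" unfolding s_exp[OF V'(3)] linear_cmul[OF linear_S] ..
    finally have "inv\<^bsub>G\<^esub> ?h \<otimes>\<^bsub>G\<^esub> (?h \<otimes>\<^bsub>G\<^esub> ?n) = inv\<^bsub>G\<^esub> ?h \<otimes>\<^bsub>G\<^esub> s (lie_exp G (real n *\<^sub>R w))" by (rule arg_cong)
    then have eq: "?n = inv\<^bsub>G\<^esub> ?h \<otimes>\<^bsub>G\<^esub> s (lie_exp G (real n *\<^sub>R w))"
      using exp_closed[OF V'(1)] exp_closed[OF V'(2)] by (simp add: m_assoc[symmetric])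
    have "(inv\<^bsub>G\<^esub> ?h, s (lie_exp G (real n *\<^sub>R w))) \<in> U \<times> s ` U"
      using 1 subgroup.m_inv_closed[OF U(1)] by blast
    then show ?thesis by (rule image_eqI[rotated]) (simp add: eq[symmetric])
  qed
  from central_bounded_zero[OF HN(3,4) compact_U_sU this] show ?thesis using HN(1,5) by simp
qed

text \<open>For central vectors in \<open>\<uu>\<close> the claim is \<open>centre_uu\<close>. The
  complex structure \<open>J\<close> exchanges the \<open>\<uu>\<close>- and
  \<open>\<mm>\<close>-parts of the centre and anticommutes with both \<open>S\<close> and
  \<open>\<tau>\<close>, which carries the claim over to \<open>\<mm>\<close>.\<close>

lemma centre_commute:
  assumes J: "\<And>w. w \<in> V \<Longrightarrow> J w \<in> V" "\<And>w. w \<in> V \<Longrightarrow> J (- w) = - J w" "\<And>w. w \<in> V \<Longrightarrow> J (J w) = - w"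
    "\<And>v w. v \<in> V \<Longrightarrow> w \<in> V \<Longrightarrow> bracket G v (J w) = J (bracket G v w)"
    "\<And>w. w \<in> V \<Longrightarrow> \<tau> (J w) = - J (\<tau> w)" "\<And>w. w \<in> V \<Longrightarrow> S (J w) = - J (S w)"
    and w: "w \<in> ra.centre"
  shows "S (\<tau> w) = \<tau> (S w)"
proof -
  obtain H N where HN: "H \<in> \<uu>" "H \<in> ra.centre" "N \<in> \<mm>" "N \<in> ra.centre" "w = H + N" "\<tau> w = H - N"
    by (rule centre_decompose[OF w])
  note HV = uu_V[OF HN(1)] and NV = mm_V[OF HN(3)]
  note SV = S_V[OF HV] S_V[OF NV]
  have J0: "J 0 = 0" using J(2)[OF subspace_0[OF V]] by (metis minus_zero add.right_inverse scaleR_half_double scaleR_zero_right)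
  have "J N \<in> ra.centre"
  proof (rule centreI[OF J(1)[OF NV]])
    fix Y assume Y: "Y \<in> V"
    have "bracket G Y (J N) = 0" unfolding J(4)[OF Y NV] centreD(3)[OF HN(4) Y] by (rule J0)
    then show "bracket G (J N) Y = 0" using bracket_antisym[OF G Y J(1)[OF NV]] by simp
  qed
  moreover have "J N \<in> \<uu>" using HN(3) J(1,2,5)[OF NV] by (simp add: uu mm)
  ultimately have "S (J N) \<in> \<uu>" by (rule centre_uu)
  then have "\<tau> (- J (S N)) = - J (S N)" unfolding J(6)[OF NV] uu by blast
  then have "J (\<tau> (S N)) = J (- S N)"
    unfolding \<tau>_minus[OF J(1)[OF SV(2)]] J(5)[OF SV(2)] J(2)[OF SV(2)] by simp
  then have "J (J (\<tau> (S N))) = J (J (- S N))" by (rule arg_cong)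
  then have 1: "\<tau> (S N) = - S N"
    unfolding J(3)[OF \<tau>_V[OF SV(2)]] J(3)[OF subspace_neg[OF V SV(2)]] by (simp only: neg_equal_iff_equal)
  have 2: "\<tau> (S H) = S H" using centre_uu[OF HN(2,1)] by (simp add: uu)
  have "\<tau> (S w) = S H - S N" unfolding HN(5) linear_add[OF linear_S] \<tau>_add[OF SV] 1 2 by simp
  then show ?thesis unfolding HN(6) linear_diff[OF linear_S] by simp
qed

text \<open>
  On the eigenspace of \<open>\<tau>S\<tau>S\<close> for the eigenvalue \<open>k\<close>, conjugation by \<open>exp (Z/4)\<close> scales \<open>S\<close> by \<open>k\<close> to the
  power \<open>-1/2\<close> and, on the image of that eigenspace under \<open>\<tau>\<close>, by \<open>k\<close> to the power \<open>1/2\<close>; there \<open>\<tau>S = kS\<tau>\<close>.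
\<close>

lemma conjugate_commuting:
  assumes comm: "\<And>w. w \<in> ra.centre \<Longrightarrow> S (\<tau> w) = \<tau> (S w)"
  obtains g where "g \<in> carrier G"
    "\<forall>X\<in>V. Ad G g (S (Ad G (inv\<^bsub>G\<^esub> g) (\<tau> X))) = \<tau> (Ad G g (S (Ad G (inv\<^bsub>G\<^esub> g) X)))"
proof -
  have autbr: "S (brV x y) = brV (S x) (S y)" if "x \<in> V" "y \<in> V" for x y
    using S_br[OF that] brV[OF that] brV[OF S_V[OF that(1)] S_V[OF that(2)]] by simp
  have commV: "S (\<tau>V w) = \<tau>V (S w)" if "w \<in> ra.centre" for w
    using comm[OF that] \<tau>V[OF centreD(1)[OF that]] \<tau>V[OF S_V[OF centreD(1)[OF that]]] by simp
  have "\<exists>Z\<in>V. (\<forall>v\<in>V. \<forall>k>0. \<tau>V (S (\<tau>V (S v))) = k *\<^sub>R v \<longrightarrow> brV Z v = ln k *\<^sub>R v) \<and>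
    V \<subseteq> span {v \<in> V. \<exists>k>0. \<tau>V (S (\<tau>V (S v))) = k *\<^sub>R v}"
  proof (rule ra.log_automorphism[OF linear_S S_V S_S autbr commV])
    fix Z assume "Z \<in> V" "V \<subseteq> span {v \<in> V. \<exists>k>0. \<tau>V (S (\<tau>V (S v))) = k *\<^sub>R v}"
      and "\<And>v k. v \<in> V \<Longrightarrow> 0 < k \<Longrightarrow> \<tau>V (S (\<tau>V (S v))) = k *\<^sub>R v \<Longrightarrow> brV Z v = ln k *\<^sub>R v"
    then show ?thesis by (intro bexI[of _ Z] conjI ballI allI impI) simp_all
  qed
  then obtain Z where ZV: "Z \<in> V" and
    Z: "\<forall>v\<in>V. \<forall>k>0. \<tau>V (S (\<tau>V (S v))) = k *\<^sub>R v \<longrightarrow> brV Z v = ln k *\<^sub>R v"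
    and span: "V \<subseteq> span {v \<in> V. \<exists>k>0. \<tau>V (S (\<tau>V (S v))) = k *\<^sub>R v}"
    by (elim bexE conjE)
  have eig: "Ad G (lie_exp G (t *\<^sub>R Z)) v = exp (ln k * t) *\<^sub>R v" if "v \<in> V" "0 < k" "\<tau> (S (\<tau> (S v))) = k *\<^sub>R v" for v k t
  proof (rule Ad_exp_eigenvector[OF G ZV that(1)])
    have "\<tau>V (S (\<tau>V (S v))) = k *\<^sub>R v" using that(3) \<tau>V[OF S_V[OF that(1)]] \<tau>V[OF S_V[OF \<tau>_V[OF S_V[OF that(1)]]]] by simp
    from Z[rule_format, OF that(1,2) this] show "bracket G Z v = ln k *\<^sub>R v" unfolding brV[OF ZV that(1)] .
  qed
  define g where "g = lie_exp G ((1/4) *\<^sub>R Z)"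
  have Z4: "(1/4) *\<^sub>R Z \<in> V" by (rule subspace_scale[OF V ZV])
  have gG: "g \<in> carrier G" unfolding g_def by (rule exp_closed[OF Z4])
  have ginv: "inv\<^bsub>G\<^esub> g = lie_exp G ((- 1/4) *\<^sub>R Z)" unfolding g_def lie_exp_neg[OF G Z4, symmetric] by simp
  have Adg: "Ad G g v = exp (ln k / 4) *\<^sub>R v" "Ad G (inv\<^bsub>G\<^esub> g) v = exp (- ln k / 4) *\<^sub>R v"
    if "v \<in> V" "0 < k" "\<tau> (S (\<tau> (S v))) = k *\<^sub>R v" for v k
    unfolding ginv unfolding g_def eig[OF that] by simp_all
  have lin: "linear (Ad G g)" "linear (Ad G (inv\<^bsub>G\<^esub> g))"
    by (intro bounded_linear.linear bounded_linear_Ad[OF G] gG inv_closed)+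
  let ?l = "\<lambda>X. Ad G g (S (Ad G (inv\<^bsub>G\<^esub> g) (\<tau>V X)))" and ?r = "\<lambda>X. \<tau>V (Ad G g (S (Ad G (inv\<^bsub>G\<^esub> g) X)))"
  have "?l v = ?r v" if vE: "v \<in> V" "\<exists>k>0. \<tau>V (S (\<tau>V (S v))) = k *\<^sub>R v" for v
  proof -
    obtain k where k: "0 < k" "\<tau>V (S (\<tau>V (S v))) = k *\<^sub>R v" using vE(2) by blast
    note v = vE(1)
    note Sv = S_V[OF v] and tv = \<tau>_V[OF v]
    note tSv = \<tau>_V[OF Sv] and Stv = S_V[OF tv]
    have A1: "\<tau> (S (\<tau> (S v))) = k *\<^sub>R v" using k(2) \<tau>V[OF Sv] \<tau>V[OF S_V[OF tSv]] by simp
    have A2: "\<tau> (S v) = k *\<^sub>R S (\<tau> v)"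
    proof -
      have "S (\<tau> (\<tau> (S (\<tau> (S v))))) = S (\<tau> (k *\<^sub>R v))" unfolding A1 ..
      then show ?thesis unfolding \<tau>_\<tau>[OF S_V[OF tSv]] S_S[OF tSv] \<tau>_scale[OF v] linear_cmul[OF linear_S] .
    qed
    have A3: "S (\<tau> v) = inverse k *\<^sub>R \<tau> (S v)" unfolding A2 using k(1) by simp
    \<comment> \<open>\<open>S\<close> and \<open>\<tau>\<close> both conjugate
      \<open>\<tau>S\<tau>S\<close> into its inverse. Each of them exchanges the eigenvalues
      \<open>k\<close> and \<open>1/k\<close>, so their product preserves them.\<close>
    have A4: "\<tau> (S (\<tau> (S (S v)))) = inverse k *\<^sub>R S v"
      unfolding S_S[OF v] A3 \<tau>_scale[OF tSv] \<tau>_\<tau>[OF Sv] ..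
    have A5: "\<tau> (S (\<tau> (S (\<tau> v)))) = inverse k *\<^sub>R \<tau> v"
      unfolding A3 \<tau>_scale[OF tSv] \<tau>_\<tau>[OF Sv] linear_cmul[OF linear_S] S_S[OF v] \<tau>_scale[OF v] ..
    have A6: "\<tau> (S (\<tau> (S (S (\<tau> v))))) = k *\<^sub>R S (\<tau> v)"
      unfolding S_S[OF tv] \<tau>_\<tau>[OF v] A2 ..
    have ik: "0 < inverse k" using k(1) by simp
    have "?l v = exp (ln k / 2) *\<^sub>R S (\<tau> v)"
      unfolding \<tau>V[OF v] Adg(2)[OF tv ik A5] linear_cmul[OF linear_S] linear_cmul[OF lin(1)] Adg(1)[OF Stv k(1) A6]
      using k(1) by (simp add: ln_inverse exp_add[symmetric])
    moreover have "Ad G g (S (Ad G (inv\<^bsub>G\<^esub> g) v)) = exp (- ln k / 2) *\<^sub>R S v"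
      unfolding Adg(2)[OF v k(1) A1] linear_cmul[OF linear_S] linear_cmul[OF lin(1)] Adg(1)[OF Sv ik A4]
      using k(1) by (simp add: ln_inverse exp_add[symmetric])
    then have "?r v = exp (- ln k / 2) *\<^sub>R \<tau> (S v)" using \<tau>V[OF subspace_scale[OF V Sv]] \<tau>_scale[OF Sv] by simp
    then have "?r v = (exp (- ln k / 2) * exp (ln k)) *\<^sub>R S (\<tau> v)" unfolding A2 using k(1) by simp
    then have "?r v = exp (ln k / 2) *\<^sub>R S (\<tau> v)" unfolding exp_add[symmetric] by simp
    ultimately show ?thesis by simp
  qed
  then have 1: "\<And>v. v \<in> {v \<in> V. \<exists>k>0. \<tau>V (S (\<tau>V (S v))) = k *\<^sub>R v} \<Longrightarrow> ?l v = ?r v" by blast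
  have l: "linear ?l" "linear ?r"
    using linear_compose[OF linear_compose[OF linear_compose[OF ra.\<tau>(1) lin(2)] linear_S] lin(1)]
      linear_compose[OF linear_compose[OF linear_compose[OF lin(2) linear_S] lin(1)] ra.\<tau>(1)] by (simp_all add: o_def)
  have "?l X = ?r X" if "X \<in> V" for X
    by (rule linear_eq_on[OF l subsetD[OF span that] 1])
  then have "\<forall>X\<in>V. Ad G g (S (Ad G (inv\<^bsub>G\<^esub> g) (\<tau> X))) = \<tau> (Ad G g (S (Ad G (inv\<^bsub>G\<^esub> g) X)))"
    using \<tau>V S_V Ad_in[OF G gG] Ad_in[OF G inv_closed[OF gG]] by simp
  from that[OF gG this] show thesis .
qed

text \<open>
  For \<open>u \<in> U\<close> with \<open>s u = h exp Y\<close>, the automorphism \<open>Ad (exp Y)\<close> commutes with \<open>\<tau>\<close>, which exchanges its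
  eigenvalues \<open>k\<close> and \<open>1/k\<close>. So \<open>Y\<close> is central.
\<close>

lemma s_U:
  assumes comm: "\<And>X. X \<in> V \<Longrightarrow> S (\<tau> X) = \<tau> (S X)" and u: "u \<in> U"
  shows "s u \<in> U"
proof -
  have uG: "u \<in> carrier G" using u U_sub by blast
  obtain h Y where h: "h \<in> U" and Y: "Y \<in> \<mm>" and x: "s u = h \<otimes>\<^bsub>G\<^esub> lie_exp G Y"
    by (rule polar[OF s_closed[OF uG]])
  have hG: "h \<in> carrier G" using h U_sub by blast
  note YV = mm_V[OF Y]
  note eG = exp_closed[OF YV]
  \<comment> \<open>\<open>Ad (s u)\<close> is \<open>Ad u\<close> conjugated by \<open>S\<close>,
    so it commutes with \<open>\<tau>\<close> as \<open>Ad u\<close> does; removing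
    \<open>Ad h\<close> leaves the same statement for \<open>Ad (exp Y)\<close>.\<close>
  have Adx: "Ad G (s u) X = S (Ad G u (S X))" if X: "X \<in> V" for X
    using diff_one_Ad[OF G G s uG S_V[OF X]] unfolding S_S[OF X] by (rule sym)
  have Ad1: "Ad G (s u) (\<tau> X) = \<tau> (Ad G (s u) X)" if X: "X \<in> V" for X
    unfolding Adx[OF X] Adx[OF \<tau>_V[OF X]] comm[OF X] Ad_U_commutes[OF u S_V[OF X]] comm[OF Ad_in[OF G uG S_V[OF X]]] ..
  have eh: "lie_exp G Y = inv\<^bsub>G\<^esub> h \<otimes>\<^bsub>G\<^esub> s u" unfolding x using hG eG by (simp add: m_assoc[symmetric])
  have Ade: "Ad G (lie_exp G Y) X = Ad G (inv\<^bsub>G\<^esub> h) (Ad G (s u) X)" if X: "X \<in> V" for X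
    unfolding eh by (rule Ad_mult[OF G inv_closed[OF hG] s_closed[OF uG] X])
  have Ad2: "Ad G (lie_exp G Y) (\<tau> X) = \<tau> (Ad G (lie_exp G Y) X)" if X: "X \<in> V" for X
    unfolding Ade[OF X] Ade[OF \<tau>_V[OF X]] Ad1[OF X]
    by (rule Ad_U_commutes[OF subgroup.m_inv_closed[OF U(1) h] Ad_in[OF G s_closed[OF uG] X]])
  obtain E k where E: "ra.orthonormal E" "E \<subseteq> V" and k: "\<forall>e\<in>E. bracket G Y e = k e *\<^sub>R e"
    and expand: "\<forall>v\<in>V. v = (\<Sum>e\<in>E. ipB v e *\<^sub>R e)" by (rule ad_mm_diagonalizable[OF Y])
  have "bracket G Y e = 0" if e: "e \<in> E" for e
  proof -
    have eV: "e \<in> V" using e E(2) by blast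
    note ke = bspec[OF k e]
    have "\<tau> (bracket G Y e) = bracket G (\<tau> Y) (\<tau> e)" by (rule \<tau>_br[OF YV eV])
    also have "\<dots> = - bracket G Y (\<tau> e)"
      using Y bracket_scale_left[OF G \<tau>_V[OF eV], of "- 1" Y] by (simp add: mm)
    finally have "bracket G Y (\<tau> e) = (- k e) *\<^sub>R \<tau> e" unfolding ke \<tau>_scale[OF eV] by simp
    from Ad_eigen[OF YV \<tau>_V[OF eV] this] have "exp (- k e) *\<^sub>R \<tau> e = Ad G (lie_exp G Y) (\<tau> e)" by simp
    also have "\<dots> = exp (k e) *\<^sub>R \<tau> e" unfolding Ad2[OF eV] Ad_eigen[OF YV eV ke] by (rule \<tau>_scale[OF eV])
    finally have "\<tau> e = 0 \<or> k e = 0" unfolding real_vector.scale_right_imp_eq scaleR_cancel_right by auto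
    then show ?thesis
    proof
      assume "\<tau> e = 0"
      then have "e = 0" using \<tau>_\<tau>[OF eV] \<tau>_scale[OF eV, of 0] by simp
      then show ?thesis unfolding ke by simp
    qed (simp add: ke)
  qed
  then have Yc: "Y \<in> ra.centre" by (rule bracket_vanish[OF YV E expand])
  \<comment> \<open>With \<open>Y\<close> central, the powers of \<open>h exp Y\<close> split. The
    powers of \<open>exp Y\<close> thus stay in the compact product of \<open>U\<close> with its
    image under \<open>s\<close>.\<close>
  have "lie_exp G (real n *\<^sub>R Y) \<in> (\<lambda>(x, y). x \<otimes>\<^bsub>G\<^esub> y) ` (U \<times> s ` U)" for n
  proof -
    have Un: "x [^]\<^bsub>G\<^esub> n \<in> U" if "x \<in> U" for x
      using that subgroup.m_closed[OF U(1)] subgroup.one_closed[OF U(1)] by (induction n) auto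
    have "s (u [^]\<^bsub>G\<^esub> n) = s u [^]\<^bsub>G\<^esub> n" by (rule group_hom.hom_nat_pow[OF s_hom uG])
    also have "\<dots> = h [^]\<^bsub>G\<^esub> n \<otimes>\<^bsub>G\<^esub> lie_exp G Y [^]\<^bsub>G\<^esub> n"
      unfolding x by (rule pow_mult_distrib[OF centre_exp_commute[OF Yc hG] hG eG])
    finally have "lie_exp G (real n *\<^sub>R Y) = inv\<^bsub>G\<^esub> (h [^]\<^bsub>G\<^esub> n) \<otimes>\<^bsub>G\<^esub> s (u [^]\<^bsub>G\<^esub> n)"
      unfolding lie_exp_pow[OF G YV] using hG eG by (simp add: m_assoc[symmetric])
    moreover have "(inv\<^bsub>G\<^esub> (h [^]\<^bsub>G\<^esub> n), s (u [^]\<^bsub>G\<^esub> n)) \<in> U \<times> s ` U"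
      using subgroup.m_inv_closed[OF U(1) Un[OF h]] Un[OF u] by blast
    ultimately show ?thesis by (intro image_eqI[where x="(inv\<^bsub>G\<^esub> (h [^]\<^bsub>G\<^esub> n), s (u [^]\<^bsub>G\<^esub> n))"]) simp_all
  qed
  from central_bounded_zero[OF Y Yc compact_U_sU this]
  have "s u = h" unfolding x using lie_exp_zero[OF G] hG by simp
  then show ?thesis using h by simp
qed

end

section \<open>Maps intertwining complex structures\<close>

text \<open>Compositions and pairs of maps are awkward to treat chart by chart; in terms of curves,
  the intertwining condition passes to them directly.\<close>

lemma intertwining_mapI:
  assumes M: "pre_manifold M" and N: "pre_manifold N" and f: "smooth_map M N f" and J: "\<And>v. v \<in> model M \<Longrightarrow> J v \<in> model M"
    and vel: "\<And>c d \<alpha> \<beta> v w. c \<in> atlas M \<Longrightarrow> d \<in> atlas N \<Longrightarrow> hasvel c \<alpha> v \<Longrightarrow> hasvel c \<beta> (J v) \<Longrightarrow> \<alpha> 0 = \<beta> 0 \<Longrightarrow>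
      hasvel d (\<lambda>t. f (\<alpha> t)) w \<Longrightarrow> hasvel d (\<lambda>t. f (\<beta> t)) (J' w)"
  shows "intertwining_map J J' M N f"
  unfolding intertwining_map_def
proof (intro conjI ballI)
  fix c d p v assume c: "c \<in> atlas M" and d: "d \<in> atlas N" and p: "p \<in> loc_dom c d f" and v: "v \<in> model M"
  obtain x where x: "p = snd c x" "x \<in> fst c" "f x \<in> fst d" using p by (auto simp: loc_dom_def)
  obtain \<alpha> where \<alpha>: "\<alpha> 0 = x" "hasvel c \<alpha> v" by (rule hasvel_exists[OF M c x(2) v])
  obtain \<beta> where \<beta>: "\<beta> 0 = x" "hasvel c \<beta> (J v)" by (rule hasvel_exists[OF M c x(2) J[OF v]])
  have "hasvel d (\<lambda>t. f (\<alpha> t)) (loc_deriv c d f p v)"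
    using hasvel_smooth_map[OF M N f c d \<alpha>(2)] x \<alpha>(1) by simp
  from vel[OF c d \<alpha>(2) \<beta>(2) _ this] have "hasvel d (\<lambda>t. f (\<beta> t)) (J' (loc_deriv c d f p v))" using \<alpha>(1) \<beta>(1) by simp
  then show "loc_deriv c d f p (J v) = J' (loc_deriv c d f p v)"
    by (rule loc_deriv_unique[OF M N f c d \<beta>(2)]) (simp add: x(1) \<beta>(1))
qed (rule f)

lemma intertwining_mapD:
  assumes M: "pre_manifold M" and N: "pre_manifold N" and f: "intertwining_map J J' M N f"
    and c: "c \<in> atlas M" and d: "d \<in> atlas N" and \<alpha>: "hasvel c \<alpha> v" and \<beta>: "hasvel c \<beta> (J v)" and eq: "\<alpha> 0 = \<beta> 0"
    and w: "hasvel d (\<lambda>t. f (\<alpha> t)) w"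
  shows "hasvel d (\<lambda>t. f (\<beta> t)) (J' w)"
proof -
  have sf: "smooth_map M N f" using f by (simp add: intertwining_map_def)
  have x: "\<alpha> 0 \<in> fst c" "f (\<alpha> 0) \<in> fst d" by (rule hasvel_0[OF \<alpha>], rule hasvel_0[OF w])
  have v: "v \<in> model M" by (rule hasvel_in_model[OF M c \<alpha>])
  have "loc_deriv c d f (snd c (\<alpha> 0)) v = w" by (rule loc_deriv_unique[OF M N sf c d \<alpha> w refl])
  moreover have "snd c (\<alpha> 0) \<in> loc_dom c d f" using x by (auto simp: loc_dom_def)
  then have "loc_deriv c d f (snd c (\<alpha> 0)) (J v) = J' (loc_deriv c d f (snd c (\<alpha> 0)) v)"
    using f c d v unfolding intertwining_map_def by blast
  ultimately show ?thesis using hasvel_smooth_map[OF M N sf c d \<beta>] x eq by simp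
qed

lemma intertwining_map_compose:
  assumes M: "pre_manifold M" and N: "pre_manifold N" and K: "pre_manifold K"
    and J: "\<And>v. v \<in> model M \<Longrightarrow> J v \<in> model M"
    and f: "intertwining_map J J' M N f" and g: "intertwining_map J' J'' N K g"
  shows "intertwining_map J J'' M K (\<lambda>x. g (f x))"
proof (rule intertwining_mapI[OF M K _ J])
  have sf: "smooth_map M N f" and sg: "smooth_map N K g" using f g by (simp_all add: intertwining_map_def)
  show "smooth_map M K (\<lambda>x. g (f x))" by (rule smooth_map_compose[OF M N K sf sg])
  fix c d \<alpha> \<beta> v w
  assume c: "c \<in> atlas M" and d: "d \<in> atlas K" and \<alpha>: "hasvel c \<alpha> v" and \<beta>: "hasvel c \<beta> (J v)" and eq: "\<alpha> 0 = \<beta> 0"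
    and w: "hasvel d (\<lambda>t. g (f (\<alpha> t))) w"
  have "\<alpha> 0 \<in> topspace (mtop M)" using hasvel_0[OF \<alpha>] chart_subset[OF M c] by blast
  from ex_chart[OF N smooth_map_in[OF sf this]] obtain e where e: "e \<in> atlas N" "f (\<alpha> 0) \<in> fst e" by blast
  note fa = hasvel_smooth_map[OF M N sf c e(1) \<alpha> e(2)]
  note fb = intertwining_mapD[OF M N f c e(1) \<alpha> \<beta> eq fa]
  show "hasvel d (\<lambda>t. g (f (\<beta> t))) (J'' w)"
    by (rule intertwining_mapD[OF N K g e(1) d fa fb _ w]) (simp add: eq)
qed

lemma bounded_linear_i_mult: "bounded_linear (i_mult :: complex ^ 'n \<Rightarrow> complex ^ 'n)"
proof (rule linear_conv_bounded_linear[THEN iffD1], rule linearI)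
  show "i_mult (x + y) = i_mult x + i_mult y" for x y :: "complex ^ 'n" by (simp add: vec_eq_iff algebra_simps)
  show "i_mult (r *\<^sub>R x) = r *\<^sub>R i_mult x" for r and x :: "complex ^ 'n" by (simp add: vec_eq_iff)
qed

lemma i_mult_i_mult: "i_mult (i_mult x) = - x" for x :: "complex ^ 'n"
  by (simp add: vec_eq_iff)

lemma complex_lie_groupD:
  assumes "complex_lie_group G"
  shows "lie_group G" "\<And>v. v \<in> lie_algebra G \<Longrightarrow> i_mult v \<in> lie_algebra G"
    "intertwining_map (map_prod i_mult i_mult) i_mult (prod_manifold (mfd G) (mfd G)) (mfd G) (\<lambda>(x, y). x \<otimes>\<^bsub>G\<^esub> y)"
  using assms by (auto simp: complex_lie_group_def vec.subspace_def)

text \<open>Translations are holomorphic: a factor held constant contributes the velocity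
  \<open>0\<close>, which multiplication by the imaginary unit fixes, so holomorphy of the group
  multiplication applies to the pair of curves.\<close>

lemma intertwining_conj:
  assumes G: "complex_lie_group G" and g: "g \<in> carrier G"
  shows "intertwining_map i_mult i_mult (mfd G) (mfd G) (conj_by G g)"
proof -
  note lie = complex_lie_groupD(1)[OF G] and iV = complex_lie_groupD(2)[OF G] and mult = complex_lie_groupD(3)[OF G]
  note M = lie_groupD(3)[OF lie]
  note MM = pre_manifold_prod[OF M M]
  interpret group G by (rule lie_groupD(1)[OF lie])
  have one: "intertwining_map i_mult i_mult (mfd G) (mfd G) (\<lambda>x. h \<otimes>\<^bsub>G\<^esub> x)"
    "intertwining_map i_mult i_mult (mfd G) (mfd G) (\<lambda>x. x \<otimes>\<^bsub>G\<^esub> h)" if h: "h \<in> carrier G" for h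
  proof -
    obtain b where b: "b \<in> atlas (mfd G)" "h \<in> fst b" using ex_chart[OF M] h lie_groupD(4)[OF lie] by blast
    show "intertwining_map i_mult i_mult (mfd G) (mfd G) (\<lambda>x. h \<otimes>\<^bsub>G\<^esub> x)"
    proof (rule intertwining_mapI[OF M M smooth_map_left_mult[OF lie h] iV])
      fix c d \<alpha> \<beta> v w
      assume c: "c \<in> atlas (mfd G)" and d: "d \<in> atlas (mfd G)" and \<alpha>: "hasvel c \<alpha> v" and \<beta>: "hasvel c \<beta> (i_mult v)" and eq: "\<alpha> 0 = \<beta> 0"
        and w: "hasvel d (\<lambda>t. h \<otimes>\<^bsub>G\<^esub> \<alpha> t) w"
      have b': "hasvel (fst b \<times> fst c, map_prod (snd b) (snd c)) (\<lambda>t. (h, \<beta> t)) (map_prod i_mult i_mult (0, v))"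
        using hasvel_Pair[OF hasvel_const[OF b(2)] \<beta>] by simp
      from intertwining_mapD[OF MM M mult prod_chart[OF b(1) c] d hasvel_Pair[OF hasvel_const[OF b(2)] \<alpha>] b']
      show "hasvel d (\<lambda>t. h \<otimes>\<^bsub>G\<^esub> \<beta> t) (i_mult w)" using eq w by simp
    qed
    have sm: "smooth_map (mfd G) (mfd G) (\<lambda>x. x \<otimes>\<^bsub>G\<^esub> h)"
      by (rule smooth_map_mult[OF lie M smooth_map_id[OF M] smooth_map_const'[OF lie M h]])
    show "intertwining_map i_mult i_mult (mfd G) (mfd G) (\<lambda>x. x \<otimes>\<^bsub>G\<^esub> h)"
    proof (rule intertwining_mapI[OF M M sm iV])
      fix c d \<alpha> \<beta> v w
      assume c: "c \<in> atlas (mfd G)" and d: "d \<in> atlas (mfd G)" and \<alpha>: "hasvel c \<alpha> v" and \<beta>: "hasvel c \<beta> (i_mult v)" and eq: "\<alpha> 0 = \<beta> 0"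
        and w: "hasvel d (\<lambda>t. \<alpha> t \<otimes>\<^bsub>G\<^esub> h) w"
      have b': "hasvel (fst c \<times> fst b, map_prod (snd c) (snd b)) (\<lambda>t. (\<beta> t, h)) (map_prod i_mult i_mult (v, 0))"
        using hasvel_Pair[OF \<beta> hasvel_const[OF b(2)]] by simp
      from intertwining_mapD[OF MM M mult prod_chart[OF c b(1)] d hasvel_Pair[OF \<alpha> hasvel_const[OF b(2)]] b']
      show "hasvel d (\<lambda>t. \<beta> t \<otimes>\<^bsub>G\<^esub> h) (i_mult w)" using eq w by simp
    qed
  qed
  show ?thesis
    using intertwining_map_compose[OF M M M iV one(1)[OF g] one(2)[OF inv_closed[OF g]]] unfolding conj_by_def .
qed

lemma intertwining_diff_one:
  assumes K: "lie_group K" and G: "lie_group G" and f: "intertwining_map J J' (mfd K) (mfd G) f" "f \<one>\<^bsub>K\<^esub> = \<one>\<^bsub>G\<^esub>" and X: "X \<in> lie_algebra K"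
  shows "diff_one K G f (J X) = J' (diff_one K G f X)"
proof -
  have "snd (id_chart K) \<one>\<^bsub>K\<^esub> \<in> loc_dom (id_chart K) (id_chart G) f"
    using id_chart(2)[OF K] id_chart(2)[OF G] f(2) by (auto simp: loc_dom_def)
  then show ?thesis
    using f(1) id_chart(1)[OF K] id_chart(1)[OF G] X unfolding diff_one_def intertwining_map_def by blast
qed

text \<open>Conjugations are holomorphic, so each \<open>Ad g\<close> is complex linear;
  differentiating along a curve keeps this property.\<close>

lemma bracket_i_mult:
  assumes G: "complex_lie_group G" and X: "X \<in> lie_algebra G" and Y: "Y \<in> lie_algebra G"
  shows "bracket G X (i_mult Y) = i_mult (bracket G X Y)"
proof -
  note lie = complex_lie_groupD(1)[OF G]
  obtain \<alpha> where \<alpha>: "tan1 G \<alpha> X" by (rule tan1_exists[OF lie X])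
  show ?thesis
  proof (rule bracket_unique[OF lie \<alpha> complex_lie_groupD(2)[OF G Y]], rule hvd_cong)
    show "((\<lambda>t. i_mult (Ad G (\<alpha> t) Y)) has_vector_derivative i_mult (bracket G X Y)) (at 0)"
      by (rule bounded_linear.has_vector_derivative[OF bounded_linear_i_mult tan1_bracket[OF lie \<alpha> Y]])
    show "\<forall>\<^sub>F t in nhds 0. i_mult (Ad G (\<alpha> t) Y) = Ad G (\<alpha> t) (i_mult Y)"
      using tan1_carrier[OF lie \<alpha>]
    proof eventually_elim
      case (elim t)
      show ?case unfolding Ad_def
        by (rule intertwining_diff_one[OF lie lie intertwining_conj[OF G elim] conj_by_one[OF lie_groupD(1)[OF lie] elim] Y, symmetric])
    qed
  qed
qed

section \<open>The fixed points of an involution commuting with the Cartan involution\<close>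

text \<open>Multiplication and inversion of \<open>G\<close> restrict smoothly, because a smooth map
  with values in an embedded submanifold is smooth into it.\<close>

lemma lie_subgroupI:
  fixes G :: "('a, 'e::euclidean_space) lie_group" and N :: "('a, 'e) manifold"
  assumes G: "lie_group G" and F: "subgroup F G" and N: "embedded_submanifold N (mfd G)" "topspace (mtop N) = F"
  shows "lie_subgroup (G\<lparr>carrier := F, mfd := N\<rparr>) G"
proof -
  interpret group G by (rule lie_groupD(1)[OF G])
  let ?K = "G\<lparr>carrier := F, mfd := N\<rparr>"
  note M = lie_groupD(3)[OF G] and N' = embedded_submanifoldD[OF N(1)]
  note NN = pre_manifold_prod[OF N'(2) N'(2)]
  have FG: "x \<in> carrier G" if "x \<in> F" for x using that subgroup.subset[OF F] by blast
  have K: "group ?K"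
  proof (rule groupI)
    fix x assume "x \<in> carrier ?K"
    then have x: "x \<in> F" by simp
    show "\<exists>y\<in>carrier ?K. y \<otimes>\<^bsub>?K\<^esub> x = \<one>\<^bsub>?K\<^esub>"
      using subgroup.m_inv_closed[OF F x] l_inv[OF FG[OF x]] by (intro bexI[of _ "inv\<^bsub>G\<^esub> x"]) simp_all
  qed (use FG subgroup.m_closed[OF F] subgroup.one_closed[OF F] m_assoc in simp_all)
  have Kinv: "m_inv ?K x = inv\<^bsub>G\<^esub> x" if "x \<in> F" for x
    using group.inv_equality[OF K, of "inv\<^bsub>G\<^esub> x" x] that FG[OF that] subgroup.m_inv_closed[OF F that] by simp
  have "smooth_map (prod_manifold N N) (mfd G) (\<lambda>z. fst z \<otimes>\<^bsub>G\<^esub> snd z)"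
    by (rule smooth_map_mult[OF G NN smooth_map_compose[OF NN N'(2) M smooth_map_fst[OF N'(2) N'(2)] N'(5)]
          smooth_map_compose[OF NN N'(2) M smooth_map_snd[OF N'(2) N'(2)] N'(5)]])
  then have "smooth_map (prod_manifold N N) N (\<lambda>z. fst z \<otimes>\<^bsub>G\<^esub> snd z)"
    by (rule smooth_map_into_embedded[OF NN M N(1)]) (use N(2) subgroup.m_closed[OF F] in auto)
  then have 1: "smooth_map (prod_manifold N N) N (\<lambda>(x, y). x \<otimes>\<^bsub>G\<^esub> y)" by (simp add: case_prod_beta')
  have "smooth_map N N (\<lambda>x. inv\<^bsub>G\<^esub> x)"
    by (rule smooth_map_into_embedded[OF N'(2) M N(1) smooth_map_inv[OF G N'(2) N'(5)]])
      (use N(2) subgroup.m_inv_closed[OF F] in auto)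
  then have 2: "smooth_map N N (m_inv ?K)"
    by (rule smooth_map_cong[OF N'(2) N'(2)]) (simp add: N(2) Kinv)
  show ?thesis unfolding lie_subgroup_def lie_group_def using K N' 1 2 F N by simp
qed

locale commuting_involution = cartan_involution G U \<tau> B L P \<nu> s
  for G :: "('a, 'e::euclidean_space) lie_group" and U \<tau> B L P \<nu> s +
  assumes comm: "\<And>X. X \<in> V \<Longrightarrow> diff_one G G s (\<tau> X) = \<tau> (diff_one G G s X)"
begin

section \<open>Fixed-point sets in the group, in \<open>U\<close> and in
  \<open>exp(\<mm>)\<close>\<close>

definition "F = {x \<in> carrier G. s x = x}"

lemma F: "subgroup F G"
proof
  show "F \<subseteq> carrier G" by (auto simp: F_def)
  show "\<one>\<^bsub>G\<^esub> \<in> F" by (simp add: F_def s_one)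
  show "x \<otimes>\<^bsub>G\<^esub> y \<in> F" if "x \<in> F" "y \<in> F" for x y using that by (simp add: F_def s_mult)
  show "inv\<^bsub>G\<^esub> x \<in> F" if "x \<in> F" for x using that group_hom.hom_inv[OF s_hom] by (simp add: F_def)
qed

lemma FD: "x \<in> F \<Longrightarrow> x \<in> carrier G" "x \<in> F \<Longrightarrow> s x = x"
  by (simp_all add: F_def)

lemma S_mm: "X \<in> \<mm> \<Longrightarrow> S X \<in> \<mm>"
  using comm[of X] S_V[of X] linear_neg[OF linear_S, of X] by (simp add: mm)

lemma s_expm: "p \<in> lie_exp G ` \<mm> \<Longrightarrow> s p \<in> lie_exp G ` \<mm>"
  using s_exp S_mm mm_V by auto

lemma one_expm: "\<one>\<^bsub>G\<^esub> \<in> lie_exp G ` \<mm>"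
  using lie_exp_zero[OF G] zero_mm by force

lemma expm_G: "p \<in> lie_exp G ` \<mm> \<Longrightarrow> p \<in> carrier G"
  using exp_closed mm_V by auto

lemma topL: "topspace (mtop (mfd L)) = U"
  using lie_groupD(4)[OF L'(1)] L(2) by simp

lemma \<nu>_in: assumes "g \<in> carrier G" shows "fst (\<nu> g) \<in> U" "snd (\<nu> g) \<in> lie_exp G ` \<mm>"
proof -
  have "\<nu> g \<in> topspace (mtop (prod_manifold (mfd L) P))" using smooth_map_in[OF \<nu>] assms top by simp
  then show "fst (\<nu> g) \<in> U" "snd (\<nu> g) \<in> lie_exp G ` \<mm>" using topL P(2) by auto
qed

text \<open>\<open>s\<close> preserves both \<open>U\<close> and \<open>exp(\<mm>)\<close>, so
  uniqueness of the polar decomposition makes \<open>\<nu>\<close> equivariant.\<close>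

lemma \<nu>_s: assumes g: "g \<in> carrier G" shows "\<nu> (s g) = (s (fst (\<nu> g)), s (snd (\<nu> g)))"
proof -
  note 1 = \<nu>_in[OF g]
  have fU: "fst (\<nu> g) \<in> carrier G" using 1(1) U_sub by blast
  have "s g = s (fst (\<nu> g)) \<otimes>\<^bsub>G\<^esub> s (snd (\<nu> g))"
    unfolding s_mult[OF fU expm_G[OF 1(2)], symmetric] mult_\<nu>[OF g] ..
  then show ?thesis using \<nu>_mult[OF s_U[OF comm 1(1)] s_expm[OF 1(2)]] by simp
qed

lemma \<nu>_F: assumes g: "g \<in> F" shows "fst (\<nu> g) \<in> F \<inter> U" "snd (\<nu> g) \<in> F \<inter> lie_exp G ` \<mm>"
proof -
  note 1 = \<nu>_in[OF FD(1)[OF g]]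
  have "(s (fst (\<nu> g)), s (snd (\<nu> g))) = \<nu> g" using \<nu>_s[OF FD(1)[OF g]] FD(2)[OF g] by simp
  then have "s (fst (\<nu> g)) = fst (\<nu> g)" "s (snd (\<nu> g)) = snd (\<nu> g)" by (metis fst_conv, metis snd_conv)
  then show "fst (\<nu> g) \<in> F \<inter> U" "snd (\<nu> g) \<in> F \<inter> lie_exp G ` \<mm>"
    using 1 expm_G U_sub by (auto simp: F_def)
qed

lemmas LM = lie_groupD(3)[OF L'(1)] and PM = embedded_submanifoldD(2)[OF P(1)]
lemmas P_incl = embedded_submanifoldD(5)[OF P(1)]

lemma fst_\<nu>: "smooth_map (mfd G) (mfd L) (\<lambda>x. fst (\<nu> x))" and snd_\<nu>: "smooth_map (mfd G) P (\<lambda>x. snd (\<nu> x))"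
  by (rule smooth_map_compose[OF M pre_manifold_prod[OF LM PM] LM \<nu> smooth_map_fst[OF LM PM]],
      rule smooth_map_compose[OF M pre_manifold_prod[OF LM PM] PM \<nu> smooth_map_snd[OF LM PM]])

text \<open>Left translation by a fixed point commutes with \<open>s\<close> and carries the
  identity to that point, which is the required homogeneity.\<close>

lemma F_submanifold: "\<exists>N :: ('a, 'e) manifold. embedded_submanifold N (mfd G) \<and> topspace (mtop N) = F"
proof (rule homogeneous_involution.fixed_point_submanifold[OF homogeneous_involution.intro])
  show "smooth_manifold (mfd G)" by (rule lie_groupD(2)[OF G])
  show "smooth_map (mfd G) (mfd G) s" by (rule s(1))
  show "s (s x) = x" if "x \<in> topspace (mtop (mfd G))" for x using ss that top by simp
  show "F = {x \<in> topspace (mtop (mfd G)). s x = x}" by (simp add: F_def top)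
  show "\<one>\<^bsub>G\<^esub> \<in> F" by (rule subgroup.one_closed[OF F])
  fix p assume p: "p \<in> F"
  note pG = FD(1)[OF p]
  show "\<exists>f g. smooth_map (mfd G) (mfd G) f \<and> smooth_map (mfd G) (mfd G) g \<and>
       (\<forall>x\<in>topspace (mtop (mfd G)). g (f x) = x) \<and> (\<forall>x\<in>topspace (mtop (mfd G)). f (g x) = x) \<and>
       (\<forall>x\<in>topspace (mtop (mfd G)). f (s x) = s (f x)) \<and> f \<one>\<^bsub>G\<^esub> = p"
  proof (intro exI conjI)
    show "smooth_map (mfd G) (mfd G) (\<lambda>x. p \<otimes>\<^bsub>G\<^esub> x)" "smooth_map (mfd G) (mfd G) (\<lambda>x. inv\<^bsub>G\<^esub> p \<otimes>\<^bsub>G\<^esub> x)"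
      by (intro smooth_map_left_mult[OF G] pG inv_closed)+
  qed (use pG FD(2)[OF p] s_mult s_closed top in \<open>simp_all add: m_assoc[symmetric]\<close>)
qed

text \<open>The same homogeneity inside \<open>L\<close>, to which \<open>s\<close> restricts
  because it preserves \<open>U\<close>.\<close>

lemma FU_submanifold: "\<exists>N :: ('a, 'e) manifold. embedded_submanifold N (mfd L) \<and> topspace (mtop N) = F \<inter> U"
proof (rule homogeneous_involution.fixed_point_submanifold[OF homogeneous_involution.intro])
  interpret L: group L by (rule lie_groupD(1)[OF L'(1)])
  have UG: "x \<in> carrier G" if "x \<in> U" for x using that U_sub by blast
  show "smooth_manifold (mfd L)" by (rule lie_groupD(2)[OF L'(1)])
  show "smooth_map (mfd L) (mfd L) s"
    by (rule smooth_map_into_embedded[OF LM M L'(3) smooth_map_compose[OF LM M M L'(6) s(1)]]) (simp add: topL s_U[OF comm])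
  show "s (s x) = x" if "x \<in> topspace (mtop (mfd L))" for x using ss that topL UG by simp
  show "F \<inter> U = {x \<in> topspace (mtop (mfd L)). s x = x}" unfolding topL F_def using UG by blast
  show "\<one>\<^bsub>L\<^esub> \<in> F \<inter> U" using L'(5) subgroup.one_closed[OF F] subgroup.one_closed[OF U(1)] by simp
  fix p assume p: "p \<in> F \<inter> U"
  have pL: "p \<in> carrier L" and sp: "s p = p" using p L(2) FD(2) by auto
  show "\<exists>f g. smooth_map (mfd L) (mfd L) f \<and> smooth_map (mfd L) (mfd L) g \<and>
       (\<forall>x\<in>topspace (mtop (mfd L)). g (f x) = x) \<and> (\<forall>x\<in>topspace (mtop (mfd L)). f (g x) = x) \<and>
       (\<forall>x\<in>topspace (mtop (mfd L)). f (s x) = s (f x)) \<and> f \<one>\<^bsub>L\<^esub> = p"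
  proof (intro exI conjI)
    show "smooth_map (mfd L) (mfd L) (\<lambda>x. p \<otimes>\<^bsub>L\<^esub> x)" "smooth_map (mfd L) (mfd L) (\<lambda>x. inv\<^bsub>L\<^esub> p \<otimes>\<^bsub>L\<^esub> x)"
      by (intro smooth_map_left_mult[OF L'(1)] pL L.inv_closed)+
    show "\<forall>x\<in>topspace (mtop (mfd L)). p \<otimes>\<^bsub>L\<^esub> s x = s (p \<otimes>\<^bsub>L\<^esub> x)"
    proof
      fix x assume "x \<in> topspace (mtop (mfd L))"
      then have x: "x \<in> U" using topL by simp
      have pU: "p \<in> U" using p by simp
      show "p \<otimes>\<^bsub>L\<^esub> s x = s (p \<otimes>\<^bsub>L\<^esub> x)"
        using L'(4)[unfolded L(2), OF pU s_U[OF comm x]] L'(4)[unfolded L(2), OF pU x] s_mult[OF UG[OF pU] UG[OF x]] sp by simp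
    qed
  qed (use pL lie_groupD(4)[OF L'(1)] in \<open>simp_all add: L.m_assoc[symmetric]\<close>)
qed

text \<open>
  \<open>exp(\<mm>)\<close> is the space of cosets \<open>Ux\<close>, on which the fixed points of \<open>s\<close> act by right multiplication.
\<close>

lemma FP_submanifold: "\<exists>N :: ('a, 'e) manifold. embedded_submanifold N P \<and> topspace (mtop N) = F \<inter> lie_exp G ` \<mm>"
proof (rule homogeneous_involution.fixed_point_submanifold[OF homogeneous_involution.intro])
  show "smooth_manifold P" by (rule embedded_submanifoldD(1)[OF P(1)])
  show "smooth_map P P s"
    by (rule smooth_map_into_embedded[OF PM M P(1) smooth_map_compose[OF PM M M P_incl s(1)]]) (unfold P(2), rule s_expm)
  show "s (s x) = x" if "x \<in> topspace (mtop P)" for x using ss that P(2) expm_G by simp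
  show "F \<inter> lie_exp G ` \<mm> = {x \<in> topspace (mtop P). s x = x}" unfolding P(2) F_def using expm_G by blast
  show "\<one>\<^bsub>G\<^esub> \<in> F \<inter> lie_exp G ` \<mm>" using one_expm subgroup.one_closed[OF F] by simp
  fix p assume p: "p \<in> F \<inter> lie_exp G ` \<mm>"
  have pG: "p \<in> carrier G" and sp: "s p = p" using p FD by auto
  let ?a = "\<lambda>q x. snd (\<nu> (x \<otimes>\<^bsub>G\<^esub> q))"
  have smooth_a: "smooth_map P P (?a q)" if q: "q \<in> carrier G" for q
    by (rule smooth_map_compose[OF PM M PM smooth_map_mult[OF G PM P_incl smooth_map_const'[OF G PM q]] snd_\<nu>])
  \<comment> \<open>Multiplying by \<open>q\<close> and discarding the \<open>U\<close>-component
    \<open>h\<close> is the action on cosets; what was discarded is only a left factor in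
    \<open>U\<close>, so the inverse element undoes the action.\<close>
  have act: "?a r (?a q x) = x" if x: "x \<in> lie_exp G ` \<mm>" and q: "q \<in> carrier G" and r: "r \<in> carrier G" and qr: "q \<otimes>\<^bsub>G\<^esub> r = \<one>\<^bsub>G\<^esub>" for q r x
  proof -
    note xG = expm_G[OF x]
    note xq = m_closed[OF xG q]
    define h where "h = fst (\<nu> (x \<otimes>\<^bsub>G\<^esub> q))"
    define y where "y = snd (\<nu> (x \<otimes>\<^bsub>G\<^esub> q))"
    have h: "h \<in> U" and y: "y \<in> lie_exp G ` \<mm>" unfolding h_def y_def by (rule \<nu>_in[OF xq])+
    have hG: "h \<in> carrier G" using h U_sub by blast
    note yG = expm_G[OF y]
    have "h \<otimes>\<^bsub>G\<^esub> y = x \<otimes>\<^bsub>G\<^esub> q" unfolding h_def y_def by (rule mult_\<nu>[OF xq])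
    then have "h \<otimes>\<^bsub>G\<^esub> y \<otimes>\<^bsub>G\<^esub> r = x \<otimes>\<^bsub>G\<^esub> q \<otimes>\<^bsub>G\<^esub> r" by simp
    then have "h \<otimes>\<^bsub>G\<^esub> (y \<otimes>\<^bsub>G\<^esub> r) = x" using hG yG q r xG qr by (simp add: m_assoc)
    then have "inv\<^bsub>G\<^esub> h \<otimes>\<^bsub>G\<^esub> (h \<otimes>\<^bsub>G\<^esub> (y \<otimes>\<^bsub>G\<^esub> r)) = inv\<^bsub>G\<^esub> h \<otimes>\<^bsub>G\<^esub> x" by simp
    then have "y \<otimes>\<^bsub>G\<^esub> r = inv\<^bsub>G\<^esub> h \<otimes>\<^bsub>G\<^esub> x" using hG yG r by (simp add: m_assoc[symmetric])
    then have "\<nu> (y \<otimes>\<^bsub>G\<^esub> r) = (inv\<^bsub>G\<^esub> h, x)" using \<nu>_mult[OF subgroup.m_inv_closed[OF U(1) h] x] by simp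
    then show ?thesis by (simp add: y_def)
  qed
  have eq: "?a p (s x) = s (?a p x)" if x: "x \<in> lie_exp G ` \<mm>" for x
    using \<nu>_s[OF m_closed[OF expm_G[OF x] pG]] s_mult[OF expm_G[OF x] pG] sp by simp
  have a1: "?a p \<one>\<^bsub>G\<^esub> = p" using \<nu>_mult[OF subgroup.one_closed[OF U(1)], of p] p by simp
  show "\<exists>f g. smooth_map P P f \<and> smooth_map P P g \<and> (\<forall>x\<in>topspace (mtop P). g (f x) = x) \<and> (\<forall>x\<in>topspace (mtop P). f (g x) = x) \<and>
       (\<forall>x\<in>topspace (mtop P). f (s x) = s (f x)) \<and> f \<one>\<^bsub>G\<^esub> = p"
  proof (rule exI[of _ "?a p"], rule exI[of _ "?a (inv\<^bsub>G\<^esub> p)"], intro conjI ballI, unfold P(2))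
    show "smooth_map P P (?a p)" "smooth_map P P (?a (inv\<^bsub>G\<^esub> p))" by (intro smooth_a pG inv_closed)+
    show "?a p \<one>\<^bsub>G\<^esub> = p" by (rule a1)
    fix x assume x: "x \<in> lie_exp G ` \<mm>"
    show "?a (inv\<^bsub>G\<^esub> p) (?a p x) = x" "?a p (?a (inv\<^bsub>G\<^esub> p) x) = x"
      by (rule act[OF x], use pG in simp_all)+
    show "?a p (s x) = s (?a p x)" by (rule eq[OF x])
  qed
qed

end

locale fixed_subgroup = commuting_involution G U \<tau> B L P \<nu> s
  for G :: "('a, 'e::euclidean_space) lie_group" and U \<tau> B L P \<nu> s +
  fixes N1 N2 N3 :: "('a, 'e) manifold"
  assumes N1: "embedded_submanifold N1 (mfd G)" "topspace (mtop N1) = F"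
    and N2: "embedded_submanifold N2 (mfd L)" "topspace (mtop N2) = F \<inter> U"
    and N3: "embedded_submanifold N3 P" "topspace (mtop N3) = F \<inter> lie_exp G ` \<mm>"
begin

definition GF :: "('a, 'e) lie_group" where "GF = G\<lparr>carrier := F, mfd := N1\<rparr>"
definition HF :: "('a, 'e) lie_group" where "HF = GF\<lparr>carrier := F \<inter> U, mfd := N2\<rparr>"

lemma GF_simps [simp]: "carrier GF = F" "mfd GF = N1" "mult GF = mult G" "one GF = one G"
  and HF_simps [simp]: "carrier HF = F \<inter> U" "mfd HF = N2" "mult HF = mult G" "one HF = one G"
  by (simp_all add: GF_def HF_def)

lemma GF_sub: "lie_subgroup GF G" unfolding GF_def by (rule lie_subgroupI[OF G F N1])

lemmas GF' = lie_subgroupD[OF GF_sub G]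
lemmas MF = lie_groupD(3)[OF GF'(1), simplified]
lemmas M2 = embedded_submanifoldD(2)[OF N2(1)] and M3 = embedded_submanifoldD(2)[OF N3(1)]
lemmas N1_incl = GF'(6)[simplified]

lemma N2_G: "smooth_map N2 (mfd G) (\<lambda>x. x)"
  by (rule smooth_map_compose[OF M2 LM M embedded_submanifoldD(5)[OF N2(1)] L'(6)])

lemma N3_G: "smooth_map N3 (mfd G) (\<lambda>x. x)"
  by (rule smooth_map_compose[OF M3 PM M embedded_submanifoldD(5)[OF N3(1)] P_incl])

lemma N2_N1: "smooth_map N2 N1 (\<lambda>x. x)"
  by (rule smooth_map_into_embedded[OF M2 M N1(1) N2_G]) (simp add: N1(2) N2(2))

lemma N3_N1: "smooth_map N3 N1 (\<lambda>x. x)"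
  by (rule smooth_map_into_embedded[OF M3 M N1(1) N3_G]) (simp add: N1(2) N3(2))

lemma N1_N2: "smooth_map N1 N2 (\<lambda>x. fst (\<nu> x))"
  by (rule smooth_map_into_embedded[OF MF LM N2(1) smooth_map_compose[OF MF M LM N1_incl fst_\<nu>]]) (unfold N1(2) N2(2), rule \<nu>_F(1))

lemma N1_N3: "smooth_map N1 N3 (\<lambda>x. snd (\<nu> x))"
  by (rule smooth_map_into_embedded[OF MF PM N3(1) smooth_map_compose[OF MF M PM N1_incl snd_\<nu>]]) (unfold N1(2) N3(2), rule \<nu>_F(2))

text \<open>The \<open>U\<close>-component of the polar decomposition restricts to a smooth
  retraction of the fixed group onto its part in \<open>U\<close>.\<close>

lemma N2_embedded: "embedded_submanifold N2 N1"
proof (rule embedded_submanifold_retract[OF MF embedded_submanifoldD(1)[OF N2(1)] _ _ N2_N1 N1_N2])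
  show "topspace (mtop N2) \<subseteq> topspace (mtop N1)" by (simp add: N1(2) N2(2))
  have "mtop N2 = subtopology (mtop (mfd L)) (F \<inter> U)" using embedded_submanifoldD(4)[OF N2(1)] unfolding N2(2) .
  also have "mtop (mfd L) = subtopology (mtop (mfd G)) U" using embedded_submanifoldD(4)[OF L'(3)] unfolding topL .
  finally have 1: "mtop N2 = subtopology (mtop (mfd G)) (F \<inter> U)" by (simp add: subtopology_subtopology inf_commute inf_left_commute)
  have "mtop N1 = subtopology (mtop (mfd G)) F" using embedded_submanifoldD(4)[OF N1(1)] unfolding N1(2) .
  then show "mtop N2 = subtopology (mtop N1) (topspace (mtop N2))" unfolding N2(2) unfolding 1 by (simp add: subtopology_subtopology Int_assoc[symmetric])
  fix x assume "x \<in> topspace (mtop N2)"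
  then have "x \<in> U" unfolding N2(2) by simp
  from \<nu>_mult[OF this one_expm] show "fst (\<nu> x) = x" using \<open>x \<in> U\<close> U_sub by (simp add: subset_iff)
qed

lemma N3_embedded: "embedded_submanifold N3 N1"
proof (rule embedded_submanifold_retract[OF MF embedded_submanifoldD(1)[OF N3(1)] _ _ N3_N1 N1_N3])
  show "topspace (mtop N3) \<subseteq> topspace (mtop N1)" by (simp add: N1(2) N3(2))
  have "mtop N3 = subtopology (mtop P) (F \<inter> lie_exp G ` \<mm>)" using embedded_submanifoldD(4)[OF N3(1)] unfolding N3(2) .
  also have "mtop P = subtopology (mtop (mfd G)) (lie_exp G ` \<mm>)" using embedded_submanifoldD(4)[OF P(1)] unfolding P(2) .
  finally have 1: "mtop N3 = subtopology (mtop (mfd G)) (F \<inter> lie_exp G ` \<mm>)" by (simp add: subtopology_subtopology inf_commute inf_left_commute)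
  have "mtop N1 = subtopology (mtop (mfd G)) F" using embedded_submanifoldD(4)[OF N1(1)] unfolding N1(2) .
  then show "mtop N3 = subtopology (mtop N1) (topspace (mtop N3))" unfolding N3(2) unfolding 1 by (simp add: subtopology_subtopology Int_assoc[symmetric])
  fix x assume "x \<in> topspace (mtop N3)"
  then have x: "x \<in> lie_exp G ` \<mm>" unfolding N3(2) by simp
  from \<nu>_mult[OF subgroup.one_closed[OF U(1)] x] show "snd (\<nu> x) = x" using expm_G[OF x] by simp
qed

lemma HF_sub: "lie_subgroup HF GF"
  unfolding HF_def
proof (rule lie_subgroupI[OF GF'(1)])
  show "subgroup (F \<inter> U) GF"
  proof
    show "inv\<^bsub>GF\<^esub> x \<in> F \<inter> U" if "x \<in> F \<inter> U" for x
      using that GF'(8)[of x] subgroup.m_inv_closed[OF F] subgroup.m_inv_closed[OF U(1)] by simp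
  qed (use subgroup.m_closed[OF F] subgroup.m_closed[OF U(1)] subgroup.one_closed[OF F] subgroup.one_closed[OF U(1)] in auto)
qed (simp_all add: N2_embedded N2(2))

lemmas HF' = lie_subgroupD[OF HF_sub GF'(1)]

text \<open>The inverse is the restriction of \<open>\<nu>\<close>, whose components at a fixed
  point are again fixed.\<close>

lemma diffeomorphism_F: "diffeomorphism (prod_manifold N2 N3) N1 (\<lambda>(h, p). h \<otimes>\<^bsub>G\<^esub> p)"
proof -
  note M23 = pre_manifold_prod[OF M2 M3]
  have "smooth_map (prod_manifold N2 N3) (mfd G) (\<lambda>z. fst z \<otimes>\<^bsub>G\<^esub> snd z)"
    by (rule smooth_map_mult[OF G M23 smooth_map_compose[OF M23 M2 M smooth_map_fst[OF M2 M3] N2_G]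
          smooth_map_compose[OF M23 M3 M smooth_map_snd[OF M2 M3] N3_G]])
  then have "smooth_map (prod_manifold N2 N3) N1 (\<lambda>z. fst z \<otimes>\<^bsub>G\<^esub> snd z)"
    by (rule smooth_map_into_embedded[OF M23 M N1(1)]) (use N1(2) N2(2) N3(2) subgroup.m_closed[OF F] in auto)
  then have 1: "smooth_map (prod_manifold N2 N3) N1 (\<lambda>(h, p). h \<otimes>\<^bsub>G\<^esub> p)" by (simp add: case_prod_beta')
  have 2: "smooth_map N1 (prod_manifold N2 N3) (\<lambda>x. (fst (\<nu> x), snd (\<nu> x)))"
    by (rule smooth_map_Pair[OF MF M2 M3 N1_N2 N1_N3])
  show ?thesis unfolding diffeomorphism_def
  proof (intro conjI exI ballI)
    show "smooth_map (prod_manifold N2 N3) N1 (\<lambda>(h, p). h \<otimes>\<^bsub>G\<^esub> p)" by (rule 1)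
    show "smooth_map N1 (prod_manifold N2 N3) (\<lambda>x. (fst (\<nu> x), snd (\<nu> x)))" by (rule 2)
    fix z assume "z \<in> topspace (mtop (prod_manifold N2 N3))"
    then have z: "fst z \<in> U" "snd z \<in> lie_exp G ` \<mm>" unfolding prod_manifold_simps topspace_prod_topology N2(2) N3(2) by auto
    show "(fst (\<nu> (case z of (h, p) \<Rightarrow> h \<otimes>\<^bsub>G\<^esub> p)), snd (\<nu> (case z of (h, p) \<Rightarrow> h \<otimes>\<^bsub>G\<^esub> p))) = z"
      unfolding case_prod_beta' \<nu>_mult[OF z] by simp
  next
    fix x assume "x \<in> topspace (mtop N1)"
    then have "x \<in> carrier G" using N1(2) FD(1) by simp
    then show "(case (fst (\<nu> x), snd (\<nu> x)) of (h, p) \<Rightarrow> h \<otimes>\<^bsub>G\<^esub> p) = x" unfolding prod.case by (rule mult_\<nu>)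
  qed
qed

section \<open>The Lie algebra of the fixed subgroup\<close>

abbreviation "V' \<equiv> model N1"
abbreviation "\<iota> \<equiv> diff_one GF G (\<lambda>x. x)"

lemma one_GF: "(\<lambda>x. x) \<one>\<^bsub>GF\<^esub> = \<one>\<^bsub>G\<^esub>" by simp

lemmas lin_\<iota> = bounded_linear.linear[OF bounded_linear_diff_one[OF GF'(1) G GF'(6) one_GF]]

lemma V': "subspace V'" by (rule model_subspace[OF MF])

lemma \<iota>_V: "X \<in> V' \<Longrightarrow> \<iota> X \<in> V"
  using diff_one_in[OF GF'(1) G GF'(6) one_GF] by simp

lemma \<iota>_inj: assumes "X \<in> V'" "Y \<in> V'" "\<iota> X = \<iota> Y" shows "X = Y"
proof -
  have "X - Y \<in> lie_algebra GF" using assms V' by (simp add: subspace_diff)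
  moreover have "\<iota> (X - Y) = 0" using linear_diff[OF lin_\<iota>] assms(3) by simp
  ultimately have "X - Y = 0" by (rule lie_subgroup_inj[OF GF_sub G])
  then show ?thesis by simp
qed

lemma \<iota>_fix: assumes "X \<in> V'" shows "S (\<iota> X) = \<iota> X"
proof -
  have X: "X \<in> lie_algebra GF" using assms by simp
  obtain \<alpha> where \<alpha>: "tan1 GF \<alpha> X" by (rule tan1_exists[OF GF'(1) X])
  note 1 = tan1_map[OF GF'(1) G GF'(6) one_GF \<alpha>]
  have "\<forall>\<^sub>F t in nhds 0. s (\<alpha> t) = \<alpha> t" using tan1_carrier[OF GF'(1) \<alpha>] by eventually_elim (simp add: FD)
  from tan1_cong[OF this tan1_map[OF G G s(1) s_one 1]] show ?thesis by (rule tan1_unique[OF _ 1])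
qed

text \<open>A vector fixed by \<open>S\<close> generates a one-parameter subgroup that
  \<open>s\<close> fixes pointwise, and this lifts to the fixed group. So the image of
  \<open>\<iota>\<close> is the full fixed space of \<open>S\<close>.\<close>

lemma \<iota>_surj: assumes X: "X \<in> V" "S X = X" obtains X' where "X' \<in> V'" "\<iota> X' = X"
proof -
  have "lie_exp G (t *\<^sub>R X) \<in> carrier GF" for t
    using s_exp[of "t *\<^sub>R X"] linear_cmul[OF linear_S, of t X] X V exp_closed by (simp add: F_def subspace_scale)
  from one_param_subgroup_lift[OF GF_sub G one_param_exp[OF G X(1)] this] that show thesis by auto
qed

lemma \<iota>_br: "X \<in> V' \<Longrightarrow> Y \<in> V' \<Longrightarrow> \<iota> (bracket GF X Y) = bracket G (\<iota> X) (\<iota> Y)"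
  using diff_one_bracket[OF GF'(1) G GF'(6,7)] by simp

lemma br_V': "X \<in> V' \<Longrightarrow> Y \<in> V' \<Longrightarrow> bracket GF X Y \<in> V'"
  using bracket_in[OF GF'(1)] by simp

lemma \<iota>_exp: "X \<in> V' \<Longrightarrow> lie_exp GF X = lie_exp G (\<iota> X)"
  using lie_exp_hom[OF GF'(1) G GF'(6,7)] by simp

text \<open>\<open>\<tau>\<close> transported along the injection \<open>\<iota>\<close>; the image
  of \<open>\<iota>\<close> is stable under \<open>\<tau>\<close> because \<open>S\<close> and
  \<open>\<tau>\<close> commute.\<close>

definition \<theta> :: "'e \<Rightarrow> 'e" where "\<theta> X = inv_into V' \<iota> (\<tau> (\<iota> X))"

lemma \<theta>: assumes "X \<in> V'" shows "\<theta> X \<in> V'" "\<iota> (\<theta> X) = \<tau> (\<iota> X)"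
proof -
  note X = \<iota>_V[OF assms]
  have "S (\<tau> (\<iota> X)) = \<tau> (\<iota> X)" unfolding comm[OF X] \<iota>_fix[OF assms] ..
  then obtain Y where Y: "Y \<in> V'" "\<iota> Y = \<tau> (\<iota> X)" by (rule \<iota>_surj[OF \<tau>_V[OF X]])
  have im: "\<tau> (\<iota> X) \<in> \<iota> ` V'" unfolding Y(2)[symmetric] by (rule imageI[OF Y(1)])
  show "\<theta> X \<in> V'" "\<iota> (\<theta> X) = \<tau> (\<iota> X)" unfolding \<theta>_def by (rule inv_into_into[OF im], rule f_inv_into_f[OF im])
qed

lemma plus_F: "X \<in> plus_space GF \<theta> \<longleftrightarrow> X \<in> V' \<and> \<iota> X \<in> \<uu>"
proof -
  have "\<theta> X = X \<longleftrightarrow> \<tau> (\<iota> X) = \<iota> X" if "X \<in> V'" using \<theta>[OF that] \<iota>_inj[OF \<theta>(1)[OF that] that] by metis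
  then show ?thesis unfolding uu plus_space_def using \<iota>_V by auto
qed

lemma minus_F: "X \<in> minus_space GF \<theta> \<longleftrightarrow> X \<in> V' \<and> \<iota> X \<in> \<mm>"
proof -
  have "\<theta> X = - X \<longleftrightarrow> \<tau> (\<iota> X) = - \<iota> X" if X: "X \<in> V'"
  proof -
    have "\<theta> X = - X \<longleftrightarrow> \<iota> (\<theta> X) = \<iota> (- X)" using \<iota>_inj[OF \<theta>(1)[OF X] subspace_neg[OF V' X]] by auto
    then show ?thesis unfolding \<theta>(2)[OF X] linear_neg[OF lin_\<iota>] .
  qed
  then show ?thesis unfolding mm minus_space_def using \<iota>_V by auto
qed

lemma involution_F: "lie_algebra_involution GF \<theta>"
  unfolding lie_algebra_involution_def linear_between_def GF_simps
proof (intro conjI ballI allI funcsetI)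
  fix X assume X: "X \<in> V'"
  show "\<theta> X \<in> V'" by (rule \<theta>(1)[OF X])
  show "\<theta> (\<theta> X) = X"
    by (rule \<iota>_inj[OF \<theta>(1)[OF \<theta>(1)[OF X]] X]) (unfold \<theta>(2)[OF \<theta>(1)[OF X]] \<theta>(2)[OF X], rule \<tau>_\<tau>[OF \<iota>_V[OF X]])
  show "\<theta> (r *\<^sub>R X) = r *\<^sub>R \<theta> X" for r
    by (rule \<iota>_inj[OF \<theta>(1)[OF subspace_scale[OF V' X]] subspace_scale[OF V' \<theta>(1)[OF X]]])
      (unfold \<theta>(2)[OF subspace_scale[OF V' X]] linear_cmul[OF lin_\<iota>] \<theta>(2)[OF X], rule \<tau>_scale[OF \<iota>_V[OF X]])
  fix Y assume Y: "Y \<in> V'"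
  show "\<theta> (X + Y) = \<theta> X + \<theta> Y"
    by (rule \<iota>_inj[OF \<theta>(1)[OF subspace_add[OF V' X Y]] subspace_add[OF V' \<theta>(1)[OF X] \<theta>(1)[OF Y]]])
      (unfold \<theta>(2)[OF subspace_add[OF V' X Y]] linear_add[OF lin_\<iota>] \<theta>(2)[OF X] \<theta>(2)[OF Y], rule \<tau>_add[OF \<iota>_V[OF X] \<iota>_V[OF Y]])
  show "\<theta> (bracket GF X Y) = bracket GF (\<theta> X) (\<theta> Y)"
    by (rule \<iota>_inj[OF \<theta>(1)[OF br_V'[OF X Y]] br_V'[OF \<theta>(1)[OF X] \<theta>(1)[OF Y]]])
      (unfold \<theta>(2)[OF br_V'[OF X Y]] \<iota>_br[OF X Y] \<iota>_br[OF \<theta>(1)[OF X] \<theta>(1)[OF Y]] \<theta>(2)[OF X] \<theta>(2)[OF Y], rule \<tau>_br[OF \<iota>_V[OF X] \<iota>_V[OF Y]])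
qed

text \<open>Invariance of \<open>B\<close> under \<open>\<tau>\<close> makes the two orders of the
  arguments agree, so \<open>ipB X X\<close> reduces to \<open>- B X (\<tau> X)\<close>. The
  restricted form is nondegenerate for this reason, with \<open>\<theta> X\<close> as test
  vector.\<close>

lemma B_\<tau>_neg: assumes X: "X \<in> V" "X \<noteq> 0" shows "B X (\<tau> X) < 0" "B (\<tau> X) X < 0"
proof -
  have "B X (\<tau> X) = B (\<tau> X) X" using B_\<tau>[OF X(1) \<tau>_V[OF X(1)]] unfolding \<tau>_\<tau>[OF X(1)] by (rule sym)
  then show "B X (\<tau> X) < 0" "B (\<tau> X) X < 0" using ra.ip_pos[OF X] unfolding ipB_def \<pi>(2)[OF X(1)] by simp_all
qed

lemma cartan_form_F: "cartan_form GF \<theta> (\<lambda>X Y. B (\<iota> X) (\<iota> Y))"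
  unfolding cartan_form_def linear_between_def GF_simps
proof (intro conjI ballI allI impI funcsetI)
  fix X assume X: "X \<in> V'"
  note iX = \<iota>_V[OF X]
  show "X = 0" if "\<forall>Y\<in>V'. B (\<iota> X) (\<iota> Y) = 0"
  proof (rule ccontr)
    assume "X \<noteq> 0"
    then have "\<iota> X \<noteq> 0" using \<iota>_inj[OF X subspace_0[OF V']] linear_0[OF lin_\<iota>] by auto
    from B_\<tau>_neg(1)[OF iX this] show False using bspec[OF that \<theta>(1)[OF X]] \<theta>(2)[OF X] by simp
  qed
  show "X = 0" if "\<forall>Y\<in>V'. B (\<iota> Y) (\<iota> X) = 0"
  proof (rule ccontr)
    assume "X \<noteq> 0"
    then have "\<iota> X \<noteq> 0" using \<iota>_inj[OF X subspace_0[OF V']] linear_0[OF lin_\<iota>] by auto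
    from B_\<tau>_neg(2)[OF iX this] show False using bspec[OF that \<theta>(1)[OF X]] \<theta>(2)[OF X] by simp
  qed
  fix Y assume Y: "Y \<in> V'"
  note iY = \<iota>_V[OF Y]
  show "B (\<iota> X) (\<iota> (r *\<^sub>R Y)) = r *\<^sub>R B (\<iota> X) (\<iota> Y)" "B (\<iota> (r *\<^sub>R Y)) (\<iota> X) = r *\<^sub>R B (\<iota> Y) (\<iota> X)" for r
    unfolding linear_cmul[OF lin_\<iota>] B_right(2)[OF iX iY] B_left(2)[OF iX iY] by simp_all
  show "B (\<iota> (\<theta> X)) (\<iota> (\<theta> Y)) = B (\<iota> X) (\<iota> Y)" unfolding \<theta>(2)[OF X] \<theta>(2)[OF Y] by (rule B_\<tau>[OF iX iY])
  show "B (\<iota> X) (\<iota> (Y + Z)) = B (\<iota> X) (\<iota> Y) + B (\<iota> X) (\<iota> Z)" "B (\<iota> (Y + Z)) (\<iota> X) = B (\<iota> Y) (\<iota> X) + B (\<iota> Z) (\<iota> X)" if Z: "Z \<in> V'" for Z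
    unfolding linear_add[OF lin_\<iota>] by (rule B_right(1)[OF iX iY \<iota>_V[OF Z]], rule B_left(1)[OF iX iY \<iota>_V[OF Z]])
  fix g assume g: "g \<in> F"
  have "\<iota> (Ad GF g X) = Ad G g (\<iota> X)" if "X \<in> V'" for X
    using diff_one_Ad[OF GF'(1) G GF'(6,7), of g X] g that by simp
  then show "B (\<iota> (Ad GF g X)) (\<iota> (Ad GF g Y)) = B (\<iota> X) (\<iota> Y)" using X Y B_Ad[OF FD(1)[OF g] iX iY] by simp
next
  fix X Y assume "X \<in> plus_space GF \<theta>" "Y \<in> minus_space GF \<theta>"
  then show "B (\<iota> X) (\<iota> Y) = 0" "B (\<iota> Y) (\<iota> X) = 0" unfolding plus_F minus_F by (blast intro: B_orth)+
next
  fix X assume X: "X \<in> plus_space GF \<theta>" "X \<noteq> 0"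
  then have "\<iota> X \<noteq> 0" using \<iota>_inj[OF _ subspace_0[OF V'], of X] linear_0[OF lin_\<iota>] by (auto simp: plus_F)
  then show "B (\<iota> X) (\<iota> X) < 0" using B_neg X by (simp add: plus_F)
next
  fix X assume X: "X \<in> minus_space GF \<theta>" "X \<noteq> 0"
  then have "\<iota> X \<noteq> 0" using \<iota>_inj[OF _ subspace_0[OF V'], of X] linear_0[OF lin_\<iota>] by (auto simp: minus_F)
  then show "0 < B (\<iota> X) (\<iota> X)" using B_pos X by (simp add: minus_F)
qed simp_all

text \<open>An element of a larger compact subgroup \<open>K\<close> has its \<open>U\<close>-factor
  in \<open>F \<inter> U\<close>, hence in \<open>K\<close>. Its other factor \<open>exp X\<close>
  then lies in \<open>K\<close> with all its integer powers, and \<open>bounded_zero\<close> gives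
  \<open>X = 0\<close>.\<close>

lemma maximal_compact_F: "maximal_compact_subgroup GF (F \<inter> U)"
  unfolding maximal_compact_subgroup_def
proof (intro conjI allI impI)
  have topF: "mtop (mfd GF) = subtopology (mtop (mfd G)) F" using embedded_submanifoldD(4)[OF N1(1)] unfolding N1(2) by simp
  have haus: "Hausdorff_space (mtop (mfd G))" by (rule lie_groupD(2)[OF G, unfolded smooth_manifold_def, THEN conjunct1])
  show "subgroup (F \<inter> U) GF" using HF'(2) by simp
  have "closedin (mtop (mfd G)) {x \<in> topspace (mtop (mfd G)). s x = x}"
    by (rule closedin_continuous_maps_eq[OF haus smooth_map_continuous[OF s(1)]]) simp
  then have "closedin (mtop (mfd G)) F" by (simp add: F_def top)
  then have "closedin (mtop (mfd G)) (F \<inter> U)" by (rule closedin_Int[OF _ compactin_imp_closedin[OF haus U(2)]])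
  then have "compactin (mtop (mfd G)) (F \<inter> U)" by (rule closed_compactin[OF U(2) Int_lower2])
  then show "compactin (mtop (mfd GF)) (F \<inter> U)" unfolding topF compactin_subtopology by simp
  fix K assume "subgroup K GF \<and> compactin (mtop (mfd GF)) K \<and> F \<inter> U \<subseteq> K"
  then have K: "subgroup K GF" "compactin (mtop (mfd G)) K" "K \<subseteq> F" "F \<inter> U \<subseteq> K" unfolding topF compactin_subtopology by auto
  have Kinv: "inv\<^bsub>G\<^esub> x \<in> K" if "x \<in> K" for x
    using subgroup.m_inv_closed[OF K(1) that] GF'(8)[of x] K(3) that by auto
  have Kmult: "x \<otimes>\<^bsub>G\<^esub> y \<in> K" if "x \<in> K" "y \<in> K" for x y
    using subgroup.m_closed[OF K(1) that] by simp
  have "K \<subseteq> F \<inter> U"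
  proof
    fix x assume x: "x \<in> K"
    then have xF: "x \<in> F" using K(3) by blast
    note xG = FD(1)[OF xF]
    have h: "fst (\<nu> x) \<in> K" "fst (\<nu> x) \<in> F \<inter> U" using \<nu>_F(1)[OF xF] K(4) by auto
    have hG: "fst (\<nu> x) \<in> carrier G" using h(2) FD(1) by blast
    obtain X where X: "X \<in> \<mm>" "snd (\<nu> x) = lie_exp G X" using \<nu>_in(2)[OF xG] by blast
    note XV = mm_V[OF X(1)]
    have xe: "fst (\<nu> x) \<otimes>\<^bsub>G\<^esub> lie_exp G X = x" using mult_\<nu>[OF xG] X(2) by simp
    have "lie_exp G X = inv\<^bsub>G\<^esub> (fst (\<nu> x)) \<otimes>\<^bsub>G\<^esub> (fst (\<nu> x) \<otimes>\<^bsub>G\<^esub> lie_exp G X)"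
      using hG exp_closed[OF XV] by (simp add: m_assoc[symmetric])
    then have eK: "lie_exp G X \<in> K" unfolding xe using Kmult[OF Kinv[OF h(1)] x] by simp
    have pow: "lie_exp G (real n *\<^sub>R X) \<in> K" for n
    proof (induction n)
      case 0
      then show ?case using lie_exp_zero[OF G] subgroup.one_closed[OF K(1)] by simp
    next
      case (Suc n)
      then show ?case using lie_exp_pow[OF G XV, of n] lie_exp_pow[OF G XV, of "Suc n"] Kmult[OF _ eK] by simp
    qed
    have "lie_exp G (of_int n *\<^sub>R X) \<in> K" for n :: int
    proof (cases "0 \<le> n")
      case True
      then show ?thesis using pow[of "nat n"] by simp
    next
      case False
      then have n: "(of_int n :: real) = - real (nat (- n))" by simp
      have "lie_exp G (- (real (nat (- n)) *\<^sub>R X)) \<in> K"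
        unfolding lie_exp_neg[OF G subspace_scale[OF V XV]] by (rule Kinv[OF pow])
      then show ?thesis unfolding n by simp
    qed
    from bounded_zero[OF X(1) K(2) this] have "x = fst (\<nu> x)" using xe lie_exp_zero[OF G] hG by simp
    then show "x \<in> F \<inter> U" using h(2) by simp
  qed
  then show "K = F \<inter> U" using K(4) by blast
qed

text \<open>For one inclusion the embedding of \<open>HF\<close> into \<open>G\<close> is factored
  through \<open>L\<close> as well as through \<open>GF\<close>; for the other, the curve
  \<open>exp (t X)\<close> lies in both \<open>F\<close> and \<open>U\<close> and lifts to
  \<open>HF\<close>.\<close>

lemma plus_space_F: "diff_one HF GF (\<lambda>x. x) ` lie_algebra HF = plus_space GF \<theta>"
proof (rule subset_antisym; rule subsetI)
  fix X assume "X \<in> diff_one HF GF (\<lambda>x. x) ` lie_algebra HF"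
  then obtain Y where Y: "Y \<in> lie_algebra HF" "X = diff_one HF GF (\<lambda>x. x) Y" by blast
  have o: "(\<lambda>x. x) \<one>\<^bsub>HF\<^esub> = \<one>\<^bsub>GF\<^esub>" "(\<lambda>x. x) \<one>\<^bsub>HF\<^esub> = \<one>\<^bsub>L\<^esub>" "(\<lambda>x. x) \<one>\<^bsub>L\<^esub> = \<one>\<^bsub>G\<^esub>" using L'(5) by simp_all
  have HL: "smooth_map (mfd HF) (mfd L) (\<lambda>x. x)" using embedded_submanifoldD(5)[OF N2(1)] by simp
  have XV: "X \<in> V'" using diff_one_in[OF HF'(1) GF'(1) HF'(6) o(1) Y(1)] Y(2) by simp
  have "\<iota> X = diff_one HF G (\<lambda>x. x) Y" unfolding Y(2)
    by (rule diff_one_comp[OF HF'(1) GF'(1) G HF'(6) o(1) GF'(6) one_GF Y(1), symmetric])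
  also have "\<dots> = diff_one L G (\<lambda>x. x) (diff_one HF L (\<lambda>x. x) Y)"
    by (rule diff_one_comp[OF HF'(1) L'(1) G HL o(2) L'(6) o(3) Y(1)])
  finally have "\<iota> X \<in> \<uu>" using diff_one_in[OF HF'(1) L'(1) HL o(2) Y(1)] L(3) by blast
  then show "X \<in> plus_space GF \<theta>" using XV plus_F by blast
next
  fix X assume "X \<in> plus_space GF \<theta>"
  then have X: "X \<in> V'" "\<iota> X \<in> \<uu>" by (simp_all add: plus_F)
  have XG: "X \<in> lie_algebra GF" using X(1) by simp
  have "lie_exp GF (t *\<^sub>R X) \<in> carrier HF" for t
  proof -
    have tX: "t *\<^sub>R X \<in> V'" by (rule subspace_scale[OF V' X(1)])
    have "lie_exp GF (t *\<^sub>R X) \<in> F" using lie_exp_closed[OF GF'(1), of "t *\<^sub>R X"] tX by simp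
    moreover have "lie_exp GF (t *\<^sub>R X) \<in> U" unfolding \<iota>_exp[OF tX] linear_cmul[OF lin_\<iota>] by (rule exp_uu[OF uu_scale[OF X(2)]])
    ultimately show ?thesis by simp
  qed
  from one_param_subgroup_lift[OF HF_sub GF'(1) one_param_exp[OF GF'(1) XG] this]
  obtain Y where "Y \<in> lie_algebra HF" "diff_one HF GF (\<lambda>x. x) Y = X" by metis
  then show "X \<in> diff_one HF GF (\<lambda>x. x) ` lie_algebra HF" by blast
qed

text \<open>That \<open>exp X\<close> is fixed only says \<open>exp (S X) = exp X\<close>;
  injectivity of the exponential on \<open>\<mm>\<close> is what turns this into
  \<open>S X = X\<close>.\<close>

lemma exp_minus_F: "F \<inter> lie_exp G ` \<mm> = lie_exp GF ` minus_space GF \<theta>"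
proof (rule subset_antisym; rule subsetI)
  fix p assume p: "p \<in> F \<inter> lie_exp G ` \<mm>"
  then obtain X where X: "X \<in> \<mm>" "p = lie_exp G X" by blast
  have "s p = p" using p FD(2) by blast
  then have "lie_exp G (S X) = lie_exp G X" using s_exp[OF mm_V[OF X(1)]] X(2) by simp
  then have "S X = X" by (rule exp_mm_inj[OF S_mm[OF X(1)] X(1)])
  then obtain X' where X': "X' \<in> V'" "\<iota> X' = X" by (rule \<iota>_surj[OF mm_V[OF X(1)]])
  have "X' \<in> minus_space GF \<theta>" using X' X(1) by (simp add: minus_F)
  moreover have "p = lie_exp GF X'" unfolding \<iota>_exp[OF X'(1)] X'(2) by (rule X(2))
  ultimately show "p \<in> lie_exp GF ` minus_space GF \<theta>" by blast
next
  fix p assume "p \<in> lie_exp GF ` minus_space GF \<theta>"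
  then obtain X where X: "X \<in> V'" "\<iota> X \<in> \<mm>" "p = lie_exp GF X" by (auto simp: minus_F)
  have "p \<in> F" using lie_exp_closed[OF GF'(1), of X] X(1,3) by simp
  moreover have "p \<in> lie_exp G ` \<mm>" unfolding X(3) \<iota>_exp[OF X(1)] by (rule imageI[OF X(2)])
  ultimately show "p \<in> F \<inter> lie_exp G ` \<mm>" by blast
qed

text \<open>The complementary ideal is the orthogonal complement for \<open>ipB\<close>: the adjoint
  of \<open>ad X\<close> is \<open>- ad (\<theta> X)\<close>, and the fixed algebra is stable under
  \<open>\<theta>\<close>.\<close>

lemma reductive_F: "reductive_lie_algebra GF"
  unfolding reductive_lie_algebra_def
proof (intro allI impI)
  fix I assume "lie_ideal GF I"
  then have I: "subspace I" "I \<subseteq> V'" "\<And>X Y. X \<in> V' \<Longrightarrow> Y \<in> I \<Longrightarrow> bracket GF X Y \<in> I" by (simp_all add: lie_ideal_def)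
  define J where "J = {Y \<in> V'. \<forall>X\<in>I. ipB (\<iota> X) (\<iota> Y) = 0}"
  have sJ: "subspace J" unfolding J_def subspace_def using V'
    by (auto simp: linear_add[OF lin_\<iota>] linear_cmul[OF lin_\<iota>] linear_0[OF lin_\<iota>] ra.ip_simps subspace_add subspace_scale subspace_0)
  have "bracket GF X Y \<in> J" if X: "X \<in> V'" and Y: "Y \<in> J" for X Y
  proof -
    have YV: "Y \<in> V'" using Y by (simp add: J_def)
    have "ipB (\<iota> Z) (\<iota> (bracket GF X Y)) = 0" if Z: "Z \<in> I" for Z
    proof -
      have ZV: "Z \<in> V'" using Z I(2) by blast
      note iX = \<iota>_V[OF X] and iY = \<iota>_V[OF YV] and iZ = \<iota>_V[OF ZV]
      have "ipB (\<iota> Z) (bracket G (\<iota> X) (\<iota> Y)) = ipB (brV (\<iota> X) (\<iota> Y)) (\<iota> Z)"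
        unfolding brV[OF iX iY] by (rule ra.ip_sym[OF iZ bracket_in[OF G iX iY]])
      also have "\<dots> = - ipB (\<iota> Y) (brV (\<tau>V (\<iota> X)) (\<iota> Z))" by (rule ra.ip_br[OF iX iY iZ])
      also have "brV (\<tau>V (\<iota> X)) (\<iota> Z) = \<iota> (bracket GF (\<theta> X) Z)"
        unfolding \<tau>V[OF iX] brV[OF \<tau>_V[OF iX] iZ] \<iota>_br[OF \<theta>(1)[OF X] ZV] \<theta>(2)[OF X] ..
      also have "ipB (\<iota> Y) (\<iota> (bracket GF (\<theta> X) Z)) = ipB (\<iota> (bracket GF (\<theta> X) Z)) (\<iota> Y)"
        by (rule ra.ip_sym[OF iY \<iota>_V[OF br_V'[OF \<theta>(1)[OF X] ZV]]])
      also have "\<dots> = 0" using Y I(3)[OF \<theta>(1)[OF X] Z] by (simp add: J_def)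
      finally show ?thesis unfolding \<iota>_br[OF X YV] by simp
    qed
    then show ?thesis using br_V'[OF X YV] by (simp add: J_def)
  qed
  then have idJ: "lie_ideal GF J" using sJ by (simp add: lie_ideal_def) (simp add: J_def)
  have IJ: "I \<inter> J = {0}"
  proof (rule subset_antisym; rule subsetI)
    fix X assume X: "X \<in> I \<inter> J"
    then have XV: "X \<in> V'" "ipB (\<iota> X) (\<iota> X) = 0" by (auto simp: J_def)
    then have "\<iota> X = \<iota> 0" using ra.ip_pos[OF \<iota>_V[OF XV(1)]] linear_0[OF lin_\<iota>] by force
    then show "X \<in> {0}" using \<iota>_inj[OF XV(1) subspace_0[OF V']] by simp
  qed (use subspace_0[OF I(1)] subspace_0[OF sJ] in simp)
  have iI: "subspace (\<iota> ` I)" "\<iota> ` I \<subseteq> V"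
    using linear_subspace_image[OF lin_\<iota> I(1)] I(2) \<iota>_V by auto
  have "\<exists>v\<in>I. \<exists>w\<in>J. X = v + w" if X: "X \<in> V'" for X
  proof -
    obtain v w where vw: "v \<in> \<iota> ` I" "w \<in> V" "\<iota> X = v + w" "\<forall>d\<in>\<iota> ` I. ipB d w = 0"
      by (rule ra.orthogonal_split[OF iI \<iota>_V[OF X]])
    obtain v' where v': "v' \<in> I" "v = \<iota> v'" using vw(1) by blast
    have "X - v' \<in> V'" using X v'(1) I(2) V' by (auto intro: subspace_diff)
    moreover have "\<iota> (X - v') = w" unfolding linear_diff[OF lin_\<iota>] vw(3) v'(2) by simp
    ultimately have "X - v' \<in> J" using vw(4) by (simp add: J_def)
    then show ?thesis using v'(1) by (intro bexI[of _ v'] bexI[of _ "X - v'"]) simp_all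
  qed
  then have "{X + Y | X Y. X \<in> I \<and> Y \<in> J} = lie_algebra GF"
    using I(2) V' unfolding GF_simps J_def by (blast intro: subspace_add)
  with idJ IJ show "\<exists>J. lie_ideal GF J \<and> I \<inter> J = {0} \<and> {X + Y | X Y. X \<in> I \<and> Y \<in> J} = lie_algebra GF" by blast
qed

theorem reductive_subgroup_F:
  assumes "real_reductive_group G U \<tau> B"
  shows "reductive_subgroup GF (F \<inter> U) \<theta> (\<lambda>X Y. B (\<iota> X) (\<iota> Y)) G U \<tau> B"
proof -
  have "cartan_data GF (F \<inter> U) \<theta> (\<lambda>X Y. B (\<iota> X) (\<iota> Y))"
    unfolding cartan_data_def id_def
  proof (intro conjI exI)
    show "maximal_compact_subgroup GF (F \<inter> U)" by (rule maximal_compact_F)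
    show "lie_algebra_involution GF \<theta>" by (rule involution_F)
    show "cartan_form GF \<theta> (\<lambda>X Y. B (\<iota> X) (\<iota> Y))" by (rule cartan_form_F)
    show "lie_subgroup HF GF" by (rule HF_sub)
    show "carrier HF = F \<inter> U" by simp
    show "diff_one HF GF (\<lambda>x. x) ` lie_algebra HF = plus_space GF \<theta>" by (rule plus_space_F)
    show "embedded_submanifold N3 (mfd GF)" using N3_embedded by simp
    show "topspace (mtop N3) = lie_exp GF ` minus_space GF \<theta>" unfolding N3(2) by (rule exp_minus_F)
    show "diffeomorphism (prod_manifold (mfd HF) N3) (mfd GF) (\<lambda>(h, p). h \<otimes>\<^bsub>GF\<^esub> p)" using diffeomorphism_F by simp
  qed
  then show ?thesis
    unfolding reductive_subgroup_def real_reductive_group_def id_def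
    using assms GF'(1) reductive_F GF_sub \<theta>(2) by (simp add: real_reductive_group_def)
qed

end

theorem (in commuting_involution) fixed_points_reductive:
  assumes "real_reductive_group G U \<tau> B"
  obtains G' :: "('a, 'e) lie_group" and H' \<theta>' B' where "carrier G' = {x \<in> carrier G. s x = x}" "reductive_subgroup G' H' \<theta>' B' G U \<tau> B"
proof -
  obtain N1 N2 N3 :: "('a, 'e) manifold" where N: "embedded_submanifold N1 (mfd G)" "topspace (mtop N1) = F"
    "embedded_submanifold N2 (mfd L)" "topspace (mtop N2) = F \<inter> U"
    "embedded_submanifold N3 P" "topspace (mtop N3) = F \<inter> lie_exp G ` \<mm>"
    using F_submanifold FU_submanifold FP_submanifold by blast
  interpret fixed_subgroup G U \<tau> B L P \<nu> s N1 N2 N3 by unfold_locales (fact N)+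
  show thesis by (rule that[OF _ reductive_subgroup_F[OF assms]]) (simp add: F_def)
qed

section \<open>Conjugating an involution into a compatible one\<close>

lemma conj_by_cancel:
  assumes "group G" "g \<in> carrier G" "x \<in> carrier G"
  shows "conj_by G g (conj_by G (inv\<^bsub>G\<^esub> g) x) = x" "conj_by G (inv\<^bsub>G\<^esub> g) (conj_by G g x) = x"
proof -
  interpret group G by (rule assms(1))
  have "conj_by G \<one>\<^bsub>G\<^esub> x = x" using assms(3) by (simp add: conj_by_def)
  then show "conj_by G g (conj_by G (inv\<^bsub>G\<^esub> g) x) = x" "conj_by G (inv\<^bsub>G\<^esub> g) (conj_by G g x) = x"
    using conj_by_mult[OF assms(1,2) inv_closed[OF assms(2)] assms(3)] conj_by_mult[OF assms(1) inv_closed[OF assms(2)] assms(2,3)] assms(2)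
    by simp_all
qed

text \<open>Conjugating \<open>s\<close> by \<open>g\<close> conjugates its differential
  \<open>S\<close> by \<open>Ad g\<close>. The relation obtained in
  \<open>conjugate_commuting\<close> therefore is exactly the hypothesis of
  \<open>commuting_involution\<close> for the new involution.\<close>

theorem (in cartan_involution) conjugate_fixed_points_reductive:
  assumes RG: "real_reductive_group G U \<tau> B" and centre: "\<And>w. w \<in> ra.centre \<Longrightarrow> S (\<tau> w) = \<tau> (S w)"
  obtains g G' H' \<theta>' B' where "g \<in> carrier G" "conj_by G g \<circ> s \<circ> conj_by G (inv\<^bsub>G\<^esub> g) \<in> hom G G"
    "\<forall>x\<in>carrier G. (conj_by G g \<circ> s \<circ> conj_by G (inv\<^bsub>G\<^esub> g)) ((conj_by G g \<circ> s \<circ> conj_by G (inv\<^bsub>G\<^esub> g)) x) = x"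
    "carrier G' = fixed_points G (conj_by G g \<circ> s \<circ> conj_by G (inv\<^bsub>G\<^esub> g))" "carrier G' = conj_by G g ` fixed_points G s"
    "reductive_subgroup (G' :: ('a, 'e) lie_group) H' \<theta>' B' G U \<tau> B"
proof -
  obtain g where g: "g \<in> carrier G" and
    g_comm: "\<forall>X\<in>V. Ad G g (S (Ad G (inv\<^bsub>G\<^esub> g) (\<tau> X))) = \<tau> (Ad G g (S (Ad G (inv\<^bsub>G\<^esub> g) X)))"
    by (rule conjugate_commuting[OF centre])
  let ?s = "conj_by G g \<circ> s \<circ> conj_by G (inv\<^bsub>G\<^esub> g)"
  note ig = inv_closed[OF g]
  note cG = conj_by_closed[OF is_group g] and iG = conj_by_closed[OF is_group ig]
  note cancel = conj_by_cancel[OF is_group g]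
  have c: "smooth_map (mfd G) (mfd G) (conj_by G g)" "smooth_map (mfd G) (mfd G) (conj_by G (inv\<^bsub>G\<^esub> g))"
    by (rule smooth_map_conj[OF G g], rule smooth_map_conj[OF G ig])
  note sc = smooth_map_compose[OF M M M c(2) s(1)]
  have smooth: "smooth_map (mfd G) (mfd G) ?s"
    using smooth_map_compose[OF M M M sc c(1)] by (simp add: o_def)
  have hom: "?s \<in> hom G G"
    using cG iG s_closed s_mult conj_by_hom[OF is_group g] conj_by_hom[OF is_group ig] by (auto simp: hom_def)
  have invol: "?s (?s x) = x" if "x \<in> carrier G" for x
    using that cancel(2)[OF s_closed[OF iG[OF that]]] ss[OF iG[OF that]] cancel(1)[OF that] by simp
  have diff: "diff_one G G ?s X = Ad G g (S (Ad G (inv\<^bsub>G\<^esub> g) X))" if X: "X \<in> V" for X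
  proof -
    have o: "conj_by G (inv\<^bsub>G\<^esub> g) \<one>\<^bsub>G\<^esub> = \<one>\<^bsub>G\<^esub>" "conj_by G g \<one>\<^bsub>G\<^esub> = \<one>\<^bsub>G\<^esub>"
      by (rule conj_by_one[OF is_group ig], rule conj_by_one[OF is_group g])
    have os: "s (conj_by G (inv\<^bsub>G\<^esub> g) \<one>\<^bsub>G\<^esub>) = \<one>\<^bsub>G\<^esub>" using o(1) s_one by simp
    show ?thesis
      using diff_one_comp[OF G G G sc os c(1) o(2) X] diff_one_comp[OF G G G c(2) o(1) s(1) s_one X]
      by (simp add: o_def Ad_def)
  qed
  interpret conj: commuting_involution G U \<tau> B L P \<nu> ?s
  proof
    show "smooth_map (mfd G) (mfd G) ?s" "?s \<in> hom G G" by (fact smooth, fact hom)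
    show "?s (?s x) = x" if "x \<in> carrier G" for x by (rule invol[OF that])
    show "diff_one G G ?s (\<tau> X) = \<tau> (diff_one G G ?s X)" if "X \<in> V" for X
      unfolding diff[OF that] diff[OF \<tau>_V[OF that]] by (rule bspec[OF g_comm that])
  qed
  have fix_eq: "fixed_points G ?s = conj_by G g ` fixed_points G s"
  proof (rule subset_antisym; rule subsetI)
    fix x assume "x \<in> fixed_points G ?s"
    then have x: "x \<in> carrier G" "?s x = x" by (simp_all add: fixed_points_def)
    have "conj_by G (inv\<^bsub>G\<^esub> g) (conj_by G g (s (conj_by G (inv\<^bsub>G\<^esub> g) x))) = conj_by G (inv\<^bsub>G\<^esub> g) x" using x(2) by simp
    then have "conj_by G (inv\<^bsub>G\<^esub> g) x \<in> fixed_points G s"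
      unfolding cancel(2)[OF s_closed[OF iG[OF x(1)]]] by (simp add: fixed_points_def iG[OF x(1)])
    then have "conj_by G g (conj_by G (inv\<^bsub>G\<^esub> g) x) \<in> conj_by G g ` fixed_points G s" by (rule imageI)
    then show "x \<in> conj_by G g ` fixed_points G s" unfolding cancel(1)[OF x(1)] .
  next
    fix x assume "x \<in> conj_by G g ` fixed_points G s"
    then obtain y where y: "y \<in> carrier G" "s y = y" "x = conj_by G g y" by (auto simp: fixed_points_def)
    then show "x \<in> fixed_points G ?s" using cancel(2)[OF y(1)] cG[OF y(1)] by (simp add: fixed_points_def)
  qed
  obtain G' :: "('a, 'e) lie_group" and H' \<theta>' B' where
    G': "carrier G' = {x \<in> carrier G. ?s x = x}" "reductive_subgroup G' H' \<theta>' B' G U \<tau> B"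
    by (rule conj.fixed_points_reductive[OF RG])
  have 1: "carrier G' = fixed_points G ?s" unfolding G'(1) fixed_points_def ..
  show thesis
    by (rule that[OF g hom _ 1 1[unfolded fix_eq] G'(2)]) (intro ballI invol)
qed

text \<open>Derivatives are real linear and hence commute with the sign. A holomorphic map thus also
  intertwines the two conjugate complex structures.\<close>

lemma intertwining_map_neg:
  assumes M: "pre_manifold M" and N: "pre_manifold N" and f: "intertwining_map J J' M N f"
  shows "intertwining_map (\<lambda>v. - J v) (\<lambda>v. - J' v) M N f"
  unfolding intertwining_map_def
proof (intro conjI ballI)
  show sf: "smooth_map M N f" using f by (simp add: intertwining_map_def)
  fix c d p v assume c: "c \<in> atlas M" and d: "d \<in> atlas N" and p: "p \<in> loc_dom c d f" and v: "v \<in> model M"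
  obtain x where x: "p = snd c x" "x \<in> fst c" "f x \<in> fst d" using p by (auto simp: loc_dom_def)
  have "loc_deriv c d f p (J v) = J' (loc_deriv c d f p v)" using f c d p v unfolding intertwining_map_def by blast
  then show "loc_deriv c d f p (- J v) = - J' (loc_deriv c d f p v)"
    using linear_neg[OF bounded_linear.linear[OF loc_deriv_linear[OF M N sf c d x(2,3)]], of "J v"] unfolding x(1) by simp
qed

theorem proposition3p6:
  fixes GC :: "('a, complex ^ 'n) lie_group"
    and U G :: "'a set"
    and \<tau> :: "complex ^ 'n \<Rightarrow> complex ^ 'n"
    and B :: "complex ^ 'n \<Rightarrow> complex ^ 'n \<Rightarrow> real"
    and \<sigma> :: "'a \<Rightarrow> 'a"
  assumes "complex_reductive_group GC U \<tau> B"
    and "connected_space (mtop (mfd GC))"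
    and "antiholomorphic_involution GC \<sigma>"
    and "G = fixed_points GC \<sigma>"
  shows "\<exists>g\<in>carrier GC. \<exists>\<sigma>'.
           \<sigma>' = conj_by GC g \<circ> \<sigma> \<circ> conj_by GC (inv\<^bsub>GC\<^esub> g) \<and>
           antiholomorphic_involution GC \<sigma>' \<and>
           (\<exists>(G' :: ('a, complex ^ 'n) lie_group) H' \<theta>' B'.
              carrier G' = fixed_points GC \<sigma>' \<and> carrier G' = conj_by GC g ` G \<and>
              reductive_subgroup G' H' \<theta>' B' GC U \<tau> B)"
proof -
  have cx: "complex_lie_group GC" and RG: "real_reductive_group GC U \<tau> B"
    and \<tau>_i: "\<And>X. X \<in> lie_algebra GC \<Longrightarrow> \<tau> (i_mult X) = - i_mult (\<tau> X)"
    using assms(1) by (simp_all add: complex_reductive_group_def)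
  have \<sigma>: "\<sigma> \<in> hom GC GC" "\<And>x. x \<in> carrier GC \<Longrightarrow> \<sigma> (\<sigma> x) = x"
    "intertwining_map i_mult (\<lambda>v. - i_mult v) (mfd GC) (mfd GC) \<sigma>"
    using assms(3) by (simp_all add: antiholomorphic_involution_def)
  have lie: "lie_group GC" by (rule complex_lie_groupD(1)[OF cx])
  note iV = complex_lie_groupD(2)[OF cx] and M = lie_groupD(3)[OF lie]
  have cd: "cartan_data GC U \<tau> B" using RG by (simp add: real_reductive_group_def)
  obtain L :: "('a, complex ^ 'n) lie_group" and P :: "('a, complex ^ 'n) manifold" where
    L: "lie_subgroup L GC" "carrier L = U" "diff_one L GC (\<lambda>x. x) ` lie_algebra L = plus_space GC \<tau>"
    and P: "embedded_submanifold P (mfd GC)" "topspace (mtop P) = lie_exp GC ` minus_space GC \<tau>"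
    and d: "diffeomorphism (prod_manifold (mfd L) P) (mfd GC) (\<lambda>(h, p). h \<otimes>\<^bsub>GC\<^esub> p)"
    using cd unfolding cartan_data_def id_def by (elim conjE exE) (rule that)
  have topL: "topspace (mtop (mfd L)) = U"
    using lie_groupD(4)[OF lie_subgroupD(1)[OF L(1) lie]] L(2) by simp
  obtain \<nu> where \<nu>: "smooth_map (mfd GC) (prod_manifold (mfd L) P) \<nu>"
    "\<forall>z\<in>topspace (mtop (prod_manifold (mfd L) P)). \<nu> (case z of (h, p) \<Rightarrow> h \<otimes>\<^bsub>GC\<^esub> p) = z"
    "\<forall>x\<in>topspace (mtop (mfd GC)). (case \<nu> x of (h, p) \<Rightarrow> h \<otimes>\<^bsub>GC\<^esub> p) = x"
    using d unfolding diffeomorphism_def by blast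
  interpret cartan_involution GC U \<tau> B L P \<nu> \<sigma>
  proof
    show "lie_group GC" by (rule lie)
    show "connected_space (mtop (mfd GC))" by (rule assms(2))
    show "maximal_compact_subgroup GC U" "lie_algebra_involution GC \<tau>" "cartan_form GC \<tau> B"
      using cd by (simp_all add: cartan_data_def)
    show "smooth_map (prod_manifold (mfd L) P) (mfd GC) (\<lambda>(h, p). h \<otimes>\<^bsub>GC\<^esub> p)"
      using d by (simp add: diffeomorphism_def)
    show "\<nu> (h \<otimes>\<^bsub>GC\<^esub> p) = (h, p)" if "h \<in> U" "p \<in> lie_exp GC ` minus_space GC \<tau>" for h p
    proof -
      have "(h, p) \<in> topspace (mtop (prod_manifold (mfd L) P))" using that topL P(2) by simp
      from bspec[OF \<nu>(2) this] show ?thesis by simp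
    qed
    show "fst (\<nu> g) \<otimes>\<^bsub>GC\<^esub> snd (\<nu> g) = g" if "g \<in> carrier GC" for g
      using bspec[OF \<nu>(3), of g] that lie_groupD(4)[OF lie] by (simp add: case_prod_beta')
    show "smooth_map (mfd GC) (mfd GC) \<sigma>" using \<sigma>(3) by (simp add: intertwining_map_def)
  qed (fact L P \<nu>(1) \<sigma>(1,2))+
  \<comment> \<open>Antiholomorphy of \<open>\<sigma>\<close> enters the Lie algebra argument here:
    multiplication by the imaginary unit serves as the complex structure \<open>J\<close>.\<close>
  have centre: "S (\<tau> w) = \<tau> (S w)" if w: "w \<in> ra.centre" for w
  proof (rule centre_commute[where J = i_mult])
    show "i_mult v \<in> V" if "v \<in> V" for v by (rule iV[OF that])
    show "i_mult (- v) = - i_mult v" for v by (simp add: vec_eq_iff)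
    show "i_mult (i_mult v) = - v" for v by (rule i_mult_i_mult)
    show "bracket GC v (i_mult w) = i_mult (bracket GC v w)" if "v \<in> V" "w \<in> V" for v w
      by (rule bracket_i_mult[OF cx that])
    show "\<tau> (i_mult v) = - i_mult (\<tau> v)" if "v \<in> V" for v by (rule \<tau>_i[OF that])
    show "S (i_mult v) = - i_mult (S v)" if "v \<in> V" for v
      by (rule intertwining_diff_one[OF lie lie \<sigma>(3) s_one that])
  qed (rule w)
  obtain g G' H' \<theta>' B' where g: "g \<in> carrier GC" "conj_by GC g \<circ> \<sigma> \<circ> conj_by GC (inv\<^bsub>GC\<^esub> g) \<in> hom GC GC"
    "\<forall>x\<in>carrier GC. (conj_by GC g \<circ> \<sigma> \<circ> conj_by GC (inv\<^bsub>GC\<^esub> g)) ((conj_by GC g \<circ> \<sigma> \<circ> conj_by GC (inv\<^bsub>GC\<^esub> g)) x) = x"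
    "carrier G' = fixed_points GC (conj_by GC g \<circ> \<sigma> \<circ> conj_by GC (inv\<^bsub>GC\<^esub> g))" "carrier G' = conj_by GC g ` fixed_points GC \<sigma>"
    "reductive_subgroup (G' :: ('a, complex ^ 'n) lie_group) H' \<theta>' B' GC U \<tau> B"
    by (rule conjugate_fixed_points_reductive[OF RG centre])
  \<comment> \<open>The outer conjugation follows an antiholomorphic map, so its complex structures
    are both negated in order that the three maps compose.\<close>
  have "intertwining_map i_mult (\<lambda>v. - i_mult v) (mfd GC) (mfd GC) (\<lambda>x. conj_by GC g (\<sigma> (conj_by GC (inv\<^bsub>GC\<^esub> g) x)))"
    by (rule intertwining_map_compose[OF M M M iV
          intertwining_map_compose[OF M M M iV intertwining_conj[OF cx inv_closed[OF g(1)]] \<sigma>(3)]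
          intertwining_map_neg[OF M M intertwining_conj[OF cx g(1)]]])
  then have "antiholomorphic_involution GC (conj_by GC g \<circ> \<sigma> \<circ> conj_by GC (inv\<^bsub>GC\<^esub> g))"
    unfolding antiholomorphic_involution_def using g(2,3) by (simp add: o_def)
  then show ?thesis using g(1,4,5,6) assms(4) by blast
qed

end
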